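(* Let $\varphi:\mathbb{D}\to\mathbb{D}$ be a holomorphic function such that there exists a hyperbolic semiflow $(\varphi_t)_{t\ge 0}$ with $\varphi=\varphi_1$. Then, for every $1\le p<\infty$: (i) Let $\Omega$ be the Koenigs domain of $(\varphi_t)_{t\ge 0}$ and assume that $\operatorname{int}(\overline{\Omega})=\Omega$ and that $\mathbb{C}\setminus\overline{\Omega}$ has at most two connected components. Then $C_\varphi\in\mathcal{L}(H^p)$ has the functional bicommutant property. In particular, there exist no non-trivial idempotents lying in $\{C_\varphi\}''$. (ii) The commutant $\{C_\varphi\}'$ of $C_\varphi\in\mathcal{L}(H^p)$ is not abelian; hence $C_\varphi$ has neither the functional commutant property nor minimal commutant.
   Context: $\mathbb{D}$ is the open unit disc of $\mathbb{C}$ and $\mathbb{T}$ the unit circle. For $1\le p<\infty$, $H^p$ is the Banach space of holomorphic $f:\mathbb{D}\to\mathbb{C}$ with $\|f\|_{H^p}=\left(\sup_{0<r<1}\int_0^{2\pi}|f(re^{i\theta})|^p\,d\theta\right)^{1/p}<\infty$. For holomorphic $\varphi:\mathbb{D}\to\mathbb{D}$, $C_\varphi f=f\circ\varphi$, a bounded operator on $H^p$. For a complex Banach space $X$, $\mathcal{L}(X)$ is the algebra of bounded linear operators on $X$. Commutants. For $T\in\mathcal{L}(X)$, $\{T\}'=\{A\in\mathcal{L}(X):AT=TA\}$ and $\{T\}''=\bigcap_{A\in\{T\}'}\{A\}'$. $T$ has minimal commutant if the closure in the weak operator topology of $\operatorname{alg}(T)=\{q(T): q \text{ a complex polynomial}\}$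 equals $\{T\}'$. A non-trivial idempotent is $J\in\mathcal{L}(X)$ with $J^2=J$, $J\ne 0$, $J\neq \mathrm{Id}_X$. For $G\subset\mathbb{C}$, $\mathcal{C}(G)$ is the algebra of all continuous functions $f:G\to\mathbb{C}$ with pointwise operations (no topology is considered). $T$ has the functional commutant property (respectively, functional bicommutant property) if there exist a connected subset $G\subset\mathbb{C}$, a subalgebra $\mathcal{A}\subseteq\mathcal{C}(G)$ and an algebra isomorphism $\Phi:\mathcal{A}\to\{T\}'$ (respectively, $\Phi:\mathcal{A}\to\{T\}''$). Semiflows. A holomorphic semiflow is a family $(\varphi_t)_{t\ge0}$ of holomorphic self-maps of $\mathbb{D}$ with $\varphi_0(z)=z$, $\varphi_{t+s}=\varphi_t\circ\varphi_s$ for all $t,s\geq 0$, and $\varphi_t\to\varphi_s$ uniformly on compact subsets of $\mathbb{D}$ as $t\to s$. It is elliptic if $\varphi_{t_0}(z_0)=z_0$ for some $t_0>0$ and $z_0\in\mathbb{D}$. If it is not elliptic, there is a unique $\tau\in\mathbb{T}$ (the Denjoy–Wolff point) such that $\varphi_t\to\tau$ uniformly on compact subsets as $t\to\infty$, and there is $\alpha\le 0$ such that $\varphi_t'$ has non-tangential limit $e^{t\alpha}$ at $\tau$ for all $t\geq 0$; the semiflow is hyperbolic if $\alpha<0$ and parabolic if $\alpha=0$. For a non-elliptic semiflow there is a univalent function $h:\mathbb{D}\to\mathbb{C}$ (the Koenigs function), unique up to an additive constant, with $\varphi_t(z)=h^{-1}(h(z)+t)$ for all $z\in\mathbb{D}$,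 $t\ge0$. The Koenigs domain is $\Omega=h(\mathbb{D})$. Interior and closure are taken in $\mathbb{C}$. *)

theory Defs
  imports "HOL-Complex_Analysis.Complex_Analysis" "HOL-Computational_Algebra.Polynomial"
begin

abbreviation unit_disc :: "complex set" where
  "unit_disc \<equiv> ball 0 1"

text \<open>
  The spaces \<open>H\<^sup>p\<close> depend on the real number \<open>p\<close>, so a complex normed space is given here by a carrier
  \<open>X\<close>, a set of complex-valued functions with the pointwise linear structure, and a norm \<open>N\<close>.
  An operator on \<open>X\<close> is represented by a map that takes the value \<open>0\<close> off \<open>X\<close>. This makes the
  representation unique, and it is preserved by \<open>\<circ>\<close> and by the pointwise operations.
\<close>

definition linear_map_on ::
  "('a \<Rightarrow> complex) set \<Rightarrow> (('a \<Rightarrow> complex) \<Rightarrow> ('a \<Rightarrow> complex)) \<Rightarrow> bool" where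
  "linear_map_on X A \<longleftrightarrow>
     (\<forall>f\<in>X. \<forall>g\<in>X. A (\<lambda>z. f z + g z) = (\<lambda>z. A f z + A g z)) \<and>
     (\<forall>c. \<forall>f\<in>X. A (\<lambda>z. c * f z) = (\<lambda>z. c * A f z))"

definition bounded_operators ::
  "('a \<Rightarrow> complex) set \<Rightarrow> (('a \<Rightarrow> complex) \<Rightarrow> real)
    \<Rightarrow> (('a \<Rightarrow> complex) \<Rightarrow> ('a \<Rightarrow> complex)) set" where
  "bounded_operators X N =
     {A. A \<in> X \<rightarrow> X \<and> linear_map_on X A \<and> (\<exists>K. \<forall>f\<in>X. N (A f) \<le> K * N f) \<and>
         (\<forall>f. f \<notin> X \<longrightarrow> A f = (\<lambda>_. 0))}"

definition zero_operator :: "('a \<Rightarrow> complex) \<Rightarrow> ('a \<Rightarrow> complex)" where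
  "zero_operator = (\<lambda>f z. 0)"

definition id_operator ::
  "('a \<Rightarrow> complex) set \<Rightarrow> ('a \<Rightarrow> complex) \<Rightarrow> ('a \<Rightarrow> complex)" where
  "id_operator X = (\<lambda>f. if f \<in> X then f else (\<lambda>_. 0))"

definition poly_operator ::
  "('a \<Rightarrow> complex) set \<Rightarrow> complex poly \<Rightarrow> (('a \<Rightarrow> complex) \<Rightarrow> ('a \<Rightarrow> complex))
    \<Rightarrow> ('a \<Rightarrow> complex) \<Rightarrow> ('a \<Rightarrow> complex)" where
  "poly_operator X q T =
     (\<lambda>f. if f \<in> X then (\<lambda>z. \<Sum>i\<le>degree q. coeff q i * (T ^^ i) f z) else (\<lambda>_. 0))"

definition alg ::
  "('a \<Rightarrow> complex) set \<Rightarrow> (('a \<Rightarrow> complex) \<Rightarrow> ('a \<Rightarrow> complex))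
    \<Rightarrow> (('a \<Rightarrow> complex) \<Rightarrow> ('a \<Rightarrow> complex)) set" where
  "alg X T = {poly_operator X q T |q. True}"

definition bounded_functionals ::
  "('a \<Rightarrow> complex) set \<Rightarrow> (('a \<Rightarrow> complex) \<Rightarrow> real) \<Rightarrow> (('a \<Rightarrow> complex) \<Rightarrow> complex) set" where
  "bounded_functionals X N =
     {l. (\<forall>f\<in>X. \<forall>g\<in>X. l (\<lambda>z. f z + g z) = l f + l g) \<and>
         (\<forall>c. \<forall>f\<in>X. l (\<lambda>z. c * f z) = c * l f) \<and>
         (\<exists>K. \<forall>f\<in>X. cmod (l f) \<le> K * N f)}"

definition weak_operator_topology ::
  "('a \<Rightarrow> complex) set \<Rightarrow> (('a \<Rightarrow> complex) \<Rightarrow> real)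
    \<Rightarrow> (('a \<Rightarrow> complex) \<Rightarrow> ('a \<Rightarrow> complex)) topology" where
  "weak_operator_topology X N =
     topology_generated_by
       {{A \<in> bounded_operators X N. l (A f) \<in> U} |f l U.
          f \<in> X \<and> l \<in> bounded_functionals X N \<and> open U}"

definition commutant ::
  "('a \<Rightarrow> complex) set \<Rightarrow> (('a \<Rightarrow> complex) \<Rightarrow> real) \<Rightarrow> (('a \<Rightarrow> complex) \<Rightarrow> ('a \<Rightarrow> complex))
    \<Rightarrow> (('a \<Rightarrow> complex) \<Rightarrow> ('a \<Rightarrow> complex)) set" where
  "commutant X N T = {A \<in> bounded_operators X N. A \<circ> T = T \<circ> A}"

definition bicommutant ::
  "('a \<Rightarrow> complex) set \<Rightarrow> (('a \<Rightarrow> complex) \<Rightarrow> real) \<Rightarrow> (('a \<Rightarrow> complex) \<Rightarrow> ('a \<Rightarrow> complex))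
    \<Rightarrow> (('a \<Rightarrow> complex) \<Rightarrow> ('a \<Rightarrow> complex)) set" where
  "bicommutant X N T = (\<Inter>A\<in>commutant X N T. commutant X N A)"

definition minimal_commutant ::
  "('a \<Rightarrow> complex) set \<Rightarrow> (('a \<Rightarrow> complex) \<Rightarrow> real) \<Rightarrow> (('a \<Rightarrow> complex) \<Rightarrow> ('a \<Rightarrow> complex))
    \<Rightarrow> bool" where
  "minimal_commutant X N T \<longleftrightarrow>
     weak_operator_topology X N closure_of alg X T = commutant X N T"

definition nontrivial_idempotent ::
  "('a \<Rightarrow> complex) set \<Rightarrow> (('a \<Rightarrow> complex) \<Rightarrow> real) \<Rightarrow> (('a \<Rightarrow> complex) \<Rightarrow> ('a \<Rightarrow> complex))
    \<Rightarrow> bool" where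
  "nontrivial_idempotent X N J \<longleftrightarrow>
     J \<in> bounded_operators X N \<and> J \<circ> J = J \<and> J \<noteq> zero_operator \<and> J \<noteq> id_operator X"

text \<open>Functions on \<open>G\<close> are extended by \<open>0\<close>, so that equality is equality on \<open>G\<close>.\<close>

definition continuous_functions :: "complex set \<Rightarrow> (complex \<Rightarrow> complex) set" where
  "continuous_functions G = {f. continuous_on G f \<and> (\<forall>z. z \<notin> G \<longrightarrow> f z = 0)}"

text \<open>
  No unit is required of a subalgebra. If it is isomorphic to an algebra of operators containing the
  identity, it has a unit, which for connected \<open>G\<close> and a nonzero algebra is the constant \<open>1\<close> on \<open>G\<close>.
\<close>

definition subalgebra_of_continuous_functions ::
  "complex set \<Rightarrow> (complex \<Rightarrow> complex) set \<Rightarrow> bool" where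
  "subalgebra_of_continuous_functions G F \<longleftrightarrow>
     F \<subseteq> continuous_functions G \<and> F \<noteq> {} \<and>
     (\<forall>f\<in>F. \<forall>g\<in>F. (\<lambda>z. f z + g z) \<in> F) \<and>
     (\<forall>c. \<forall>f\<in>F. (\<lambda>z. c * f z) \<in> F) \<and>
     (\<forall>f\<in>F. \<forall>g\<in>F. (\<lambda>z. f z * g z) \<in> F)"

definition algebra_isomorphism ::
  "(complex \<Rightarrow> complex) set \<Rightarrow> (('a \<Rightarrow> complex) \<Rightarrow> ('a \<Rightarrow> complex)) set
    \<Rightarrow> ((complex \<Rightarrow> complex) \<Rightarrow> ('a \<Rightarrow> complex) \<Rightarrow> ('a \<Rightarrow> complex)) \<Rightarrow> bool" where
  "algebra_isomorphism F S \<Phi> \<longleftrightarrow>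
     bij_betw \<Phi> F S \<and>
     (\<forall>f\<in>F. \<forall>g\<in>F. \<Phi> (\<lambda>z. f z + g z) = (\<lambda>x w. \<Phi> f x w + \<Phi> g x w)) \<and>
     (\<forall>c. \<forall>f\<in>F. \<Phi> (\<lambda>z. c * f z) = (\<lambda>x w. c * \<Phi> f x w)) \<and>
     (\<forall>f\<in>F. \<forall>g\<in>F. \<Phi> (\<lambda>z. f z * g z) = \<Phi> f \<circ> \<Phi> g)"

definition functional_commutant_property ::
  "('a \<Rightarrow> complex) set \<Rightarrow> (('a \<Rightarrow> complex) \<Rightarrow> real) \<Rightarrow> (('a \<Rightarrow> complex) \<Rightarrow> ('a \<Rightarrow> complex))
    \<Rightarrow> bool" where
  "functional_commutant_property X N T \<longleftrightarrow>
     (\<exists>G F \<Phi>. connected G \<and> subalgebra_of_continuous_functions G F \<and>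
        algebra_isomorphism F (commutant X N T) \<Phi>)"

definition functional_bicommutant_property ::
  "('a \<Rightarrow> complex) set \<Rightarrow> (('a \<Rightarrow> complex) \<Rightarrow> real) \<Rightarrow> (('a \<Rightarrow> complex) \<Rightarrow> ('a \<Rightarrow> complex))
    \<Rightarrow> bool" where
  "functional_bicommutant_property X N T \<longleftrightarrow>
     (\<exists>G F \<Phi>. connected G \<and> subalgebra_of_continuous_functions G F \<and>
        algebra_isomorphism F (bicommutant X N T) \<Phi>)"

definition hardy_mean :: "real \<Rightarrow> (complex \<Rightarrow> complex) \<Rightarrow> real \<Rightarrow> real" where
  "hardy_mean p f r = integral {0..2*pi} (\<lambda>\<theta>. cmod (f (of_real r * cis \<theta>)) powr p)"

text \<open>Functions on the disc are extended by \<open>0\<close>, so that equality is equality on the disc.\<close>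

definition hardy_space :: "real \<Rightarrow> (complex \<Rightarrow> complex) set" where
  "hardy_space p =
     {f. f holomorphic_on unit_disc \<and> bdd_above (hardy_mean p f ` {0<..<1}) \<and>
         (\<forall>z. z \<notin> unit_disc \<longrightarrow> f z = 0)}"

definition hardy_norm :: "real \<Rightarrow> (complex \<Rightarrow> complex) \<Rightarrow> real" where
  "hardy_norm p f = (SUP r\<in>{0<..<1}. hardy_mean p f r) powr (1 / p)"

definition composition_operator ::
  "real \<Rightarrow> (complex \<Rightarrow> complex) \<Rightarrow> (complex \<Rightarrow> complex) \<Rightarrow> (complex \<Rightarrow> complex)" where
  "composition_operator p \<phi> =
     (\<lambda>f. if f \<in> hardy_space p then (\<lambda>z. if z \<in> unit_disc then f (\<phi> z) else 0) else (\<lambda>_. 0))"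

definition holomorphic_semiflow :: "(real \<Rightarrow> complex \<Rightarrow> complex) \<Rightarrow> bool" where
  "holomorphic_semiflow \<phi> \<longleftrightarrow>
     (\<forall>t\<ge>0. \<phi> t holomorphic_on unit_disc \<and> \<phi> t \<in> unit_disc \<rightarrow> unit_disc) \<and>
     (\<forall>z\<in>unit_disc. \<phi> 0 z = z) \<and>
     (\<forall>t\<ge>0. \<forall>s\<ge>0. \<forall>z\<in>unit_disc. \<phi> (t + s) z = \<phi> t (\<phi> s z)) \<and>
     (\<forall>s\<ge>0. \<forall>K. compact K \<and> K \<subseteq> unit_disc \<longrightarrow> uniform_limit K \<phi> (\<phi> s) (at s within {0..}))"

definition elliptic_semiflow :: "(real \<Rightarrow> complex \<Rightarrow> complex) \<Rightarrow> bool" where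
  "elliptic_semiflow \<phi> \<longleftrightarrow>
     holomorphic_semiflow \<phi> \<and> (\<exists>t>0. \<exists>z\<in>unit_disc. \<phi> t z = z)"

definition denjoy_wolff_point :: "(real \<Rightarrow> complex \<Rightarrow> complex) \<Rightarrow> complex \<Rightarrow> bool" where
  "denjoy_wolff_point \<phi> \<tau> \<longleftrightarrow>
     cmod \<tau> = 1 \<and>
     (\<forall>K. compact K \<and> K \<subseteq> unit_disc \<longrightarrow> uniform_limit K \<phi> (\<lambda>_. \<tau>) at_top)"

definition stolz_region :: "complex \<Rightarrow> real \<Rightarrow> complex set" where
  "stolz_region \<tau> M = {z \<in> unit_disc. cmod (z - \<tau>) < M * (1 - cmod z)}"

definition nontangential_limit ::
  "(complex \<Rightarrow> complex) \<Rightarrow> complex \<Rightarrow> complex \<Rightarrow> bool" where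
  "nontangential_limit g \<tau> l \<longleftrightarrow> (\<forall>M>1. (g \<longlongrightarrow> l) (at \<tau> within stolz_region \<tau> M))"

definition hyperbolic_semiflow :: "(real \<Rightarrow> complex \<Rightarrow> complex) \<Rightarrow> bool" where
  "hyperbolic_semiflow \<phi> \<longleftrightarrow>
     holomorphic_semiflow \<phi> \<and> \<not> elliptic_semiflow \<phi> \<and>
     (\<exists>\<tau> (\<alpha>::real). denjoy_wolff_point \<phi> \<tau> \<and> \<alpha> < 0 \<and>
        (\<forall>t\<ge>0. nontangential_limit (deriv (\<phi> t)) \<tau> (of_real (exp (t * \<alpha>)))))"

text \<open>
  A Koenigs function is determined only up to an additive constant, hence a predicate; its range
  \<open>h ` unit_disc\<close> is the Koenigs domain.
\<close>

definition koenigs_function ::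
  "(real \<Rightarrow> complex \<Rightarrow> complex) \<Rightarrow> (complex \<Rightarrow> complex) \<Rightarrow> bool" where
  "koenigs_function \<phi> h \<longleftrightarrow>
     h holomorphic_on unit_disc \<and> inj_on h unit_disc \<and>
     (\<forall>t\<ge>0. \<forall>z\<in>unit_disc. h z + of_real t \<in> h ` unit_disc \<and>
        \<phi> t z = the_inv_into unit_disc h (h z + of_real t))"

definition koenigs_domain ::
  "(real \<Rightarrow> complex \<Rightarrow> complex) \<Rightarrow> complex set \<Rightarrow> bool" where
  "koenigs_domain \<phi> \<Omega> \<longleftrightarrow> (\<exists>h. koenigs_function \<phi> h \<and> \<Omega> = h ` unit_disc)"

end

theory Submission
  imports Defs "HOL-Real_Asymp.Real_Asymp"
begin

text \<open>
  A bounded strip model. By Wolff's and Julia's lemmas the orbits of a hyperbolic semiflow converge to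
  the Denjoy-Wolff point non-tangentially, and normalizing them gives a holomorphic \<open>\<sigma>\<close> with
  \<open>Re \<sigma> > 0\<close> and \<open>\<sigma> \<circ> \<phi>\<^sub>t = exp (- \<alpha> t) \<sigma>\<close>. Its logarithm divided by \<open>- \<alpha>\<close> differs from the
  Koenigs function \<open>h\<close> by a constant, so \<open>Im h\<close> is bounded, and all functions \<open>e\<^sub>s = exp (\<i> s h)\<close> with real
  \<open>s\<close> are bounded and satisfy \<open>e\<^sub>s \<circ> \<phi>\<^sub>t = exp (\<i> s t) e\<^sub>s\<close>.

  Non-commutativity. Multiplication by \<open>exp (2 \<pi> \<i> h)\<close> and composition with \<open>\<phi>\<^sub>t\<close>, \<open>t = 1/2\<close>, both commute
  with \<open>C\<^sub>\<phi>\<close>, but they anticommute.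

  Bicommutant. An operator in the bicommutant commutes with every composition operator of the
  semiflow, hence acts on each \<open>e\<^sub>s\<close> as a scalar \<open>m s\<close>, and \<open>m\<close> is continuous. If the \<open>e\<^sub>s\<close> span a dense
  subspace, the operator is determined by \<open>m\<close>, and the bicommutant is an algebra of continuous
  functions on the real line, which has no idempotents other than 0 and 1.

  Density. Let \<open>M\<close> be the closed span of the \<open>e\<^sub>s\<close>; its bounded elements form an algebra. Geometric
  series give \<open>1 / (h - \<xi>) \<in> M\<close> for \<open>\<xi>\<close> outside the strip, and this propagates along the components of
  the complement of the closure of \<open>\<Omega>\<close>. Each of them reaches beyond the strip, since the complement is
  invariant under translations to the left and has at most two components. Cauchy's formula on fine
  grids then puts \<open>F \<circ> h\<close> into \<open>M\<close> for \<open>F\<close> bounded and holomorphic near the closure. Taking for \<open>F\<close> the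
  Riemann maps of shrinking neighbourhoods of \<open>\<Omega>\<close>, which converge to the inverse of \<open>h\<close> because \<open>\<Omega>\<close> is
  the interior of its closure, we find the identity function, hence all polynomials, in \<open>M\<close>.
\<close>

section \<open>Means on circles and subordination\<close>

text \<open>Boundary values on the unit circle are avoided: all estimates concern integral means
  over smaller circles. Their supremum \<open>hardy_sup\<close>, the p-th power of the norm,
  replaces the norm, and (a + b)^p \<le> 2^p (a^p + b^p) replaces Minkowski's inequality. The
  obstacle in the density proof is that \<open>h\<close> is unbounded, so Riemann sums and Cauchy
  integrals do not converge uniformly on the disc. But since exponentials of small real multiples of
  \<open>h\<close> take values in a sector, \<open>h\<close> lies in every H^p. Hence an error of
  size \<epsilon> (1 + |h|) is small in norm, and the approximations are made in this form. The
  passage from polynomials to H^p needs f (r z) \<rightarrow> f in norm for every p \<ge> 1. For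
  exponents at least 2 this is Clarkson's inequality; a Riesz factorization into two functions of
  H^(2p) reduces the general case to it. A non-abelian commutant excludes minimality because the
  weak closure of the polynomials in the operator commutes with the whole commutant.\<close>

definition poisson_kernel :: "complex \<Rightarrow> complex \<Rightarrow> real" where
  "poisson_kernel w \<zeta> = (1 - (cmod w)\<^sup>2) / (cmod (\<zeta> - w))\<^sup>2"

lemma continuous_on_circle:
  assumes "continuous_on (sphere 0 r) f" "0 \<le> r"
  shows "continuous_on A (\<lambda>\<theta>. f (of_real r * cis \<theta>))"
  by (rule continuous_on_compose2[OF assms(1)])
     (auto intro!: continuous_intros simp: norm_mult assms(2))

lemma cis_neq: "cmod w < 1 \<Longrightarrow> cis \<theta> \<noteq> w"
  using norm_cis[of \<theta>] by auto

lemma poisson_kernel_nonneg: "cmod w < 1 \<Longrightarrow> 0 \<le> poisson_kernel w \<zeta>"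
  unfolding poisson_kernel_def
  by (intro divide_nonneg_nonneg) (auto simp: abs_square_le_1)

lemma poisson_kernel_le:
  assumes "cmod w < 1"
  shows "poisson_kernel w (cis \<theta>) \<le> (1 + cmod w) / (1 - cmod w)"
proof -
  have "1 - cmod w \<le> cmod (cis \<theta> - w)"
    using norm_triangle_ineq2[of "cis \<theta>" w] by simp
  then have "(1 - cmod w)\<^sup>2 \<le> (cmod (cis \<theta> - w))\<^sup>2"
    using assms by (intro power_mono) auto
  then have "poisson_kernel w (cis \<theta>) \<le> (1 - (cmod w)\<^sup>2) / (1 - cmod w)\<^sup>2"
    unfolding poisson_kernel_def using assms
    by (intro divide_left_mono) (auto simp: abs_square_le_1 cis_neq)
  also have "\<dots> = (1 + cmod w) / (1 - cmod w)"
    using assms by (simp add: power2_eq_square divide_simps) (simp add: algebra_simps)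
  finally show ?thesis .
qed

lemma poisson_kernel_eq_Re:
  assumes "cmod w < 1"
  shows "poisson_kernel w (cis \<theta>) = Re ((cis \<theta> + w) / (cis \<theta> - w))"
proof -
  have "(cis \<theta> + w) / (cis \<theta> - w) = (cis \<theta> + w) * cnj (cis \<theta> - w) / (cmod (cis \<theta> - w))\<^sup>2"
    by (simp only: complex_div_cnj[of "cis \<theta> + w"])
  moreover have "Re ((cis \<theta> + w) * cnj (cis \<theta> - w)) = 1 - (cmod w)\<^sup>2"
    using sin_cos_squared_add[of \<theta>]
    unfolding cmod_power2 by (simp add: algebra_simps power2_eq_square)
  ultimately show ?thesis
    unfolding poisson_kernel_def by (metis Re_divide_of_real)
qed

lemma continuous_on_poisson_kernel:
  "cmod w < 1 \<Longrightarrow> continuous_on A (\<lambda>\<theta>. poisson_kernel w (cis \<theta>))"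
  unfolding poisson_kernel_def by (intro continuous_intros) (auto simp: cis_neq)

text \<open>Cauchy's formula for \<open>g\<close>, which agrees with \<open>f\<close> at
  \<open>w\<close>: on the unit circle the factor of \<open>g\<close> and the Cauchy kernel multiply
  to the Poisson kernel.\<close>

lemma Poisson_formula:
  fixes f :: "complex \<Rightarrow> complex"
  assumes cont: "continuous_on (cball 0 1) f" and hol: "f holomorphic_on ball 0 1"
    and w: "cmod w < 1"
  shows "((\<lambda>\<theta>. of_real (poisson_kernel w (cis \<theta>)) * f (cis \<theta>)) has_integral (2 * pi * f w)) {0..2*pi}"
proof -
  have nz: "1 - cnj w * u \<noteq> 0" if "cmod u \<le> 1" for u
  proof
    assume "1 - cnj w * u = 0"
    then have "cmod (cnj w * u) = 1" by (metis eq_iff_diff_eq_0 norm_one)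
    moreover have "cmod w * cmod u \<le> cmod w * 1" using that by (intro mult_left_mono) auto
    ultimately show False using w by (simp add: norm_mult)
  qed
  define g where "g = (\<lambda>u. f u * (1 - of_real ((cmod w)\<^sup>2)) / (1 - cnj w * u))"
  have "continuous_on (cball 0 1) g"
    unfolding g_def using nz by (intro continuous_intros cont) auto
  moreover have "g holomorphic_on ball 0 1"
    unfolding g_def using nz by (intro holomorphic_intros hol) auto
  ultimately have "((\<lambda>u. g u / (u - w)) has_contour_integral (2 * of_real pi * \<i> * g w)) (circlepath 0 1)"
    using w by (intro Cauchy_integral_circlepath) auto
  moreover have "cnj w * w = of_real ((cmod w)\<^sup>2)"
    by (metis complex_norm_square mult.commute)
  then have gw: "g w = f w"
    using nz[of w] w unfolding g_def by simp
  ultimately have "((\<lambda>t. g (0 + of_real 1 * cis t) / (0 + of_real 1 * cis t - w) * of_real 1 * \<i> * cis t)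
      has_integral (2 * of_real pi * \<i> * f w)) {0..2*pi}"
    unfolding circlepath_def by (subst (asm) has_contour_integral_part_circlepath_iff) auto
  then have "((\<lambda>t. -\<i> * (g (0 + of_real 1 * cis t) / (0 + of_real 1 * cis t - w) * of_real 1 * \<i> * cis t))
      has_integral (-\<i> * (2 * of_real pi * \<i> * f w))) {0..2*pi}"
    by (rule has_integral_mult_right)
  also have "-\<i> * (2 * of_real pi * \<i> * f w) = 2 * pi * f w" by simp
  also have "(\<lambda>t. -\<i> * (g (0 + of_real 1 * cis t) / (0 + of_real 1 * cis t - w) * of_real 1 * \<i> * cis t))
     = (\<lambda>\<theta>. of_real (poisson_kernel w (cis \<theta>)) * f (cis \<theta>))"
  proof
    fix t
    define \<zeta> where "\<zeta> = cis t"
    have z1: "\<zeta> * cnj \<zeta> = 1" unfolding \<zeta>_def by (simp add: cis_cnj cis_mult)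
    have zw: "\<zeta> \<noteq> w" using w \<zeta>_def cis_neq by blast
    have nz': "1 - cnj w * \<zeta> \<noteq> 0" using nz[of \<zeta>] \<zeta>_def by simp
    have "of_real ((cmod (\<zeta> - w))\<^sup>2) = (\<zeta> - w) * cnj (\<zeta> - w)"
      using complex_norm_square by blast
    then have "\<zeta> * of_real ((cmod (\<zeta> - w))\<^sup>2) = \<zeta> * ((\<zeta> - w) * cnj (\<zeta> - w))"
      by (simp only:)
    then have "\<zeta> * of_real ((cmod (\<zeta> - w))\<^sup>2) = (\<zeta> - w) * (\<zeta> * cnj \<zeta> - cnj w * \<zeta>)"
      by (simp add: algebra_simps)
    then have *: "\<zeta> * of_real ((cmod (\<zeta> - w))\<^sup>2) = (\<zeta> - w) * (1 - cnj w * \<zeta>)"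
      using z1 by simp
    have nn: "of_real ((cmod (\<zeta> - w))\<^sup>2) \<noteq> (0::complex)" using zw by simp
    have "\<zeta> / ((\<zeta> - w) * (1 - cnj w * \<zeta>)) = 1 / of_real ((cmod (\<zeta> - w))\<^sup>2)"
      using * nn nz' zw by (simp add: frac_eq_eq)
    then have "(1 - of_real ((cmod w)\<^sup>2)) * f \<zeta> * (\<zeta> / ((\<zeta> - w) * (1 - cnj w * \<zeta>)))
       = of_real (poisson_kernel w \<zeta>) * f \<zeta>"
      by (simp add: poisson_kernel_def)
    then show "-\<i> * (g (0 + of_real 1 * cis t) / (0 + of_real 1 * cis t - w) * of_real 1 * \<i> * cis t)
       = of_real (poisson_kernel w (cis t)) * f (cis t)"
      by (simp add: \<zeta>_def g_def mult_ac)
  qed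
  finally show ?thesis .
qed

lemma poisson_kernel_integral:
  assumes "cmod w < 1"
  shows "((\<lambda>\<theta>. poisson_kernel w (cis \<theta>)) has_integral (2 * pi)) {0..2*pi}"
proof -
  have "((\<lambda>\<theta>. of_real (poisson_kernel w (cis \<theta>))) has_integral complex_of_real (2 * pi)) {0..2*pi}"
    using Poisson_formula[of "\<lambda>_. 1" w] assms by simp
  from has_integral_Re[OF this] show ?thesis by simp
qed

text \<open>The tangent of a convex function lies below its graph; this takes the place of Jensen's
  inequality. The point \<open>x = 0\<close> is treated apart because convexity is derived from the
  second derivative on the open half line.\<close>

lemma powr_tangent:
  fixes a x p :: real
  assumes "0 \<le> x" "0 < a" "1 \<le> p"
  shows "a powr p + p * a powr (p - 1) * (x - a) \<le> x powr p"
proof (cases "x = 0")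
  case True
  have "a powr p = a powr (p - 1) * a"
    using assms by (metis powr_mult_base mult.commute add.commute diff_add_cancel less_imp_le)
  then have "a powr p + p * a powr (p - 1) * (x - a) = (1 - p) * a powr p"
    using True by (simp add: algebra_simps)
  also have "\<dots> \<le> 0" using assms by (simp add: mult_nonpos_nonneg)
  finally show ?thesis using True by simp
next
  case False
  have "p * a powr (p - 1) * (x - a) \<le> x powr p - a powr p"
  proof (rule convex_on_imp_above_tangent[where A = "{0<..}" and f = "\<lambda>x. x powr p"])
    show "convex_on {0<..} (\<lambda>x. x powr p)"
    proof (rule f''_ge0_imp_convex)
      fix y :: real assume "y \<in> {0<..}"
      then show "((\<lambda>x. x powr p) has_real_derivative p * y powr (p - 1)) (at y)"
        by (auto intro!: derivative_eq_intros)
      show "((\<lambda>x. p * x powr (p - 1)) has_real_derivative p * ((p - 1) * y powr (p - 1 - 1))) (at y)"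
        using \<open>y \<in> {0<..}\<close> by (auto intro!: derivative_eq_intros)
      show "0 \<le> p * ((p - 1) * y powr (p - 1 - 1))" using assms by simp
    qed auto
    show "((\<lambda>x. x powr p) has_real_derivative p * a powr (p - 1)) (at a within {0<..})"
      using assms by (auto intro!: derivative_eq_intros)
  qed (use assms False in \<open>auto simp: interior_open\<close>)
  then show ?thesis by simp
qed

lemma continuous_on_norm_powr:
  fixes f :: "'a::topological_space \<Rightarrow> 'b::real_normed_vector"
  assumes "continuous_on A f" "0 < p"
  shows "continuous_on A (\<lambda>x. norm (f x) powr p)"
  using assms by (intro continuous_on_powr' continuous_intros) auto

text \<open>The Poisson formula bounds |f w| by the Poisson integral of |f|. Jensen's inequality for
  the probability density \<open>poisson_kernel\<close> / (2 pi) then raises this to the power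
  \<open>p\<close>: the tangent inequality at \<open>a\<close> = |f w| is integrated against the
  kernel.\<close>

lemma norm_powr_le_Poisson:
  fixes f :: "complex \<Rightarrow> complex"
  assumes cont: "continuous_on (cball 0 1) f" and hol: "f holomorphic_on ball 0 1"
    and w: "cmod w < 1" and p: "1 \<le> p"
  shows "2 * pi * cmod (f w) powr p
     \<le> integral {0..2*pi} (\<lambda>\<theta>. poisson_kernel w (cis \<theta>) * cmod (f (cis \<theta>)) powr p)"
proof -
  have cc: "continuous_on A (\<lambda>\<theta>. f (cis \<theta>))" for A
    using continuous_on_circle[of 1 f A] cont continuous_on_subset sphere_cball by fastforce
  have cP: "continuous_on A (\<lambda>\<theta>. poisson_kernel w (cis \<theta>))" for A
    using w by (rule continuous_on_poisson_kernel)
  define a where "a = cmod (f w)"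
  define I where "I = integral {0..2*pi} (\<lambda>\<theta>. poisson_kernel w (cis \<theta>) * cmod (f (cis \<theta>)))"
  have int1: "((\<lambda>\<theta>. poisson_kernel w (cis \<theta>) * cmod (f (cis \<theta>))) has_integral I) {0..2*pi}"
    unfolding I_def
    by (intro integrable_integral integrable_continuous_real continuous_intros cc cP)
  have intp: "(\<lambda>\<theta>. poisson_kernel w (cis \<theta>) * cmod (f (cis \<theta>)) powr p) integrable_on {0..2*pi}"
    using p by (intro integrable_continuous_real continuous_intros cP continuous_on_norm_powr cc) auto
  have le1: "2 * pi * a \<le> I"
  proof -
    note P = Poisson_formula[OF cont hol w]
    have "cmod (integral {0..2*pi} (\<lambda>\<theta>. of_real (poisson_kernel w (cis \<theta>)) * f (cis \<theta>))) \<le> I"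
      unfolding integral_unique[OF int1, symmetric] using P int1
      by (intro integral_norm_bound_integral) (auto simp: norm_mult poisson_kernel_nonneg[OF w])
    then show ?thesis unfolding integral_unique[OF P] by (simp add: a_def norm_mult)
  qed
  show ?thesis
  proof (cases "a = 0")
    case True
    have "0 \<le> integral {0..2*pi} (\<lambda>\<theta>. poisson_kernel w (cis \<theta>) * cmod (f (cis \<theta>)) powr p)"
      by (intro integral_nonneg intp) (auto simp: poisson_kernel_nonneg[OF w])
    with True show ?thesis by (simp add: a_def)
  next
    case False
    then have a: "0 < a" by (simp add: a_def)
    define c where "c = p * a powr (p - 1)"
    have c: "0 \<le> c" using p by (simp add: c_def)
    have "((\<lambda>\<theta>. (a powr p - c * a) * poisson_kernel w (cis \<theta>)
            + c * (poisson_kernel w (cis \<theta>) * cmod (f (cis \<theta>))))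
           has_integral ((a powr p - c * a) * (2 * pi) + c * I)) {0..2*pi}"
      by (intro has_integral_add has_integral_mult_right poisson_kernel_integral w int1)
    moreover have "(a powr p - c * a) * poisson_kernel w (cis \<theta>)
            + c * (poisson_kernel w (cis \<theta>) * cmod (f (cis \<theta>)))
          \<le> poisson_kernel w (cis \<theta>) * cmod (f (cis \<theta>)) powr p" for \<theta>
    proof -
      have "poisson_kernel w (cis \<theta>) * (a powr p + c * (cmod (f (cis \<theta>)) - a))
          \<le> poisson_kernel w (cis \<theta>) * cmod (f (cis \<theta>)) powr p"
        unfolding c_def using p a
        by (intro mult_left_mono powr_tangent poisson_kernel_nonneg w) auto
      then show ?thesis by (simp add: algebra_simps)
    qed
    ultimately have "(a powr p - c * a) * (2 * pi) + c * I
       \<le> integral {0..2*pi} (\<lambda>\<theta>. poisson_kernel w (cis \<theta>) * cmod (f (cis \<theta>)) powr p)"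
      using intp by (intro has_integral_le[OF _ integrable_integral]) auto
    moreover have "c * (2 * pi * a) \<le> c * I" using le1 c by (rule mult_left_mono)
    ultimately show ?thesis by (simp add: a_def algebra_simps)
  qed
qed

lemma mean_value_circle:
  fixes f :: "complex \<Rightarrow> complex"
  assumes "f holomorphic_on ball 0 1" "0 \<le> r" "r < 1"
  shows "((\<lambda>\<theta>. f (of_real r * cis \<theta>)) has_integral (2 * pi * f 0)) {0..2*pi}"
proof -
  have le: "cmod (of_real r * z) < 1" if "cmod z \<le> 1" for z
    using that assms mult_left_le[of "cmod z" r] by (simp add: norm_mult)
  have "continuous_on (cball 0 1) (\<lambda>z. f (of_real r * z))"
    by (rule continuous_on_compose2[OF holomorphic_on_imp_continuous_on[OF assms(1)]])
       (auto intro!: continuous_intros le)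
  moreover have "(\<lambda>z. f (of_real r * z)) holomorphic_on ball 0 1"
    by (rule holomorphic_on_compose_gen[OF _ assms(1), unfolded o_def])
       (auto intro!: holomorphic_intros le)
  ultimately show ?thesis
    using Poisson_formula[of "\<lambda>z. f (of_real r * z)" 0] by (simp add: poisson_kernel_def)
qed

text \<open>As a function of its first argument the kernel is the real part of a holomorphic
  function, so the mean value property applies after composition with \<open>\<psi>\<close>.\<close>

lemma poisson_kernel_comp_integral:
  assumes hol: "\<psi> holomorphic_on ball 0 1" and maps: "\<psi> \<in> ball 0 1 \<rightarrow> ball 0 1"
    and r: "0 \<le> r" "r < 1"
  shows "((\<lambda>\<theta>. poisson_kernel (\<psi> (of_real r * cis \<theta>)) (cis t)) has_integral
     (2 * pi * poisson_kernel (\<psi> 0) (cis t))) {0..2*pi}"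
proof -
  have lt: "cmod (\<psi> z) < 1" if "cmod z < 1" for z using maps that by auto
  have "(\<lambda>z. (cis t + \<psi> z) / (cis t - \<psi> z)) holomorphic_on ball 0 1"
    using lt cis_neq by (intro holomorphic_intros hol) auto
  from has_integral_Re[OF mean_value_circle[OF this r]]
  show ?thesis using r
    by (simp add: poisson_kernel_eq_Re lt norm_mult del: times_divide_eq_right)
qed

text \<open>|f (\<psi> z)|^p is at most the Poisson integral of |f|^p at \<psi> z. After exchanging
  the integrations the inner mean of the kernel equals its value at \<open>\<psi> 0\<close>, and the
  constant is the maximum of that kernel on the circle.\<close>

lemma Littlewood_subordination_closed:
  fixes f :: "complex \<Rightarrow> complex"
  assumes cont: "continuous_on (cball 0 1) f" and hol: "f holomorphic_on ball 0 1"
    and \<psi>: "\<psi> holomorphic_on ball 0 1" "\<psi> \<in> ball 0 1 \<rightarrow> ball 0 1"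
    and r: "0 \<le> r" "r < 1" and p: "1 \<le> p"
  shows "hardy_mean p (\<lambda>z. f (\<psi> z)) r \<le> (1 + cmod (\<psi> 0)) / (1 - cmod (\<psi> 0)) * hardy_mean p f 1"
proof -
  have lt: "cmod (\<psi> z) < 1" if "cmod z < 1" for z using \<psi> that by auto
  have lt': "cmod (\<psi> (of_real r * cis \<theta>)) < 1" for \<theta> using r by (intro lt) (simp add: norm_mult)
  have c\<psi>: "continuous_on A (\<lambda>\<theta>. \<psi> (of_real r * cis \<theta>))" for A
    using r by (intro continuous_on_circle continuous_on_subset[OF holomorphic_on_imp_continuous_on[OF \<psi>(1)]]) auto
  have cc: "continuous_on A (\<lambda>\<theta>. f (cis \<theta>))" for A
    using continuous_on_circle[of 1 f A] cont continuous_on_subset sphere_cball by fastforce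
  have cf\<psi>: "continuous_on A (\<lambda>\<theta>. f (\<psi> (of_real r * cis \<theta>)))" for A
    by (rule continuous_on_compose2[OF cont c\<psi>]) (use lt' in \<open>auto simp: less_imp_le\<close>)
  define K where "K = (1 + cmod (\<psi> 0)) / (1 - cmod (\<psi> 0))"
  have cK: "continuous_on (cbox (0,0) (2*pi,2*pi))
      (\<lambda>(\<theta>,t). poisson_kernel (\<psi> (of_real r * cis \<theta>)) (cis t) * cmod (f (cis t)) powr p)"
  proof -
    have 1: "continuous_on (cbox (0,0) (2*pi,2*pi)) (\<lambda>x. \<psi> (of_real r * cis (fst x)))"
      by (rule continuous_on_compose2[OF c\<psi>[of UNIV]]) (auto intro!: continuous_intros)
    have 2: "continuous_on (cbox (0,0) (2*pi,2*pi)) (\<lambda>x. f (cis (snd x)))"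
      by (rule continuous_on_compose2[OF cc[of UNIV]]) (auto intro!: continuous_intros)
    show ?thesis unfolding poisson_kernel_def case_prod_beta
      using p cis_neq lt' by (intro continuous_intros continuous_on_norm_powr 1 2) auto
  qed
  have "2 * pi * hardy_mean p (\<lambda>z. f (\<psi> z)) r
     = integral {0..2*pi} (\<lambda>\<theta>. 2 * pi * cmod (f (\<psi> (of_real r * cis \<theta>))) powr p)"
    by (simp add: hardy_mean_def)
  also have "\<dots> \<le> integral {0..2*pi} (\<lambda>\<theta>. integral {0..2*pi}
      (\<lambda>t. poisson_kernel (\<psi> (of_real r * cis \<theta>)) (cis t) * cmod (f (cis t)) powr p))"
  proof (rule integral_le)
    show "(\<lambda>\<theta>. 2 * pi * cmod (f (\<psi> (of_real r * cis \<theta>))) powr p) integrable_on {0..2*pi}"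
      using p by (intro integrable_continuous_real continuous_intros continuous_on_norm_powr cf\<psi>) auto
    show "(\<lambda>\<theta>. integral {0..2*pi}
      (\<lambda>t. poisson_kernel (\<psi> (of_real r * cis \<theta>)) (cis t) * cmod (f (cis t)) powr p)) integrable_on {0..2*pi}"
      using integral_integrable_2dim[OF cK] by (simp add: cbox_interval)
  qed (use norm_powr_le_Poisson[OF cont hol lt' p] in auto)
  also have "\<dots> = integral {0..2*pi} (\<lambda>t. integral {0..2*pi}
      (\<lambda>\<theta>. poisson_kernel (\<psi> (of_real r * cis \<theta>)) (cis t) * cmod (f (cis t)) powr p))"
    using integral_swap_continuous[OF cK] by (simp add: cbox_interval)
  also have "\<dots> = integral {0..2*pi} (\<lambda>t. 2 * pi * poisson_kernel (\<psi> 0) (cis t) * cmod (f (cis t)) powr p)"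
    by (simp only: integral_unique[OF has_integral_mult_left[OF poisson_kernel_comp_integral[OF \<psi> r]]])
  also have "\<dots> \<le> integral {0..2*pi} (\<lambda>t. 2 * pi * (K * cmod (f (cis t)) powr p))"
  proof (rule integral_le)
    show "(\<lambda>t. 2 * pi * poisson_kernel (\<psi> 0) (cis t) * cmod (f (cis t)) powr p) integrable_on {0..2*pi}"
      using p lt[of 0]
      by (intro integrable_continuous_real continuous_intros continuous_on_norm_powr cc continuous_on_poisson_kernel) auto
    show "(\<lambda>t. 2 * pi * (K * cmod (f (cis t)) powr p)) integrable_on {0..2*pi}"
      using p by (intro integrable_continuous_real continuous_intros continuous_on_norm_powr cc) auto
    fix t
    have "poisson_kernel (\<psi> 0) (cis t) \<le> K"
      unfolding K_def using lt[of 0] by (intro poisson_kernel_le) auto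
    then show "2 * pi * poisson_kernel (\<psi> 0) (cis t) * cmod (f (cis t)) powr p \<le> 2 * pi * (K * cmod (f (cis t)) powr p)"
      by (simp add: mult_right_mono)
  qed
  also have "\<dots> = 2 * pi * (K * hardy_mean p f 1)"
    by (simp add: hardy_mean_def)
  finally have "hardy_mean p (\<lambda>z. f (\<psi> z)) r \<le> K * hardy_mean p f 1"
    using mult_le_cancel_left_pos[of "2 * pi"] by simp
  then show ?thesis by (simp add: K_def)
qed

section \<open>Means and norms of functions on the open disc\<close>

lemma hardy_mean_scale:
  "hardy_mean p (\<lambda>z. f (of_real R * z)) r = hardy_mean p f (R * r)"
  by (simp add: hardy_mean_def mult.assoc)

lemma holomorphic_scale:
  assumes "f holomorphic_on ball 0 1" "0 \<le> R" "R < 1"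
  shows "continuous_on (cball 0 1) (\<lambda>z. f (of_real R * z))"
    and "(\<lambda>z. f (of_real R * z)) holomorphic_on ball 0 1"
proof -
  have le: "cmod (of_real R * z) < 1" if "cmod z \<le> 1" for z
    using that assms mult_left_le[of "cmod z" R] by (simp add: norm_mult)
  show "continuous_on (cball 0 1) (\<lambda>z. f (of_real R * z))"
    by (rule continuous_on_compose2[OF holomorphic_on_imp_continuous_on[OF assms(1)]])
       (auto intro!: continuous_intros le)
  show "(\<lambda>z. f (of_real R * z)) holomorphic_on ball 0 1"
    by (rule holomorphic_on_compose_gen[OF _ assms(1), unfolded o_def])
       (auto intro!: holomorphic_intros le)
qed

lemma continuous_on_circle_holomorphic:
  assumes "f holomorphic_on ball 0 1" "0 \<le> r" "r < 1"
  shows "continuous_on A (\<lambda>\<theta>. f (of_real r * cis \<theta>))"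
  using assms
  by (intro continuous_on_circle continuous_on_subset[OF holomorphic_on_imp_continuous_on]) auto

lemma hardy_mean_integrable:
  assumes "f holomorphic_on ball 0 1" "0 \<le> r" "r < 1" "1 \<le> p"
  shows "(\<lambda>\<theta>. cmod (f (of_real r * cis \<theta>)) powr p) integrable_on {0..2*pi}"
  using assms
  by (intro integrable_continuous_real continuous_on_norm_powr continuous_on_circle_holomorphic) auto

lemma hardy_mean_nonneg: "0 \<le> hardy_mean p f r"
  unfolding hardy_mean_def
  by (cases "(\<lambda>\<theta>. cmod (f (of_real r * cis \<theta>)) powr p) integrable_on {0..2*pi}")
     (auto intro: integral_nonneg simp: not_integrable_integral)

lemma hardy_mean_cong:
  assumes "\<And>z. cmod z = r \<Longrightarrow> f z = g z" "0 \<le> r"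
  shows "hardy_mean p f r = hardy_mean p g r"
  unfolding hardy_mean_def by (intro integral_cong) (simp add: assms norm_mult)

text \<open>Subordination for the identity map, with constant 1 because it fixes the origin; scaling
  by \<open>R\<close> moves the larger circle to the unit circle.\<close>

lemma hardy_mean_mono:
  assumes hol: "f holomorphic_on ball 0 1" and "0 \<le> r" "r \<le> R" "R < 1" "1 \<le> p"
  shows "hardy_mean p f r \<le> hardy_mean p f R"
proof (cases "r = R")
  case False
  then have "0 < R" "r / R < 1" "0 \<le> r / R" using assms by auto
  have "hardy_mean p (\<lambda>z. f (of_real R * z)) (r / R) \<le> hardy_mean p (\<lambda>z. f (of_real R * z)) 1"
    using Littlewood_subordination_closed[OF holomorphic_scale[OF hol], of R "\<lambda>z. z" "r / R" p]
      \<open>0 < R\<close> \<open>r / R < 1\<close> assms by auto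
  then show ?thesis using \<open>0 < R\<close> by (simp add: hardy_mean_scale)
qed auto

text \<open>The dilated functions f (R z) are continuous on the closed disc. The limit R
  \<rightarrow> 1 is harmless since \<open>\<psi>\<close> maps the circle of radius \<open>r\<close>
  into the open disc, where \<open>f\<close> is continuous.\<close>

lemma Littlewood_subordination:
  assumes hol: "f holomorphic_on ball 0 1"
    and \<psi>: "\<psi> holomorphic_on ball 0 1" "\<psi> \<in> ball 0 1 \<rightarrow> ball 0 1"
    and r: "0 \<le> r" "r < 1" and p: "1 \<le> p"
    and B: "\<And>R. 0 < R \<Longrightarrow> R < 1 \<Longrightarrow> hardy_mean p f R \<le> B"
  shows "hardy_mean p (\<lambda>z. f (\<psi> z)) r \<le> (1 + cmod (\<psi> 0)) / (1 - cmod (\<psi> 0)) * B"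
proof -
  have lt: "cmod (\<psi> z) < 1" if "cmod z < 1" for z using \<psi> that by auto
  define K where "K = (1 + cmod (\<psi> 0)) / (1 - cmod (\<psi> 0))"
  have K: "0 \<le> K" using lt[of 0] by (simp add: K_def)
  define I where "I = (\<lambda>R. hardy_mean p (\<lambda>z. f (of_real R * \<psi> z)) r)"
  have le: "I R \<le> K * B" if "0 < R" "R < 1" for R
  proof -
    have "I R \<le> K * hardy_mean p (\<lambda>z. f (of_real R * z)) 1"
      unfolding I_def K_def using that
      by (intro Littlewood_subordination_closed[of "\<lambda>z. f (of_real R * z)"] holomorphic_scale hol \<psi> r p) auto
    also have "\<dots> \<le> K * B" using B[OF that] K by (simp add: hardy_mean_scale mult_left_mono)
    finally show ?thesis .
  qed
  have lt': "cmod (\<psi> (of_real r * cis \<theta>)) < 1" for \<theta> using r by (intro lt) (simp add: norm_mult)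
  have "continuous_on {0..1} I"
  proof -
    have 1: "continuous_on ({0..1} \<times> {0..2*pi}) (\<lambda>x. \<psi> (of_real r * cis (snd x)))"
      by (rule continuous_on_compose2[OF continuous_on_circle_holomorphic[OF \<psi>(1) r, of UNIV]])
        (auto intro!: continuous_intros)
    have lt2: "cmod (of_real R * \<psi> (of_real r * cis \<theta>)) < 1" if "0 \<le> R" "R \<le> 1" for R \<theta>
      using lt'[of \<theta>] that mult_left_le_one_le[of "cmod (\<psi> (of_real r * cis \<theta>))" R]
      by (simp add: norm_mult)
    have "continuous_on ({0..1} \<times> {0..2*pi}) (\<lambda>x. f (of_real (fst x) * \<psi> (of_real r * cis (snd x))))"
      by (rule continuous_on_compose2[OF holomorphic_on_imp_continuous_on[OF hol]])
         (use lt2 in \<open>auto intro!: continuous_intros 1\<close>)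
    then have "continuous_on ({0..1} \<times> {0..2*pi})
       (\<lambda>(R,\<theta>). cmod (f (of_real R * \<psi> (of_real r * cis \<theta>))) powr p)"
      unfolding case_prod_beta using p by (intro continuous_on_norm_powr) auto
    then show ?thesis
      unfolding I_def hardy_mean_def
      by (intro integral_continuous_on_param[where 'b = real, unfolded cbox_interval])
  qed
  then have "(I \<longlongrightarrow> I 1) (at 1 within {0..1})"
    by (simp add: continuous_on_def)
  then have "(I \<longlongrightarrow> I 1) (at 1 within {0<..<1})"
    by (rule tendsto_within_subset) auto
  then have "I 1 \<le> K * B"
    by (rule tendsto_upperbound) (use le in \<open>auto simp: eventually_at_filter at_within_eq_bot_iff\<close>)
  then show ?thesis by (simp add: I_def K_def)
qed

text \<open>The p-th power of \<open>hardy_norm\<close>. Working with it keeps all estimates at the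
  level of integrals; the price is a factor 2^p in the triangle inequality, which affects neither
  boundedness nor closedness.\<close>

definition hardy_sup :: "real \<Rightarrow> (complex \<Rightarrow> complex) \<Rightarrow> real" where
  "hardy_sup p f = (SUP r\<in>{0<..<1}. hardy_mean p f r)"

definition disc_ext :: "(complex \<Rightarrow> complex) \<Rightarrow> complex \<Rightarrow> complex" where
  "disc_ext u = (\<lambda>z. if z \<in> unit_disc then u z else 0)"

lemma disc_ext_simps [simp]:
  "cmod z < 1 \<Longrightarrow> disc_ext u z = u z" "\<not> cmod z < 1 \<Longrightarrow> disc_ext u z = 0"
  by (auto simp: disc_ext_def)

lemma holomorphic_disc_ext [simp]: "disc_ext u holomorphic_on unit_disc \<longleftrightarrow> u holomorphic_on unit_disc"
  by (rule holomorphic_cong) auto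

lemma hardy_mean_disc_ext: "0 \<le> r \<Longrightarrow> r < 1 \<Longrightarrow> hardy_mean p (disc_ext u) r = hardy_mean p u r"
  by (rule hardy_mean_cong) auto

lemma hardy_spaceI:
  assumes "f holomorphic_on unit_disc" "\<And>r. 0 < r \<Longrightarrow> r < 1 \<Longrightarrow> hardy_mean p f r \<le> B"
    "\<And>z. \<not> cmod z < 1 \<Longrightarrow> f z = 0"
  shows "f \<in> hardy_space p"
  unfolding hardy_space_def using assms by (auto intro!: bdd_aboveI2[where M = B])

lemma hardy_space_disc_extI:
  assumes "f holomorphic_on unit_disc" "\<And>r. 0 < r \<Longrightarrow> r < 1 \<Longrightarrow> hardy_mean p f r \<le> B"
  shows "disc_ext f \<in> hardy_space p"
  using assms by (intro hardy_spaceI[where B = B]) (auto simp: hardy_mean_disc_ext)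

lemma hardy_space_holomorphic: "f \<in> hardy_space p \<Longrightarrow> f holomorphic_on unit_disc"
  by (simp add: hardy_space_def)

lemma hardy_space_zero: "f \<in> hardy_space p \<Longrightarrow> \<not> cmod z < 1 \<Longrightarrow> f z = 0"
  by (simp add: hardy_space_def)

lemma hardy_mean_le_sup:
  "f \<in> hardy_space p \<Longrightarrow> 0 < r \<Longrightarrow> r < 1 \<Longrightarrow> hardy_mean p f r \<le> hardy_sup p f"
  unfolding hardy_sup_def hardy_space_def by (intro cSUP_upper) auto

lemma hardy_sup_le:
  assumes "\<And>r. 0 < r \<Longrightarrow> r < 1 \<Longrightarrow> hardy_mean p f r \<le> B"
  shows "hardy_sup p f \<le> B"
  unfolding hardy_sup_def using assms by (intro cSUP_least) auto

lemma hardy_sup_nonneg: "f \<in> hardy_space p \<Longrightarrow> 0 \<le> hardy_sup p f"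
  using hardy_mean_le_sup[of f p "1/2"] hardy_mean_nonneg[of p f "1/2"] by simp

lemma hardy_norm_eq: "hardy_norm p f = hardy_sup p f powr (1 / p)"
  by (simp add: hardy_norm_def hardy_sup_def)

text \<open>Subordination for the constant map with value \<open>z\<close>. At radius 0 the mean of
  the constant is 2 pi |f z|^p, and 2 pi \<ge> 1 is dropped.\<close>

lemma hardy_eval:
  assumes f: "f \<in> hardy_space p" and z: "cmod z < 1" and p: "1 \<le> p"
  shows "cmod (f z) powr p \<le> (1 + cmod z) / (1 - cmod z) * hardy_sup p f"
proof -
  have "hardy_mean p (\<lambda>_. f z) 0 \<le> (1 + cmod z) / (1 - cmod z) * hardy_sup p f"
    using Littlewood_subordination[of f "\<lambda>_. z" 0 p "hardy_sup p f"] assms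
    by (auto simp: hardy_space_holomorphic hardy_mean_le_sup)
  moreover have "1 * cmod (f z) powr p \<le> 2 * pi * cmod (f z) powr p"
    using pi_gt3 by (intro mult_right_mono) auto
  ultimately show ?thesis by (simp add: hardy_mean_def)
qed

lemma hardy_mean_mult_le:
  assumes "f holomorphic_on unit_disc" "u holomorphic_on unit_disc" "1 \<le> p" "0 \<le> r" "r < 1"
    and B: "\<And>z. cmod z < 1 \<Longrightarrow> cmod (u z) \<le> B"
  shows "hardy_mean p (\<lambda>z. u z * f z) r \<le> B powr p * hardy_mean p f r"
proof -
  have B0: "0 \<le> B" using order_trans[OF norm_ge_zero B[of 0]] by simp
  have "hardy_mean p (\<lambda>z. u z * f z) r \<le> integral {0..2*pi} (\<lambda>\<theta>. B powr p * cmod (f (of_real r * cis \<theta>)) powr p)"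
    unfolding hardy_mean_def
  proof (rule integral_le)
    show "(\<lambda>\<theta>. cmod (u (of_real r * cis \<theta>) * f (of_real r * cis \<theta>)) powr p) integrable_on {0..2*pi}"
      using assms hardy_mean_integrable[of "\<lambda>z. u z * f z" r p] by (simp add: holomorphic_on_mult)
    show "(\<lambda>\<theta>. B powr p * cmod (f (of_real r * cis \<theta>)) powr p) integrable_on {0..2*pi}"
      using assms hardy_mean_integrable[of f r p] by (intro integrable_on_mult_right) auto
    show "cmod (u (of_real r * cis \<theta>) * f (of_real r * cis \<theta>)) powr p \<le> B powr p * cmod (f (of_real r * cis \<theta>)) powr p" for \<theta>
      using B[of "of_real r * cis \<theta>"] assms B0
      by (simp add: norm_mult powr_mult mult_right_mono powr_mono2)
  qed
  then show ?thesis by (simp add: hardy_mean_def)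
qed

lemma hardy_mean_cmult: "hardy_mean p (\<lambda>z. c * f z) r = cmod c powr p * hardy_mean p f r"
  by (simp add: hardy_mean_def norm_mult powr_mult)

lemma powr_add_le:
  fixes a b p :: real
  assumes "0 \<le> a" "0 \<le> b" "0 \<le> p"
  shows "(a + b) powr p \<le> 2 powr p * (a powr p + b powr p)"
proof -
  have "(a + b) powr p \<le> (2 * max a b) powr p"
    using assms by (intro powr_mono2) auto
  also have "\<dots> = 2 powr p * (max a b) powr p" using assms by (simp add: powr_mult)
  also have "\<dots> \<le> 2 powr p * (a powr p + b powr p)"
    by (intro mult_left_mono) (auto simp: max_def)
  finally show ?thesis .
qed

lemma hardy_mean_add_le:
  assumes "f holomorphic_on unit_disc" "g holomorphic_on unit_disc" "1 \<le> p" "0 \<le> r" "r < 1"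
  shows "hardy_mean p (\<lambda>z. f z + g z) r \<le> 2 powr p * (hardy_mean p f r + hardy_mean p g r)"
proof -
  note I = hardy_mean_integrable[OF _ assms(4,5,3)]
  have "hardy_mean p (\<lambda>z. f z + g z) r \<le> integral {0..2*pi} (\<lambda>\<theta>. 2 powr p *
      (cmod (f (of_real r * cis \<theta>)) powr p + cmod (g (of_real r * cis \<theta>)) powr p))"
    unfolding hardy_mean_def
  proof (rule integral_le)
    show "(\<lambda>\<theta>. cmod (f (of_real r * cis \<theta>) + g (of_real r * cis \<theta>)) powr p) integrable_on {0..2*pi}"
      using I[of "\<lambda>z. f z + g z"] assms by (simp add: holomorphic_on_add)
    show "(\<lambda>\<theta>. 2 powr p * (cmod (f (of_real r * cis \<theta>)) powr p + cmod (g (of_real r * cis \<theta>)) powr p)) integrable_on {0..2*pi}"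
      using I[OF assms(1)] I[OF assms(2)] by (intro integrable_on_mult_right integrable_add)
    fix \<theta>
    let ?a = "f (of_real r * cis \<theta>)" and ?b = "g (of_real r * cis \<theta>)"
    have "cmod (?a + ?b) powr p \<le> (cmod ?a + cmod ?b) powr p"
      using assms by (intro powr_mono2 norm_triangle_ineq) auto
    then show "cmod (?a + ?b) powr p \<le> 2 powr p * (cmod ?a powr p + cmod ?b powr p)"
      using powr_add_le[of "cmod ?a" "cmod ?b" p] assms by simp
  qed
  also have "\<dots> = 2 powr p * (hardy_mean p f r + hardy_mean p g r)"
    using I[OF assms(1)] I[OF assms(2)] by (simp add: hardy_mean_def integral_add)
  finally show ?thesis .
qed

lemma hardy_space_add:
  assumes "f \<in> hardy_space p" "g \<in> hardy_space p" "1 \<le> p"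
  shows "(\<lambda>z. f z + g z) \<in> hardy_space p"
    and "hardy_sup p (\<lambda>z. f z + g z) \<le> 2 powr p * (hardy_sup p f + hardy_sup p g)"
proof -
  have *: "hardy_mean p (\<lambda>z. f z + g z) r \<le> 2 powr p * (hardy_sup p f + hardy_sup p g)"
    if "0 < r" "r < 1" for r
    using hardy_mean_add_le[of f g p r] assms that
      hardy_mean_le_sup[OF assms(1) that] hardy_mean_le_sup[OF assms(2) that]
    by (smt (verit) hardy_space_holomorphic mult_left_mono powr_ge_zero)
  show "(\<lambda>z. f z + g z) \<in> hardy_space p"
    using assms * by (intro hardy_spaceI) (auto intro!: holomorphic_intros simp: hardy_space_holomorphic hardy_space_zero)
  show "hardy_sup p (\<lambda>z. f z + g z) \<le> 2 powr p * (hardy_sup p f + hardy_sup p g)"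
    using * by (intro hardy_sup_le)
qed

lemma hardy_space_mult:
  assumes "f \<in> hardy_space p" "u holomorphic_on unit_disc" "1 \<le> p"
    and B: "\<And>z. cmod z < 1 \<Longrightarrow> cmod (u z) \<le> B"
  shows "(\<lambda>z. u z * f z) \<in> hardy_space p"
    and "hardy_sup p (\<lambda>z. u z * f z) \<le> B powr p * hardy_sup p f"
proof -
  have *: "hardy_mean p (\<lambda>z. u z * f z) r \<le> B powr p * hardy_sup p f"
    if "0 < r" "r < 1" for r
    using hardy_mean_mult_le[of f u p r B] assms that hardy_mean_le_sup[OF assms(1) that]
    by (smt (verit) hardy_space_holomorphic mult_left_mono powr_ge_zero)
  show "(\<lambda>z. u z * f z) \<in> hardy_space p"
    using assms * by (intro hardy_spaceI) (auto intro!: holomorphic_intros simp: hardy_space_holomorphic hardy_space_zero)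
  show "hardy_sup p (\<lambda>z. u z * f z) \<le> B powr p * hardy_sup p f"
    using * by (intro hardy_sup_le)
qed

lemma hardy_space_cmult:
  assumes "f \<in> hardy_space p" "1 \<le> p"
  shows "(\<lambda>z. c * f z) \<in> hardy_space p"
    and "hardy_sup p (\<lambda>z. c * f z) \<le> cmod c powr p * hardy_sup p f"
  using hardy_space_mult[of f p "\<lambda>_. c" "cmod c"] assms by auto

lemma hardy_mean_bounded:
  assumes "u holomorphic_on unit_disc" "1 \<le> p" "0 \<le> r" "r < 1"
    and B: "\<And>z. cmod z < 1 \<Longrightarrow> cmod (u z) \<le> B"
  shows "hardy_mean p u r \<le> 2 * pi * B powr p"
  using hardy_mean_mult_le[of "\<lambda>_. 1" u p r B] assms by (auto simp: hardy_mean_def mult_ac)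

lemma hardy_space_bounded:
  assumes "u holomorphic_on unit_disc" "1 \<le> p"
    and B: "\<And>z. cmod z < 1 \<Longrightarrow> cmod (u z) \<le> B"
  shows "disc_ext u \<in> hardy_space p" "hardy_sup p (disc_ext u) \<le> 2 * pi * B powr p"
proof -
  have *: "hardy_mean p u r \<le> 2 * pi * B powr p" if "0 < r" "r < 1" for r
    using hardy_mean_bounded[OF assms(1,2) _ _ B] that by auto
  show "disc_ext u \<in> hardy_space p" using assms(1) * by (rule hardy_space_disc_extI)
  show "hardy_sup p (disc_ext u) \<le> 2 * pi * B powr p"
    using * by (intro hardy_sup_le) (simp add: hardy_mean_disc_ext)
qed

lemma hardy_space_comp:
  assumes "f \<in> hardy_space p" "1 \<le> p"
    and \<psi>: "\<psi> holomorphic_on ball 0 1" "\<psi> \<in> ball 0 1 \<rightarrow> ball 0 1"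
  shows "disc_ext (\<lambda>z. f (\<psi> z)) \<in> hardy_space p"
    and "hardy_sup p (disc_ext (\<lambda>z. f (\<psi> z))) \<le> (1 + cmod (\<psi> 0)) / (1 - cmod (\<psi> 0)) * hardy_sup p f"
proof -
  have *: "hardy_mean p (\<lambda>z. f (\<psi> z)) r \<le> (1 + cmod (\<psi> 0)) / (1 - cmod (\<psi> 0)) * hardy_sup p f"
    if "0 < r" "r < 1" for r
    using that assms
    by (intro Littlewood_subordination) (auto simp: hardy_space_holomorphic hardy_mean_le_sup)
  have "(\<lambda>z. f (\<psi> z)) holomorphic_on unit_disc"
    using holomorphic_on_compose_gen[OF \<psi>(1) hardy_space_holomorphic[OF assms(1)]] \<psi>(2)
    by (auto simp: o_def)
  then show "disc_ext (\<lambda>z. f (\<psi> z)) \<in> hardy_space p"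
    using * by (rule hardy_space_disc_extI)
  show "hardy_sup p (disc_ext (\<lambda>z. f (\<psi> z))) \<le> (1 + cmod (\<psi> 0)) / (1 - cmod (\<psi> 0)) * hardy_sup p f"
    using * by (intro hardy_sup_le) (simp add: hardy_mean_disc_ext)
qed

section \<open>The lemmas of Schwarz-Pick, Wolff and Julia\<close>

text \<open>With q = f - f 0 and Re q < B, the function q / (2 B - q) maps the disc into itself and
  fixes 0, so the Schwarz lemma applies to it.\<close>

lemma Borel_Caratheodory:
  assumes hol: "f holomorphic_on unit_disc" and Re: "\<And>z. cmod z < 1 \<Longrightarrow> Re (f z) < A"
    and z: "cmod z < 1"
  shows "cmod (f z - f 0) \<le> 2 * (A - Re (f 0)) * cmod z / (1 - cmod z)"
proof -
  define B where "B = A - Re (f 0)"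
  have B: "0 < B" using Re[of 0] by (simp add: B_def)
  define q where "q = (\<lambda>z. f z - f 0)"
  define g where "g = (\<lambda>z. q z / (of_real (2 * B) - q z))"
  have Req: "Re (q z) < B" if "cmod z < 1" for z using Re[OF that] by (simp add: q_def B_def)
  have nz: "of_real (2 * B) - q z \<noteq> 0" if "cmod z < 1" for z
    using Req[OF that] B by (auto simp: complex_eq_iff)
  have "g holomorphic_on unit_disc"
    unfolding g_def q_def by (intro holomorphic_intros hol) (use nz in \<open>auto simp: q_def\<close>)
  moreover have "g 0 = 0" by (simp add: g_def q_def)
  moreover have "cmod (g z) < 1" if "cmod z < 1" for z
  proof -
    have "0 < 4 * B * (B - Re (q z))" using B Req[OF that] by simp
    then have "(cmod (q z))\<^sup>2 < (cmod (of_real (2 * B) - q z))\<^sup>2"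
      unfolding cmod_power2 by (simp add: power2_eq_square algebra_simps)
    then have "cmod (q z) < cmod (of_real (2 * B) - q z)" using power2_less_imp_less norm_ge_zero by blast
    then show ?thesis unfolding g_def norm_divide by (subst divide_less_eq_1_pos) auto
  qed
  ultimately have "cmod (g z) \<le> cmod z" using z by (rule Schwarz_Lemma(1))
  then have "cmod (q z) \<le> cmod z * cmod (of_real (2 * B) - q z)"
    using nz[OF z] by (simp add: g_def norm_divide divide_le_eq)
  also have "\<dots> \<le> cmod z * (2 * B + cmod (q z))"
    using norm_triangle_ineq4[of "of_real (2 * B)" "q z"] B by (intro mult_left_mono) auto
  finally show ?thesis using z by (simp add: q_def B_def field_simps)
qed

text \<open>The relation cosh^2 - sinh^2 = 1 for half the hyperbolic distance of \<open>a\<close>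
  and \<open>b\<close>, with denominators cleared.\<close>

lemma cmod_one_minus_diff:
  "(cmod (1 - cnj b * a))\<^sup>2 - (cmod (a - b))\<^sup>2 = (1 - (cmod a)\<^sup>2) * (1 - (cmod b)\<^sup>2)"
  unfolding cmod_power2 by (simp add: power2_eq_square algebra_simps)

lemma cnj_mult_neq_1: "cmod a < 1 \<Longrightarrow> cmod b < 1 \<Longrightarrow> 1 - cnj b * a \<noteq> 0"
proof
  assume "cmod a < 1" "cmod b < 1" "1 - cnj b * a = 0"
  then have "0 < (1 - (cmod a)\<^sup>2) * (1 - (cmod b)\<^sup>2)" by (simp add: abs_square_less_1)
  with \<open>1 - cnj b * a = 0\<close> cmod_one_minus_diff[of b a] show False
    using zero_le_power2[of "cmod (a - b)"] by (simp del: zero_le_power2)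
qed

lemma Schwarz_Pick:
  assumes hol: "f holomorphic_on unit_disc" and maps: "\<And>z. cmod z < 1 \<Longrightarrow> cmod (f z) < 1"
    and z: "cmod z < 1" and w: "cmod w < 1"
  shows "cmod (f z - f w) * cmod (1 - cnj w * z) \<le> cmod (z - w) * cmod (1 - cnj (f w) * f z)"
proof -
  define M where "M = Moebius_function 0"
  have Mh: "M a holomorphic_on unit_disc" if "cmod a < 1" for a
    unfolding M_def by (rule Moebius_function_holomorphic[OF that])
  have Ml: "cmod (M a z) < 1" if "cmod a < 1" "cmod z < 1" for a z
    unfolding M_def by (rule Moebius_function_norm_lt_1[OF that])
  define G where "G = (\<lambda>z. M (f w) (f (M (- w) z)))"
  have "G holomorphic_on unit_disc"
    unfolding G_def
    using holomorphic_on_compose_gen[OF holomorphic_on_compose_gen[OF Mh hol] Mh] Ml maps w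
    by (auto simp: o_def image_subset_iff)
  moreover have "G 0 = 0" by (simp add: G_def M_def Moebius_function_simple)
  moreover have "cmod (G z) < 1" if "cmod z < 1" for z
    unfolding G_def using that w by (intro Ml maps) auto
  moreover have "cmod (M w z) < 1" using Ml w z by auto
  ultimately have "cmod (G (M w z)) \<le> cmod (M w z)" by (rule Schwarz_Lemma(1))
  also have "M (- w) (M w z) = z" unfolding M_def using w z by (intro Moebius_function_compose) auto
  then have "G (M w z) = M (f w) (f z)" by (simp add: G_def)
  finally have "cmod (f z - f w) / cmod (1 - cnj (f w) * f z) \<le> cmod (z - w) / cmod (1 - cnj w * z)"
    by (simp add: M_def Moebius_function_simple norm_divide)
  moreover have "0 < cmod (1 - cnj (f w) * f z)" "0 < cmod (1 - cnj w * z)"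
    using cnj_mult_neq_1 maps w z by auto
  ultimately show ?thesis by (simp add: field_simps)
qed

text \<open>|z - w|^2 / ((1 - |z|^2) (1 - |w|^2)) is the squared hyperbolic sine of half the
  hyperbolic distance. This form and the next both result from squaring \<open>Schwarz_Pick\<close>
  and cancelling a common product by \<open>cmod_one_minus_diff\<close>. This one controls
  increments of orbits, the next one survives the passage to a boundary point.\<close>

lemma Schwarz_Pick_sinh:
  assumes "f holomorphic_on unit_disc" and "\<And>z. cmod z < 1 \<Longrightarrow> cmod (f z) < 1"
    and "cmod z < 1" and "cmod w < 1"
  shows "(cmod (f z - f w))\<^sup>2 * ((1 - (cmod z)\<^sup>2) * (1 - (cmod w)\<^sup>2))
    \<le> (cmod (z - w))\<^sup>2 * ((1 - (cmod (f z))\<^sup>2) * (1 - (cmod (f w))\<^sup>2))"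
proof -
  have "(cmod (f z - f w) * cmod (1 - cnj w * z))\<^sup>2 \<le> (cmod (z - w) * cmod (1 - cnj (f w) * f z))\<^sup>2"
    using Schwarz_Pick[OF assms] by (intro power_mono) auto
  then show ?thesis
    unfolding cmod_one_minus_diff[symmetric] power_mult_distrib
    by (simp add: right_diff_distrib left_diff_distrib mult_ac)
qed

lemma Schwarz_Pick_cosh:
  assumes "f holomorphic_on unit_disc" and "\<And>z. cmod z < 1 \<Longrightarrow> cmod (f z) < 1"
    and "cmod z < 1" and "cmod w < 1"
  shows "(1 - (cmod z)\<^sup>2) * (1 - (cmod w)\<^sup>2) * (cmod (1 - cnj (f w) * f z))\<^sup>2
    \<le> (1 - (cmod (f z))\<^sup>2) * (1 - (cmod (f w))\<^sup>2) * (cmod (1 - cnj w * z))\<^sup>2"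
proof -
  have "(cmod (f z - f w) * cmod (1 - cnj w * z))\<^sup>2 \<le> (cmod (z - w) * cmod (1 - cnj (f w) * f z))\<^sup>2"
    using Schwarz_Pick[OF assms] by (intro power_mono) auto
  then show ?thesis
    unfolding cmod_one_minus_diff[symmetric] power_mult_distrib
    by (simp add: right_diff_distrib left_diff_distrib mult_ac)
qed

lemma cmod_one_minus_cnj_unit: "cmod \<tau> = 1 \<Longrightarrow> cmod (1 - cnj \<tau> * z) = cmod (\<tau> - z)"
proof -
  assume "cmod \<tau> = 1"
  then have "cnj \<tau> * \<tau> = 1" by (metis complex_norm_square mult.commute of_real_1 power_one)
  then have "1 - cnj \<tau> * z = cnj \<tau> * (\<tau> - z)" by (simp add: algebra_simps)
  then show ?thesis using \<open>cmod \<tau> = 1\<close> by (simp add: norm_mult)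
qed

text \<open>Brouwer gives fixed points \<open>w n\<close> of \<open>r n\<close> times
  \<open>\<psi>\<close>. They accumulate at a boundary point \<open>\<omega>\<close>, since an
  interior limit would be a fixed point of \<open>\<psi>\<close>. Schwarz-Pick with one argument
  \<open>w n\<close> becomes in the limit the invariance of horodiscs at \<open>\<omega>\<close>.
  The orbit of \<open>z0\<close> thus stays in a horodisc whose closure meets the circle only in
  \<open>\<omega>\<close>, which forces \<omega> = \<tau>.\<close>

lemma Wolff:
  assumes hol: "\<psi> holomorphic_on unit_disc" and maps: "\<And>z. cmod z < 1 \<Longrightarrow> cmod (\<psi> z) < 1"
    and nofix: "\<And>z::complex. cmod z < 1 \<Longrightarrow> \<psi> z \<noteq> z"
    and z0: "cmod z0 < 1" and lim: "(\<lambda>n. (\<psi> ^^ n) z0) \<longlonglongrightarrow> \<tau>" and \<tau>: "cmod \<tau> = 1"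
    and z: "cmod z < 1"
  shows "(cmod (\<tau> - \<psi> z))\<^sup>2 * (1 - (cmod z)\<^sup>2) \<le> (cmod (\<tau> - z))\<^sup>2 * (1 - (cmod (\<psi> z))\<^sup>2)"
proof -
  define r where "r = (\<lambda>n::nat. 1 - 1 / (of_nat n + 2) :: real)"
  have r: "0 < r n" "r n < 1" for n by (auto simp: r_def)
  have cont: "continuous_on unit_disc \<psi>" using hol by (rule holomorphic_on_imp_continuous_on)
  have "\<exists>w. cmod w < 1 \<and> of_real (r n) * \<psi> w = w" for n
  proof -
    have "continuous_on (cball 0 (r n)) (\<lambda>z. of_real (r n) * \<psi> z)"
      using r[of n] by (intro continuous_intros continuous_on_subset[OF cont]) auto
    moreover have "(\<lambda>z::complex. complex_of_real (r n) * \<psi> z) \<in> cball 0 (r n) \<rightarrow> cball 0 (r n)"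
    proof
      fix z :: complex assume "z \<in> cball 0 (r n)"
      then have "cmod (\<psi> z) < 1" using r[of n] by (intro maps) auto
      then show "of_real (r n) * \<psi> z \<in> cball 0 (r n)"
        using r[of n] mult_left_le[of "cmod (\<psi> z)" "r n"] by (simp add: norm_mult)
    qed
    ultimately obtain w where "w \<in> cball 0 (r n)" "of_real (r n) * \<psi> w = w"
      using brouwer_ball[OF r(1)] by blast
    then show ?thesis using r[of n] by (intro exI[of _ w]) auto
  qed
  then obtain w where w: "\<And>n. cmod (w n) < 1" "\<And>n. of_real (r n) * \<psi> (w n) = w n" by metis
  have "\<And>n. w n \<in> cball 0 1" using w(1) by (simp add: less_imp_le)
  then obtain \<omega> k where \<omega>: "\<omega> \<in> cball 0 1" "strict_mono k" and wk: "(w \<circ> k) \<longlonglongrightarrow> \<omega>"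
    using compact_cball[of "0::complex" 1] unfolding compact_def by metis
  have "r \<longlonglongrightarrow> 1" unfolding r_def by real_asymp
  then have rk: "(\<lambda>n. r (k n)) \<longlonglongrightarrow> 1" using \<omega>(2) LIMSEQ_subseq_LIMSEQ unfolding o_def by blast
  have wk': "(\<lambda>n. w (k n)) \<longlonglongrightarrow> \<omega>" using wk by (simp add: o_def)
  have "cmod \<omega> = 1"
  proof (rule ccontr)
    assume "cmod \<omega> \<noteq> 1"
    then have lt: "cmod \<omega> < 1" using \<omega> by simp
    then have "isCont \<psi> \<omega>" using cont by (simp add: continuous_on_eq_continuous_at)
    then have "(\<lambda>n. of_real (r (k n)) * \<psi> (w (k n))) \<longlonglongrightarrow> of_real 1 * \<psi> \<omega>"
      using rk wk' by (intro tendsto_mult tendsto_of_real isCont_tendsto_compose[of _ \<psi>])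
    then have "\<psi> \<omega> = \<omega>" using wk' w(2) LIMSEQ_unique by fastforce
    then show False using nofix lt by blast
  qed
  have horo: "(cmod (1 - cnj \<omega> * \<psi> z))\<^sup>2 * (1 - (cmod z)\<^sup>2) \<le> (cmod (1 - cnj \<omega> * z))\<^sup>2 * (1 - (cmod (\<psi> z))\<^sup>2)"
    if z: "cmod z < 1" for z :: complex
  proof -
    have *: "(cmod (1 - cnj (w n) * (of_real (r n) * \<psi> z)))\<^sup>2 * (1 - (cmod z)\<^sup>2)
       \<le> (cmod (1 - cnj (w n) * z))\<^sup>2 * (1 - (cmod (of_real (r n) * \<psi> z))\<^sup>2)" for n
    proof -
      have "(1 - (cmod z)\<^sup>2) * (1 - (cmod (w n))\<^sup>2) * (cmod (1 - cnj (of_real (r n) * \<psi> (w n)) * (of_real (r n) * \<psi> z)))\<^sup>2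
       \<le> (1 - (cmod (of_real (r n) * \<psi> z))\<^sup>2) * (1 - (cmod (of_real (r n) * \<psi> (w n)))\<^sup>2) * (cmod (1 - cnj (w n) * z))\<^sup>2"
        using r[of n] w z
        by (intro Schwarz_Pick_cosh[of "\<lambda>z. of_real (r n) * \<psi> z"])
          (auto intro!: holomorphic_intros hol maps simp: norm_mult intro: le_less_trans[OF mult_left_le_one_le])
      then have "(1 - (cmod (w n))\<^sup>2) * ((cmod (1 - cnj (w n) * (of_real (r n) * \<psi> z)))\<^sup>2 * (1 - (cmod z)\<^sup>2))
        \<le> (1 - (cmod (w n))\<^sup>2) * ((cmod (1 - cnj (w n) * z))\<^sup>2 * (1 - (cmod (of_real (r n) * \<psi> z))\<^sup>2))"
        by (simp add: w(2) mult_ac)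
      moreover have "0 < 1 - (cmod (w n))\<^sup>2" using w(1)[of n] by (simp add: abs_square_less_1)
      ultimately show ?thesis using mult_le_cancel_left_pos by blast
    qed
    have "(\<lambda>n. (cmod (1 - cnj (w (k n)) * (of_real (r (k n)) * \<psi> z)))\<^sup>2 * (1 - (cmod z)\<^sup>2))
        \<longlonglongrightarrow> (cmod (1 - cnj \<omega> * (of_real 1 * \<psi> z)))\<^sup>2 * (1 - (cmod z)\<^sup>2)"
      by (intro tendsto_intros rk wk')
    moreover have "(\<lambda>n. (cmod (1 - cnj (w (k n)) * z))\<^sup>2 * (1 - (cmod (of_real (r (k n)) * \<psi> z))\<^sup>2))
       \<longlonglongrightarrow> (cmod (1 - cnj \<omega> * z))\<^sup>2 * (1 - (cmod (of_real 1 * \<psi> z))\<^sup>2)"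
      by (intro tendsto_intros rk wk')
    ultimately show ?thesis using LIMSEQ_le[of _ _ _ _] * by fastforce
  qed
  \<comment> \<open>Chosen so that \<open>z0\<close> lies on the boundary of the horodisc |1 - cnj
    \<omega> z|^2 \<le> C (1 - |z|^2).\<close>
  define C where "C = (cmod (1 - cnj \<omega> * z0))\<^sup>2 / (1 - (cmod z0)\<^sup>2)"
  have it: "cmod ((\<psi> ^^ n) z0) < 1" for n by (induction n) (auto simp: z0 maps)
  have orb: "(cmod (1 - cnj \<omega> * (\<psi> ^^ n) z0))\<^sup>2 \<le> C * (1 - (cmod ((\<psi> ^^ n) z0))\<^sup>2)" for n
  proof (induction n)
    case 0
    have "0 < 1 - (cmod z0)\<^sup>2" using z0 by (simp add: abs_square_less_1)
    then show ?case by (simp add: C_def)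
  next
    case (Suc n)
    let ?u = "(\<psi> ^^ n) z0"
    have pos: "0 < 1 - (cmod ?u)\<^sup>2" "0 < 1 - (cmod (\<psi> ?u))\<^sup>2"
      using it[of n] it[of "Suc n"] by (auto simp: abs_square_less_1)
    have "(cmod (1 - cnj \<omega> * \<psi> ?u))\<^sup>2 * (1 - (cmod ?u)\<^sup>2) \<le> (cmod (1 - cnj \<omega> * ?u))\<^sup>2 * (1 - (cmod (\<psi> ?u))\<^sup>2)"
      by (rule horo[OF it])
    also have "\<dots> \<le> C * (1 - (cmod ?u)\<^sup>2) * (1 - (cmod (\<psi> ?u))\<^sup>2)"
      using Suc pos by (intro mult_right_mono) auto
    finally show ?case using pos by (simp add: mult_ac)
  qed
  have "(\<lambda>n. (cmod (1 - cnj \<omega> * (\<psi> ^^ n) z0))\<^sup>2) \<longlonglongrightarrow> (cmod (1 - cnj \<omega> * \<tau>))\<^sup>2"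
    by (intro tendsto_intros lim)
  moreover have "(\<lambda>n. C * (1 - (cmod ((\<psi> ^^ n) z0))\<^sup>2)) \<longlonglongrightarrow> C * (1 - (cmod \<tau>)\<^sup>2)"
    by (intro tendsto_intros lim)
  ultimately have "(cmod (1 - cnj \<omega> * \<tau>))\<^sup>2 \<le> C * (1 - (cmod \<tau>)\<^sup>2)"
    using orb by (intro LIMSEQ_le) auto
  then have "cmod (\<omega> - \<tau>) = 0"
    using \<tau> cmod_one_minus_cnj_unit[OF \<open>cmod \<omega> = 1\<close>] by simp
  then have "\<omega> = \<tau>" by simp
  then show ?thesis using horo[OF z] cmod_one_minus_cnj_unit[OF \<tau>] by simp
qed

text \<open>The region is cut out of the disc by the sublevel set |z - \<tau>| + M |z| < M of a
  convex function.\<close>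

lemma convex_stolz: "0 < M \<Longrightarrow> convex (stolz_region \<tau> M)"
proof (rule convexI)
  fix x y and u v :: real
  assume M: "0 < M" and x: "x \<in> stolz_region \<tau> M" and y: "y \<in> stolz_region \<tau> M"
    and u: "0 \<le> u" "0 \<le> v" "u + v = 1"
  let ?w = "u *\<^sub>R x + v *\<^sub>R y"
  have "?w \<in> unit_disc"
    using convexD[OF convex_ball[of 0 1]] x y u by (auto simp: stolz_region_def)
  moreover have "cmod (?w - \<tau>) + M * cmod ?w < M"
  proof -
    have "?w - \<tau> = u *\<^sub>R (x - \<tau>) + v *\<^sub>R (y - \<tau>)"
      using u by (simp add: algebra_simps flip: scaleR_add_left)
    then have "cmod (?w - \<tau>) \<le> u * cmod (x - \<tau>) + v * cmod (y - \<tau>)"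
      using u norm_triangle_ineq[of "u *\<^sub>R (x - \<tau>)" "v *\<^sub>R (y - \<tau>)"] by simp
    moreover have "M * cmod ?w \<le> M * (u * cmod x + v * cmod y)"
      using u norm_triangle_ineq[of "u *\<^sub>R x" "v *\<^sub>R y"] M by (intro mult_left_mono) auto
    ultimately have "cmod (?w - \<tau>) + M * cmod ?w
       \<le> u * (cmod (x - \<tau>) + M * cmod x) + v * (cmod (y - \<tau>) + M * cmod y)"
      by (simp add: algebra_simps)
    also have "\<dots> < M"
      using x y u by (intro convex_bound_lt) (auto simp: stolz_region_def algebra_simps)
    finally show ?thesis .
  qed
  ultimately show "?w \<in> stolz_region \<tau> M" by (simp add: stolz_region_def algebra_simps)
qed

text \<open>On the convex set \<open>S\<close> the derivative of \<psi> z - d z is at most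
  \<epsilon> in modulus, so the mean value inequality makes this function Lipschitz there. Letting
  one of the two points run along a segment to \<open>\<tau>\<close> gives the quotient. The limit
  \<open>\<tau>\<close> of \<open>\<psi>\<close> along the segment is not contained in the limit of
  the derivative; it comes from the horodisc inequality.\<close>

lemma angular_derivative_quotient:
  assumes hol: "\<psi> holomorphic_on unit_disc" and maps: "\<And>z. cmod z < 1 \<Longrightarrow> cmod (\<psi> z) < 1"
    and \<tau>: "cmod \<tau> = 1"
    and horo: "\<And>z. cmod z < 1 \<Longrightarrow>
      (cmod (\<tau> - \<psi> z))\<^sup>2 * (1 - (cmod z)\<^sup>2) \<le> (cmod (\<tau> - z))\<^sup>2 * (1 - (cmod (\<psi> z))\<^sup>2)"
    and nt: "nontangential_limit (deriv \<psi>) \<tau> d" and M: "1 < M"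
  shows "((\<lambda>z. (\<tau> - \<psi> z) / (\<tau> - z)) \<longlongrightarrow> d) (at \<tau> within stolz_region \<tau> M)"
proof (rule tendstoI)
  fix e :: real assume e: "0 < e"
  define \<epsilon> where "\<epsilon> = e / 2"
  have \<epsilon>: "0 < \<epsilon>" using e by (simp add: \<epsilon>_def)
  have "(deriv \<psi> \<longlongrightarrow> d) (at \<tau> within stolz_region \<tau> M)" using nt M by (simp add: nontangential_limit_def)
  from tendstoD[OF this \<epsilon>] obtain \<delta> where \<delta>: "0 < \<delta>"
    and D: "\<And>z. z \<in> stolz_region \<tau> M \<Longrightarrow> z \<noteq> \<tau> \<Longrightarrow> dist z \<tau> < \<delta> \<Longrightarrow> dist (deriv \<psi> z) d < \<epsilon>"
    unfolding eventually_at by blast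
  define S where "S = stolz_region \<tau> M \<inter> ball \<tau> \<delta>"
  have S: "convex S" unfolding S_def using M by (intro convex_Int convex_stolz) auto
  have Sd: "cmod z < 1" "z \<noteq> \<tau>" "dist z \<tau> < \<delta>" "z \<in> stolz_region \<tau> M" if "z \<in> S" for z
    using that \<tau> by (auto simp: S_def stolz_region_def dist_commute)
  define k where "k = (\<lambda>z. \<psi> z - d * z)"
  have kd: "(k has_field_derivative (deriv \<psi> z - d)) (at z within S)" if "z \<in> S" for z
    unfolding k_def
    by (auto intro!: derivative_eq_intros DERIV_subset[OF holomorphic_derivI[OF hol]] simp: Sd[OF that])
  have kl: "cmod (k x - k y) \<le> \<epsilon> * cmod (x - y)" if "x \<in> S" "y \<in> S" for x y
    by (rule field_differentiable_bound[OF S kd _ that])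
       (use D Sd in \<open>auto simp: dist_norm intro!: less_imp_le\<close>)
  have key: "cmod (k v - (\<tau> - d * \<tau>)) \<le> \<epsilon> * cmod (v - \<tau>)" if v: "v \<in> S" for v
  proof -
    define u where "u = (\<lambda>n::nat. \<tau> + of_real (1 / (real n + 1)) * (v - \<tau>))"
    have uS: "u n \<in> S" for n
    proof -
      define l where "l = 1 / (real n + 1)"
      have l: "0 < l" "l \<le> 1" by (auto simp: l_def)
      have eq: "u n - \<tau> = of_real l * (v - \<tau>)" by (simp add: u_def l_def)
      have "u n = of_real (1 - l) * \<tau> + of_real l * v" unfolding u_def l_def[symmetric] by (simp add: algebra_simps)
      then have "cmod (u n) \<le> cmod (of_real (1 - l) * \<tau>) + cmod (of_real l * v)"
        by (metis norm_triangle_ineq)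
      also have "\<dots> = (1 - l) + l * cmod v"
        using l \<tau> by (simp only: norm_mult norm_of_real) simp
      finally have "cmod (u n) \<le> (1 - l) + l * cmod v" .
      then have le: "l * (1 - cmod v) \<le> 1 - cmod (u n)" by (simp add: algebra_simps)
      have "0 < l * (1 - cmod v)" using l Sd(1)[OF v] by simp
      moreover have "cmod (u n - \<tau>) < M * (1 - cmod (u n))"
      proof -
        have "cmod (u n - \<tau>) = l * cmod (v - \<tau>)" using l by (simp add: eq norm_mult)
        also have "\<dots> < l * (M * (1 - cmod v))" using v l by (simp add: S_def stolz_region_def)
        also have "\<dots> = M * (l * (1 - cmod v))" by simp
        also have "\<dots> \<le> M * (1 - cmod (u n))" using le M by (intro mult_left_mono) auto
        finally show ?thesis .
      qed
      moreover have "cmod (u n - \<tau>) < \<delta>"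
      proof -
        have "cmod (u n - \<tau>) \<le> cmod (v - \<tau>)" using l by (simp add: eq norm_mult mult_left_le_one_le)
        then show ?thesis using Sd(3)[OF v] by (simp add: dist_norm)
      qed
      moreover from this have "dist \<tau> (u n) < \<delta>" by (metis dist_norm dist_commute)
      moreover have "cmod (u n) < 1" using le \<open>0 < l * (1 - cmod v)\<close> by linarith
      ultimately show ?thesis unfolding S_def stolz_region_def by simp
    qed
    have ul: "u \<longlonglongrightarrow> \<tau>"
    proof -
      have "(\<lambda>n::nat. 1 / (real n + 1)) \<longlonglongrightarrow> 0" by real_asymp
      then have "u \<longlonglongrightarrow> \<tau> + of_real 0 * (v - \<tau>)" unfolding u_def by (intro tendsto_intros)
      then show ?thesis by simp
    qed
    have "(\<lambda>n. \<psi> (u n)) \<longlonglongrightarrow> \<tau>"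
    proof -
      \<comment> \<open>The horodisc inequality bounds |\<tau> - \<psi> x|^2 (1 - |x|) by |\<tau> -
        x|^2, and in the Stolz region |\<tau> - x| is at most M (1 - |x|).\<close>
      have "(cmod (\<psi> (u n) - \<tau>))\<^sup>2 \<le> M * cmod (u n - \<tau>)" for n
      proof -
        let ?x = "u n"
        have x: "cmod ?x < 1" "cmod (?x - \<tau>) < M * (1 - cmod ?x)" using uS[of n] by (auto simp: S_def stolz_region_def)
        have "(1 - cmod ?x) * (cmod (\<tau> - \<psi> ?x))\<^sup>2 \<le> (1 - (cmod ?x)\<^sup>2) * (cmod (\<tau> - \<psi> ?x))\<^sup>2"
          using x by (intro mult_right_mono) (auto simp: power2_eq_square mult_left_le)
        also have "\<dots> \<le> (cmod (\<tau> - ?x))\<^sup>2 * (1 - (cmod (\<psi> ?x))\<^sup>2)" using horo[OF x(1)] by (simp add: mult.commute)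
        also have "\<dots> \<le> (cmod (\<tau> - ?x))\<^sup>2" by (simp add: mult_left_le)
        also have "\<dots> = cmod (?x - \<tau>) * cmod (?x - \<tau>)" by (simp add: power2_eq_square norm_minus_commute)
        also have "\<dots> \<le> cmod (?x - \<tau>) * (M * (1 - cmod ?x))" using x by (intro mult_left_mono) auto
        finally have "(1 - cmod ?x) * (cmod (\<tau> - \<psi> ?x))\<^sup>2 \<le> (1 - cmod ?x) * (M * cmod (?x - \<tau>))"
          by (simp add: mult_ac)
        then show ?thesis using x(1) by (simp add: norm_minus_commute)
      qed
      note bound = this
      have "(\<lambda>n. M * cmod (u n - \<tau>)) \<longlonglongrightarrow> M * cmod (\<tau> - \<tau>)" by (intro tendsto_intros ul)
      then have "(\<lambda>n. M * cmod (u n - \<tau>)) \<longlonglongrightarrow> 0" by simp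
      then have "(\<lambda>n. (cmod (\<psi> (u n) - \<tau>))\<^sup>2) \<longlonglongrightarrow> 0"
        by (rule Lim_null_comparison[rotated]) (simp add: bound)
      then have "(\<lambda>n. sqrt ((cmod (\<psi> (u n) - \<tau>))\<^sup>2)) \<longlonglongrightarrow> sqrt 0" by (intro tendsto_intros)
      then show ?thesis by (simp add: tendsto_norm_zero_iff LIM_zero_iff)
    qed
    then have "(\<lambda>n. cmod (k v - k (u n))) \<longlonglongrightarrow> cmod (k v - (\<tau> - d * \<tau>))"
      unfolding k_def by (intro tendsto_intros ul)
    moreover have "(\<lambda>n. \<epsilon> * cmod (v - u n)) \<longlonglongrightarrow> \<epsilon> * cmod (v - \<tau>)"
      by (intro tendsto_intros ul)
    ultimately show ?thesis using kl[OF v uS] by (intro LIMSEQ_le) auto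
  qed
  show "\<forall>\<^sub>F z in at \<tau> within stolz_region \<tau> M. dist ((\<tau> - \<psi> z) / (\<tau> - z)) d < e"
    unfolding eventually_at
  proof (intro exI[of _ \<delta>] conjI ballI impI \<delta>)
    fix v assume "v \<in> stolz_region \<tau> M" "v \<noteq> \<tau> \<and> dist v \<tau> < \<delta>"
    then have v: "v \<in> S" by (simp add: S_def dist_commute)
    have nz: "\<tau> - v \<noteq> 0" using Sd(2)[OF v] by simp
    have "(\<tau> - \<psi> v) / (\<tau> - v) - d = - (k v - (\<tau> - d * \<tau>)) / (\<tau> - v)"
      using nz by (simp add: k_def field_simps)
    then have "dist ((\<tau> - \<psi> v) / (\<tau> - v)) d = cmod (k v - (\<tau> - d * \<tau>)) / cmod (v - \<tau>)"
      by (simp add: dist_norm norm_divide norm_minus_commute)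
    also have "\<dots> \<le> \<epsilon>" using key[OF v] nz by (simp add: divide_le_eq)
    finally show "dist ((\<tau> - \<psi> v) / (\<tau> - v)) d < e" using e by (simp add: \<epsilon>_def)
  qed
qed

text \<open>Schwarz-Pick with the second argument \<open>x n\<close> on the radius to
  \<open>\<tau>\<close>. There 1 - |x n| = |\<tau> - x n|, so division by it leaves the difference
  quotient of \<open>\<psi>\<close>, whose limit is \<open>d\<close>, as the only factor that could
  blow up.\<close>

lemma Julia:
  assumes hol: "\<psi> holomorphic_on unit_disc" and maps: "\<And>z. cmod z < 1 \<Longrightarrow> cmod (\<psi> z) < 1"
    and \<tau>: "cmod \<tau> = 1" and d: "0 \<le> d"
    and lim: "((\<lambda>z. (\<tau> - \<psi> z) / (\<tau> - z)) \<longlongrightarrow> of_real d) (at \<tau> within stolz_region \<tau> 2)"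
    and z: "cmod z < 1"
  shows "(1 - (cmod z)\<^sup>2) * (cmod (\<tau> - \<psi> z))\<^sup>2 \<le> d * (1 - (cmod (\<psi> z))\<^sup>2) * (cmod (\<tau> - z))\<^sup>2"
proof -
  define x where "x = (\<lambda>n::nat. of_real (1 - 1 / (real n + 2)) * \<tau>)"
  have nx: "cmod (x n) = 1 - 1 / (real n + 2)" "cmod (\<tau> - x n) = 1 / (real n + 2)" for n
  proof -
    show "cmod (x n) = 1 - 1 / (real n + 2)" using \<tau> by (simp add: x_def norm_mult del: of_real_diff)
    have "\<tau> - x n = of_real (1 / (real n + 2)) * \<tau>" by (simp add: x_def algebra_simps)
    then show "cmod (\<tau> - x n) = 1 / (real n + 2)" using \<tau> by (simp only: norm_mult norm_of_real) simp
  qed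
  have x1: "cmod (x n) < 1" for n by (simp add: nx)
  have xS: "x n \<in> stolz_region \<tau> 2" "x n \<noteq> \<tau>" for n
    using \<tau> x1[of n] by (auto simp: stolz_region_def nx norm_minus_commute divide_strict_right_mono)
  have xl: "x \<longlonglongrightarrow> \<tau>"
  proof -
    have "(\<lambda>n::nat. 1 - 1 / (real n + 2)) \<longlonglongrightarrow> 1" by real_asymp
    then have "x \<longlonglongrightarrow> of_real 1 * \<tau>" unfolding x_def by (intro tendsto_intros)
    then show ?thesis by simp
  qed
  have q: "(\<lambda>n. (\<tau> - \<psi> (x n)) / (\<tau> - x n)) \<longlonglongrightarrow> of_real d"
    by (rule filterlim_compose[OF lim]) (use xl xS in \<open>auto simp: filterlim_at\<close>)
  have \<psi>x: "(\<lambda>n. \<psi> (x n)) \<longlonglongrightarrow> \<tau>"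
  proof -
    have "(\<lambda>n. \<tau> - (\<tau> - \<psi> (x n)) / (\<tau> - x n) * (\<tau> - x n)) \<longlonglongrightarrow> \<tau> - of_real d * (\<tau> - \<tau>)"
      by (intro tendsto_intros q xl)
    moreover have "(\<tau> - \<psi> (x n)) / (\<tau> - x n) * (\<tau> - x n) = \<tau> - \<psi> (x n)" for n
      using xS(2)[of n] by simp
    ultimately show ?thesis by simp
  qed
  have "(1 - (cmod z)\<^sup>2) * (1 + cmod (x n)) * (cmod (1 - cnj (\<psi> (x n)) * \<psi> z))\<^sup>2
    \<le> (1 - (cmod (\<psi> z))\<^sup>2) * ((1 + cmod (\<psi> (x n))) * cmod ((\<tau> - \<psi> (x n)) / (\<tau> - x n))) * (cmod (1 - cnj (x n) * z))\<^sup>2" for n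
  proof -
    define e where "e = 1 - cmod (x n)"
    have e: "0 < e" "cmod (\<tau> - x n) = e" using x1[of n] by (auto simp: e_def nx)
    have "(1 - (cmod z)\<^sup>2) * (1 - (cmod (x n))\<^sup>2) * (cmod (1 - cnj (\<psi> (x n)) * \<psi> z))\<^sup>2
       \<le> (1 - (cmod (\<psi> z))\<^sup>2) * (1 - (cmod (\<psi> (x n)))\<^sup>2) * (cmod (1 - cnj (x n) * z))\<^sup>2"
      by (intro Schwarz_Pick_cosh hol maps z x1)
    also have "\<dots> \<le> (1 - (cmod (\<psi> z))\<^sup>2) * ((1 + cmod (\<psi> (x n))) * cmod (\<tau> - \<psi> (x n))) * (cmod (1 - cnj (x n) * z))\<^sup>2"
    proof -
      have "1 - cmod (\<psi> (x n)) \<le> cmod (\<tau> - \<psi> (x n))" using norm_triangle_ineq2[of \<tau> "\<psi> (x n)"] \<tau> by simp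
      then have "(1 + cmod (\<psi> (x n))) * (1 - cmod (\<psi> (x n))) \<le> (1 + cmod (\<psi> (x n))) * cmod (\<tau> - \<psi> (x n))"
        by (intro mult_left_mono) auto
      moreover have "0 \<le> 1 - (cmod (\<psi> z))\<^sup>2" using maps[OF z] by (simp add: abs_square_le_1)
      ultimately show ?thesis
        by (intro mult_right_mono mult_left_mono) (auto simp: power2_eq_square algebra_simps)
    qed
    finally have le: "(1 - (cmod z)\<^sup>2) * (1 - (cmod (x n))\<^sup>2) * (cmod (1 - cnj (\<psi> (x n)) * \<psi> z))\<^sup>2
        \<le> (1 - (cmod (\<psi> z))\<^sup>2) * ((1 + cmod (\<psi> (x n))) * cmod (\<tau> - \<psi> (x n))) * (cmod (1 - cnj (x n) * z))\<^sup>2" .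
    have 1: "1 - (cmod (x n))\<^sup>2 = e * (1 + cmod (x n))"
      by (simp add: e_def power2_eq_square algebra_simps)
    have 2: "cmod (\<tau> - \<psi> (x n)) = e * cmod ((\<tau> - \<psi> (x n)) / (\<tau> - x n))"
      unfolding norm_divide e(2) using e(1) by simp
    from le have "e * ((1 - (cmod z)\<^sup>2) * (1 + cmod (x n)) * (cmod (1 - cnj (\<psi> (x n)) * \<psi> z))\<^sup>2)
       \<le> e * ((1 - (cmod (\<psi> z))\<^sup>2) * ((1 + cmod (\<psi> (x n))) * cmod ((\<tau> - \<psi> (x n)) / (\<tau> - x n))) * (cmod (1 - cnj (x n) * z))\<^sup>2)"
      unfolding 1 2 by (simp only: mult_ac)
    then show ?thesis using e(1) by simp
  qed
  moreover have "(\<lambda>n. (1 - (cmod z)\<^sup>2) * (1 + cmod (x n)) * (cmod (1 - cnj (\<psi> (x n)) * \<psi> z))\<^sup>2)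
     \<longlonglongrightarrow> (1 - (cmod z)\<^sup>2) * (1 + cmod \<tau>) * (cmod (1 - cnj \<tau> * \<psi> z))\<^sup>2"
    by (intro tendsto_intros xl \<psi>x)
  moreover have "(\<lambda>n. (1 - (cmod (\<psi> z))\<^sup>2) * ((1 + cmod (\<psi> (x n))) * cmod ((\<tau> - \<psi> (x n)) / (\<tau> - x n))) * (cmod (1 - cnj (x n) * z))\<^sup>2)
     \<longlonglongrightarrow> (1 - (cmod (\<psi> z))\<^sup>2) * ((1 + cmod \<tau>) * cmod (of_real d :: complex)) * (cmod (1 - cnj \<tau> * z))\<^sup>2"
    by (intro tendsto_intros xl \<psi>x q)
  ultimately have "(1 - (cmod z)\<^sup>2) * (1 + cmod \<tau>) * (cmod (1 - cnj \<tau> * \<psi> z))\<^sup>2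
     \<le> (1 - (cmod (\<psi> z))\<^sup>2) * ((1 + cmod \<tau>) * cmod (of_real d :: complex)) * (cmod (1 - cnj \<tau> * z))\<^sup>2"
    by (intro LIMSEQ_le) auto
  then show ?thesis
    unfolding cmod_one_minus_cnj_unit[OF \<tau>] using \<tau> d by (simp add: algebra_simps)
qed

section \<open>The linear model of a hyperbolic semiflow\<close>

text \<open>The Cayley transform onto the right half plane that sends \<open>\<tau>\<close> to
  infinity. Horodiscs at \<open>\<tau>\<close> become half planes, and Julia's inequality becomes a
  comparison of real parts.\<close>

definition cay :: "complex \<Rightarrow> complex \<Rightarrow> complex" where
  "cay \<tau> z = (\<tau> + z) / (\<tau> - z)"

lemma Re_cay: "cmod \<tau> = 1 \<Longrightarrow> Re (cay \<tau> z) = (1 - (cmod z)\<^sup>2) / (cmod (\<tau> - z))\<^sup>2"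
proof -
  assume \<tau>: "cmod \<tau> = 1"
  have "cay \<tau> z = (\<tau> + z) * cnj (\<tau> - z) / (cmod (\<tau> - z))\<^sup>2"
    unfolding cay_def by (simp only: complex_div_cnj[of "\<tau> + z"])
  moreover have "Re ((\<tau> + z) * cnj (\<tau> - z)) = (cmod \<tau>)\<^sup>2 - (cmod z)\<^sup>2"
    unfolding cmod_power2 by (simp add: algebra_simps power2_eq_square)
  ultimately show ?thesis using \<tau> by (metis Re_divide_of_real one_power2)
qed

lemma Re_cay_pos: "cmod \<tau> = 1 \<Longrightarrow> cmod z < 1 \<Longrightarrow> 0 < Re (cay \<tau> z)"
  by (auto simp: Re_cay abs_square_less_1 intro!: divide_pos_pos)

lemma cay_diff:
  assumes "\<tau> \<noteq> a" "\<tau> \<noteq> b"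
  shows "cay \<tau> a - cay \<tau> b = 2 * \<tau> * (a - b) / ((\<tau> - a) * (\<tau> - b))"
  using assms by (simp add: cay_def divide_simps) (simp add: algebra_simps)

lemma holomorphic_cay: "cmod \<tau> = 1 \<Longrightarrow> cay \<tau> holomorphic_on unit_disc"
  unfolding cay_def by (intro holomorphic_intros) auto

text \<open>Both sides compare the expression for the hyperbolic distance in the disc with the one
  in the half plane.\<close>

lemma cmod_cay_diff:
  assumes \<tau>: "cmod \<tau> = 1" and a: "cmod a < 1" and b: "cmod b < 1"
  shows "(cmod (cay \<tau> a - cay \<tau> b))\<^sup>2 * ((1 - (cmod a)\<^sup>2) * (1 - (cmod b)\<^sup>2))
    = 4 * (cmod (a - b))\<^sup>2 * (Re (cay \<tau> a) * Re (cay \<tau> b))"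
proof -
  have ne: "\<tau> \<noteq> a" "\<tau> \<noteq> b" using assms by auto
  show ?thesis
    using ne \<tau>
    by (simp add: cay_diff Re_cay norm_mult norm_divide power_divide power_mult_distrib)
qed

text \<open>
  Successive points of the orbit have bounded hyperbolic distance, while \<open>Re (cay \<tau> (\<psi>\<^sup>n z))\<close> grows
  geometrically; so the displacements sum up to a multiple of the last real part.
\<close>

lemma orbit_nontangential:
  assumes hol: "\<psi> holomorphic_on unit_disc" and maps: "\<And>z. cmod z < 1 \<Longrightarrow> cmod (\<psi> z) < 1"
    and \<tau>: "cmod \<tau> = 1" and d: "0 < d" "d < 1"
    and julia: "\<And>z. cmod z < 1 \<Longrightarrow> Re (cay \<tau> z) \<le> d * Re (cay \<tau> (\<psi> z))"
    and z: "cmod z < 1"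
  shows "\<exists>K\<ge>0. \<forall>n. cmod (cay \<tau> ((\<psi> ^^ n) z) - cay \<tau> z) \<le> K * Re (cay \<tau> ((\<psi> ^^ n) z))"
proof -
  define a where "a = (\<lambda>n. (\<psi> ^^ n) z)"
  define s where "s = (\<lambda>n. cay \<tau> (a n))"
  have a: "cmod (a n) < 1" for n unfolding a_def by (induction n) (auto simp: z maps)
  have aS: "a (Suc n) = \<psi> (a n)" for n by (simp add: a_def)
  have pos: "0 < 1 - (cmod (a n))\<^sup>2" for n using a[of n] by (simp add: abs_square_less_1)
  have R: "0 < Re (s n)" for n unfolding s_def by (rule Re_cay_pos[OF \<tau> a])
  define \<rho> where "\<rho> = (\<lambda>n. (cmod (a (Suc n) - a n))\<^sup>2 / ((1 - (cmod (a (Suc n)))\<^sup>2) * (1 - (cmod (a n))\<^sup>2)))"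
  have "\<rho> (Suc n) \<le> \<rho> n" for n
  proof -
    have "(cmod (\<psi> (a (Suc n)) - \<psi> (a n)))\<^sup>2 * ((1 - (cmod (a (Suc n)))\<^sup>2) * (1 - (cmod (a n))\<^sup>2))
      \<le> (cmod (a (Suc n) - a n))\<^sup>2 * ((1 - (cmod (\<psi> (a (Suc n))))\<^sup>2) * (1 - (cmod (\<psi> (a n)))\<^sup>2))"
      by (intro Schwarz_Pick_sinh hol maps a)
    then show ?thesis
      using mult_pos_pos[OF pos[of "Suc n"] pos[of n]] mult_pos_pos[OF pos[of "Suc (Suc n)"] pos[of "Suc n"]]
      unfolding \<rho>_def by (simp add: aS field_simps)
  qed
  then have \<rho>: "\<rho> n \<le> \<rho> 0" for n by (induction n) (auto intro: order_trans)
  have \<rho>0: "0 \<le> \<rho> 0" unfolding \<rho>_def using pos[of 0] pos[of "Suc 0"]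
    by (intro divide_nonneg_nonneg mult_nonneg_nonneg) auto
  \<comment> \<open>The displacement D satisfies D^2 \<le> 4 \<rho> 0 (R + D) R with R = Re (s n).
    Either D \<le> R, which accounts for the 1, or R < D and then D^2 \<le> 8 \<rho> 0 D R.\<close>
  define C where "C = 1 + 8 * \<rho> 0"
  have step: "cmod (s (Suc n) - s n) \<le> C * Re (s n)" for n
  proof -
    define D where "D = cmod (s (Suc n) - s n)"
    have "D\<^sup>2 = 4 * \<rho> n * (Re (s (Suc n)) * Re (s n))"
      using cmod_cay_diff[OF \<tau> a[of "Suc n"] a[of n]] pos[of n] pos[of "Suc n"]
      unfolding D_def s_def \<rho>_def by (simp add: divide_simps mult_ac)
    also have "\<dots> \<le> 4 * \<rho> 0 * (Re (s (Suc n)) * Re (s n))"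
      using \<rho>[of n] R[of n] R[of "Suc n"] by (intro mult_right_mono mult_nonneg_nonneg) auto
    also have "\<dots> \<le> 4 * \<rho> 0 * ((Re (s n) + D) * Re (s n))"
    proof -
      have "Re (s (Suc n)) \<le> Re (s n) + D" using abs_Re_le_cmod[of "s (Suc n) - s n"] by (simp add: D_def)
      then show ?thesis using R[of n] \<rho>0 by (intro mult_left_mono mult_right_mono) auto
    qed
    finally have q: "D\<^sup>2 \<le> 4 * \<rho> 0 * ((Re (s n) + D) * Re (s n))" .
    show ?thesis
    proof (cases "D \<le> Re (s n)")
      case True
      then show ?thesis using \<rho>0 R[of n] by (simp add: C_def D_def algebra_simps add_increasing2)
    next
      case False
      then have D: "0 < D" using R[of n] by simp
      have "(Re (s n) + D) * Re (s n) \<le> (D + D) * Re (s n)"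
        using False R[of n] by (intro mult_right_mono) auto
      then have "4 * \<rho> 0 * ((Re (s n) + D) * Re (s n)) \<le> 4 * \<rho> 0 * ((D + D) * Re (s n))"
        using \<rho>0 by (intro mult_left_mono) auto
      with q have "D * D \<le> D * (8 * \<rho> 0 * Re (s n))" by (simp add: power2_eq_square algebra_simps)
      then have "D \<le> 8 * \<rho> 0 * Re (s n)" using D by simp
      also have "\<dots> \<le> C * Re (s n)" using R[of n] by (simp add: C_def)
      finally show ?thesis by (simp add: D_def)
    qed
  qed
  \<comment> \<open>The solution of (K + C) d = K: one step adds C Re (s n), and Re (s n) \<le> d Re
    (s (n + 1)) restores the constant K.\<close>
  define K where "K = C * d / (1 - d)"
  have C: "0 \<le> C" using \<rho>0 by (simp add: C_def)
  have Keq: "(K + C) * d = K" using d by (simp add: K_def divide_simps) (simp add: algebra_simps)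
  have K0: "0 \<le> K" using d C by (simp add: K_def)
  have "cmod (s n - s 0) \<le> K * Re (s n)" for n
  proof (induction n)
    case 0
    then show ?case using K0 R[of 0] by simp
  next
    case (Suc n)
    have "cmod (s (Suc n) - s 0) \<le> cmod (s (Suc n) - s n) + cmod (s n - s 0)"
      using norm_triangle_ineq[of "s (Suc n) - s n" "s n - s 0"] by simp
    also have "\<dots> \<le> (K + C) * Re (s n)" using Suc step[of n] by (simp add: algebra_simps)
    also have "\<dots> \<le> (K + C) * (d * Re (s (Suc n)))"
      using julia[OF a[of n]] K0 C by (intro mult_left_mono) (auto simp: s_def aS)
    also have "\<dots> = K * Re (s (Suc n))" using Keq by (simp add: mult.assoc[symmetric])
    finally show ?case .
  qed
  then show ?thesis using K0 by (intro exI[of _ K]) (auto simp: s_def a_def)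
qed


text \<open>The normalized iterates \<open>S n\<close> have positive real part and real part 1 at 0,
  and are bounded at 0 because the orbit of 0 is non-tangential; so they form a normal family, and
  \<open>\<sigma>\<close> is a subsequential limit. The functional equation holds since the ratio of
  \<open>cay\<close> at the points \<phi> t (v n) and v n tends to the inverse of the angular
  derivative: each orbit stays in a Stolz region, where the derivative is known to converge.\<close>

lemma hyperbolic_model:
  assumes "hyperbolic_semiflow \<phi>"
  obtains \<sigma> \<alpha> where "\<alpha> < 0" "\<sigma> holomorphic_on unit_disc" "\<And>z. cmod z < 1 \<Longrightarrow> 0 < Re (\<sigma> z)"
    "\<And>t z. 0 \<le> t \<Longrightarrow> cmod z < 1 \<Longrightarrow> \<sigma> (\<phi> t z) = of_real (exp (- \<alpha> * t)) * \<sigma> z"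
proof -
  have sf: "holomorphic_semiflow \<phi>" and nell: "\<not> elliptic_semiflow \<phi>"
    and ex: "\<exists>\<tau> (\<alpha>::real). denjoy_wolff_point \<phi> \<tau> \<and> \<alpha> < 0 \<and>
        (\<forall>t\<ge>0. nontangential_limit (deriv (\<phi> t)) \<tau> (of_real (exp (t * \<alpha>))))"
    using assms by (simp_all add: hyperbolic_semiflow_def)
  from ex obtain \<tau> and \<alpha> :: real where dw: "denjoy_wolff_point \<phi> \<tau>" and \<alpha>: "\<alpha> < 0"
    and nt': "\<forall>t\<ge>0. nontangential_limit (deriv (\<phi> t)) \<tau> (of_real (exp (t * \<alpha>)))"
    by (elim exE conjE)
  note nt = nt'[rule_format]
  have hol: "\<phi> t holomorphic_on unit_disc" if "0 \<le> t" for t using sf that by (simp add: holomorphic_semiflow_def)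
  have maps: "cmod (\<phi> t z) < 1" if "0 \<le> t" "cmod z < 1" for t z
    using sf that unfolding holomorphic_semiflow_def by (metis Pi_mem mem_ball_0)
  have add: "\<phi> (t + s) z = \<phi> t (\<phi> s z)" if "0 \<le> t" "0 \<le> s" "cmod z < 1" for t s z
    using sf that by (simp add: holomorphic_semiflow_def)
  have zero: "\<phi> 0 z = z" if "cmod z < 1" for z using sf that by (simp add: holomorphic_semiflow_def)
  have \<tau>: "cmod \<tau> = 1" using dw by (simp add: denjoy_wolff_point_def)
  have lim: "((\<lambda>t. \<phi> t z) \<longlongrightarrow> \<tau>) at_top" if "cmod z < 1" for z
  proof -
    have "compact {z} \<and> {z} \<subseteq> unit_disc" using that by simp
    then have "uniform_limit {z} \<phi> (\<lambda>_. \<tau>) at_top" using dw unfolding denjoy_wolff_point_def by blast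
    then show ?thesis by (simp only: uniform_limit_singleton)
  qed
  have iter: "(\<phi> t ^^ n) z = \<phi> (of_nat n * t) z" if "0 \<le> t" "cmod z < 1" for t n z
  proof (induction n)
    case (Suc n)
    have "(\<phi> t ^^ Suc n) z = \<phi> t (\<phi> (of_nat n * t) z)" by (simp add: Suc)
    also have "\<dots> = \<phi> (t + of_nat n * t) z" using add[of t "of_nat n * t" z] that by simp
    also have "t + of_nat n * t = of_nat (Suc n) * t" by (simp add: algebra_simps)
    finally show ?case .
  qed (simp add: zero that)
  have iterlim: "(\<lambda>n. (\<phi> t ^^ n) z) \<longlonglongrightarrow> \<tau>" if "0 < t" "cmod z < 1" for t z
  proof -
    have "filterlim (\<lambda>n::nat. of_nat n * t) at_top sequentially"
      using filterlim_tendsto_pos_mult_at_top[OF tendsto_const that(1) filterlim_real_sequentially]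
      by (simp add: mult.commute)
    from filterlim_compose[OF lim[OF that(2)] this] show ?thesis
      unfolding iter[OF less_imp_le[OF that(1)] that(2)] .
  qed
  have nofix: "\<phi> t z \<noteq> z" if "0 < t" "cmod z < 1" for t z
  proof
    assume "\<phi> t z = z"
    moreover have "z \<in> unit_disc" using that by simp
    ultimately have "elliptic_semiflow \<phi>" unfolding elliptic_semiflow_def using sf that(1) by blast
    then show False using nell by contradiction
  qed
  have horo: "(cmod (\<tau> - \<phi> t z))\<^sup>2 * (1 - (cmod z)\<^sup>2) \<le> (cmod (\<tau> - z))\<^sup>2 * (1 - (cmod (\<phi> t z))\<^sup>2)"
    if "0 < t" "cmod z < 1" for t z
  proof (rule Wolff[where z0 = z])
    have t: "0 \<le> t" using that(1) by simp
    show "\<phi> t holomorphic_on unit_disc" by (rule hol[OF t])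
    show "cmod (\<phi> t z) < 1" if "cmod z < 1" for z by (rule maps[OF t that])
  qed (rule that nofix[OF that(1)] iterlim[OF that] \<tau> | assumption)+
  have quot: "((\<lambda>z. (\<tau> - \<phi> t z) / (\<tau> - z)) \<longlongrightarrow> of_real (exp (t * \<alpha>))) (at \<tau> within stolz_region \<tau> M)"
    if "0 < t" "1 < M" for t M
  proof (rule angular_derivative_quotient)
    have t: "0 \<le> t" using that(1) by simp
    show "\<phi> t holomorphic_on unit_disc" by (rule hol[OF t])
    show "cmod (\<phi> t z) < 1" if "cmod z < 1" for z by (rule maps[OF t that])
    show "nontangential_limit (deriv (\<phi> t)) \<tau> (of_real (exp (t * \<alpha>)))" by (rule nt[OF t])
  qed (rule that \<tau> horo[OF that(1)] | assumption)+
  define \<psi> where "\<psi> = \<phi> 1"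
  have \<psi>: "\<psi> holomorphic_on unit_disc" "\<And>z. cmod z < 1 \<Longrightarrow> cmod (\<psi> z) < 1"
    using hol[of 1] maps[of 1] by (auto simp: \<psi>_def)
  have \<psi>n: "cmod ((\<psi> ^^ n) z) < 1" if "cmod z < 1" for n z
    using that by (induction n) (auto simp: \<psi>)
  define d where "d = exp \<alpha>"
  have d: "0 < d" "d < 1" using \<alpha> by (auto simp: d_def)
  have julia: "Re (cay \<tau> z) \<le> d * Re (cay \<tau> (\<psi> z))" if "cmod z < 1" for z
  proof -
    have "(1 - (cmod z)\<^sup>2) * (cmod (\<tau> - \<psi> z))\<^sup>2 \<le> d * (1 - (cmod (\<psi> z))\<^sup>2) * (cmod (\<tau> - z))\<^sup>2"
      using Julia[OF \<psi> \<tau>, of d z] quot[of 1 2] that d by (simp add: \<psi>_def d_def)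
    moreover have "\<tau> \<noteq> z" "\<tau> \<noteq> \<psi> z" using \<psi>(2)[OF that] that \<tau> by auto
    then have "0 < (cmod (\<tau> - z))\<^sup>2" "0 < (cmod (\<tau> - \<psi> z))\<^sup>2" by auto
    ultimately show ?thesis unfolding Re_cay[OF \<tau>] by (simp add: pos_divide_le_eq pos_le_divide_eq)
  qed
  have orb: "\<exists>K\<ge>0. \<forall>n. cmod (cay \<tau> ((\<psi> ^^ n) z) - cay \<tau> z) \<le> K * Re (cay \<tau> ((\<psi> ^^ n) z))"
    if "cmod z < 1" for z
    by (rule orbit_nontangential[OF \<psi> \<tau> d julia that])
  have Rinc: "Re (cay \<tau> z) \<le> Re (cay \<tau> ((\<psi> ^^ n) z))" if "cmod z < 1" for z n
  proof (induction n)
    case (Suc n)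
    let ?r = "Re (cay \<tau> (\<psi> ((\<psi> ^^ n) z)))"
    have "0 < ?r" by (intro Re_cay_pos \<tau> \<psi> \<psi>n that)
    then have "d * ?r \<le> ?r" using d by simp
    then show ?case using Suc julia[OF \<psi>n[OF that, of n]] by simp
  qed auto
  have orb': "\<exists>K. \<forall>n. cmod (cay \<tau> ((\<psi> ^^ n) z)) \<le> K * Re (cay \<tau> ((\<psi> ^^ n) z))" if z: "cmod z < 1" for z
  proof -
    obtain K where K: "0 \<le> K" "\<And>n. cmod (cay \<tau> ((\<psi> ^^ n) z) - cay \<tau> z) \<le> K * Re (cay \<tau> ((\<psi> ^^ n) z))"
      using orb[OF z] by blast
    define L where "L = cmod (cay \<tau> z) / Re (cay \<tau> z)"
    have "cmod (cay \<tau> ((\<psi> ^^ n) z)) \<le> (K + L) * Re (cay \<tau> ((\<psi> ^^ n) z))" for n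
    proof -
      have "cmod (cay \<tau> z) = L * Re (cay \<tau> z)" using Re_cay_pos[OF \<tau> z] by (simp add: L_def)
      also have "\<dots> \<le> L * Re (cay \<tau> ((\<psi> ^^ n) z))"
        using Rinc[OF z] Re_cay_pos[OF \<tau> z] by (intro mult_left_mono) (auto simp: L_def)
      finally show ?thesis
        using K(2)[of n] norm_triangle_ineq2[of "cay \<tau> ((\<psi> ^^ n) z)" "cay \<tau> z"] by (simp add: algebra_simps)
    qed
    then show ?thesis by blast
  qed
  define x where "x = (\<lambda>n. Re (cay \<tau> ((\<psi> ^^ n) 0)))"
  have x: "0 < x n" for n unfolding x_def by (intro Re_cay_pos \<tau> \<psi>n) auto
  define S where "S = (\<lambda>n z. cay \<tau> ((\<psi> ^^ n) z) / of_real (x n))"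
  have hol_it: "\<psi> ^^ n holomorphic_on unit_disc" for n
  proof (induction n)
    case (Suc n)
    have "\<psi> \<circ> (\<psi> ^^ n) holomorphic_on unit_disc"
      by (rule holomorphic_on_compose_gen[OF Suc \<psi>(1)]) (use \<psi>n in auto)
    then show ?case by (simp add: o_def)
  qed (simp add: id_def)
  have S_hol: "S n holomorphic_on unit_disc" for n
  proof -
    have "cay \<tau> \<circ> (\<psi> ^^ n) holomorphic_on unit_disc"
      by (rule holomorphic_on_compose_gen[OF hol_it holomorphic_cay[OF \<tau>]]) (use \<psi>n in auto)
    then show ?thesis unfolding S_def o_def using x[of n] by (intro holomorphic_on_divide) auto
  qed
  have S_Re: "0 < Re (S n z)" if "cmod z < 1" for n z
    using Re_cay_pos[OF \<tau> \<psi>n[OF that]] x[of n] by (simp add: S_def Re_divide_of_real)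
  have S_Re0: "Re (S n 0) = 1" for n using x[of n] by (simp add: S_def x_def Re_divide_of_real)
  obtain K where K: "\<And>n. cmod (S n 0) \<le> K"
  proof -
    obtain K where "\<And>n. cmod (cay \<tau> ((\<psi> ^^ n) 0)) \<le> K * x n" using orb'[of 0] by (auto simp: x_def)
    then have "cmod (S n 0) \<le> K" for n using x[of n] by (simp add: S_def norm_divide divide_le_eq)
    then show ?thesis by (rule that)
  qed
  have S_bd: "cmod (S n z) \<le> K + 2 * cmod z / (1 - cmod z)" if "cmod z < 1" for n z
  proof -
    \<comment> \<open>Applied to - S n, whose real part is negative, with bound 0 and value -1 of
      the real part at the origin.\<close>
    have "cmod (- S n z - - S n 0) \<le> 2 * (0 - Re (- S n 0)) * cmod z / (1 - cmod z)"
      using Borel_Caratheodory[of "\<lambda>z. - S n z" 0 z] S_Re S_hol that by (auto intro: holomorphic_on_minus)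
    then have "cmod (S n z - S n 0) \<le> 2 * cmod z / (1 - cmod z)"
      by (simp add: S_Re0 norm_minus_commute)
    then show ?thesis using K[of n] norm_triangle_ineq2[of "S n z" "S n 0"] by simp
  qed
  obtain \<sigma> k where \<sigma>: "\<sigma> holomorphic_on unit_disc" and k: "strict_mono (k :: nat \<Rightarrow> nat)"
    and Slim: "\<And>z. z \<in> unit_disc \<Longrightarrow> (\<lambda>n. S (k n) z) \<longlonglongrightarrow> \<sigma> z"
  proof (rule Montel[of unit_disc "range S" S])
    fix C :: "complex set" assume C: "compact C" "C \<subseteq> unit_disc"
    have "continuous_on C (\<lambda>z. K + 2 * cmod z / (1 - cmod z))"
      using C by (intro continuous_intros) auto
    then have "bounded ((\<lambda>z. K + 2 * cmod z / (1 - cmod z)) ` C)"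
      using C compact_continuous_image compact_imp_bounded by blast
    then obtain B where B: "\<And>z. z \<in> C \<Longrightarrow> norm (K + 2 * cmod z / (1 - cmod z)) \<le> B"
      unfolding bounded_iff by blast
    show "\<exists>B. \<forall>h\<in>range S. \<forall>z\<in>C. cmod (h z) \<le> B"
    proof (intro exI[of _ B] ballI)
      fix f z assume "f \<in> range S" "z \<in> C"
      then obtain n where "f = S n" "cmod z < 1" using C(2) by auto
      then show "cmod (f z) \<le> B" using S_bd[of z n] B[OF \<open>z \<in> C\<close>] by simp
    qed
  qed (use S_hol in auto)
  have \<sigma>0: "Re (\<sigma> 0) = 1"
    using tendsto_Re[OF Slim[of 0]] by (simp add: S_Re0 LIMSEQ_const_iff)
  have Re\<sigma>: "0 \<le> Re (\<sigma> z)" if "cmod z < 1" for z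
  proof (rule LIMSEQ_le_const)
    show "(\<lambda>n. Re (S (k n) z)) \<longlonglongrightarrow> Re (\<sigma> z)" using that by (intro tendsto_Re Slim) auto
    show "\<exists>N. \<forall>n\<ge>N. 0 \<le> Re (S (k n) z)" using S_Re[OF that] by (meson less_imp_le)
  qed
  have pos: "0 < Re (\<sigma> z)" if z: "cmod z < 1" for z
  proof (rule ccontr)
    assume "\<not> 0 < Re (\<sigma> z)"
    then have "Re (\<sigma> z) = 0" using Re\<sigma>[OF z] by simp
    \<comment> \<open>A zero of Re \<sigma> is a point where |exp (- \<sigma>)| attains its maximum
      1. At the origin this modulus is exp (-1), which gives the contradiction.\<close>
    then have "(\<lambda>z. exp (- \<sigma> z)) constant_on unit_disc"
      using z Re\<sigma>
      by (intro maximum_modulus_principle[of _ _ unit_disc z] holomorphic_intros \<sigma>) auto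
    then obtain y where y: "\<And>z. z \<in> unit_disc \<Longrightarrow> exp (- \<sigma> z) = y" unfolding constant_on_def by blast
    have "exp (- \<sigma> z) = exp (- \<sigma> 0)" using y[of z] y[of 0] z by simp
    then have "cmod (exp (- \<sigma> z)) = cmod (exp (- \<sigma> 0))" by simp
    then show False using \<open>Re (\<sigma> z) = 0\<close> \<sigma>0 by simp
  qed
  have eq: "\<sigma> (\<phi> t z) = of_real (exp (- \<alpha> * t)) * \<sigma> z" if t: "0 < t" and z: "cmod z < 1" for t z
  proof -
    define v where "v = (\<lambda>n. (\<psi> ^^ n) z)"
    have v: "cmod (v n) < 1" for n by (simp add: v_def \<psi>n z)
    have vlim: "v \<longlonglongrightarrow> \<tau>" unfolding v_def \<psi>_def by (rule iterlim) (use z in auto)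
    have v\<phi>: "\<phi> t (v n) = (\<psi> ^^ n) (\<phi> t z)" for n
    proof -
      have "\<phi> t (v n) = \<phi> (t + of_nat n) z"
        using add[of t "of_nat n" z] iter[of 1 z n] t z by (simp add: v_def \<psi>_def)
      also have "\<dots> = \<phi> (of_nat n + t) z" by (simp add: add.commute)
      also have "\<dots> = (\<psi> ^^ n) (\<phi> t z)"
        using add[of "of_nat n" t z] iter[of 1 "\<phi> t z" n] maps[of t z] t z by (simp add: \<psi>_def)
      finally show ?thesis .
    qed
    have v\<phi>lim: "(\<lambda>n. \<phi> t (v n)) \<longlonglongrightarrow> \<tau>"
      unfolding v\<phi> \<psi>_def by (rule iterlim) (use maps[of t z] t z in auto)
    obtain L where L: "\<And>n. cmod (cay \<tau> (v n)) \<le> L * Re (cay \<tau> (v n))" using orb'[OF z] by (auto simp: v_def)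
    \<comment> \<open>Near \<open>\<tau>\<close> the bound of |cay| by L times its real part reads
      |\<tau> - v n| \<le> 2 L (1 - |v n|); the summand 2 makes the Stolz inequality strict and M
      greater than 1.\<close>
    define M where "M = 2 * L + 2"
    have Lp: "0 \<le> L"
    proof -
      have "0 \<le> L * Re (cay \<tau> (v 0))" using L[of 0] norm_ge_zero order_trans by blast
      then show ?thesis using Re_cay_pos[OF \<tau> v[of 0]] by (simp add: zero_le_mult_iff)
    qed
    have ev: "\<forall>\<^sub>F n in sequentially. v n \<in> stolz_region \<tau> M"
    proof -
      have "\<forall>\<^sub>F n in sequentially. dist (v n) \<tau> < 1" using vlim tendstoD zero_less_one by blast
      then show ?thesis
      proof eventually_elim
        case (elim n)
        have ne: "0 < cmod (\<tau> - v n)" using v[of n] \<tau> by auto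
        have "2 * \<tau> = (\<tau> + v n) + (\<tau> - v n)" by simp
        then have "cmod (2 * \<tau>) \<le> cmod (\<tau> + v n) + cmod (\<tau> - v n)" by (metis norm_triangle_ineq)
        then have ge1: "1 \<le> cmod (\<tau> + v n)" using \<tau> elim by (simp add: norm_mult dist_norm norm_minus_commute)
        have "cmod (\<tau> + v n) / cmod (\<tau> - v n) \<le> L * ((1 - (cmod (v n))\<^sup>2) / (cmod (\<tau> - v n))\<^sup>2)"
          using L[of n] by (simp add: Re_cay[OF \<tau>]) (simp add: cay_def norm_divide)
        then have "cmod (\<tau> + v n) * cmod (\<tau> - v n) \<le> L * (1 - (cmod (v n))\<^sup>2)"
          using ne by (simp add: field_simps power2_eq_square)
        moreover have "1 * cmod (\<tau> - v n) \<le> cmod (\<tau> + v n) * cmod (\<tau> - v n)" using ge1 by (intro mult_right_mono) auto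
        moreover have "1 - (cmod (v n))\<^sup>2 \<le> 2 * (1 - cmod (v n))"
          using zero_le_power2[of "1 - cmod (v n)"] by (simp add: power2_eq_square algebra_simps)
        then have "L * (1 - (cmod (v n))\<^sup>2) \<le> L * (2 * (1 - cmod (v n)))" using Lp by (rule mult_left_mono)
        ultimately have "cmod (\<tau> - v n) \<le> L * (2 * (1 - cmod (v n)))" by linarith
        then show ?case using v[of n] by (simp add: stolz_region_def M_def norm_minus_commute algebra_simps)
      qed
    qed
    have q: "(\<lambda>n. (\<tau> - \<phi> t (v n)) / (\<tau> - v n)) \<longlonglongrightarrow> of_real (exp (t * \<alpha>))"
    proof (rule filterlim_compose[OF quot[OF t, of M]])
      show "1 < M" using Lp by (simp add: M_def)
      show "filterlim v (at \<tau> within stolz_region \<tau> M) sequentially"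
      proof -
        have "v n \<noteq> \<tau>" for n using v[of n] \<tau> by (metis less_irrefl)
        then show ?thesis unfolding filterlim_at using vlim ev by (auto elim!: eventually_mono)
      qed
    qed
    \<comment> \<open>The quotient of the two Cayley transforms: the sums \<tau> + \<phi> t (v n)
      and \<tau> + v n both tend to 2 \<tau>, and only the quotient of the differences
      contributes.\<close>
    have cq: "(\<lambda>n. ((\<tau> + \<phi> t (v n)) / (\<tau> + v n)) / ((\<tau> - \<phi> t (v n)) / (\<tau> - v n))) \<longlonglongrightarrow> ((\<tau> + \<tau>) / (\<tau> + \<tau>)) / of_real (exp (t * \<alpha>))"
      by (intro tendsto_intros q vlim v\<phi>lim) (use \<tau> in auto)
    have vn: "(\<psi> ^^ n) z = v n" for n by (simp add: v_def)
    have "S n (\<phi> t z) = ((\<tau> + \<phi> t (v n)) / (\<tau> + v n)) / ((\<tau> - \<phi> t (v n)) / (\<tau> - v n)) * S n z" for n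
    proof -
      have "\<tau> - v n \<noteq> 0" "\<tau> - \<phi> t (v n) \<noteq> 0" using v[of n] maps[of t "v n"] t \<tau> by auto
      moreover have "\<tau> + v n \<noteq> 0"
      proof
        assume "\<tau> + v n = 0"
        then have "v n = - \<tau>" by (simp add: eq_neg_iff_add_eq_0 add.commute)
        then show False using v[of n] \<tau> by simp
      qed
      ultimately show ?thesis unfolding S_def v\<phi>[symmetric] cay_def vn
        using x[of n] by (simp add: divide_simps)
    qed
    then have "(\<lambda>n. S (k n) (\<phi> t z)) \<longlonglongrightarrow> ((\<tau> + \<tau>) / (\<tau> + \<tau>)) / of_real (exp (t * \<alpha>)) * \<sigma> z"
      using tendsto_mult[OF LIMSEQ_subseq_LIMSEQ[OF cq k] Slim[of z]] z by (simp add: o_def)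
    then have "\<sigma> (\<phi> t z) = ((\<tau> + \<tau>) / (\<tau> + \<tau>)) / of_real (exp (t * \<alpha>)) * \<sigma> z"
      using Slim[of "\<phi> t z"] maps[of t z] t z LIMSEQ_unique by auto
    moreover have "(\<tau> + \<tau>) / (\<tau> + \<tau>) = 1" using \<tau> by auto
    moreover have "complex_of_real (exp (- \<alpha> * t)) = 1 / of_real (exp (t * \<alpha>))"
      by (simp add: exp_minus mult.commute divide_inverse)
    ultimately show ?thesis by simp
  qed
  show ?thesis
  proof (rule that[OF \<alpha> \<sigma> pos])
    fix t z assume "0 \<le> (t::real)" "cmod z < 1"
    then show "\<sigma> (\<phi> t z) = of_real (exp (- \<alpha> * t)) * \<sigma> z"
      using eq[of t z] zero[of z] by (cases "t = 0") auto
  qed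
qed

lemma hyperbolic_linearizer:
  assumes "hyperbolic_semiflow \<phi>"
  obtains L B where "L holomorphic_on unit_disc" "\<And>z. cmod z < 1 \<Longrightarrow> \<bar>Im (L z)\<bar> \<le> B"
    "\<And>t z. 0 \<le> t \<Longrightarrow> cmod z < 1 \<Longrightarrow> L (\<phi> t z) = L z + of_real t"
proof -
  obtain \<sigma> \<alpha> where \<alpha>: "\<alpha> < 0" and hol: "\<sigma> holomorphic_on unit_disc"
    and pos: "\<And>z. cmod z < 1 \<Longrightarrow> 0 < Re (\<sigma> z)"
    and eq: "\<And>t z. 0 \<le> t \<Longrightarrow> cmod z < 1 \<Longrightarrow> \<sigma> (\<phi> t z) = of_real (exp (- \<alpha> * t)) * \<sigma> z"
    using hyperbolic_model[OF assms] by metis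
  define L where "L = (\<lambda>z. Ln (\<sigma> z) / of_real (- \<alpha>))"
  have nz: "\<sigma> z \<noteq> 0" if "cmod z < 1" for z using pos[OF that] by auto
  show ?thesis
  proof (rule that)
    have "\<sigma> z \<notin> \<real>\<^sub>\<le>\<^sub>0" if "cmod z < 1" for z
      using pos[OF that] by (auto simp: complex_nonpos_Reals_iff)
    then show "L holomorphic_on unit_disc"
      unfolding L_def using \<alpha> by (intro holomorphic_intros hol) auto
    show "\<bar>Im (L z)\<bar> \<le> pi / (- \<alpha>)" if "cmod z < 1" for z
    proof -
      have "\<bar>Im (Ln (\<sigma> z))\<bar> \<le> pi"
        using Im_Ln_le_pi[OF nz[OF that]] mpi_less_Im_Ln[OF nz[OF that]] by simp
      then have "\<bar>Im (Ln (\<sigma> z))\<bar> / (- \<alpha>) \<le> pi / (- \<alpha>)" using \<alpha> by (intro divide_right_mono) auto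
      then show ?thesis using \<alpha> by (simp add: L_def Im_divide_of_real abs_divide del: of_real_minus)
    qed
    show "L (\<phi> t z) = L z + of_real t" if "0 \<le> t" "cmod z < 1" for t z
    proof -
      have "Ln (\<sigma> (\<phi> t z)) = of_real (- \<alpha> * t) + Ln (\<sigma> z)"
        unfolding eq[OF that] Ln_times_of_real[OF exp_gt_zero nz[OF that(2)]] by (simp only: Ln_of_real exp_gt_zero ln_exp)
      then show ?thesis using \<alpha> by (simp add: L_def field_simps)
    qed
  qed
qed

section \<open>Operators on Hardy spaces\<close>

lemma hardy_norm_nonneg: "0 \<le> hardy_norm p f"
  by (simp add: hardy_norm_eq)

lemma hardy_sup_eq_norm_powr:
  "f \<in> hardy_space p \<Longrightarrow> 1 \<le> p \<Longrightarrow> hardy_sup p f = hardy_norm p f powr p"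
  by (simp add: hardy_norm_eq powr_powr hardy_sup_nonneg)

lemma hardy_zero_mem: "1 \<le> p \<Longrightarrow> (\<lambda>_. 0) \<in> hardy_space p"
  by (rule hardy_spaceI[where B = 0]) (auto simp: hardy_mean_def)

lemma bounded_operatorI:
  assumes p: "1 \<le> p" and "A \<in> hardy_space p \<rightarrow> hardy_space p" "linear_map_on (hardy_space p) A"
    and K: "0 \<le> K" "\<And>f. f \<in> hardy_space p \<Longrightarrow> hardy_sup p (A f) \<le> K * hardy_sup p f"
    and "\<And>f. f \<notin> hardy_space p \<Longrightarrow> A f = (\<lambda>_. 0)"
  shows "A \<in> bounded_operators (hardy_space p) (hardy_norm p)"
proof -
  have "hardy_norm p (A f) \<le> K powr (1 / p) * hardy_norm p f" if f: "f \<in> hardy_space p" for f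
  proof -
    have "0 \<le> hardy_sup p (A f)" "0 \<le> hardy_sup p f" using f assms(2) by (auto intro: hardy_sup_nonneg)
    then have "hardy_sup p (A f) powr (1 / p) \<le> (K * hardy_sup p f) powr (1 / p)"
      using p K(2)[OF f] by (intro powr_mono2) auto
    then show ?thesis using K(1) \<open>0 \<le> hardy_sup p f\<close> by (simp add: hardy_norm_eq powr_mult)
  qed
  with assms show ?thesis unfolding bounded_operators_def by blast
qed

lemma bounded_operatorD:
  assumes "A \<in> bounded_operators (hardy_space p) (hardy_norm p)"
  shows bounded_operator_mem: "f \<in> hardy_space p \<Longrightarrow> A f \<in> hardy_space p"
    and bounded_operator_add: "f \<in> hardy_space p \<Longrightarrow> g \<in> hardy_space p \<Longrightarrow> A (\<lambda>z. f z + g z) = (\<lambda>z. A f z + A g z)"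
    and bounded_operator_cmult: "f \<in> hardy_space p \<Longrightarrow> A (\<lambda>z. c * f z) = (\<lambda>z. c * A f z)"
    and bounded_operator_outside: "f \<notin> hardy_space p \<Longrightarrow> A f = (\<lambda>_. 0)"
  using assms unfolding bounded_operators_def linear_map_on_def by auto

lemma bounded_operator_sup:
  assumes p: "1 \<le> p" and A: "A \<in> bounded_operators (hardy_space p) (hardy_norm p)"
  obtains K where "0 \<le> K" "\<And>f. f \<in> hardy_space p \<Longrightarrow> hardy_sup p (A f) \<le> K * hardy_sup p f"
proof -
  obtain K where K: "\<And>f. f \<in> hardy_space p \<Longrightarrow> hardy_norm p (A f) \<le> K * hardy_norm p f"
    using A unfolding bounded_operators_def by auto
  have "hardy_sup p (A f) \<le> \<bar>K\<bar> powr p * hardy_sup p f" if f: "f \<in> hardy_space p" for f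
  proof -
    have "hardy_norm p (A f) \<le> \<bar>K\<bar> * hardy_norm p f"
      using K[OF f] mult_right_mono[OF abs_ge_self hardy_norm_nonneg] order_trans by blast
    then have "hardy_norm p (A f) powr p \<le> (\<bar>K\<bar> * hardy_norm p f) powr p"
      using p by (intro powr_mono2) (auto simp: hardy_norm_nonneg)
    then show ?thesis
      using f p bounded_operator_mem[OF A f]
      by (simp add: hardy_sup_eq_norm_powr powr_mult hardy_norm_nonneg)
  qed
  then show ?thesis by (intro that[of "\<bar>K\<bar> powr p"]) auto
qed

lemma composition_operator_apply:
  "f \<in> hardy_space p \<Longrightarrow> composition_operator p \<psi> f = disc_ext (\<lambda>z. f (\<psi> z))"
  by (simp add: composition_operator_def disc_ext_def)

lemma composition_operator_bounded:
  assumes p: "1 \<le> p" and \<psi>: "\<psi> holomorphic_on ball 0 1" "\<psi> \<in> ball 0 1 \<rightarrow> ball 0 1"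
  shows "composition_operator p \<psi> \<in> bounded_operators (hardy_space p) (hardy_norm p)"
proof (rule bounded_operatorI[OF p])
  show "composition_operator p \<psi> \<in> hardy_space p \<rightarrow> hardy_space p"
    using hardy_space_comp[OF _ p \<psi>] by (auto simp: composition_operator_apply)
  show "linear_map_on (hardy_space p) (composition_operator p \<psi>)"
    unfolding linear_map_on_def using p
    by (auto simp: composition_operator_apply hardy_space_add hardy_space_cmult disc_ext_def)
  show "0 \<le> (1 + cmod (\<psi> 0)) / (1 - cmod (\<psi> 0))"
    using \<psi>(2) by (intro divide_nonneg_nonneg) (auto simp: Pi_iff dest!: bspec[of _ _ 0] intro: less_imp_le)
qed (use hardy_space_comp[OF _ p \<psi>] in \<open>auto simp: composition_operator_apply, auto simp: composition_operator_def\<close>)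

definition mult_operator :: "real \<Rightarrow> (complex \<Rightarrow> complex) \<Rightarrow> (complex \<Rightarrow> complex) \<Rightarrow> (complex \<Rightarrow> complex)" where
  "mult_operator p u = (\<lambda>f. if f \<in> hardy_space p then (\<lambda>z. u z * f z) else (\<lambda>_. 0))"

lemma mult_operator_bounded:
  assumes p: "1 \<le> p" and u: "u holomorphic_on ball 0 1" "\<And>z. cmod z < 1 \<Longrightarrow> cmod (u z) \<le> B"
  shows "mult_operator p u \<in> bounded_operators (hardy_space p) (hardy_norm p)"
proof (rule bounded_operatorI[OF p])
  show "mult_operator p u \<in> hardy_space p \<rightarrow> hardy_space p"
    using hardy_space_mult[OF _ u(1) p u(2)] by (auto simp: mult_operator_def)
  show "linear_map_on (hardy_space p) (mult_operator p u)"
    unfolding linear_map_on_def using p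
    by (auto simp: mult_operator_def hardy_space_add hardy_space_cmult algebra_simps)
  show "0 \<le> B powr p" by simp
qed (use hardy_space_mult[OF _ u(1) p u(2)] in \<open>auto simp: mult_operator_def\<close>)

lemma hardy_eval_norm:
  assumes f: "f \<in> hardy_space p" and z: "cmod z < 1" and p: "1 \<le> p"
  shows "cmod (f z) \<le> ((1 + cmod z) / (1 - cmod z)) powr (1 / p) * hardy_norm p f"
proof -
  have "(cmod (f z) powr p) powr (1 / p) \<le> ((1 + cmod z) / (1 - cmod z) * hardy_sup p f) powr (1 / p)"
    using hardy_eval[OF assms] p by (intro powr_mono2) auto
  moreover have "0 \<le> (1 + cmod z) / (1 - cmod z)" using z by simp
  ultimately show ?thesis using p hardy_sup_nonneg[OF f]
    by (simp add: hardy_norm_eq powr_powr powr_mult del: times_divide_eq_left)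
qed

lemma eval_bounded_functional:
  assumes p: "1 \<le> p" and B: "B \<in> bounded_operators (hardy_space p) (hardy_norm p)"
  shows "(\<lambda>f. B f z) \<in> bounded_functionals (hardy_space p) (hardy_norm p)"
proof -
  obtain K where K: "\<And>f. f \<in> hardy_space p \<Longrightarrow> hardy_norm p (B f) \<le> K * hardy_norm p f"
    using B unfolding bounded_operators_def by auto
  have "\<exists>K. \<forall>f\<in>hardy_space p. cmod (B f z) \<le> K * hardy_norm p f"
  proof (cases "cmod z < 1")
    case True
    define C where "C = ((1 + cmod z) / (1 - cmod z)) powr (1 / p)"
    have "cmod (B f z) \<le> (C * K) * hardy_norm p f" if f: "f \<in> hardy_space p" for f
    proof -
      have "cmod (B f z) \<le> C * hardy_norm p (B f)"
        unfolding C_def using bounded_operator_mem[OF B f] True p by (rule hardy_eval_norm)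
      also have "\<dots> \<le> C * (K * hardy_norm p f)" using K[OF f] by (intro mult_left_mono) (auto simp: C_def)
      finally show ?thesis by simp
    qed
    then show ?thesis by blast
  next
    case False
    then show ?thesis
      using hardy_space_zero[OF bounded_operator_mem[OF B]] by (intro exI[of _ 0]) auto
  qed
  then show ?thesis
    unfolding bounded_functionals_def
    by (auto simp: bounded_operator_add[OF B] bounded_operator_cmult[OF B])
qed

lemma id_operator_bounded: "1 \<le> p \<Longrightarrow> id_operator (hardy_space p) \<in> bounded_operators (hardy_space p) (hardy_norm p)"
  by (rule bounded_operatorI[where K = 1])
     (auto simp: id_operator_def linear_map_on_def hardy_space_add hardy_space_cmult)

lemma bounded_operator_zero:
  assumes "1 \<le> p" "A \<in> bounded_operators (hardy_space p) (hardy_norm p)"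
  shows "A (\<lambda>_. 0) = (\<lambda>_. 0)"
  using bounded_operator_cmult[OF assms(2) hardy_zero_mem[OF assms(1)], of 0] by simp

text \<open>Operators vanish off H^p and functions of H^p vanish off the disc, so equality of the
  products has to be checked only at points of the disc for functions in H^p.\<close>

lemma operators_commuteI:
  assumes p: "1 \<le> p" and A: "A \<in> bounded_operators (hardy_space p) (hardy_norm p)"
    and B: "B \<in> bounded_operators (hardy_space p) (hardy_norm p)"
    and eq: "\<And>f z. f \<in> hardy_space p \<Longrightarrow> cmod z < 1 \<Longrightarrow> A (B f) z = B (A f) z"
  shows "A \<circ> B = B \<circ> A"
proof (intro ext)
  fix f z
  note mem = bounded_operator_mem[OF A] bounded_operator_mem[OF B]
  show "(A \<circ> B) f z = (B \<circ> A) f z"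
  proof (cases "f \<in> hardy_space p")
    case True
    then show ?thesis using eq[of f z] hardy_space_zero[OF mem(1)[OF mem(2)], of f z]
        hardy_space_zero[OF mem(2)[OF mem(1)], of f z] by (cases "cmod z < 1") auto
  next
    case False
    then show ?thesis
      by (simp add: bounded_operator_outside[OF A] bounded_operator_outside[OF B]
          bounded_operator_zero[OF p A] bounded_operator_zero[OF p B])
  qed
qed

lemma composition_operators_commute:
  assumes p: "1 \<le> p" and \<psi>: "\<psi> holomorphic_on ball 0 1" "\<psi> \<in> ball 0 1 \<rightarrow> ball 0 1"
    and \<phi>: "\<phi> holomorphic_on ball 0 1" "\<phi> \<in> ball 0 1 \<rightarrow> ball 0 1"
    and eq: "\<And>z. cmod z < 1 \<Longrightarrow> \<phi> (\<psi> z) = \<psi> (\<phi> z)"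
  shows "composition_operator p \<psi> \<in> commutant (hardy_space p) (hardy_norm p) (composition_operator p \<phi>)"
proof -
  note b = composition_operator_bounded[OF p \<psi>] composition_operator_bounded[OF p \<phi>]
  have "composition_operator p \<psi> \<circ> composition_operator p \<phi> = composition_operator p \<phi> \<circ> composition_operator p \<psi>"
  proof (rule operators_commuteI[OF p b])
    fix f z assume f: "f \<in> hardy_space p" and z: "cmod z < 1"
    have "cmod (\<phi> z) < 1" "cmod (\<psi> z) < 1" using \<phi> \<psi> z by auto
    then show "composition_operator p \<psi> (composition_operator p \<phi> f) z = composition_operator p \<phi> (composition_operator p \<psi> f) z"
      using hardy_space_comp(1)[OF f p \<phi>] hardy_space_comp(1)[OF f p \<psi>] f z eq[OF z]
      by (simp add: composition_operator_apply)
  qed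
  with b show ?thesis by (simp add: commutant_def)
qed

lemma mult_operator_in_commutant:
  assumes p: "1 \<le> p" and u: "u holomorphic_on ball 0 1" "\<And>z. cmod z < 1 \<Longrightarrow> cmod (u z) \<le> B"
    and \<phi>: "\<phi> holomorphic_on ball 0 1" "\<phi> \<in> ball 0 1 \<rightarrow> ball 0 1"
    and eq: "\<And>z. cmod z < 1 \<Longrightarrow> u (\<phi> z) = u z"
  shows "mult_operator p u \<in> commutant (hardy_space p) (hardy_norm p) (composition_operator p \<phi>)"
proof -
  note b = mult_operator_bounded[OF p u] composition_operator_bounded[OF p \<phi>]
  have "mult_operator p u \<circ> composition_operator p \<phi> = composition_operator p \<phi> \<circ> mult_operator p u"
  proof (rule operators_commuteI[OF p b])
    fix f z assume f: "f \<in> hardy_space p" and z: "cmod z < 1"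
    show "mult_operator p u (composition_operator p \<phi> f) z = composition_operator p \<phi> (mult_operator p u f) z"
      using hardy_space_comp(1)[OF f p \<phi>] hardy_space_mult(1)[OF f u(1) p u(2)] f z eq[OF z]
      by (simp add: composition_operator_apply mult_operator_def)
  qed
  with b show ?thesis by (simp add: commutant_def)
qed

section \<open>Properties of an operator that force a commutative commutant\<close>

lemma functional_commutant_imp_commutative:
  assumes "functional_commutant_property X N T" "A \<in> commutant X N T" "B \<in> commutant X N T"
  shows "A \<circ> B = B \<circ> A"
proof -
  obtain G F \<Phi> where F: "subalgebra_of_continuous_functions G F" and \<Phi>: "algebra_isomorphism F (commutant X N T) \<Phi>"
    using assms(1) unfolding functional_commutant_property_def by blast
  have "commutant X N T = \<Phi> ` F" using \<Phi> by (simp add: algebra_isomorphism_def bij_betw_def)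
  then obtain f g where fg: "f \<in> F" "g \<in> F" and AB: "A = \<Phi> f" "B = \<Phi> g"
    using assms(2,3) by auto
  have "\<forall>f\<in>F. \<forall>g\<in>F. \<Phi> (\<lambda>z. f z * g z) = \<Phi> f \<circ> \<Phi> g"
    using \<Phi> unfolding algebra_isomorphism_def by (elim conjE)
  then have m: "\<Phi> (\<lambda>z. f z * g z) = \<Phi> f \<circ> \<Phi> g" if "f \<in> F" "g \<in> F" for f g
    using that by simp
  have "(\<lambda>z. f z * g z) = (\<lambda>z. g z * f z)" by (simp add: mult.commute)
  then show ?thesis using m[OF fg] m[OF fg(2,1)] AB by simp
qed

lemma hardy_space_sum:
  fixes n :: nat
  assumes p: "1 \<le> p" and "\<And>i. i \<le> n \<Longrightarrow> g i \<in> hardy_space p"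
  shows "(\<lambda>z. \<Sum>i\<le>n. c i * g i z) \<in> hardy_space p"
  using assms(2)
proof (induction n)
  case 0
  then show ?case using hardy_space_cmult(1)[of "g 0" p] p by simp
next
  case (Suc n)
  then show ?case
    using hardy_space_add(1)[OF _ hardy_space_cmult(1)[of "g (Suc n)" p "c (Suc n)"] p] p by simp
qed

lemma bounded_operator_sum:
  fixes n :: nat
  assumes p: "1 \<le> p" and B: "B \<in> bounded_operators (hardy_space p) (hardy_norm p)"
    and "\<And>i. i \<le> n \<Longrightarrow> g i \<in> hardy_space p"
  shows "B (\<lambda>z. \<Sum>i\<le>n. c i * g i z) = (\<lambda>z. \<Sum>i\<le>n. c i * B (g i) z)"
  using assms(3)
proof (induction n)
  case 0
  then show ?case using bounded_operator_cmult[OF B] by simp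
next
  case (Suc n)
  have 1: "(\<lambda>z. \<Sum>i\<le>n. c i * g i z) \<in> hardy_space p" using Suc by (intro hardy_space_sum p) auto
  have 2: "(\<lambda>z. c (Suc n) * g (Suc n) z) \<in> hardy_space p" using Suc by (intro hardy_space_cmult p) auto
  show ?case using bounded_operator_add[OF B 1 2] bounded_operator_cmult[OF B, of "g (Suc n)"] Suc by simp
qed

lemma alg_commutes:
  assumes p: "1 \<le> p" and P: "P \<in> alg (hardy_space p) T"
    and T: "T \<in> bounded_operators (hardy_space p) (hardy_norm p)"
    and B: "B \<in> commutant (hardy_space p) (hardy_norm p) T" and f: "f \<in> hardy_space p"
  shows "P (B f) = B (P f)"
proof -
  have Bb: "B \<in> bounded_operators (hardy_space p) (hardy_norm p)" and BT: "B \<circ> T = T \<circ> B"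
    using B by (auto simp: commutant_def)
  have BT': "B (T x) = T (B x)" for x using BT by (metis comp_apply)
  obtain q where q: "P = poly_operator (hardy_space p) q T" using P by (auto simp: alg_def)
  have mem: "(T ^^ i) f \<in> hardy_space p" for i
    by (induction i) (auto simp: f bounded_operator_mem[OF T])
  have "B ((T ^^ i) f) = (T ^^ i) (B f)" for i by (induction i) (auto simp: BT')
  then show ?thesis
    using bounded_operator_sum[OF p Bb mem, where n = "degree q" and c = "coeff q"] f bounded_operator_mem[OF Bb f]
    by (simp add: q poly_operator_def)
qed

text \<open>For fixed \<open>f\<close> and \<open>z\<close> the values of A (B f) and of B (A f) at
  \<open>z\<close> depend continuously on \<open>A\<close> in the weak operator topology and
  coincide on the polynomials in \<open>T\<close>. If they differed at a closure point, disjoint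
  neighbourhoods of the two values would define a weakly open set that contains no such
  polynomial.\<close>

lemma wot_closure_commutes:
  assumes p: "1 \<le> p" and T: "T \<in> bounded_operators (hardy_space p) (hardy_norm p)"
    and A: "A \<in> weak_operator_topology (hardy_space p) (hardy_norm p) closure_of alg (hardy_space p) T"
    and B: "B \<in> commutant (hardy_space p) (hardy_norm p) T"
  shows "A \<circ> B = B \<circ> A"
proof -
  let ?X = "hardy_space p" and ?N = "hardy_norm p"
  have Bb: "B \<in> bounded_operators ?X ?N" using B by (simp add: commutant_def)
  have Ab: "A \<in> bounded_operators ?X ?N"
  proof -
    have "A \<in> topspace (weak_operator_topology ?X ?N)" using A by (rule in_closure_of[THEN iffD1, THEN conjunct1])
    then show ?thesis by (auto simp: weak_operator_topology_def topology_generated_by_topspace)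
  qed
  have "id_operator ?X \<in> bounded_operators ?X ?N" by (rule id_operator_bounded[OF p])
  show ?thesis
  proof (rule operators_commuteI[OF p Ab Bb])
    fix f z assume f: "f \<in> ?X" and "cmod z < 1"
    have Bf: "B f \<in> ?X" by (rule bounded_operator_mem[OF Bb f])
    define l where "l = (\<lambda>g. id_operator ?X g z)"
    define m where "m = (\<lambda>g. B g z)"
    have l: "l \<in> bounded_functionals ?X ?N" unfolding l_def by (rule eval_bounded_functional[OF p id_operator_bounded[OF p]])
    have m: "m \<in> bounded_functionals ?X ?N" unfolding m_def by (rule eval_bounded_functional[OF p Bb])
    show "A (B f) z = B (A f) z"
    proof (rule ccontr)
      assume "A (B f) z \<noteq> B (A f) z"
      then have "l (A (B f)) \<noteq> m (A f)"
        using bounded_operator_mem[OF Ab Bf] by (simp add: l_def m_def id_operator_def)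
      then obtain U V where UV: "open U" "open V" "l (A (B f)) \<in> U" "m (A f) \<in> V" "U \<inter> V = {}"
        by (meson hausdorff)
      define W1 where "W1 = {C \<in> bounded_operators ?X ?N. l (C (B f)) \<in> U}"
      define W2 where "W2 = {C \<in> bounded_operators ?X ?N. m (C f) \<in> V}"
      have "openin (weak_operator_topology ?X ?N) W1" "openin (weak_operator_topology ?X ?N) W2"
        unfolding weak_operator_topology_def W1_def W2_def using l m UV f Bf
        by (auto intro!: topology_generated_by_Basis)
      then have "openin (weak_operator_topology ?X ?N) (W1 \<inter> W2)" by blast
      moreover have "A \<in> W1 \<inter> W2" using UV Ab by (simp add: W1_def W2_def)
      ultimately obtain P where P: "P \<in> alg ?X T" "P \<in> W1 \<inter> W2"
        using A unfolding in_closure_of by blast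
      have Pb: "P \<in> bounded_operators ?X ?N" using P by (simp add: W1_def)
      have "l (P (B f)) = m (P f)"
        using alg_commutes[OF p P(1) T B f] bounded_operator_mem[OF Pb Bf] by (simp add: l_def m_def id_operator_def)
      then show False using P UV(5) by (auto simp: W1_def W2_def)
    qed
  qed
qed

lemma noncommuting_commutant:
  assumes p: "1 \<le> p" and \<phi>: "\<phi> holomorphic_on unit_disc" "\<phi> \<in> unit_disc \<rightarrow> unit_disc"
    and hyp: "hyperbolic_semiflow \<phi>s" and eq: "\<And>z. cmod z < 1 \<Longrightarrow> \<phi> z = \<phi>s 1 z"
  shows "\<exists>A\<in>commutant (hardy_space p) (hardy_norm p) (composition_operator p \<phi>).
    \<exists>B\<in>commutant (hardy_space p) (hardy_norm p) (composition_operator p \<phi>). A \<circ> B \<noteq> B \<circ> A"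
proof -
  obtain L B where L: "L holomorphic_on unit_disc" "\<And>z. cmod z < 1 \<Longrightarrow> \<bar>Im (L z)\<bar> \<le> B"
    and Leq: "\<And>t z. 0 \<le> t \<Longrightarrow> cmod z < 1 \<Longrightarrow> L (\<phi>s t z) = L z + of_real t"
    using hyperbolic_linearizer[OF hyp] by metis
  \<comment> \<open>The linearizer \<open>L\<close> serves as a Koenigs function. \<open>u\<close>
    is invariant under time 1, and half a period multiplies it by exp (pi \<i>) = -1.\<close>
  define u where "u = (\<lambda>z. exp (2 * pi * \<i> * L z))"
  define \<psi> where "\<psi> = \<phi>s (1/2)"
  have sf: "holomorphic_semiflow \<phi>s" using hyp by (simp add: hyperbolic_semiflow_def)
  have hol: "\<psi> holomorphic_on unit_disc" and maps: "\<psi> \<in> unit_disc \<rightarrow> unit_disc"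
    using sf by (auto simp: holomorphic_semiflow_def \<psi>_def)
  have \<psi>lt: "cmod (\<psi> z) < 1" if "cmod z < 1" for z using maps that by auto
  have comm: "\<phi> (\<psi> z) = \<psi> (\<phi> z)" if "cmod z < 1" for z
  proof -
    have z: "z \<in> unit_disc" using that by simp
    have "\<phi>s (1 + 1/2) z = \<phi>s 1 (\<phi>s (1/2) z)" "\<phi>s (1/2 + 1) z = \<phi>s (1/2) (\<phi>s 1 z)"
      using sf z unfolding holomorphic_semiflow_def by (metis zero_le_one zero_le_divide_1_iff zero_le_numeral)+
    then show ?thesis using eq[OF that] eq[OF \<psi>lt[OF that]] by (simp add: \<psi>_def)
  qed
  have "composition_operator p \<psi> \<in> commutant (hardy_space p) (hardy_norm p) (composition_operator p \<phi>)"
    by (rule composition_operators_commute[OF p hol maps \<phi> comm])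
  moreover
  have uh: "u holomorphic_on unit_disc" unfolding u_def by (intro holomorphic_intros L)
  have ub: "cmod (u z) \<le> exp (2 * pi * B)" if "cmod z < 1" for z
  proof -
    have "- Im (L z) \<le> B" using L(2)[OF that] by linarith
    then have "2 * pi * (- Im (L z)) \<le> 2 * pi * B" by (intro mult_left_mono) auto
    then show ?thesis by (simp add: u_def)
  qed
  have "u (\<phi> z) = u z" if "cmod z < 1" for z
    using Leq[of 1 z] that by (simp add: u_def eq[OF that] ring_distribs exp_add)
  then have "mult_operator p u \<in> commutant (hardy_space p) (hardy_norm p) (composition_operator p \<phi>)"
    by (intro mult_operator_in_commutant[OF p uh ub \<phi>])
  moreover have "mult_operator p u \<circ> composition_operator p \<psi> \<noteq> composition_operator p \<psi> \<circ> mult_operator p u"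
  proof
    assume *: "mult_operator p u \<circ> composition_operator p \<psi> = composition_operator p \<psi> \<circ> mult_operator p u"
    define e where "e = disc_ext (\<lambda>_. 1)"
    have e: "e \<in> hardy_space p" unfolding e_def using p by (intro hardy_space_bounded(1)[where B = 1]) auto
    have ue: "(\<lambda>z. u z * e z) \<in> hardy_space p" by (rule hardy_space_mult(1)[OF e uh p ub])
    have Ce: "disc_ext (\<lambda>z. e (\<psi> z)) \<in> hardy_space p" by (rule hardy_space_comp(1)[OF e p hol maps])
    have "(mult_operator p u \<circ> composition_operator p \<psi>) e 0 = u 0"
      using e Ce \<psi>lt[of 0] by (simp add: composition_operator_apply mult_operator_def) (simp add: e_def)
    moreover have "(composition_operator p \<psi> \<circ> mult_operator p u) e 0 = u (\<psi> 0)"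
      using e ue \<psi>lt[of 0] by (simp add: composition_operator_apply mult_operator_def) (simp add: e_def)
    moreover have "u (\<psi> 0) = - u 0"
    proof -
      have "u (\<psi> 0) = exp (2 * pi * \<i> * L 0 + pi * \<i>)" using Leq[of "1/2" 0] by (simp add: u_def \<psi>_def ring_distribs)
      then show ?thesis by (simp add: u_def exp_add)
    qed
    ultimately have "u 0 = - u 0" unfolding * by simp
    then show False by (simp add: u_def)
  qed
  ultimately show ?thesis by blast
qed

section \<open>Convergence of dilations\<close>

lemma powr_superadditive:
  fixes s t q :: real
  assumes "0 \<le> s" "0 \<le> t" "1 \<le> q"
  shows "s powr q + t powr q \<le> (s + t) powr q"
proof -
  have *: "x powr q \<le> x * (s + t) powr (q - 1)" if "0 \<le> x" "x \<le> s + t" for x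
  proof (cases "x = 0")
    case False
    then have "x powr q = x * x powr (q - 1)" using that powr_mult_base[of x "q - 1"] by simp
    also have "\<dots> \<le> x * (s + t) powr (q - 1)" using that assms by (intro mult_left_mono powr_mono2) auto
    finally show ?thesis .
  qed auto
  have "s powr q + t powr q \<le> (s + t) * (s + t) powr (q - 1)"
    using *[of s] *[of t] assms by (simp add: ring_distribs)
  also have "\<dots> = (s + t) powr q" using powr_mult_base[of "s + t" "q - 1"] assms by simp
  finally show ?thesis .
qed

lemma powr_midpoint:
  fixes s t q :: real
  assumes "0 \<le> s" "0 \<le> t" "1 \<le> q"
  shows "2 * ((s + t) / 2) powr q \<le> s powr q + t powr q"
proof (cases "s + t = 0")
  case True
  then show ?thesis by simp
next
  case False
  define a where "a = (s + t) / 2"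
  have a: "0 < a" using False assms by (simp add: a_def)
  have "a powr q + q * a powr (q - 1) * (s - a) + (a powr q + q * a powr (q - 1) * (t - a)) \<le> s powr q + t powr q"
    using assms a by (intro add_mono powr_tangent) auto
  moreover have "s - a + (t - a) = 0" by (simp add: a_def field_simps)
  then have "q * a powr (q - 1) * (s - a) + q * a powr (q - 1) * (t - a) = 0"
    unfolding distrib_left[symmetric] by simp
  ultimately show ?thesis by (simp add: a_def[symmetric])
qed

text \<open>With q = p / 2 the p-th powers are q-th powers of squares: superadditivity of the q-th
  power joins the two terms, the parallelogram law evaluates the sum of squares, and convexity
  splits it again.\<close>

lemma Clarkson:
  fixes a b :: complex
  assumes p: "2 \<le> p"
  shows "cmod (a - b) powr p + cmod (a + b) powr p \<le> 2 powr (p - 1) * (cmod a powr p + cmod b powr p)"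
proof -
  define q where "q = p / 2"
  have q: "1 \<le> q" using p by (simp add: q_def)
  have sq: "x powr p = (x\<^sup>2) powr q" if "0 \<le> x" for x :: real
    using that by (cases "x = 0") (auto simp: q_def powr_powr simp flip: powr_numeral)
  have "cmod (a - b) powr p + cmod (a + b) powr p \<le> ((cmod (a - b))\<^sup>2 + (cmod (a + b))\<^sup>2) powr q"
    using q by (simp add: sq powr_superadditive)
  also have "(cmod (a - b))\<^sup>2 + (cmod (a + b))\<^sup>2 = 4 * (((cmod a)\<^sup>2 + (cmod b)\<^sup>2) / 2)"
    unfolding cmod_power2 by (simp add: power2_eq_square algebra_simps)
  also have "\<dots> powr q = 4 powr q * (((cmod a)\<^sup>2 + (cmod b)\<^sup>2) / 2) powr q"
    by (subst powr_mult) auto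
  also have "\<dots> \<le> 4 powr q * (((cmod a)\<^sup>2 powr q + (cmod b)\<^sup>2 powr q) / 2)"
    using powr_midpoint[of "(cmod a)\<^sup>2" "(cmod b)\<^sup>2" q] q by (intro mult_left_mono) auto
  also have "4 powr q = 2 powr p"
    using sq[of 2] by simp
  also have "2 powr p * (((cmod a)\<^sup>2 powr q + (cmod b)\<^sup>2 powr q) / 2) = 2 powr (p - 1) * (cmod a powr p + cmod b powr p)"
    by (simp add: sq powr_diff)
  finally show ?thesis .
qed

text \<open>Bounded means without the extension by zero, since dilation destroys that
  extension.\<close>

definition hardy_bounded :: "real \<Rightarrow> real \<Rightarrow> (complex \<Rightarrow> complex) \<Rightarrow> bool" where
  "hardy_bounded p B f \<longleftrightarrow> f holomorphic_on unit_disc \<and> (\<forall>r. 0 < r \<longrightarrow> r < 1 \<longrightarrow> hardy_mean p f r \<le> B)"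

lemma hardy_bounded_scale:
  assumes "hardy_bounded p B f" "0 < r" "r < 1"
  shows "hardy_bounded p B (\<lambda>z. f (of_real r * z))"
proof -
  have "hardy_mean p f (r * R) \<le> B" if "0 < R" "R < 1" for R
    using that assms mult_strict_mono[of r 1 R 1] by (simp add: hardy_bounded_def)
  then show ?thesis
    using assms holomorphic_scale(2)[of f r] by (simp add: hardy_bounded_def hardy_mean_scale)
qed

lemma hardy_bounded_eval:
  assumes "hardy_bounded p B f" "1 \<le> p" "cmod z < 1"
  shows "cmod (f z) powr p \<le> (1 + cmod z) / (1 - cmod z) * B"
proof -
  have "disc_ext f \<in> hardy_space p" using assms by (intro hardy_space_disc_extI) (auto simp: hardy_bounded_def)
  then have "cmod (disc_ext f z) powr p \<le> (1 + cmod z) / (1 - cmod z) * hardy_sup p (disc_ext f)"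
    using assms by (intro hardy_eval)
  also have "\<dots> \<le> (1 + cmod z) / (1 - cmod z) * B"
    using assms by (intro mult_left_mono hardy_sup_le) (auto simp: hardy_bounded_def hardy_mean_disc_ext)
  finally show ?thesis using assms by simp
qed

lemma continuous_on_hardy_mean_dilate:
  assumes hol: "f holomorphic_on unit_disc" and R: "0 \<le> R" "R < 1" and p: "1 \<le> p"
  shows "continuous_on {0..1} (\<lambda>r. hardy_mean p (\<lambda>z. f z + c * f (of_real r * z)) R)"
proof -
  have lt: "cmod (of_real r * (of_real R * cis \<theta>)) < 1" if "0 \<le> r" "r \<le> 1" for r \<theta>
    using R that mult_left_le_one_le[of R r] by (simp add: norm_mult)
  have 1: "continuous_on ({0..1} \<times> {0..2*pi}) (\<lambda>x. f (of_real (fst x) * (of_real R * cis (snd x))))"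
    by (rule continuous_on_compose2[OF holomorphic_on_imp_continuous_on[OF hol]])
       (use lt in \<open>auto intro!: continuous_intros\<close>)
  have 2: "continuous_on ({0..1} \<times> {0..2*pi}) (\<lambda>x. f (of_real R * cis (snd x)))"
    by (rule continuous_on_compose2[OF continuous_on_circle_holomorphic[OF hol R, of UNIV]])
        (auto intro!: continuous_intros)
  have "continuous_on ({0..1} \<times> {0..2*pi})
     (\<lambda>(r,\<theta>). cmod (f (of_real R * cis \<theta>) + c * f (of_real r * (of_real R * cis \<theta>))) powr p)"
    unfolding case_prod_beta using p by (intro continuous_on_norm_powr continuous_intros 1 2) auto
  then show ?thesis
    unfolding hardy_mean_def
    by (intro integral_continuous_on_param[where 'b = real, unfolded cbox_interval])
qed

text \<open>Uniform convexity. At a radius \<open>R0\<close> the mean of \<open>f\<close> is within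
  \<eta> of its supremum S, and for r near 1 the mean of f + f (r z) at \<open>R0\<close> exceeds
  2^p (S - 2 \<eta>). Clarkson bounds the means of sum and difference together by 2^p S, so 2^p (2
  \<eta>) = \<epsilon> is left for the difference. Monotonicity of means carries the lower bound for
  the sum to larger radii and the upper bound for the difference to smaller ones.\<close>

lemma dilation_converges_ge2:
  assumes f: "hardy_bounded p B f" and p: "2 \<le> p" and \<epsilon>: "0 < \<epsilon>"
  shows "\<exists>r0<1. \<forall>r. r0 < r \<longrightarrow> 0 < r \<longrightarrow> r < 1 \<longrightarrow> hardy_bounded p \<epsilon> (\<lambda>z. f z - f (of_real r * z))"
proof -
  have hol: "f holomorphic_on unit_disc" using f by (simp add: hardy_bounded_def)
  have p1: "1 \<le> p" using p by simp
  define S where "S = (SUP r\<in>{0<..<1}. hardy_mean p f r)"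
  have bdd: "bdd_above (hardy_mean p f ` {0<..<1})"
    using f by (auto simp: hardy_bounded_def intro!: bdd_aboveI2[where M = B])
  have S: "hardy_mean p f r \<le> S" if "0 < r" "r < 1" for r
    unfolding S_def using that bdd by (intro cSUP_upper) auto
  define \<eta> where "\<eta> = \<epsilon> / (2 * 2 powr p)"
  have \<eta>: "0 < \<eta>" using \<epsilon> by (simp add: \<eta>_def)
  have "S - \<eta> < S" using \<eta> by simp
  then obtain R0 where R0: "0 < R0" "R0 < 1" "S - \<eta> < hardy_mean p f R0"
    unfolding S_def using less_cSUP_iff[OF _ bdd] by auto
  define I where "I = (\<lambda>r. hardy_mean p (\<lambda>z. f z + 1 * f (of_real r * z)) R0)"
  have "continuous_on {0..1} I"
    unfolding I_def using R0 p1 by (intro continuous_on_hardy_mean_dilate hol) auto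
  then have cI: "(I \<longlongrightarrow> I 1) (at 1 within {0..1})" by (simp add: continuous_on_def)
  have I1: "I 1 = 2 powr p * hardy_mean p f R0"
  proof -
    have "(\<lambda>z. f z + 1 * f (of_real 1 * z)) = (\<lambda>z. 2 * f z)" by auto
    then show ?thesis unfolding I_def by (simp only: hardy_mean_cmult) simp
  qed
  have "0 < 2 powr p * \<eta>" using \<eta> by simp
  from tendstoD[OF cI this] obtain d where d: "0 < d"
    and dI: "\<And>r. r \<in> {0..1} \<Longrightarrow> r \<noteq> 1 \<Longrightarrow> dist r 1 < d \<Longrightarrow> dist (I r) (I 1) < 2 powr p * \<eta>"
    unfolding eventually_at by blast
  have main: "hardy_mean p (\<lambda>z. f z - f (of_real r * z)) R \<le> \<epsilon>" if r: "1 - d < r" "0 < r" "r < 1" and R: "R0 \<le> R" "R < 1" for r R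
  proof -
    have fr: "(\<lambda>z. f (of_real r * z)) holomorphic_on unit_disc" using hol r by (intro holomorphic_scale) auto
    have R': "0 \<le> R" using R R0 by simp
    note int = hardy_mean_integrable[OF _ R' R(2) p1]
    have "hardy_mean p (\<lambda>z. f z - f (of_real r * z)) R + hardy_mean p (\<lambda>z. f z + 1 * f (of_real r * z)) R
      \<le> 2 powr (p - 1) * (hardy_mean p f R + hardy_mean p (\<lambda>z. f (of_real r * z)) R)"
    proof -
      define F where "F = (\<lambda>\<theta>. f (of_real R * cis \<theta>))"
      define G where "G = (\<lambda>\<theta>. f (of_real r * (of_real R * cis \<theta>)))"
      have i: "(\<lambda>\<theta>. cmod (F \<theta> - G \<theta>) powr p) integrable_on {0..2*pi}" "(\<lambda>\<theta>. cmod (F \<theta> + G \<theta>) powr p) integrable_on {0..2*pi}"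
        "(\<lambda>\<theta>. cmod (F \<theta>) powr p) integrable_on {0..2*pi}" "(\<lambda>\<theta>. cmod (G \<theta>) powr p) integrable_on {0..2*pi}"
        unfolding F_def G_def
        using int[OF hol] int[OF fr] int[OF holomorphic_on_diff[OF hol fr]] int[OF holomorphic_on_add[OF hol fr]]
        by (simp_all only:)
      have "integral {0..2*pi} (\<lambda>\<theta>. cmod (F \<theta> - G \<theta>) powr p + cmod (F \<theta> + G \<theta>) powr p)
        \<le> integral {0..2*pi} (\<lambda>\<theta>. 2 powr (p - 1) * (cmod (F \<theta>) powr p + cmod (G \<theta>) powr p))"
        using Clarkson[OF p] by (intro integral_le integrable_add integrable_on_mult_right i) auto
      then show ?thesis
        unfolding hardy_mean_def using integral_add[OF i(1,2)] integral_add[OF i(3,4)]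
        by (simp add: F_def G_def)
    qed
    also have "\<dots> \<le> 2 powr (p - 1) * (S + S)"
      using S[of R] S[of "r * R"] R R0 r mult_strict_mono[of r 1 R 1]
      by (intro mult_left_mono add_mono) (auto simp: hardy_mean_scale)
    also have "\<dots> = 2 powr p * S" by (simp add: powr_diff)
    finally have 1: "hardy_mean p (\<lambda>z. f z - f (of_real r * z)) R + hardy_mean p (\<lambda>z. f z + 1 * f (of_real r * z)) R \<le> 2 powr p * S" .
    have "I r \<le> hardy_mean p (\<lambda>z. f z + 1 * f (of_real r * z)) R"
      unfolding I_def using R0 R p1 by (intro hardy_mean_mono holomorphic_intros hol fr) auto
    moreover have "2 powr p * (S - \<eta>) - 2 powr p * \<eta> \<le> I r"
    proof -
      have "2 powr p * (S - \<eta>) \<le> I 1" unfolding I1 using R0(3) by (intro mult_left_mono) auto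
      moreover have "dist (I r) (I 1) < 2 powr p * \<eta>" using r by (intro dI) (auto simp: dist_real_def)
      ultimately show ?thesis by (simp add: dist_real_def abs_less_iff)
    qed
    ultimately have "hardy_mean p (\<lambda>z. f z - f (of_real r * z)) R \<le> 2 powr p * (2 * \<eta>)"
      using 1 by (simp add: algebra_simps)
    then show ?thesis by (simp add: \<eta>_def)
  qed
  show ?thesis
  proof (intro exI[of _ "1 - d"] conjI allI impI)
    show "1 - d < 1" using d by simp
    fix r assume r: "1 - d < r" "0 < r" "r < 1"
    have fr: "(\<lambda>z. f (of_real r * z)) holomorphic_on unit_disc" using hol r by (intro holomorphic_scale) auto
    have "hardy_mean p (\<lambda>z. f z - f (of_real r * z)) R \<le> \<epsilon>" if "0 < R" "R < 1" for R
    proof (cases "R0 \<le> R")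
      case True
      then show ?thesis using main r that by auto
    next
      case False
      then have "hardy_mean p (\<lambda>z. f z - f (of_real r * z)) R \<le> hardy_mean p (\<lambda>z. f z - f (of_real r * z)) R0"
        using R0 that p1 by (intro hardy_mean_mono holomorphic_intros hol fr) auto
      then show ?thesis using main[OF r, of R0] R0 by simp
    qed
    then show "hardy_bounded p \<epsilon> (\<lambda>z. f z - f (of_real r * z))"
      using hol fr by (simp add: hardy_bounded_def holomorphic_on_diff)
  qed
qed

text \<open>\<open>b\<close> is a finite Blaschke product. Each induction step removes one zero with
  its full multiplicity, replacing its linear factors by factors without zeros in the disc. Zeros on
  the unit circle remain in \<open>g\<close>.\<close>

lemma divide_out_zeros:
  assumes "f holomorphic_on ball 0 \<rho>" "1 < \<rho>" "finite {z \<in> unit_disc. f z = 0}"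
  shows "\<exists>b g. g holomorphic_on ball 0 \<rho> \<and> (\<forall>z\<in>unit_disc. g z \<noteq> 0) \<and> b holomorphic_on unit_disc \<and>
     (\<forall>z\<in>unit_disc. cmod (b z) \<le> 1 \<and> f z = b z * g z) \<and> (\<forall>z. cmod z = 1 \<longrightarrow> cmod (g z) = cmod (f z))"
  using assms
proof (induction "card {z \<in> unit_disc. f z = 0}" arbitrary: f)
  case 0
  then have "{z \<in> unit_disc. f z = 0} = {}" by (metis card_0_eq)
  then show ?case using 0 by (intro exI[of _ "\<lambda>_. 1"] exI[of _ f]) auto
next
  case (Suc n)
  obtain a where a: "cmod a < 1" "f a = 0"
  proof -
    have "{z \<in> unit_disc. f z = 0} \<noteq> {}" using Suc.hyps(2) by (metis card.empty nat.distinct(1))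
    then show ?thesis using that by auto
  qed
  have aS: "a \<in> ball 0 \<rho>" using a Suc.prems by simp
  have nc: "\<not> f constant_on ball 0 \<rho>"
  proof
    assume "f constant_on ball 0 \<rho>"
    then have "\<And>z. z \<in> ball 0 \<rho> \<Longrightarrow> f z = 0" using aS a(2) unfolding constant_on_def by metis
    then have "{z \<in> unit_disc. f z = 0} = unit_disc" using Suc.prems by auto
    moreover have "infinite unit_disc" by (intro uncountable_infinite uncountable_ball) simp
    ultimately show False using Suc.prems(3) by simp
  qed
  obtain h r m where m: "0 < (m::nat)" and r: "0 < r" "ball a r \<subseteq> ball 0 \<rho>" and h: "h holomorphic_on ball a r"
    "\<And>w. w \<in> ball a r \<Longrightarrow> f w = (w - a)^m * h w" "\<And>w. w \<in> ball a r \<Longrightarrow> h w \<noteq> 0"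
    using holomorphic_factor_zero_nonconstant[OF Suc.prems(1) _ _ aS a(2) nc] by (metis open_ball connected_ball)
  define q where "q = (\<lambda>z. if z \<in> ball a r then h z else f z / (z - a)^m)"
  have "q holomorphic_on (ball a r \<union> (ball 0 \<rho> - {a}))"
    unfolding q_def
    by (rule holomorphic_on_If_Un)
       (use h in \<open>auto intro!: holomorphic_intros holomorphic_on_subset[OF Suc.prems(1)]\<close>)
  moreover have "ball a r \<union> (ball 0 \<rho> - {a}) = ball 0 \<rho>" using r by auto
  ultimately have qh: "q holomorphic_on ball 0 \<rho>" by simp
  have qf: "f z = (z - a)^m * q z" for z using h(2) m r(1) a by (cases "z = a") (auto simp: q_def)
  have qa: "q a \<noteq> 0" using h(3)[of a] r by (simp add: q_def)
  \<comment> \<open>On the unit circle |1 - cnj a z| = |z - a|, so \<open>F\<close> and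
    \<open>f\<close> have the same modulus there.\<close>
  define F where "F = (\<lambda>z. q z * (1 - cnj a * z)^m)"
  have nz: "1 - cnj a * z \<noteq> 0" if "cmod z < 1" for z using cnj_mult_neq_1[OF that a(1)] .
  have Z: "{z \<in> unit_disc. F z = 0} = {z \<in> unit_disc. f z = 0} - {a}"
    using qa nz by (auto simp: F_def qf)
  have "n = card {z \<in> unit_disc. F z = 0}"
    unfolding Z using Suc.hyps(2) Suc.prems(3) a by (subst card_Diff_singleton) auto
  moreover have "F holomorphic_on ball 0 \<rho>" unfolding F_def by (intro holomorphic_intros qh)
  moreover have "finite {z \<in> unit_disc. F z = 0}" unfolding Z using Suc.prems by simp
  ultimately obtain b g where g: "g holomorphic_on ball 0 \<rho>" "\<And>z. z \<in> unit_disc \<Longrightarrow> g z \<noteq> 0"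
    and b: "b holomorphic_on unit_disc" "\<And>z. z \<in> unit_disc \<Longrightarrow> cmod (b z) \<le> 1"
    and bg: "\<And>z. z \<in> unit_disc \<Longrightarrow> F z = b z * g z" and gF: "\<And>z. cmod z = 1 \<Longrightarrow> cmod (g z) = cmod (F z)"
    using Suc.hyps(1)[of F] Suc.prems(2) by blast
  define b' where "b' = (\<lambda>z. ((z - a) / (1 - cnj a * z))^m * b z)"
  have b'h: "b' holomorphic_on unit_disc" unfolding b'_def using nz by (intro holomorphic_intros b) auto
  have fb: "f z = b' z * g z" if z: "z \<in> unit_disc" for z
    using bg[OF z] nz[of z] z by (simp add: b'_def qf F_def power_divide field_simps)
  have b'1: "cmod (b' z) \<le> 1" if z: "z \<in> unit_disc" for z
  proof -
    have "0 \<le> (1 - (cmod z)\<^sup>2) * (1 - (cmod a)\<^sup>2)"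
      using z a by (intro mult_nonneg_nonneg) (auto simp: abs_square_le_1)
    then have "(cmod (z - a))\<^sup>2 \<le> (cmod (1 - cnj a * z))\<^sup>2" using cmod_one_minus_diff[of a z] by linarith
    then have "cmod (z - a) \<le> cmod (1 - cnj a * z)" using power2_le_imp_le norm_ge_zero by blast
    then have "cmod ((z - a) / (1 - cnj a * z)) \<le> 1" using nz[of z] z by (simp add: norm_divide)
    then have "cmod ((z - a) / (1 - cnj a * z)) ^ m * cmod (b z) \<le> 1" using b(2)[OF z]
      by (intro mult_le_one power_le_one) auto
    then show ?thesis by (simp only: b'_def norm_mult norm_power)
  qed
  have gf: "cmod (g z) = cmod (f z)" if z: "cmod z = 1" for z
  proof -
    have "(cmod (1 - cnj a * z))\<^sup>2 = (cmod (z - a))\<^sup>2" using cmod_one_minus_diff[of a z] z by simp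
    then have "cmod (1 - cnj a * z) = cmod (z - a)" by simp
    then show ?thesis by (simp add: gF[OF z] F_def qf norm_mult norm_power)
  qed
  show ?case
    by (rule exI[of _ b'], rule exI[of _ g]) (use g b'h fb b'1 gf in blast)
qed

lemma zero_free_square_root:
  assumes "g holomorphic_on unit_disc" "\<And>z. cmod z < 1 \<Longrightarrow> g z \<noteq> 0"
  obtains v where "v holomorphic_on unit_disc" "\<And>z. cmod z < 1 \<Longrightarrow> g z = (v z)\<^sup>2"
proof -
  have "simply_connected unit_disc" by (intro convex_imp_simply_connected convex_ball)
  then have "\<forall>f. f holomorphic_on unit_disc \<and> (\<forall>z \<in> unit_disc. f z \<noteq> 0)
     \<longrightarrow> (\<exists>g. g holomorphic_on unit_disc \<and> (\<forall>z \<in> unit_disc. f z = (g z)\<^sup>2))"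
    using simply_connected_eq_holomorphic_sqrt[OF open_ball] by blast
  then show ?thesis using assms that by (metis mem_ball_0)
qed

text \<open>The dilated function extends beyond the closed disc, so it has finitely many zeros in it
  unless it is constant. Once they are divided out, \<open>g\<close> has a square root
  \<open>v\<close>, and b v and v are the two factors. The 2p-means of \<open>v\<close> are p-means
  of \<open>g\<close>, hence at most the mean of \<open>g\<close> over the unit circle, where |g| is
  the modulus of the dilated function.\<close>

lemma hardy_factor_dilation:
  assumes f: "hardy_bounded p B f" and p: "1 \<le> p" and ne: "cmod z0 < 1" "f z0 \<noteq> 0" and R: "0 < R" "R < 1"
  obtains u v where "hardy_bounded (2 * p) B u" "hardy_bounded (2 * p) B v"
    "\<And>z. cmod z < 1 \<Longrightarrow> f (of_real R * z) = u z * v z"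
proof -
  have hol: "f holomorphic_on unit_disc" using f by (simp add: hardy_bounded_def)
  define F where "F = (\<lambda>z. f (of_real R * z))"
  define \<rho> where "\<rho> = 1 / R"
  have \<rho>: "1 < \<rho>" using R by (simp add: \<rho>_def)
  have "(f \<circ> (\<lambda>z. of_real R * z)) holomorphic_on ball 0 \<rho>"
    by (rule holomorphic_on_compose_gen[OF _ hol])
       (use R in \<open>auto intro!: holomorphic_intros simp: \<rho>_def norm_mult field_simps\<close>)
  then have Fh: "F holomorphic_on ball 0 \<rho>" by (simp add: F_def o_def)
  have fin: "finite {z \<in> unit_disc. F z = 0}"
  proof (cases "F constant_on ball 0 \<rho>")
    case True
    then obtain c where c: "\<And>z. z \<in> ball 0 \<rho> \<Longrightarrow> F z = c" unfolding constant_on_def by blast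
    have "z0 / of_real R \<in> ball 0 \<rho>" using ne R by (simp add: \<rho>_def norm_divide divide_strict_right_mono)
    then have "c = f z0" using c[of "z0 / of_real R"] R by (simp add: F_def)
    then have "{z \<in> unit_disc. F z = 0} = {}" using c \<rho> ne by force
    then show ?thesis by (metis finite.emptyI)
  next
    case False
    have "finite {z \<in> cball 0 1. F z = 0}"
      using False \<rho> by (intro holomorphic_compact_finite_zeros[OF Fh]) auto
    then show ?thesis by (rule finite_subset[rotated]) auto
  qed
  obtain b g where g: "g holomorphic_on ball 0 \<rho>" "\<And>z. z \<in> unit_disc \<Longrightarrow> g z \<noteq> 0"
    and b: "b holomorphic_on unit_disc" "\<And>z. z \<in> unit_disc \<Longrightarrow> cmod (b z) \<le> 1"
    and bg: "\<And>z. z \<in> unit_disc \<Longrightarrow> F z = b z * g z" and gF: "\<And>z. cmod z = 1 \<Longrightarrow> cmod (g z) = cmod (F z)"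
    using divide_out_zeros[OF Fh \<rho> fin] by blast
  have g1: "g holomorphic_on unit_disc" using \<rho> by (intro holomorphic_on_subset[OF g(1)]) auto
  have gc: "continuous_on (cball 0 1) g"
    using \<rho> by (intro continuous_on_subset[OF holomorphic_on_imp_continuous_on[OF g(1)]]) auto
  obtain v where v: "v holomorphic_on unit_disc" "\<And>z. cmod z < 1 \<Longrightarrow> g z = (v z)\<^sup>2"
    using zero_free_square_root[OF g1] g(2) by auto
  have vb: "hardy_mean (2 * p) v r \<le> B" if r: "0 < r" "r < 1" for r
  proof -
    have "hardy_mean (2 * p) v r = hardy_mean p g r"
      unfolding hardy_mean_def
    proof (rule integral_cong)
      fix \<theta>
      let ?z = "of_real r * cis \<theta>"
      have eq: "cmod (g ?z) = cmod (v ?z) powr 2"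
        using v(2)[of ?z] r by (simp add: norm_mult norm_power)
      show "cmod (v ?z) powr (2 * p) = cmod (g ?z) powr p" unfolding eq by (simp only: powr_powr)
    qed
    also have "\<dots> \<le> hardy_mean p g 1"
      using Littlewood_subordination_closed[OF gc g1, of "\<lambda>z. z" r p] r p by auto
    also have "\<dots> = hardy_mean p F 1" unfolding hardy_mean_def by (intro integral_cong) (simp add: gF)
    also have "\<dots> = hardy_mean p f R" by (simp add: F_def hardy_mean_scale)
    also have "\<dots> \<le> B" using f R by (simp add: hardy_bounded_def)
    finally show ?thesis .
  qed
  have ub: "hardy_mean (2 * p) (\<lambda>z. b z * v z) r \<le> B" if r: "0 < r" "r < 1" for r
  proof -
    have "hardy_mean (2 * p) (\<lambda>z. b z * v z) r \<le> 1 powr (2 * p) * hardy_mean (2 * p) v r"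
      using r p b by (intro hardy_mean_mult_le v b) auto
    then show ?thesis using vb[OF r] by simp
  qed
  show ?thesis
  proof (rule that[of "\<lambda>z. b z * v z" v])
    show "hardy_bounded (2 * p) B v" using v vb by (simp add: hardy_bounded_def)
    show "hardy_bounded (2 * p) B (\<lambda>z. b z * v z)" using v b ub by (simp add: hardy_bounded_def holomorphic_on_mult)
    fix z :: complex assume "cmod z < 1"
    then show "f (of_real R * z) = b z * v z * v z"
      using bg[of z] v(2)[of z] by (simp add: F_def power2_eq_square)
  qed
qed

lemma Montel_disc:
  fixes F :: "nat \<Rightarrow> complex \<Rightarrow> complex"
  assumes "\<And>n. F n holomorphic_on unit_disc" and "continuous_on unit_disc b"
    and "\<And>n z. cmod z < 1 \<Longrightarrow> cmod (F n z) \<le> b z"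
  obtains g k where "g holomorphic_on unit_disc" "strict_mono (k :: nat \<Rightarrow> nat)"
    "\<And>z. cmod z < 1 \<Longrightarrow> (\<lambda>n. F (k n) z) \<longlonglongrightarrow> g z"
    "\<And>K. compact K \<Longrightarrow> K \<subseteq> unit_disc \<Longrightarrow> uniform_limit K (F \<circ> k) g sequentially"
proof -
  have bounded: "\<exists>B. \<forall>h\<in>range F. \<forall>z\<in>C. cmod (h z) \<le> B" if C: "compact C" "C \<subseteq> unit_disc" for C
  proof -
    have "compact (b ` C)"
      using C assms(2) by (intro compact_continuous_image) (auto intro: continuous_on_subset)
    then have "bounded (b ` C)" by (rule compact_imp_bounded)
    then obtain B where B: "\<And>z. z \<in> C \<Longrightarrow> norm (b z) \<le> B" unfolding bounded_iff by auto
    show ?thesis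
    proof (intro exI[of _ B] ballI)
      fix f z assume "f \<in> range F" "z \<in> C"
      then obtain n where "f = F n" "cmod z < 1" using C(2) by auto
      then show "cmod (f z) \<le> B" using assms(3)[of z n] B[OF \<open>z \<in> C\<close>] by simp
    qed
  qed
  obtain g k where *: "g holomorphic_on unit_disc" "strict_mono (k :: nat \<Rightarrow> nat)"
    "\<And>z. z \<in> unit_disc \<Longrightarrow> (\<lambda>n. F (k n) z) \<longlonglongrightarrow> g z"
    "\<And>K. compact K \<Longrightarrow> K \<subseteq> unit_disc \<Longrightarrow> uniform_limit K (F \<circ> k) g sequentially"
    by (rule Montel[OF open_ball, of "range F" 0 1 F]) (use assms(1) bounded in auto)
  show ?thesis by (rule that[OF *(1,2) _ *(4)]) (use *(3) in auto)
qed

text \<open>Dominated convergence on each circle; the constant majorant is the bound for point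
  evaluations.\<close>

lemma hardy_bounded_limit:
  assumes F: "\<And>n. hardy_bounded p B (F n)" and p: "1 \<le> p" and hol: "g holomorphic_on unit_disc"
    and lim: "\<And>z. cmod z < 1 \<Longrightarrow> (\<lambda>n. F n z) \<longlonglongrightarrow> g z"
  shows "hardy_bounded p B g"
proof -
  have "hardy_mean p g r \<le> B" if r: "0 < r" "r < 1" for r
  proof -
    have lt: "cmod (of_real r * cis \<theta>) < 1" for \<theta> using r by (simp add: norm_mult)
    have "(\<lambda>n. hardy_mean p (F n) r) \<longlonglongrightarrow> hardy_mean p g r"
      unfolding hardy_mean_def
    proof (rule dominated_convergence(2))
      show "(\<lambda>\<theta>. cmod (F n (of_real r * cis \<theta>)) powr p) integrable_on {0..2*pi}" for n
        using F[of n] r p by (intro hardy_mean_integrable) (auto simp: hardy_bounded_def)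
      show "(\<lambda>\<theta>. (1 + r) / (1 - r) * B) integrable_on {0..2*pi}"
        by (intro integrable_continuous_real continuous_on_const)
      show "norm (cmod (F n (of_real r * cis \<theta>)) powr p) \<le> (1 + r) / (1 - r) * B" for n \<theta>
        using hardy_bounded_eval[OF F[of n] p lt] r by (simp add: norm_mult)
      show "(\<lambda>n. cmod (F n (of_real r * cis \<theta>)) powr p) \<longlonglongrightarrow> cmod (g (of_real r * cis \<theta>)) powr p" for \<theta>
        using p by (intro tendsto_powr' tendsto_intros lim lt) auto
    qed
    then show ?thesis using F r by (intro LIMSEQ_le_const2) (auto simp: hardy_bounded_def)
  qed
  then show ?thesis using hol by (simp add: hardy_bounded_def)
qed

text \<open>The Riesz factorization, obtained as a limit of factorizations of dilations. The bound
  \<open>B\<close> does not depend on the dilation, so both sequences of factors are normal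
  families.\<close>

lemma hardy_factor:
  assumes f: "hardy_bounded p B f" and p: "1 \<le> p"
  obtains u v where "hardy_bounded (2 * p) B u" "hardy_bounded (2 * p) B v"
    "\<And>z. cmod z < 1 \<Longrightarrow> f z = u z * v z"
proof (cases "\<exists>z. cmod z < 1 \<and> f z \<noteq> 0")
  case False
  have "hardy_mean p f (1/2) \<le> B" using f by (simp add: hardy_bounded_def)
  then have "0 \<le> B" using hardy_mean_nonneg[of p f "1/2"] by simp
  then have "hardy_bounded (2 * p) B (\<lambda>_. 0)" by (simp add: hardy_bounded_def hardy_mean_def)
  then show ?thesis using False by (intro that[of "\<lambda>_. 0" "\<lambda>_. 0"]) auto
next
  case True
  then obtain z0 where z0: "cmod z0 < 1" "f z0 \<noteq> 0" by blast
  have hol: "f holomorphic_on unit_disc" using f by (simp add: hardy_bounded_def)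
  define R where "R = (\<lambda>n::nat. 1 - 1 / (real n + 2))"
  have R: "0 < R n" "R n < 1" for n by (auto simp: R_def)
  have "\<exists>u v. hardy_bounded (2 * p) B u \<and> hardy_bounded (2 * p) B v \<and>
    (\<forall>z. cmod z < 1 \<longrightarrow> f (of_real (R n) * z) = u z * v z)" for n
    using hardy_factor_dilation[OF f p z0 R[of n]] by metis
  then obtain u v where u: "\<And>n. hardy_bounded (2 * p) B (u n)" and v: "\<And>n. hardy_bounded (2 * p) B (v n)"
    and uv: "\<And>n z. cmod z < 1 \<Longrightarrow> f (of_real (R n) * z) = u n z * v n z"
    by metis
  \<comment> \<open>Point evaluation controls the power 2 p of the modulus; t \<le> 1 + t^(2p) turns
    this into a bound for the modulus itself.\<close>
  define b where "b = (\<lambda>z::complex. 1 + (1 + cmod z) / (1 - cmod z) * B)"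
  have bc: "continuous_on unit_disc b" unfolding b_def by (intro continuous_intros) auto
  have bound: "cmod (w z) \<le> b z" if "hardy_bounded (2 * p) B w" "cmod z < 1" for w z
  proof -
    have "cmod (w z) \<le> 1 + cmod (w z) powr (2 * p)"
    proof (cases "cmod (w z) \<le> 1")
      case False
      then have "cmod (w z) powr 1 \<le> cmod (w z) powr (2 * p)" using p by (intro powr_mono) auto
      then show ?thesis using False by simp
    qed (simp add: add_increasing2)
    then show ?thesis using hardy_bounded_eval[OF that(1) _ that(2)] p by (simp add: b_def)
  qed
  obtain U k where U: "U holomorphic_on unit_disc" and k: "strict_mono (k :: nat \<Rightarrow> nat)"
    and Ul: "\<And>z. cmod z < 1 \<Longrightarrow> (\<lambda>n. u (k n) z) \<longlonglongrightarrow> U z"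
    by (rule Montel_disc[OF _ bc, of u]) (use u bound[OF u] in \<open>auto simp: hardy_bounded_def\<close>)
  obtain V l where V: "V holomorphic_on unit_disc" and l: "strict_mono (l :: nat \<Rightarrow> nat)"
    and Vl: "\<And>z. cmod z < 1 \<Longrightarrow> (\<lambda>n. v (k (l n)) z) \<longlonglongrightarrow> V z"
    by (rule Montel_disc[OF _ bc, of "\<lambda>n. v (k n)"]) (use v bound[OF v] in \<open>auto simp: hardy_bounded_def\<close>)
  have Ul': "(\<lambda>n. u (k (l n)) z) \<longlonglongrightarrow> U z" if "cmod z < 1" for z
    using LIMSEQ_subseq_LIMSEQ[OF Ul[OF that] l] by (simp add: o_def)
  show ?thesis
  proof (rule that[of U V])
    show "hardy_bounded (2 * p) B U" using p by (intro hardy_bounded_limit[OF u _ U Ul']) auto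
    show "hardy_bounded (2 * p) B V" using p by (intro hardy_bounded_limit[OF v _ V Vl]) auto
    fix z :: complex assume z: "cmod z < 1"
    have "R \<longlonglongrightarrow> 1" unfolding R_def by real_asymp
    then have "(\<lambda>n. R (k (l n))) \<longlonglongrightarrow> 1"
      using LIMSEQ_subseq_LIMSEQ[OF _ strict_mono_o[OF k l], of R 1] by (simp add: o_def)
    then have "(\<lambda>n. of_real (R (k (l n))) * z) \<longlonglongrightarrow> of_real 1 * z" by (intro tendsto_intros)
    moreover have "isCont f z"
      using holomorphic_on_imp_continuous_on[OF hol] z by (simp add: continuous_on_eq_continuous_at)
    ultimately have "(\<lambda>n. f (of_real (R (k (l n))) * z)) \<longlonglongrightarrow> f z"
      by (intro isCont_tendsto_compose[of z f]) auto
    moreover have "(\<lambda>n. u (k (l n)) z * v (k (l n)) z) \<longlonglongrightarrow> U z * V z"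
      by (intro tendsto_mult Ul' Vl z)
    ultimately show "f z = U z * V z" using uv[OF z] LIMSEQ_unique by auto
  qed
qed

text \<open>A weighted inequality between arithmetic and geometric means, used instead of
  Cauchy-Schwarz; the weight \<open>\<kappa>\<close> lets a small first factor absorb a merely
  bounded second one.\<close>

lemma hardy_mean_product_le:
  assumes "a holomorphic_on unit_disc" "b holomorphic_on unit_disc" "1 \<le> p" "0 \<le> r" "r < 1" "0 < \<kappa>"
  shows "hardy_mean p (\<lambda>z. a z * b z) r \<le> \<kappa> * hardy_mean (2 * p) a r + (1 / \<kappa>) * hardy_mean (2 * p) b r"
proof -
  note int = hardy_mean_integrable[OF _ assms(4,5)]
  have "hardy_mean p (\<lambda>z. a z * b z) r \<le> integral {0..2*pi} (\<lambda>\<theta>. \<kappa> * cmod (a (of_real r * cis \<theta>)) powr (2 * p)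
      + (1 / \<kappa>) * cmod (b (of_real r * cis \<theta>)) powr (2 * p))"
    unfolding hardy_mean_def
  proof (rule integral_le)
    show "(\<lambda>\<theta>. cmod (a (of_real r * cis \<theta>) * b (of_real r * cis \<theta>)) powr p) integrable_on {0..2*pi}"
      using int[of "\<lambda>z. a z * b z" p] assms by (simp add: holomorphic_on_mult)
    show "(\<lambda>\<theta>. \<kappa> * cmod (a (of_real r * cis \<theta>)) powr (2 * p)
      + (1 / \<kappa>) * cmod (b (of_real r * cis \<theta>)) powr (2 * p)) integrable_on {0..2*pi}"
      using assms by (intro integrable_add integrable_on_mult_right int) auto
    fix \<theta>
    define x y where "x = cmod (a (of_real r * cis \<theta>)) powr p" and "y = cmod (b (of_real r * cis \<theta>)) powr p"
    have sq: "t powr (2 * p) = (t powr p)\<^sup>2" for t :: real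
      by (simp only: powr_add mult_2 power2_eq_square)
    have "0 \<le> (\<kappa> * x - y)\<^sup>2" "0 \<le> \<kappa> * x * y" using assms by (auto simp: x_def y_def)
    then have "\<kappa> * (x * y) \<le> \<kappa> * (\<kappa> * x\<^sup>2) + y\<^sup>2" by (simp add: power2_eq_square algebra_simps)
    then have "x * y \<le> \<kappa> * x\<^sup>2 + (1 / \<kappa>) * y\<^sup>2" using assms(6) by (simp add: field_simps power2_eq_square)
    then show "cmod (a (of_real r * cis \<theta>) * b (of_real r * cis \<theta>)) powr p \<le> \<kappa> * cmod (a (of_real r * cis \<theta>)) powr (2 * p)
      + (1 / \<kappa>) * cmod (b (of_real r * cis \<theta>)) powr (2 * p)"
      by (simp add: norm_mult powr_mult sq x_def y_def)
  qed
  also have "\<dots> = \<kappa> * hardy_mean (2 * p) a r + (1 / \<kappa>) * hardy_mean (2 * p) b r"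
    unfolding hardy_mean_def
    using int[OF assms(1), of "2 * p"] int[OF assms(2), of "2 * p"] assms
    by (subst integral_add) (auto intro!: integrable_on_mult_right simp del: times_divide_eq_left)
  finally show ?thesis .
qed

text \<open>With f = u v and subscripts for dilation, f - f_r = (u - u_r) v + (v - v_r) u_r. The
  factors lie in H^(2p) with 2 p \<ge> 2, where the differences are known to be small.\<close>

lemma dilation_converges:
  assumes f: "hardy_bounded p B f" and p: "1 \<le> p" and \<epsilon>: "0 < \<epsilon>"
  obtains r where "0 < r" "r < 1" "hardy_bounded p \<epsilon> (\<lambda>z. f z - f (of_real r * z))"
proof -
  obtain u v where u: "hardy_bounded (2 * p) B u" and v: "hardy_bounded (2 * p) B v"
    and uv: "\<And>z. cmod z < 1 \<Longrightarrow> f z = u z * v z"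
    using hardy_factor[OF f p] by metis
  have hol: "f holomorphic_on unit_disc" "u holomorphic_on unit_disc" "v holomorphic_on unit_disc"
    using f u v by (auto simp: hardy_bounded_def)
  have "hardy_mean p f (1/2) \<le> B" using f by (simp add: hardy_bounded_def)
  then have B: "0 \<le> B" using hardy_mean_nonneg[of p f "1/2"] by simp
  define C where "C = 2 powr p"
  have C: "0 < C" by (simp add: C_def)
  \<comment> \<open>The total error is 2 C \<kappa> \<eta> + 2 C B / \<kappa>. This
    \<open>\<kappa>\<close> makes the second term at most \<epsilon> / 2, and then
    \<open>\<eta>\<close> makes the first equal to \<epsilon> / 2.\<close>
  define \<kappa> where "\<kappa> = 4 * C * (B + 1) / \<epsilon>"
  have \<kappa>: "0 < \<kappa>" using \<epsilon> B C by (simp add: \<kappa>_def)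
  define \<eta> where "\<eta> = \<epsilon> / (4 * C * \<kappa>)"
  have \<eta>: "0 < \<eta>" using \<epsilon> \<kappa> C by (simp add: \<eta>_def)
  obtain ru where ru: "ru < 1" "\<And>r. ru < r \<Longrightarrow> 0 < r \<Longrightarrow> r < 1 \<Longrightarrow> hardy_bounded (2 * p) \<eta> (\<lambda>z. u z - u (of_real r * z))"
    using dilation_converges_ge2[OF u _ \<eta>] p by auto
  obtain rv where rv: "rv < 1" "\<And>r. rv < r \<Longrightarrow> 0 < r \<Longrightarrow> r < 1 \<Longrightarrow> hardy_bounded (2 * p) \<eta> (\<lambda>z. v z - v (of_real r * z))"
    using dilation_converges_ge2[OF v _ \<eta>] p by auto
  define r where "r = (1 + max 0 (max ru rv)) / 2"
  have r: "0 < r" "r < 1" "ru < r" "rv < r" using ru(1) rv(1) by (auto simp: r_def max_def)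
  have du: "hardy_bounded (2 * p) \<eta> (\<lambda>z. u z - u (of_real r * z))" using ru r by auto
  have dv: "hardy_bounded (2 * p) \<eta> (\<lambda>z. v z - v (of_real r * z))" using rv r by auto
  have ur: "hardy_bounded (2 * p) B (\<lambda>z. u (of_real r * z))" using hardy_bounded_scale[OF u r(1,2)] .
  have "hardy_mean p (\<lambda>z. f z - f (of_real r * z)) R \<le> \<epsilon>" if R: "0 < R" "R < 1" for R
  proof -
    have "hardy_mean p (\<lambda>z. f z - f (of_real r * z)) R
      = hardy_mean p (\<lambda>z. (u z - u (of_real r * z)) * v z + (v z - v (of_real r * z)) * u (of_real r * z)) R"
    proof (rule hardy_mean_cong)
      fix z :: complex assume "cmod z = R"
      then have "cmod z < 1" "cmod (of_real r * z) < 1" using R r mult_strict_mono[of r 1 R 1] by (auto simp: norm_mult)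
      then show "f z - f (of_real r * z) = (u z - u (of_real r * z)) * v z + (v z - v (of_real r * z)) * u (of_real r * z)"
        by (simp add: uv algebra_simps)
    qed (use R in auto)
    also have "\<dots> \<le> C * (hardy_mean p (\<lambda>z. (u z - u (of_real r * z)) * v z) R
       + hardy_mean p (\<lambda>z. (v z - v (of_real r * z)) * u (of_real r * z)) R)"
      unfolding C_def using R p du dv ur v
      by (intro hardy_mean_add_le holomorphic_on_mult) (auto simp: hardy_bounded_def)
    also have "\<dots> \<le> C * ((\<kappa> * \<eta> + (1 / \<kappa>) * B) + (\<kappa> * \<eta> + (1 / \<kappa>) * B))"
    proof -
      have *: "hardy_mean p (\<lambda>z. a z * b z) R \<le> \<kappa> * \<eta> + (1 / \<kappa>) * B"
        if "hardy_bounded (2 * p) \<eta> a" "hardy_bounded (2 * p) B b" for a b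
      proof -
        have "hardy_mean p (\<lambda>z. a z * b z) R \<le> \<kappa> * hardy_mean (2 * p) a R + (1 / \<kappa>) * hardy_mean (2 * p) b R"
          using that R p \<kappa> by (intro hardy_mean_product_le) (auto simp: hardy_bounded_def)
        also have "\<dots> \<le> \<kappa> * \<eta> + (1 / \<kappa>) * B"
          using that R \<kappa> by (intro add_mono mult_left_mono) (auto simp: hardy_bounded_def)
        finally show ?thesis .
      qed
      show ?thesis using C by (intro mult_left_mono add_mono * du dv v ur) auto
    qed
    also have "\<dots> = \<epsilon> / 2 + 2 * C * B / \<kappa>" using \<kappa> C by (simp add: \<eta>_def field_simps)
    also have "\<dots> \<le> \<epsilon>"
    proof -
      have "B + 1 \<noteq> 0" using B by simp
      then have "2 * C * B / \<kappa> = \<epsilon> / 2 * (B / (B + 1))" using C \<epsilon> by (simp add: \<kappa>_def divide_simps)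
      also have "\<dots> \<le> \<epsilon> / 2 * 1" using B \<epsilon> by (intro mult_left_mono) auto
      finally show ?thesis by simp
    qed
    finally show ?thesis .
  qed
  moreover have "(\<lambda>z. f z - f (of_real r * z)) holomorphic_on unit_disc"
    using hol r by (intro holomorphic_on_diff holomorphic_scale) auto
  ultimately show ?thesis using r by (intro that[of r]) (auto simp: hardy_bounded_def)
qed

section \<open>The closed span of the exponentials\<close>

definition closed_subspace :: "real \<Rightarrow> (complex \<Rightarrow> complex) set \<Rightarrow> bool" where
  "closed_subspace p Y \<longleftrightarrow> Y \<subseteq> hardy_space p \<and>
     (\<forall>f\<in>Y. \<forall>g\<in>Y. (\<lambda>z. f z + g z) \<in> Y) \<and> (\<forall>c. \<forall>f\<in>Y. (\<lambda>z. c * f z) \<in> Y) \<and>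
     (\<forall>f\<in>hardy_space p. (\<forall>\<epsilon>>0. \<exists>g\<in>Y. hardy_sup p (\<lambda>z. f z - g z) \<le> \<epsilon>) \<longrightarrow> f \<in> Y)"

lemma closed_subspaceD:
  assumes "closed_subspace p Y"
  shows "f \<in> Y \<Longrightarrow> f \<in> hardy_space p"
    and "f \<in> Y \<Longrightarrow> g \<in> Y \<Longrightarrow> (\<lambda>z. f z + g z) \<in> Y"
    and "f \<in> Y \<Longrightarrow> (\<lambda>z. c * f z) \<in> Y"
    and "f \<in> hardy_space p \<Longrightarrow> (\<And>\<epsilon>. 0 < \<epsilon> \<Longrightarrow> \<exists>g\<in>Y. hardy_sup p (\<lambda>z. f z - g z) \<le> \<epsilon>) \<Longrightarrow> f \<in> Y"
  using assms unfolding closed_subspace_def by auto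

text \<open>The tool for passing from generators to a closed span: if a bounded operator maps the
  generators into a closed subspace, then it maps the whole closed span into it.\<close>

lemma closed_subspace_vimage:
  assumes p: "1 \<le> p" and Y: "closed_subspace p Y" and A: "A \<in> bounded_operators (hardy_space p) (hardy_norm p)"
  shows "closed_subspace p {f \<in> hardy_space p. A f \<in> Y}"
  unfolding closed_subspace_def
proof (intro conjI ballI allI impI)
  note D = closed_subspaceD[OF Y]
  fix f g c assume f: "f \<in> {f \<in> hardy_space p. A f \<in> Y}" and g: "g \<in> {f \<in> hardy_space p. A f \<in> Y}"
  show "(\<lambda>z. f z + g z) \<in> {f \<in> hardy_space p. A f \<in> Y}"
    using f g D p by (auto simp: bounded_operator_add[OF A] hardy_space_add)
next
  note D = closed_subspaceD[OF Y]
  fix f c assume f: "f \<in> {f \<in> hardy_space p. A f \<in> Y}"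
  show "(\<lambda>z. c * f z) \<in> {f \<in> hardy_space p. A f \<in> Y}"
    using f D p by (auto simp: bounded_operator_cmult[OF A] hardy_space_cmult)
next
  note D = closed_subspaceD[OF Y]
  fix f assume f: "f \<in> hardy_space p"
    and lim: "\<forall>\<epsilon>>0. \<exists>g\<in>{f \<in> hardy_space p. A f \<in> Y}. hardy_sup p (\<lambda>z. f z - g z) \<le> \<epsilon>"
  obtain K where K: "0 \<le> K" "\<And>f. f \<in> hardy_space p \<Longrightarrow> hardy_sup p (A f) \<le> K * hardy_sup p f"
    using bounded_operator_sup[OF p A] by metis
  have "\<exists>g\<in>Y. hardy_sup p (\<lambda>z. A f z - g z) \<le> \<epsilon>" if \<epsilon>: "0 < \<epsilon>" for \<epsilon>
  proof -
    have "0 < \<epsilon> / (K + 1)" using \<epsilon> K by simp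
    then obtain g where g: "g \<in> hardy_space p" "A g \<in> Y" and le: "hardy_sup p (\<lambda>z. f z - g z) \<le> \<epsilon> / (K + 1)"
      using lim by blast
    have mg: "(\<lambda>z. - 1 * g z) \<in> hardy_space p" by (rule hardy_space_cmult(1)[OF g(1) p])
    have "A (\<lambda>z. f z + - 1 * g z) = (\<lambda>z. A f z + - 1 * A g z)"
      by (simp only: bounded_operator_add[OF A f mg] bounded_operator_cmult[OF A g(1)])
    then have "hardy_sup p (\<lambda>z. A f z - A g z) \<le> K * hardy_sup p (\<lambda>z. f z - g z)"
      using K(2)[OF hardy_space_add(1)[OF f mg p]] by simp
    also have "\<dots> \<le> K * (\<epsilon> / (K + 1))" using le K by (intro mult_left_mono) auto
    also have "\<dots> \<le> \<epsilon>" using K \<epsilon> by (simp add: divide_le_eq algebra_simps)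
    finally show ?thesis using g by blast
  qed
  then have "A f \<in> Y" by (rule D(4)[OF bounded_operator_mem[OF A f]])
  then show "f \<in> {f \<in> hardy_space p. A f \<in> Y}" using f by simp
qed auto

text \<open>Defined as an intersection of closed subspaces, so that inclusions of the span follow
  from minimality without handling linear combinations.\<close>

definition closed_span :: "real \<Rightarrow> (complex \<Rightarrow> complex) set \<Rightarrow> (complex \<Rightarrow> complex) set" where
  "closed_span p E = {f \<in> hardy_space p. \<forall>Y. closed_subspace p Y \<and> E \<subseteq> Y \<longrightarrow> f \<in> Y}"

lemma closed_span_subset: "closed_subspace p Y \<Longrightarrow> E \<subseteq> Y \<Longrightarrow> closed_span p E \<subseteq> Y"
  by (auto simp: closed_span_def)

lemma closed_subspace_closed_span:
  assumes "1 \<le> p"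
  shows "closed_subspace p (closed_span p E)"
  unfolding closed_subspace_def
proof (intro conjI ballI allI impI)
  fix f g assume "f \<in> closed_span p E" "g \<in> closed_span p E"
  then show "(\<lambda>z. f z + g z) \<in> closed_span p E"
    using assms by (auto simp: closed_span_def hardy_space_add intro: closed_subspaceD)
next
  fix f c assume "f \<in> closed_span p E"
  then show "(\<lambda>z. c * f z) \<in> closed_span p E"
    using assms by (auto simp: closed_span_def hardy_space_cmult intro: closed_subspaceD)
next
  fix f assume f: "f \<in> hardy_space p" and *: "\<forall>\<epsilon>>0. \<exists>g\<in>closed_span p E. hardy_sup p (\<lambda>z. f z - g z) \<le> \<epsilon>"
  have "f \<in> Y" if Y: "closed_subspace p Y" "E \<subseteq> Y" for Y
    by (rule closed_subspaceD(4)[OF Y(1) f]) (use * closed_span_subset[OF Y] in blast)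
  then show "f \<in> closed_span p E" using f by (simp add: closed_span_def)
qed (auto simp: closed_span_def)

text \<open>What the density argument keeps of the semiflow: a univalent map whose image lies in a
  horizontal strip and is invariant under translations to the right.\<close>

locale strip_map =
  fixes p B :: real and h :: "complex \<Rightarrow> complex"
  assumes p: "1 \<le> p" and hol_h: "h holomorphic_on unit_disc" and inj_h: "inj_on h unit_disc"
    and Im_h: "\<And>z. cmod z < 1 \<Longrightarrow> \<bar>Im (h z)\<bar> \<le> B"
    and shift: "\<And>z t. cmod z < 1 \<Longrightarrow> 0 \<le> t \<Longrightarrow> h z + of_real t \<in> h ` unit_disc"
begin

lemma B_nonneg: "0 \<le> B"
  using Im_h[of 0] by simp

text \<open>For |c| B \<le> 1 the argument of exp (c h) is at most 1, so its modulus is at most its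
  real part divided by cos 1, and the real part has the mean value property.\<close>

lemma exp_strip_mean:
  assumes c: "\<bar>c\<bar> * B \<le> 1" and r: "0 \<le> r" "r < 1"
  shows "integral {0..2*pi} (\<lambda>\<theta>. cmod (exp (of_real c * h (of_real r * cis \<theta>)))) \<le> 2 * pi * Re (exp (of_real c * h 0)) / cos 1"
proof -
  have cos1: "0 < cos (1::real)" using cos_gt_zero_pi[of 1] pi_gt3 by simp
  have hol: "(\<lambda>z. exp (of_real c * h z)) holomorphic_on unit_disc" by (intro holomorphic_intros hol_h)
  have int: "((\<lambda>\<theta>. Re (exp (of_real c * h (of_real r * cis \<theta>)))) has_integral (2 * pi * Re (exp (of_real c * h 0)))) {0..2*pi}"
    using has_integral_Re[OF mean_value_circle[OF hol r]] by (simp del: times_divide_eq_right)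
  have cont: "continuous_on A (\<lambda>\<theta>. exp (of_real c * h (of_real r * cis \<theta>)))" for A
    by (rule continuous_on_circle_holomorphic[OF hol r])
  have "integral {0..2*pi} (\<lambda>\<theta>. cos 1 * cmod (exp (of_real c * h (of_real r * cis \<theta>)))) \<le> 2 * pi * Re (exp (of_real c * h 0))"
    unfolding integral_unique[OF int, symmetric]
  proof (rule integral_le)
    show "(\<lambda>\<theta>. cos 1 * cmod (exp (of_real c * h (of_real r * cis \<theta>)))) integrable_on {0..2*pi}"
      by (intro integrable_continuous_real continuous_intros cont)
    show "(\<lambda>\<theta>. Re (exp (of_real c * h (of_real r * cis \<theta>)))) integrable_on {0..2*pi}"
      using int by blast
    fix \<theta>
    define w where "w = h (of_real r * cis \<theta>)"
    have "\<bar>c * Im w\<bar> \<le> 1"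
    proof -
      have "\<bar>c\<bar> * \<bar>Im w\<bar> \<le> \<bar>c\<bar> * B" unfolding w_def using r by (intro mult_left_mono Im_h) (auto simp: norm_mult)
      then show ?thesis using c by (simp add: abs_mult)
    qed
    then have "cos 1 \<le> cos \<bar>c * Im w\<bar>" using pi_gt3 by (intro cos_monotone_0_pi_le) auto
    then have "cos 1 \<le> cos (c * Im w)" by (simp only: cos_abs_real)
    then have "exp (c * Re w) * cos 1 \<le> exp (c * Re w) * cos (c * Im w)" by (intro mult_left_mono) auto
    then show "cos 1 * cmod (exp (of_real c * h (of_real r * cis \<theta>))) \<le> Re (exp (of_real c * h (of_real r * cis \<theta>)))"
      by (simp add: w_def Re_exp mult.commute)
  qed
  then show ?thesis using cos1 by (simp add: field_simps)
qed

text \<open>The imaginary part of \<open>h\<close> is bounded, and a p-th power of its real part is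
  dominated by exponentials with rates c p and - c p. The choice of \<open>c\<close> makes c p B
  \<le> 1, as \<open>exp_strip_mean\<close> demands.\<close>

lemma hardy_mean_h_bounded: "\<exists>C. \<forall>r. 0 \<le> r \<longrightarrow> r < 1 \<longrightarrow> hardy_mean p h r \<le> C"
proof -
  define c where "c = 1 / (p * (B + 1))"
  have c: "0 < c" using p B_nonneg by (simp add: c_def)
  have "c * p = 1 / (B + 1)" using p by (simp add: c_def)
  then have cB: "\<bar>c * p\<bar> * B \<le> 1" using B_nonneg by simp
  define q where "q = (\<lambda>\<sigma> z. exp (of_real (\<sigma> * (c * p)) * h z))"
  define C where "C = (\<lambda>\<sigma>. 2 * pi * Re (exp (of_real (\<sigma> * (c * p)) * h 0)) / cos 1)"
  define D where "D = 2 powr p * ((1/c) powr p * (C 1 + C (-1)) + 2 * pi * B powr p)"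
  have ptw: "cmod (h z) powr p \<le> 2 powr p * ((1/c) powr p * (cmod (q 1 z) + cmod (q (-1) z)) + B powr p)" if z: "cmod z < 1" for z
  proof -
    define x where "x = \<bar>Re (h z)\<bar>"
    have "x powr p \<le> (1/c) powr p * (cmod (q 1 z) + cmod (q (-1) z))"
    proof -
      have "c * x \<le> exp (c * x)" using exp_ge_add_one_self[of "c * x"] by linarith
      then have "(c * x) powr p \<le> exp (c * x) powr p" using c p by (intro powr_mono2) (auto simp: x_def)
      also have "\<dots> = exp (c * p * x)" by (simp add: powr_def mult_ac)
      also have "\<dots> \<le> cmod (q 1 z) + cmod (q (-1) z)"
        by (cases "0 \<le> Re (h z)") (auto simp: q_def x_def)
      finally have "(1/c) powr p * (c * x) powr p \<le> (1/c) powr p * (cmod (q 1 z) + cmod (q (-1) z))"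
        by (intro mult_left_mono) auto
      moreover have "(1/c) powr p * (c * x) powr p = x powr p"
        using c by (subst powr_mult[symmetric]) (auto simp: x_def)
      ultimately show ?thesis by simp
    qed
    moreover have "cmod (h z) powr p \<le> (x + B) powr p"
      using cmod_le[of "h z"] Im_h[OF z] p by (intro powr_mono2) (auto simp: x_def)
    moreover have "(x + B) powr p \<le> 2 powr p * (x powr p + B powr p)"
      using B_nonneg p by (intro powr_add_le) (auto simp: x_def)
    moreover have "2 powr p * (x powr p + B powr p) \<le> 2 powr p * ((1/c) powr p * (cmod (q 1 z) + cmod (q (-1) z)) + B powr p)"
      using calculation(1) by (intro mult_left_mono) auto
    ultimately show ?thesis by linarith
  qed
  have "hardy_mean p h r \<le> D" if r: "0 \<le> r" "r < 1" for r
  proof -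
    have ci: "(\<lambda>\<theta>. cmod (q \<sigma> (of_real r * cis \<theta>))) integrable_on {0..2*pi}" for \<sigma>
      unfolding q_def
      by (intro integrable_continuous_real continuous_intros continuous_on_circle_holomorphic[OF hol_h r])
    have qC: "integral {0..2*pi} (\<lambda>\<theta>. cmod (q \<sigma> (of_real r * cis \<theta>))) \<le> C \<sigma>" if "\<bar>\<sigma>\<bar> = 1" for \<sigma>
      unfolding q_def C_def using that cB by (intro exp_strip_mean r) (simp add: abs_mult)
    have "hardy_mean p h r \<le> integral {0..2*pi} (\<lambda>\<theta>. 2 powr p * ((1/c) powr p *
        (cmod (q 1 (of_real r * cis \<theta>)) + cmod (q (-1) (of_real r * cis \<theta>))) + B powr p))"
      unfolding hardy_mean_def
    proof (rule integral_le)
      show "(\<lambda>\<theta>. cmod (h (of_real r * cis \<theta>)) powr p) integrable_on {0..2*pi}"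
        by (rule hardy_mean_integrable[OF hol_h r p])
      show "(\<lambda>\<theta>. 2 powr p * ((1/c) powr p * (cmod (q 1 (of_real r * cis \<theta>)) + cmod (q (-1) (of_real r * cis \<theta>))) + B powr p)) integrable_on {0..2*pi}"
        by (intro integrable_on_mult_right integrable_add ci integrable_continuous_real continuous_on_const)
    qed (use ptw r in \<open>auto simp: norm_mult\<close>)
    also have "\<dots> = 2 powr p * ((1/c) powr p * (integral {0..2*pi} (\<lambda>\<theta>. cmod (q 1 (of_real r * cis \<theta>)))
        + integral {0..2*pi} (\<lambda>\<theta>. cmod (q (-1) (of_real r * cis \<theta>)))) + 2 * pi * B powr p)"
      using integral_add[OF integrable_on_mult_right[OF integrable_add[OF ci[of 1] ci[of "-1"]], of "(1/c) powr p"]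
          integrable_continuous_real[OF continuous_on_const[of _ "B powr p"]]] integral_add[OF ci[of 1] ci[of "-1"]]
      by simp
    also have "\<dots> \<le> D"
      unfolding D_def using qC[of 1] qC[of "-1"] by (intro mult_left_mono add_mono) auto
    finally show ?thesis .
  qed
  then show ?thesis by blast
qed

definition H :: real where "H = 2 powr p * (2 * pi + (SOME C. \<forall>r. 0 \<le> r \<longrightarrow> r < 1 \<longrightarrow> hardy_mean p h r \<le> C))"

text \<open>\<open>H\<close> bounds the means of (1 + |h|)^p. Hence an error that is small only
  relative to 1 + |h| is small in H^p, which is the mode of convergence of all later
  approximations.\<close>

lemma dominated_hardy_bounded:
  assumes u: "u holomorphic_on unit_disc" and \<delta>: "0 \<le> \<delta>"
    and le: "\<And>z. cmod z < 1 \<Longrightarrow> cmod (u z) \<le> \<delta> * (1 + cmod (h z))"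
  shows "hardy_bounded p (\<delta> powr p * H) u"
proof -
  define C where "C = (SOME C. \<forall>r. 0 \<le> r \<longrightarrow> r < 1 \<longrightarrow> hardy_mean p h r \<le> C)"
  have C: "hardy_mean p h r \<le> C" if "0 \<le> r" "r < 1" for r
    using someI_ex[OF hardy_mean_h_bounded] that unfolding C_def by blast
  have "hardy_mean p u r \<le> \<delta> powr p * H" if r: "0 < r" "r < 1" for r
  proof -
    have r0: "0 \<le> r" using r by simp
    have i: "(\<lambda>\<theta>. cmod (h (of_real r * cis \<theta>)) powr p) integrable_on {0..2*pi}"
      by (rule hardy_mean_integrable[OF hol_h r0 r(2) p])
    have "hardy_mean p u r \<le> integral {0..2*pi} (\<lambda>\<theta>. \<delta> powr p * (2 powr p * (1 + cmod (h (of_real r * cis \<theta>)) powr p)))"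
      unfolding hardy_mean_def
    proof (rule integral_le)
      show "(\<lambda>\<theta>. cmod (u (of_real r * cis \<theta>)) powr p) integrable_on {0..2*pi}"
        by (rule hardy_mean_integrable[OF u r0 r(2) p])
      show "(\<lambda>\<theta>. \<delta> powr p * (2 powr p * (1 + cmod (h (of_real r * cis \<theta>)) powr p))) integrable_on {0..2*pi}"
        by (intro integrable_on_mult_right integrable_add i integrable_continuous_real continuous_on_const)
      fix \<theta>
      have lt: "cmod (of_real r * cis \<theta>) < 1" using r by (simp add: norm_mult)
      have "cmod (u (of_real r * cis \<theta>)) powr p \<le> (\<delta> * (1 + cmod (h (of_real r * cis \<theta>)))) powr p"
        using le[OF lt] p by (intro powr_mono2) auto
      also have "\<dots> = \<delta> powr p * (1 + cmod (h (of_real r * cis \<theta>))) powr p" using \<delta> by (simp add: powr_mult)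
      also have "\<dots> \<le> \<delta> powr p * (2 powr p * (1 powr p + cmod (h (of_real r * cis \<theta>)) powr p))"
        using p by (intro mult_left_mono powr_add_le) auto
      finally show "cmod (u (of_real r * cis \<theta>)) powr p \<le> \<delta> powr p * (2 powr p * (1 + cmod (h (of_real r * cis \<theta>)) powr p))" by simp
    qed
    also have "\<dots> = \<delta> powr p * (2 powr p * (2 * pi + hardy_mean p h r))"
      using integral_add[OF integrable_continuous_real[OF continuous_on_const[of _ 1]] i]
      by (simp add: hardy_mean_def)
    also have "\<dots> \<le> \<delta> powr p * H"
      unfolding H_def C_def[symmetric] using C[OF r0 r(2)] by (intro mult_left_mono add_mono) auto
    finally show ?thesis .
  qed
  then show ?thesis using u by (simp add: hardy_bounded_def)
qed

definition span_exp :: "(complex \<Rightarrow> complex) set" where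
  "span_exp = closed_span p (range (\<lambda>s::real. disc_ext (\<lambda>z. exp (\<i> * of_real s * h z))))"

section \<open>Closure properties of the span of the exponentials\<close>

definition inM :: "(complex \<Rightarrow> complex) \<Rightarrow> bool" where
  "inM u \<longleftrightarrow> disc_ext u \<in> span_exp"

lemma span_exp_subspace: "closed_subspace p span_exp"
  unfolding span_exp_def using p by (rule closed_subspace_closed_span)

lemma exp_bounded: "cmod z < 1 \<Longrightarrow> cmod (exp (\<i> * of_real s * h z)) \<le> exp (\<bar>s\<bar> * B)"
proof -
  assume "cmod z < 1"
  then have "\<bar>s\<bar> * \<bar>Im (h z)\<bar> \<le> \<bar>s\<bar> * B" by (intro mult_left_mono Im_h) auto
  moreover have "- (s * Im (h z)) \<le> \<bar>s\<bar> * \<bar>Im (h z)\<bar>"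
    by (metis abs_ge_minus_self abs_mult)
  ultimately show ?thesis by simp
qed

lemma inM_exp: "inM (\<lambda>z. exp (\<i> * of_real s * h z))"
proof -
  have "disc_ext (\<lambda>z. exp (\<i> * of_real s * h z)) \<in> hardy_space p"
    using exp_bounded p by (intro hardy_space_bounded(1)[where B = "exp (\<bar>s\<bar> * B)"] holomorphic_intros hol_h) auto
  then show ?thesis unfolding inM_def span_exp_def closed_span_def by blast
qed

lemma inM_mem: "inM u \<Longrightarrow> disc_ext u \<in> hardy_space p"
  using closed_subspaceD(1)[OF span_exp_subspace] by (simp add: inM_def)

lemma inM_holomorphic: "inM u \<Longrightarrow> u holomorphic_on unit_disc"
  using inM_mem hardy_space_holomorphic by fastforce

lemma inM_cong: "inM u \<Longrightarrow> (\<And>z. cmod z < 1 \<Longrightarrow> u z = v z) \<Longrightarrow> inM v"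
proof -
  assume "inM u" "\<And>z. cmod z < 1 \<Longrightarrow> u z = v z"
  then have "disc_ext u = disc_ext v" by (auto simp: disc_ext_def)
  with \<open>inM u\<close> show ?thesis by (simp add: inM_def)
qed

lemma inM_add: "inM u \<Longrightarrow> inM v \<Longrightarrow> inM (\<lambda>z. u z + v z)"
proof -
  assume "inM u" "inM v"
  then have "(\<lambda>z. disc_ext u z + disc_ext v z) \<in> span_exp"
    unfolding inM_def by (rule closed_subspaceD(2)[OF span_exp_subspace])
  moreover have "(\<lambda>z. disc_ext u z + disc_ext v z) = disc_ext (\<lambda>z. u z + v z)"
    by (auto simp: disc_ext_def)
  ultimately show ?thesis by (simp add: inM_def)
qed

lemma inM_cmult: "inM u \<Longrightarrow> inM (\<lambda>z. c * u z)"
proof -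
  assume "inM u"
  then have "(\<lambda>z. c * disc_ext u z) \<in> span_exp"
    unfolding inM_def by (rule closed_subspaceD(3)[OF span_exp_subspace])
  moreover have "(\<lambda>z. c * disc_ext u z) = disc_ext (\<lambda>z. c * u z)"
    by (auto simp: disc_ext_def)
  ultimately show ?thesis by (simp add: inM_def)
qed

lemma inM_const: "inM (\<lambda>_. c)"
  using inM_cmult[OF inM_exp[of 0], of c] by simp

lemma inM_sum: "finite A \<Longrightarrow> (\<And>i. i \<in> A \<Longrightarrow> inM (u i)) \<Longrightarrow> inM (\<lambda>z. \<Sum>i\<in>A. u i z)"
  by (induction A rule: finite_induct) (auto intro: inM_const inM_add)

lemma inM_limit:
  assumes u: "disc_ext u \<in> hardy_space p"
    and lim: "\<And>\<epsilon>. 0 < \<epsilon> \<Longrightarrow> \<exists>v. inM v \<and> hardy_bounded p \<epsilon> (\<lambda>z. u z - v z)"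
  shows "inM u"
  unfolding inM_def
proof (rule closed_subspaceD(4)[OF span_exp_subspace u])
  fix \<epsilon> :: real assume "0 < \<epsilon>"
  then obtain v where v: "inM v" and le: "hardy_bounded p \<epsilon> (\<lambda>z. u z - v z)" using lim by blast
  have "(\<lambda>z. disc_ext u z - disc_ext v z) = disc_ext (\<lambda>z. u z - v z)" by (auto simp: disc_ext_def)
  then have "hardy_sup p (\<lambda>z. disc_ext u z - disc_ext v z) \<le> \<epsilon>"
    using le by (auto intro!: hardy_sup_le simp: hardy_bounded_def hardy_mean_disc_ext)
  then show "\<exists>g\<in>span_exp. hardy_sup p (\<lambda>z. disc_ext u z - g z) \<le> \<epsilon>" using v unfolding inM_def by blast
qed

lemma H_nonneg: "0 \<le> H"
  using dominated_hardy_bounded[of "\<lambda>_. 1" 1] hardy_mean_nonneg[of p "\<lambda>_. 1" "1/2"]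
  by (auto simp: hardy_bounded_def dest!: spec[of _ "1/2"])

lemma inM_dominated_limit:
  assumes u: "u holomorphic_on unit_disc"
    and lim: "\<And>\<epsilon>. 0 < \<epsilon> \<Longrightarrow> \<exists>v. inM v \<and> (\<forall>z. cmod z < 1 \<longrightarrow> cmod (u z - v z) \<le> \<epsilon> * (1 + cmod (h z)))"
  shows "inM u"
proof (rule inM_limit)
  have bd: "\<exists>v. inM v \<and> hardy_bounded p \<epsilon> (\<lambda>z. u z - v z)" if \<epsilon>: "0 < \<epsilon>" for \<epsilon>
  proof -
    define \<delta> where "\<delta> = (\<epsilon> / (H + 1)) powr (1 / p)"
    have \<delta>: "0 < \<delta>" using \<epsilon> H_nonneg by (simp add: \<delta>_def)
    have "\<delta> powr p = \<epsilon> / (H + 1)" using p \<epsilon> H_nonneg by (simp add: \<delta>_def powr_powr)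
    then have le: "\<delta> powr p * H \<le> \<epsilon>" using H_nonneg \<epsilon> by (simp add: divide_le_eq algebra_simps)
    obtain v where v: "inM v" "\<And>z. cmod z < 1 \<Longrightarrow> cmod (u z - v z) \<le> \<delta> * (1 + cmod (h z))"
      using lim[OF \<delta>] by blast
    have "hardy_bounded p (\<delta> powr p * H) (\<lambda>z. u z - v z)"
      using \<delta> v by (intro dominated_hardy_bounded holomorphic_on_diff u inM_holomorphic) auto
    then have "hardy_bounded p \<epsilon> (\<lambda>z. u z - v z)" using le by (force simp: hardy_bounded_def)
    with v show ?thesis by blast
  qed
  then show "\<And>\<epsilon>. 0 < \<epsilon> \<Longrightarrow> \<exists>v. inM v \<and> hardy_bounded p \<epsilon> (\<lambda>z. u z - v z)" .
  \<comment> \<open>Membership of \<open>u\<close> in H^p needs just one approximant: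
    \<open>u\<close> is the sum of \<open>v\<close> and a difference with bounded means.\<close>
  obtain v where v: "inM v" "hardy_bounded p 1 (\<lambda>z. u z - v z)" using bd[of 1] by auto
  have "disc_ext (\<lambda>z. u z - v z) \<in> hardy_space p"
    using v(2) by (intro hardy_space_disc_extI[where B = 1]) (auto simp: hardy_bounded_def)
  from hardy_space_add(1)[OF this inM_mem[OF v(1)] p]
  have "(\<lambda>z. disc_ext (\<lambda>z. u z - v z) z + disc_ext v z) \<in> hardy_space p" .
  also have "(\<lambda>z. disc_ext (\<lambda>z. u z - v z) z + disc_ext v z) = disc_ext u" by (auto simp: disc_ext_def)
  finally show "disc_ext u \<in> hardy_space p" .
qed

lemma inM_uniform_limit:
  assumes u: "u holomorphic_on unit_disc"
    and lim: "\<And>\<epsilon>. 0 < \<epsilon> \<Longrightarrow> \<exists>v. inM v \<and> (\<forall>z. cmod z < 1 \<longrightarrow> cmod (u z - v z) \<le> \<epsilon>)"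
  shows "inM u"
proof (rule inM_dominated_limit[OF u])
  fix \<epsilon> :: real assume \<epsilon>: "0 < \<epsilon>"
  then obtain v where v: "inM v" "\<And>z. cmod z < 1 \<Longrightarrow> cmod (u z - v z) \<le> \<epsilon>" using lim by blast
  have "cmod (u z - v z) \<le> \<epsilon> * (1 + cmod (h z))" if "cmod z < 1" for z
    using v(2)[OF that] \<epsilon> by (simp add: distrib_left add_increasing2)
  with v show "\<exists>v. inM v \<and> (\<forall>z. cmod z < 1 \<longrightarrow> cmod (u z - v z) \<le> \<epsilon> * (1 + cmod (h z)))" by blast
qed

text \<open>
  Multiplication by a bounded function preserves the span of the exponentials as soon as it maps
  each exponential into it; so the bounded functions in the closed span form an algebra.
\<close>

lemma span_exp_mult_invariant:
  assumes u: "u holomorphic_on unit_disc" "\<And>z. cmod z < 1 \<Longrightarrow> cmod (u z) \<le> K"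
    and gen: "\<And>s. inM (\<lambda>z. u z * exp (\<i> * of_real s * h z))" and v: "inM v"
  shows "inM (\<lambda>z. u z * v z)"
proof -
  have "closed_subspace p {f \<in> hardy_space p. mult_operator p u f \<in> span_exp}"
    by (intro closed_subspace_vimage p span_exp_subspace mult_operator_bounded[OF p u])
  moreover have "mult_operator p u (disc_ext w) = disc_ext (\<lambda>z. u z * w z)" if "inM w" for w
    using inM_mem[OF that] by (auto simp: mult_operator_def disc_ext_def)
  then have "disc_ext w \<in> {f \<in> hardy_space p. mult_operator p u f \<in> span_exp} \<longleftrightarrow> inM (\<lambda>z. u z * w z)" if "inM w" for w
    using that inM_mem[OF that] by (simp add: inM_def[of "\<lambda>z. u z * w z"])
  note eq = this
  have "range (\<lambda>s::real. disc_ext (\<lambda>z. exp (\<i> * of_real s * h z))) \<subseteq> {f \<in> hardy_space p. mult_operator p u f \<in> span_exp}"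
  proof (rule image_subsetI)
    fix s
    show "disc_ext (\<lambda>z. exp (\<i> * of_real s * h z)) \<in> {f \<in> hardy_space p. mult_operator p u f \<in> span_exp}"
      using eq[OF inM_exp[of s]] gen[of s] by blast
  qed
  ultimately have "span_exp \<subseteq> {f \<in> hardy_space p. mult_operator p u f \<in> span_exp}"
    unfolding span_exp_def by (intro closed_span_subset) (simp_all add: span_exp_def)
  then show ?thesis using eq[OF v] v unfolding inM_def by blast
qed

text \<open>Multiplier invariance is used twice. Exponentials multiply exponentials into
  exponentials, so they preserve the span; applied to \<open>u\<close> this shows that
  multiplication by \<open>u\<close> sends each exponential into the span.\<close>

lemma inM_mult:
  assumes u: "inM u" "\<And>z. cmod z < 1 \<Longrightarrow> cmod (u z) \<le> K" and v: "inM v"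
  shows "inM (\<lambda>z. u z * v z)"
proof (rule span_exp_mult_invariant[OF inM_holomorphic[OF u(1)] u(2) _ v])
  fix s :: real
  have "inM (\<lambda>z. exp (\<i> * of_real s * h z) * u z)"
  proof (rule span_exp_mult_invariant[OF inM_holomorphic[OF inM_exp] exp_bounded _ u(1)])
    fix t :: real
    show "inM (\<lambda>z. exp (\<i> * of_real s * h z) * exp (\<i> * of_real t * h z))"
      by (rule inM_cong[OF inM_exp[of "s + t"]]) (simp add: exp_add[symmetric] algebra_simps)
  qed
  then show "inM (\<lambda>z. u z * exp (\<i> * of_real s * h z))" by (simp add: mult.commute)
qed

lemma inM_power:
  assumes u: "inM u" "\<And>z. cmod z < 1 \<Longrightarrow> cmod (u z) \<le> K"
  shows "inM (\<lambda>z. u z ^ n)"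
proof (induction n)
  case 0
  show ?case using inM_const[of 1] by simp
next
  case (Suc n)
  show ?case using inM_mult[OF u Suc] by simp
qed

lemma inM_geometric:
  assumes x: "inM x" "\<And>z. cmod z < 1 \<Longrightarrow> cmod (x z) \<le> \<rho>" and \<rho>: "\<rho> < 1"
  shows "inM (\<lambda>z. 1 / (1 - x z))"
proof (rule inM_uniform_limit)
  have \<rho>0: "0 \<le> \<rho>" using order_trans[OF norm_ge_zero x(2)[of 0]] by simp
  have ne: "x z \<noteq> 1" if "cmod z < 1" for z using x(2)[OF that] \<rho> by auto
  show "(\<lambda>z. 1 / (1 - x z)) holomorphic_on unit_disc"
    using ne by (intro holomorphic_on_divide holomorphic_on_diff holomorphic_on_const inM_holomorphic x) auto
  fix \<epsilon> :: real assume \<epsilon>: "0 < \<epsilon>"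
  have "(\<lambda>n. \<rho> ^ n / (1 - \<rho>)) \<longlonglongrightarrow> 0 / (1 - \<rho>)"
    using \<rho> \<rho>0 by (intro tendsto_intros LIMSEQ_power_zero) auto
  then have "\<forall>\<^sub>F n in sequentially. \<rho> ^ n / (1 - \<rho>) < \<epsilon>"
    using \<epsilon> by (intro order_tendstoD) auto
  then obtain n where n: "\<rho> ^ n / (1 - \<rho>) < \<epsilon>" by (auto simp: eventually_sequentially)
  show "\<exists>v. inM v \<and> (\<forall>z. cmod z < 1 \<longrightarrow> cmod (1 / (1 - x z) - v z) \<le> \<epsilon>)"
  proof (intro exI[of _ "\<lambda>z. \<Sum>k<n. x z ^ k"] conjI allI impI)
    show "inM (\<lambda>z. \<Sum>k<n. x z ^ k)" by (intro inM_sum inM_power[OF x]) auto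
    fix z :: complex assume z: "cmod z < 1"
    have "1 - \<rho> \<le> cmod (1 - x z)" using norm_triangle_ineq2[of 1 "x z"] x(2)[OF z] by simp
    have "(\<Sum>k<n. x z ^ k) = (1 - x z ^ n) / (1 - x z)" using ne[OF z] by (simp add: geometric_sum divide_simps) (simp add: algebra_simps)
    then have "1 / (1 - x z) - (\<Sum>k<n. x z ^ k) = x z ^ n / (1 - x z)"
      by (simp add: diff_divide_distrib)
    then have "cmod (1 / (1 - x z) - (\<Sum>k<n. x z ^ k)) = cmod (x z) ^ n / cmod (1 - x z)"
      by (simp add: norm_divide norm_power)
    also have "\<dots> \<le> \<rho> ^ n / (1 - \<rho>)"
      using \<rho> \<rho>0 x(2)[OF z] \<open>1 - \<rho> \<le> cmod (1 - x z)\<close> by (intro frac_le power_mono) auto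
    finally show "cmod (1 / (1 - x z) - (\<Sum>k<n. x z ^ k)) \<le> \<epsilon>" using n by simp
  qed
qed

end

section \<open>Reciprocals\<close>

lemma norm_exp_minus_one_le:
  fixes s :: complex
  assumes "0 \<le> Re s"
  shows "cmod (1 - exp (- s)) \<le> cmod s"
proof -
  have "convex {z. 0 \<le> Re z}" using convex_halfspace_ge[of 0 "1::complex"] by (simp add: inner_complex_def)
  then have "cmod (exp (- s) - exp (- 0)) \<le> 1 * cmod (s - 0)"
    by (rule field_differentiable_bound[where f' = "\<lambda>z. - exp (- z)"])
       (use assms in \<open>auto intro!: derivative_eq_intros\<close>)
  then show ?thesis by (simp add: norm_minus_commute)
qed

text \<open>The mean value inequality on the segment from 0 to \<open>s\<close>, where the
  derivative 1 - exp (- z) is at most |s| by the first-order estimate.\<close>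

lemma norm_exp_second_order_le:
  fixes s :: complex
  assumes "0 \<le> Re s"
  shows "cmod (exp (- s) - 1 + s) \<le> (cmod s)\<^sup>2"
proof -
  have "cmod ((exp (- s) - 1 + s) - (exp (- 0) - 1 + 0)) \<le> cmod s * cmod (s - 0)"
  proof (rule field_differentiable_bound[where f' = "\<lambda>z. 1 - exp (- z)" and S = "closed_segment 0 s"])
    fix z assume "z \<in> closed_segment 0 s"
    then obtain u where u: "0 \<le> u" "u \<le> 1" "z = of_real u * s"
      by (auto simp: in_segment scaleR_conv_of_real)
    have "cmod (1 - exp (- z)) \<le> cmod z" using u assms by (intro norm_exp_minus_one_le) simp
    also have "\<dots> \<le> cmod s" using u by (simp add: norm_mult mult_left_le_one_le)
    finally show "cmod (1 - exp (- z)) \<le> cmod s" .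
  qed (auto intro!: derivative_eq_intros)
  then show ?thesis by (simp add: power2_eq_square)
qed

context strip_map
begin

text \<open>
  \<open>1 / v = \<integral>\<^sub>0\<^sup>\<infinity> exp (- s v) ds\<close> for \<open>Re v > 0\<close>; the Riemann sums of step \<open>\<delta>\<close> are the geometric series
  \<open>\<delta> / (1 - exp (- \<delta> v))\<close>.
\<close>

lemma inM_reciprocal_halfplane:
  assumes \<sigma>: "\<sigma> = 1 \<or> \<sigma> = (-1::real)" and d: "0 < d"
    and Re: "\<And>z. cmod z < 1 \<Longrightarrow> d \<le> Re (of_real \<sigma> * \<i> * (h z - \<xi>))"
  shows "inM (\<lambda>z. 1 / (h z - \<xi>))"
proof -
  define v where "v = (\<lambda>z. of_real \<sigma> * \<i> * (h z - \<xi>))"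
  have vd: "d \<le> Re (v z)" if "cmod z < 1" for z using Re[OF that] by (simp add: v_def)
  have vn: "0 < cmod (v z)" "v z \<noteq> 0" if "cmod z < 1" for z using vd[OF that] d by auto
  have "inM (\<lambda>z. 1 / v z)"
  proof (rule inM_dominated_limit)
    show "(\<lambda>z. 1 / v z) holomorphic_on unit_disc"
      using vn unfolding v_def by (intro holomorphic_on_divide holomorphic_intros hol_h) auto
    fix \<epsilon> :: real assume \<epsilon>: "0 < \<epsilon>"
    define K where "K = (1 + cmod \<xi>) * (1 + d) / d"
    have K: "0 < K" using d by (simp add: K_def add_pos_nonneg)
    define \<delta> where "\<delta> = min 1 (\<epsilon> / K)"
    have \<delta>: "0 < \<delta>" "\<delta> \<le> 1" "\<delta> * K \<le> \<epsilon>"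
      using \<epsilon> K by (auto simp: \<delta>_def min_def field_simps)
    define x where "x = (\<lambda>z. exp (- (of_real \<delta> * v z)))"
    define \<rho> where "\<rho> = exp (- (\<delta> * d))"
    have \<rho>: "\<rho> < 1" using \<delta> d by (simp add: \<rho>_def)
    have xl: "cmod (x z) \<le> \<rho>" if "cmod z < 1" for z
      using vd[OF that] \<delta> by (simp add: x_def \<rho>_def)
    have xM: "inM x"
    proof -
      have "inM (\<lambda>z. exp (of_real (\<delta> * \<sigma>) * \<i> * \<xi>) * exp (\<i> * of_real (- (\<delta> * \<sigma>)) * h z))"
        by (intro inM_cmult inM_exp)
      then show ?thesis
        by (rule inM_cong) (simp add: x_def v_def exp_add[symmetric] algebra_simps)
    qed
    show "\<exists>w. inM w \<and> (\<forall>z. cmod z < 1 \<longrightarrow> cmod (1 / v z - w z) \<le> \<epsilon> * (1 + cmod (h z)))"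
    proof (intro exI[of _ "\<lambda>z. of_real \<delta> * (1 / (1 - x z))"] conjI allI impI)
      show "inM (\<lambda>z. of_real \<delta> * (1 / (1 - x z)))"
        by (intro inM_cmult inM_geometric[OF xM xl \<rho>])
      fix z :: complex assume z: "cmod z < 1"
      define s where "s = of_real \<delta> * v z"
      have s: "0 \<le> Re s" "s \<noteq> 0" using vd[OF z] vn[OF z] d \<delta> by (auto simp: s_def)
      have "\<delta> * d / (1 + d) \<le> \<delta> * d / (1 + \<delta> * d)"
        using \<delta> d by (intro divide_left_mono) (auto intro!: mult_pos_pos add_pos_pos simp: mult_left_le_one_le)
      also have "\<dots> \<le> 1 - \<rho>"
      proof -
        have "1 + \<delta> * d \<le> exp (\<delta> * d)" by (rule exp_ge_add_one_self)
        then have "exp (- (\<delta> * d)) \<le> 1 / (1 + \<delta> * d)"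
          using \<delta> d by (simp add: exp_minus field_simps add_pos_pos)
        moreover have "1 - 1 / (1 + \<delta> * d) = \<delta> * d / (1 + \<delta> * d)"
          using \<delta> d by (simp add: divide_simps add_pos_pos) (smt (verit) mult_pos_pos)
        ultimately show ?thesis by (simp add: \<rho>_def)
      qed
      also have "\<dots> \<le> cmod (1 - x z)" using norm_triangle_ineq2[of 1 "x z"] xl[OF z] by simp
      finally have den: "\<delta> * d / (1 + d) \<le> cmod (1 - x z)" .
      have dp: "0 < \<delta> * d / (1 + d)" using \<delta> d by simp
      have x1: "1 - x z \<noteq> 0" using den dp by auto
      \<comment> \<open>The numerator is of second order in \<open>s\<close>, the factor
        \<open>s\<close> of first order, and 1 - x z is at least of order \<delta>. There remains a
        multiple of |s| = \<delta> |v z|, which is small only relative to 1 + |h z|.\<close>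
      have "1 / v z - of_real \<delta> * (1 / (1 - x z)) = of_real \<delta> * (- (exp (- s) - 1 + s)) / (s * (1 - x z))"
      proof -
        have "1 / v z = of_real \<delta> / s" using \<delta> vn[OF z] by (simp add: s_def)
        moreover have "x z = exp (- s)" by (simp add: x_def s_def)
        ultimately show ?thesis using s(2) x1 by (simp add: divide_simps)
      qed
      then have "cmod (1 / v z - of_real \<delta> * (1 / (1 - x z))) = \<delta> * cmod (exp (- s) - 1 + s) / (cmod s * cmod (1 - x z))"
        using \<delta> by (simp only: norm_divide norm_mult norm_minus_cancel norm_of_real abs_of_pos)
      also have "\<dots> \<le> \<delta> * (cmod s)\<^sup>2 / (cmod s * (\<delta> * d / (1 + d)))"
        using \<delta> den dp s by (intro frac_le mult_left_mono norm_exp_second_order_le mult_pos_pos) auto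
      also have "\<dots> = cmod s * (1 + d) / d"
        using \<delta> d s by (simp add: power2_eq_square divide_simps)
      also have "\<dots> \<le> \<epsilon> * (1 + cmod (h z))"
      proof -
        have "cmod s = \<delta> * cmod (h z - \<xi>)" using \<sigma> \<delta> by (auto simp: s_def v_def norm_mult)
        also have "\<dots> \<le> \<delta> * ((1 + cmod \<xi>) * (1 + cmod (h z)))"
        proof -
          have "cmod (h z - \<xi>) \<le> cmod (h z) + cmod \<xi>" by (rule norm_triangle_ineq4)
          also have "\<dots> \<le> (1 + cmod \<xi>) * (1 + cmod (h z))" by (simp add: algebra_simps)
          finally show ?thesis using \<delta> by (intro mult_left_mono) auto
        qed
        finally have "cmod s * (1 + d) / d \<le> \<delta> * ((1 + cmod \<xi>) * (1 + cmod (h z))) * (1 + d) / d"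
          using d by (intro divide_right_mono mult_right_mono) auto
        also have "\<dots> = (\<delta> * K) * (1 + cmod (h z))" by (simp add: K_def)
        also have "\<dots> \<le> \<epsilon> * (1 + cmod (h z))" using \<delta> by (intro mult_right_mono) auto
        finally show ?thesis .
      qed
      finally show "cmod (1 / v z - of_real \<delta> * (1 / (1 - x z))) \<le> \<epsilon> * (1 + cmod (h z))" .
    qed
  qed
  then have "inM (\<lambda>z. (of_real \<sigma> * \<i>) * (1 / v z))" by (rule inM_cmult)
  then show ?thesis by (rule inM_cong) (use \<sigma> in \<open>auto simp: v_def divide_simps\<close>)
qed

abbreviation \<Omega> :: "complex set" where "\<Omega> \<equiv> h ` unit_disc"

lemma closure_Im: "w \<in> closure \<Omega> \<Longrightarrow> \<bar>Im w\<bar> \<le> B"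
proof -
  have "closed {w. \<bar>Im w\<bar> \<le> B}" by (intro closed_Collect_le continuous_intros)
  then have "closure \<Omega> \<subseteq> {w. \<bar>Im w\<bar> \<le> B}" using Im_h by (intro closure_minimal) auto
  then show "w \<in> closure \<Omega> \<Longrightarrow> \<bar>Im w\<bar> \<le> B" by blast
qed

lemma closure_shift:
  assumes "w \<in> closure \<Omega>" "0 \<le> t"
  shows "w + of_real t \<in> closure \<Omega>"
proof -
  have "(\<lambda>w. w + of_real t) ` closure \<Omega> \<subseteq> closure \<Omega>"
    using shift assms(2) closure_subset[of \<Omega>]
    by (intro image_closure_subset continuous_intros closed_closure) force
  then show ?thesis using assms(1) by auto
qed

lemma inM_reciprocal_far:
  assumes "B < \<bar>Im \<xi>\<bar>"
  shows "inM (\<lambda>z. 1 / (h z - \<xi>))"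
proof (cases "0 \<le> Im \<xi>")
  case True
  show ?thesis
  proof (rule inM_reciprocal_halfplane[of 1 "\<bar>Im \<xi>\<bar> - B"])
    fix z :: complex assume "cmod z < 1"
    then show "\<bar>Im \<xi>\<bar> - B \<le> Re (of_real 1 * \<i> * (h z - \<xi>))" using Im_h[of z] True by simp
  qed (use assms in auto)
next
  case False
  show ?thesis
  proof (rule inM_reciprocal_halfplane[of "-1" "\<bar>Im \<xi>\<bar> - B"])
    fix z :: complex assume "cmod z < 1"
    then show "\<bar>Im \<xi>\<bar> - B \<le> Re (of_real (-1) * \<i> * (h z - \<xi>))" using Im_h[of z] False by simp
  qed (use assms in auto)
qed

text \<open>1 / (h - \<xi>') is the product of 1 / (h - \<xi>) and a Neumann series in (\<xi>' -
  \<xi>) / (h - \<xi>), whose modulus is bounded by a number less than 1.\<close>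

lemma inM_reciprocal_step:
  assumes M: "inM (\<lambda>z. 1 / (h z - \<xi>))" and \<rho>: "0 < \<rho>" "\<And>z. cmod z < 1 \<Longrightarrow> \<rho> \<le> cmod (h z - \<xi>)"
    and close: "cmod (\<xi>' - \<xi>) < \<rho>"
  shows "inM (\<lambda>z. 1 / (h z - \<xi>'))"
proof -
  define x where "x = (\<lambda>z. (\<xi>' - \<xi>) * (1 / (h z - \<xi>)))"
  have bd: "cmod (1 / (h z - \<xi>)) \<le> 1 / \<rho>" if "cmod z < 1" for z
    using \<rho>(2)[OF that] \<rho>(1) by (simp add: norm_divide frac_le)
  have xM: "inM x" unfolding x_def by (intro inM_cmult M)
  have xl: "cmod (x z) \<le> cmod (\<xi>' - \<xi>) / \<rho>" if "cmod z < 1" for z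
    using mult_left_mono[OF bd[OF that], of "cmod (\<xi>' - \<xi>)"] by (simp add: x_def norm_mult norm_divide)
  have lt1: "cmod (\<xi>' - \<xi>) / \<rho> < 1" using close \<rho> by simp
  have "inM (\<lambda>z. 1 / (h z - \<xi>) * (1 / (1 - x z)))"
    by (rule inM_mult[OF M bd inM_geometric[OF xM xl lt1]])
  then show ?thesis
  proof (rule inM_cong)
    fix z :: complex assume z: "cmod z < 1"
    have ne: "h z - \<xi> \<noteq> 0" using \<rho>(2)[OF z] \<rho>(1) by auto
    then have "(h z - \<xi>) * (1 - x z) = h z - \<xi>'" by (simp add: x_def field_simps)
    then show "1 / (h z - \<xi>) * (1 / (1 - x z)) = 1 / (h z - \<xi>')" by simp
  qed
qed

text \<open>Membership is locally constant on \<open>C\<close>. If the ball of radius e about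
  \<open>a\<close> avoids the closure, all points of the ball of radius e / 2 keep the distance e /
  2 from \<open>\<Omega>\<close>, so \<open>inM_reciprocal_step\<close> leads from \<open>a\<close>
  to each of them and back.\<close>

lemma inM_reciprocal_connected:
  assumes C: "connected C" "C \<subseteq> - closure \<Omega>" and \<xi>: "\<xi> \<in> C" "inM (\<lambda>z. 1 / (h z - \<xi>))" and \<xi>': "\<xi>' \<in> C"
  shows "inM (\<lambda>z. 1 / (h z - \<xi>'))"
proof -
  define P where "P = (\<lambda>\<xi>. inM (\<lambda>z. 1 / (h z - \<xi>)))"
  have "P \<xi> \<longleftrightarrow> P \<xi>'"
  proof (rule connected_equivalence_relation[OF C(1) \<xi>(1) \<xi>'])
    fix a assume a: "a \<in> C"
    have "open (- closure \<Omega>)" by auto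
    then obtain e where e: "0 < e" "ball a e \<subseteq> - closure \<Omega>" using a C(2) openE by blast
    have far: "e / 2 \<le> cmod (h z - b)" if "cmod z < 1" "b \<in> ball a (e / 2)" for z b
    proof -
      have "h z \<in> closure \<Omega>" using that(1) closure_subset by fastforce
      then have "h z \<notin> ball a e" using e by blast
      then have "e \<le> dist a (h z)" by simp
      moreover have "dist a (h z) \<le> dist a b + dist b (h z)" by (rule dist_triangle)
      ultimately show ?thesis using that(2) by (simp add: dist_norm norm_minus_commute)
    qed
    have "P b \<longleftrightarrow> P a" if b: "b \<in> ball a (e / 2)" for b
    proof -
      have "cmod (a - b) < e / 2" using b by (simp add: dist_norm)
      then show ?thesis
        using inM_reciprocal_step[of a "e / 2" b] inM_reciprocal_step[of b "e / 2" a] far b e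
        unfolding P_def by (auto simp: norm_minus_commute)
    qed
    note eq = this
    show "\<exists>T. openin (top_of_set C) T \<and> a \<in> T \<and> (\<forall>x\<in>T. P a \<longleftrightarrow> P x)"
    proof (intro exI[of _ "C \<inter> ball a (e / 2)"] conjI ballI)
      show "openin (top_of_set C) (C \<inter> ball a (e / 2))" by (rule openin_open_Int[OF open_ball])
      show "a \<in> C \<inter> ball a (e / 2)" using a e by simp
      show "P a \<longleftrightarrow> P x" if "x \<in> C \<inter> ball a (e / 2)" for x using eq[of x] that by blast
    qed
  qed auto
  then show ?thesis using \<xi>(2) by (simp add: P_def)
qed

text \<open>
  The complement of the closure is invariant under translations to the left, so it is connected as
  soon as one of its components meets both half planes beyond the strip; otherwise these two half
  planes lie in different components, and there is no third one.
\<close>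

lemma inM_reciprocal:
  assumes comp: "finite (components (- closure \<Omega>))" "card (components (- closure \<Omega>)) \<le> 2"
    and \<xi>: "\<xi> \<notin> closure \<Omega>"
  shows "inM (\<lambda>z. 1 / (h z - \<xi>))"
proof -
  let ?E = "- closure \<Omega>"
  define up where "up = \<i> * of_real (B + 1)"
  define lo where "lo = - \<i> * of_real (B + 1)"
  have far: "B < \<bar>Im up\<bar>" "B < \<bar>Im lo\<bar>" using B_nonneg by (auto simp: up_def lo_def)
  have E: "up \<in> ?E" "lo \<in> ?E" "\<xi> \<in> ?E" using closure_Im far \<xi> by fastforce+
  define C where "C = (\<lambda>x. connected_component_set ?E x)"
  have conn: "connected (C x)" "C x \<subseteq> ?E" for x
    by (auto simp: C_def connected_component_subset)
  have self: "x \<in> C x" if "x \<in> ?E" for x using that by (simp add: C_def connected_component_refl_eq)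
  have upM: "inM (\<lambda>z. 1 / (h z - up))" and loM: "inM (\<lambda>z. 1 / (h z - lo))"
    using inM_reciprocal_far far by auto
  have "\<exists>\<eta>\<in>C \<xi>. inM (\<lambda>z. 1 / (h z - \<eta>))"
  proof (cases "C up = C lo")
    case False
    have "C x \<in> components ?E" if "x \<in> ?E" for x using that unfolding C_def by (rule componentsI)
    then have "{C up, C lo, C \<xi>} \<subseteq> components ?E" using E by simp
    then have "card {C up, C lo, C \<xi>} \<le> card (components ?E)" by (rule card_mono[OF comp(1)])
    then have "card {C up, C lo, C \<xi>} \<le> 2" using comp(2) by (rule le_trans)
    moreover have "card {C up, C lo, C \<xi>} = 3" if "C \<xi> \<noteq> C up" "C \<xi> \<noteq> C lo"
    proof -
      have "C up \<notin> {C lo, C \<xi>}" "C lo \<notin> {C \<xi>}" using False that by blast+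
      then show ?thesis by simp
    qed
    ultimately have "C \<xi> = C up \<or> C \<xi> = C lo" by (cases "C \<xi> = C up"; cases "C \<xi> = C lo") simp_all
    then consider "C \<xi> = C up" | "C \<xi> = C lo" by (elim disjE)
    then show ?thesis
    proof cases
      case 1
      have "up \<in> C \<xi>" unfolding 1 by (rule self[OF E(1)])
      then show ?thesis using upM by (rule bexI[rotated])
    next
      case 2
      have "lo \<in> C \<xi>" unfolding 2 by (rule self[OF E(2)])
      then show ?thesis using loM by (rule bexI[rotated])
    qed
  next
    case True
    show ?thesis
    proof (cases "B < \<bar>Im \<xi>\<bar>")
      case True
      show ?thesis by (rule bexI[of _ \<xi>], rule inM_reciprocal_far[OF True], rule self[OF E(3)])
    next
      case False
      \<comment> \<open>A component that contains points above and below the strip meets every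
        height in between, in particular that of \<open>\<xi>\<close>.\<close>
      have "connected (Im ` C up)" using conn by (intro connected_continuous_image continuous_intros)
      moreover have "Im up \<in> Im ` C up" "Im lo \<in> Im ` C up" using self E True by auto
      moreover have "Im lo \<le> Im \<xi>" "Im \<xi> \<le> Im up" using False by (auto simp: up_def lo_def)
      ultimately have "Im \<xi> \<in> Im ` C up" by (meson connectedD_interval)
      then obtain \<eta> where \<eta>: "\<eta> \<in> C up" "Im \<eta> = Im \<xi>" by auto
      have \<eta>E: "\<eta> \<in> ?E" using \<eta> conn by blast
      have line: "x \<in> ?E" if y: "y \<in> ?E" and x: "Im x = Im y" "Re x \<le> Re y" for x y
      proof
        assume "x \<in> closure \<Omega>"
        then have "x + of_real (Re y - Re x) \<in> closure \<Omega>" using x by (intro closure_shift) auto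
        moreover have "x + of_real (Re y - Re x) = y" using x by (simp add: complex_eq_iff)
        ultimately show False using y by simp
      qed
      have "closed_segment \<xi> \<eta> \<subseteq> ?E"
      proof
        fix x assume "x \<in> closed_segment \<xi> \<eta>"
        then obtain u where u: "0 \<le> u" "u \<le> 1" "x = (1 - u) *\<^sub>R \<xi> + u *\<^sub>R \<eta>" by (auto simp: in_segment)
        have "Im x = (1 - u) * Im \<xi> + u * Im \<eta>" by (simp add: u(3))
        then have Im: "Im x = Im \<xi>" unfolding \<eta>(2) by (simp add: algebra_simps)
        \<comment> \<open>A point of the horizontal segment is not to the right of both ends, so it
          is reached from \<open>\<xi>\<close> or \<open>\<eta>\<close> by a translation to the
          left.\<close>
        have "Re x \<le> max (Re \<xi>) (Re \<eta>)"
          using u convex_bound_le[of "Re \<xi>" "max (Re \<xi>) (Re \<eta>)" "Re \<eta>" "1 - u" u] by simp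
        then have "Re x \<le> Re \<xi> \<or> Re x \<le> Re \<eta>" by (auto simp: max_def split: if_splits)
        then show "x \<in> ?E" using line[OF E(3)] line[OF \<eta>E] Im \<eta> by auto
      qed
      then have "closed_segment \<xi> \<eta> \<subseteq> C \<xi>"
        unfolding C_def by (intro connected_component_maximal) auto
      then have "\<eta> \<in> C \<xi>" by auto
      moreover have "inM (\<lambda>z. 1 / (h z - \<eta>))"
        by (rule inM_reciprocal_connected[OF conn self[OF E(1)] upM \<eta>(1)])
      ultimately show ?thesis by blast
    qed
  qed
  then show ?thesis using inM_reciprocal_connected[OF conn _ _ self[OF E(3)]] by blast
qed

end

section \<open>The Cauchy formula on grids\<close>

text \<open>The edges are oriented to the right and upwards instead of around the rectangle, so that
  neighbouring cells of a grid share the same edge integrals, with opposite signs.\<close>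

lemma rectangle_Cauchy:
  fixes F :: "complex \<Rightarrow> complex"
  assumes xy: "x0 < x1" "y0 < y1" and F: "F holomorphic_on cbox (Complex x0 y0) (Complex x1 y1)"
    and w: "w \<in> box (Complex x0 y0) (Complex x1 y1) \<or> w \<notin> cbox (Complex x0 y0) (Complex x1 y1)"
  shows "contour_integral (linepath (Complex x0 y0) (Complex x1 y0)) (\<lambda>\<xi>. F \<xi> / (\<xi> - w))
       + contour_integral (linepath (Complex x1 y0) (Complex x1 y1)) (\<lambda>\<xi>. F \<xi> / (\<xi> - w))
       - contour_integral (linepath (Complex x0 y1) (Complex x1 y1)) (\<lambda>\<xi>. F \<xi> / (\<xi> - w))
       - contour_integral (linepath (Complex x0 y0) (Complex x0 y1)) (\<lambda>\<xi>. F \<xi> / (\<xi> - w))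
     = (if w \<in> box (Complex x0 y0) (Complex x1 y1) then 2 * pi * \<i> * F w else 0)"
proof -
  define a1 a2 a3 a4 where "a1 = Complex x0 y0" and "a2 = Complex x1 y0" and "a3 = Complex x1 y1" and "a4 = Complex x0 y1"
  note a_defs = a1_def a2_def a3_def a4_def
  let ?Q = "cbox a1 a3"
  let ?f = "\<lambda>\<xi>. F \<xi> / (\<xi> - w)"
  have pim: "path_image (rectpath a1 a3) = ?Q - box a1 a3"
    using xy by (intro path_image_rectpath_cbox_minus_box) (auto simp: a_defs)
  have wn: "w \<notin> path_image (rectpath a1 a3)" using w by (auto simp: pim[unfolded a_defs] a_defs)
  have rp: "rectpath a1 a3 = linepath a1 a2 +++ linepath a2 a3 +++ linepath a3 a4 +++ linepath a4 a1"
    by (simp add: rectpath_def Let_def a_defs)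
  have pi: "path_image (rectpath a1 a3) = closed_segment a1 a2 \<union> closed_segment a2 a3 \<union> closed_segment a3 a4 \<union> closed_segment a4 a1"
    by (simp add: rp path_image_join Un_assoc)
  have cont: "continuous_on (path_image (rectpath a1 a3)) ?f"
    using wn pim by (intro continuous_intros continuous_on_subset[OF holomorphic_on_imp_continuous_on[OF F]]) (auto simp: a_defs)
  have ci: "?f contour_integrable_on linepath a1 a2" "?f contour_integrable_on linepath a2 a3"
    "?f contour_integrable_on linepath a3 a4" "?f contour_integrable_on linepath a4 a1"
    using cont unfolding pi by (auto intro!: contour_integrable_continuous_linepath elim: continuous_on_subset)
  have rev: "contour_integral (linepath a3 a4) ?f = - contour_integral (linepath a4 a3) ?f"
    "contour_integral (linepath a4 a1) ?f = - contour_integral (linepath a1 a4) ?f"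
    using cont unfolding pi by (auto intro!: contour_integral_reverse_linepath elim: continuous_on_subset)
  have "contour_integral (rectpath a1 a3) ?f = contour_integral (linepath a1 a2) ?f
     + (contour_integral (linepath a2 a3) ?f + (contour_integral (linepath a3 a4) ?f + contour_integral (linepath a4 a1) ?f))"
    unfolding rp using ci by (simp add: contour_integrable_join)
  moreover define val where "val = (if w \<in> box a1 a3 then 2 * pi * \<i> * F w else 0)"
  have "contour_integral (rectpath a1 a3) ?f = val"
  proof (cases "w \<in> box a1 a3")
    case True
    have "(?f has_contour_integral (2 * pi * \<i> * winding_number (rectpath a1 a3) w * F w)) (rectpath a1 a3)"
      using F True pim by (intro Cauchy_integral_formula_convex_simple[of ?Q]) (auto simp: a_defs interior_cbox)
    then show ?thesis using True winding_number_rectpath[OF True] by (simp add: contour_integral_unique val_def)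
  next
    case False
    then have wQ: "w \<notin> ?Q" using w by (simp add: a_defs)
    have "(?f has_contour_integral 0) (rectpath a1 a3)"
      using F wQ pim by (intro Cauchy_theorem_convex_simple[of _ ?Q] holomorphic_intros) (auto simp: a_defs)
    then show ?thesis using False by (simp add: contour_integral_unique val_def)
  qed
  ultimately have "contour_integral (linepath a1 a2) ?f + contour_integral (linepath a2 a3) ?f
      - contour_integral (linepath a4 a3) ?f - contour_integral (linepath a1 a4) ?f = val"
    unfolding rev by (simp add: algebra_simps)
  then show ?thesis unfolding val_def a_defs .
qed

lemma sum_shift_int: "(\<Sum>j\<in>{l..<u}. f (j + 1)) = (\<Sum>j\<in>{l+1..<u+1::int}. f j)"
  by (rule sum.reindex_bij_witness[of _ "\<lambda>j. j - 1" "\<lambda>j. j + 1"]) auto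

text \<open>Abel summation turns a weighted sum over cells into a sum over edges whose coefficients
  are the jumps of the weight. This version serves the horizontal edges, as the weight vanishes in
  the extreme rows; the next one keeps the end terms for the vertical edges.\<close>

lemma sum_by_parts_zero_ends:
  fixes g :: "int \<Rightarrow> complex"
  assumes "l \<le> u" "a (l - 1) = 0" "a u = 0"
  shows "(\<Sum>j\<in>{l..<u}. a j * (g j - g (j + 1))) = (\<Sum>j\<in>{l..u}. (a j - a (j - 1)) * g j)"
proof -
  have "(\<Sum>j\<in>{l..<u}. a j * g (j + 1)) = (\<Sum>j\<in>{l+1..<u+1}. a (j - 1) * g j)"
    using sum_shift_int[of "\<lambda>j. a (j - 1) * g j" l u] by simp
  also have "\<dots> = (\<Sum>j\<in>{l..u}. a (j - 1) * g j)"
  proof -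
    have "{l..u} = insert l {l+1..<u+1}" using assms(1) by auto
    then show ?thesis using assms(2) by simp
  qed
  finally have 1: "(\<Sum>j\<in>{l..<u}. a j * g (j + 1)) = (\<Sum>j\<in>{l..u}. a (j - 1) * g j)" .
  have "{l..u} = insert u {l..<u}" using assms(1) by auto
  then have 2: "(\<Sum>j\<in>{l..u}. a j * g j) = (\<Sum>j\<in>{l..<u}. a j * g j)" using assms(3) by simp
  show ?thesis by (simp add: right_diff_distrib left_diff_distrib sum_subtractf 1 2)
qed

lemma sum_by_parts_ends:
  fixes g :: "int \<Rightarrow> complex"
  assumes "l < u"
  shows "(\<Sum>i\<in>{l..<u}. a i * (g (i + 1) - g i))
     = (\<Sum>i\<in>{l+1..<u}. (a (i - 1) - a i) * g i) + (a (u - 1) * g u - a l * g l)"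
proof -
  have "(\<Sum>i\<in>{l..<u}. a i * g (i + 1)) = (\<Sum>i\<in>{l+1..<u+1}. a (i - 1) * g i)"
    using sum_shift_int[of "\<lambda>i. a (i - 1) * g i" l u] by simp
  also have "{l+1..<u+1} = insert u {l+1..<u}" using assms by auto
  finally have 1: "(\<Sum>i\<in>{l..<u}. a i * g (i + 1)) = a (u - 1) * g u + (\<Sum>i\<in>{l+1..<u}. a (i - 1) * g i)" by simp
  have "{l..<u} = insert l {l+1..<u}" using assms by auto
  then have 2: "(\<Sum>i\<in>{l..<u}. a i * g i) = a l * g l + (\<Sum>i\<in>{l+1..<u}. a i * g i)" by simp
  show ?thesis by (simp add: right_diff_distrib left_diff_distrib sum_subtractf 1 2)
qed

text \<open>The subtracted term makes the induction telescope; only the bound 4 is used.\<close>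

lemma inverse_square_sum_le: "(\<Sum>i\<in>{- int n..int n}. 1 / (1 + \<bar>real_of_int i\<bar>)\<^sup>2) \<le> 4 - 2 / (real n + 1)"
proof (induction n)
  case (Suc n)
  have "{- int (Suc n)..int (Suc n)} = insert (- int n - 1) (insert (int n + 1) {- int n..int n})" by auto
  then have "(\<Sum>i\<in>{- int (Suc n)..int (Suc n)}. 1 / (1 + \<bar>real_of_int i\<bar>)\<^sup>2)
    = 2 / (real n + 2)\<^sup>2 + (\<Sum>i\<in>{- int n..int n}. 1 / (1 + \<bar>real_of_int i\<bar>)\<^sup>2)"
    by (simp add: add_ac)
  also have "\<dots> \<le> 2 / (real n + 2)\<^sup>2 + (4 - 2 / (real n + 1))" using Suc by simp
  also have "2 / (real n + 2)\<^sup>2 \<le> 2 / ((real n + 1) * (real n + 2))"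
    by (intro divide_left_mono) (auto simp: power2_eq_square intro!: mult_right_mono)
  also have "2 / ((real n + 1) * (real n + 2)) + (4 - 2 / (real n + 1)) = 4 - 2 / (real (Suc n) + 1)"
    by (simp add: divide_simps) (simp add: algebra_simps)
  finally show ?case by simp
qed simp

lemma riemann_sum_error:
  fixes f :: "real \<Rightarrow> complex"
  assumes f: "continuous_on {0..1} f" and N: "0 < N"
    and osc: "\<And>t t'. 0 \<le> t \<Longrightarrow> t \<le> t' \<Longrightarrow> t' \<le> 1 \<Longrightarrow> t' - t \<le> 1 / real N \<Longrightarrow> cmod (f t' - f t) \<le> \<epsilon>"
  shows "cmod (integral {0..1} f - (\<Sum>k<N. of_real (1 / real N) * f (real k / real N))) \<le> \<epsilon>"
proof -
  have "n \<le> N \<Longrightarrow> cmod (integral {0..real n / real N} f - (\<Sum>k<n. of_real (1 / real N) * f (real k / real N))) \<le> \<epsilon> * (real n / real N)" for n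
  proof (induction n)
    case (Suc n)
    define a b where "a = real n / real N" and "b = real (Suc n) / real N"
    have ab: "0 \<le> a" "a \<le> b" "b \<le> 1" "b - a = 1 / real N"
      using Suc.prems N by (auto simp: a_def b_def field_simps)
    have int: "f integrable_on {0..b}"
      using ab by (intro integrable_continuous_real continuous_on_subset[OF f]) auto
    have intab: "f integrable_on {a..b}"
      using ab by (intro integrable_continuous_real continuous_on_subset[OF f]) auto
    have "integral {0..b} f = integral {0..a} f + integral {a..b} f"
      using ab int by (intro Henstock_Kurzweil_Integration.integral_combine[symmetric])
    moreover have "cmod (integral {a..b} f - of_real (1 / real N) * f a) \<le> \<epsilon> * (1 / real N)"
    proof -
      have "((\<lambda>t. f t - f a) has_integral (integral {a..b} f - (b - a) *\<^sub>R f a)) {a..b}"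
        using ab has_integral_const_real[of "f a" a b] by (intro has_integral_diff integrable_integral intab) auto
      then have "cmod (integral {a..b} f - (b - a) *\<^sub>R f a) \<le> \<epsilon> * Henstock_Kurzweil_Integration.content (cbox a b)"
        using ab osc[of a a] by (intro has_integral_bound[where f = "\<lambda>t. f t - f a"]) (auto intro!: osc)
      then show ?thesis using ab by (simp add: scaleR_conv_of_real)
    qed
    ultimately have "cmod (integral {0..b} f - (\<Sum>k<Suc n. of_real (1 / real N) * f (real k / real N)))
      \<le> \<epsilon> * (real n / real N) + \<epsilon> * (1 / real N)"
      using norm_triangle_ineq[of "integral {0..a} f - (\<Sum>k<n. of_real (1 / real N) * f (real k / real N))" "integral {a..b} f - of_real (1 / real N) * f a"] Suc
      by (simp add: a_def[symmetric] algebra_simps)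
    then show ?case by (simp add: b_def add_divide_distrib distrib_left)
  qed auto
  from this[of N] show ?thesis using N by simp
qed

text \<open>\<open>s\<close> is the mesh size. The neighbourhood of radius 3 s leaves room for a
  layer of cells around \<open>\<Omega>\<close>, and the quadratic decay of \<open>F\<close> makes
  sums over infinitely many columns converge.\<close>

locale grid = strip_map +
  fixes s D :: real and F :: "complex \<Rightarrow> complex"
  assumes s: "0 < s" and D: "0 \<le> D"
    and recip: "\<And>\<xi>. \<xi> \<notin> closure (h ` unit_disc) \<Longrightarrow> inM (\<lambda>z. 1 / (h z - \<xi>))"
    and F_hol: "F holomorphic_on (\<Union>w\<in>h ` unit_disc. ball w (3 * s))"
    and F_bd: "\<And>\<xi>. \<xi> \<in> (\<Union>w\<in>h ` unit_disc. ball w (3 * s)) \<Longrightarrow> cmod (F \<xi>) \<le> D / (1 + \<bar>Re \<xi>\<bar>)\<^sup>2"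
begin

abbreviation U :: "complex set" where "U \<equiv> (\<Union>w\<in>h ` unit_disc. ball w (3 * s))"

definition edge :: "complex \<Rightarrow> complex \<Rightarrow> complex \<Rightarrow> complex" where
  "edge a b w = contour_integral (linepath a b) (\<lambda>\<xi>. F \<xi> / (\<xi> - w))"

text \<open>Riemann sums of the edge integral are linear combinations of the functions 1 / (h -
  \<xi>). As the edge keeps the distance \<open>s\<close> from \<open>\<Omega>\<close>, the
  integrands are equicontinuous along the edge, uniformly in the point of \<open>\<Omega>\<close>,
  and the sums converge uniformly.\<close>

lemma
  assumes seg: "closed_segment a b \<subseteq> U" and far: "\<And>x w. x \<in> closed_segment a b \<Longrightarrow> w \<in> \<Omega> \<Longrightarrow> s \<le> cmod (x - w)"
  shows edge_inM: "inM (\<lambda>z. edge a b (h z))"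
    and edge_bound: "\<And>E w. (\<And>x. x \<in> closed_segment a b \<Longrightarrow> cmod (F x) \<le> E) \<Longrightarrow> w \<in> \<Omega> \<Longrightarrow> cmod (edge a b w) \<le> E / s * cmod (b - a)"
proof -
  have Fc: "continuous_on (closed_segment a b) F"
    using seg by (intro continuous_on_subset[OF holomorphic_on_imp_continuous_on[OF F_hol]])
  have ne: "x \<noteq> w" if "x \<in> closed_segment a b" "w \<in> \<Omega>" for x w using far[OF that] s by auto
  have cont: "continuous_on (closed_segment a b) (\<lambda>\<xi>. F \<xi> / (\<xi> - w))" if "w \<in> \<Omega>" for w
    using ne[OF _ that] by (intro continuous_intros Fc) auto
  show "cmod (edge a b w) \<le> E / s * cmod (b - a)"
    if E: "\<And>x. x \<in> closed_segment a b \<Longrightarrow> cmod (F x) \<le> E" and w: "w \<in> \<Omega>" for E w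
    unfolding edge_def
  proof (rule contour_integral_bound_linepath)
    show "(\<lambda>\<xi>. F \<xi> / (\<xi> - w)) contour_integrable_on linepath a b"
      by (rule contour_integrable_continuous_linepath[OF cont[OF w]])
    show "0 \<le> E / s" using order_trans[OF norm_ge_zero E[of a]] s by simp
    show "cmod (F x / (x - w)) \<le> E / s" if "x \<in> closed_segment a b" for x
      using far[OF that w] E[OF that] s order_trans[OF norm_ge_zero E[OF that]]
      by (auto simp: norm_divide intro!: frac_le)
  qed
  define l where "l = linepath a b"
  have lseg: "l t \<in> closed_segment a b" if "0 \<le> t" "t \<le> 1" for t
    using that linepath_in_path[of t a b] by (simp add: l_def)
  have lc: "continuous_on A l" for A unfolding l_def by (rule continuous_on_linepath)
  have Flc: "continuous_on {0..1} (\<lambda>t. F (l t))"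
    by (rule continuous_on_compose2[OF Fc lc]) (use lseg in auto)
  have edge_eq: "edge a b w = (b - a) * integral {0..1} (\<lambda>t. F (l t) / (l t - w))" for w
    unfolding edge_def contour_integral_integral integral_mult_right[symmetric] by (simp add: l_def mult.commute)
  have approx: "\<exists>v. inM v \<and> (\<forall>z. cmod z < 1 \<longrightarrow> cmod (edge a b (h z) - v z) \<le> \<epsilon>)" if \<epsilon>: "0 < \<epsilon>" for \<epsilon>
  proof -
    obtain K where "\<forall>x\<in>(\<lambda>t. F (l t)) ` {0..1}. cmod x \<le> K"
      using compact_imp_bounded[OF compact_continuous_image[OF Flc compact_Icc]] unfolding bounded_iff by blast
    then have K: "\<And>t. t \<in> {0..1} \<Longrightarrow> cmod (F (l t)) \<le> K" by blast
    have K0: "0 \<le> K" using order_trans[OF norm_ge_zero K[of 0]] by simp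
    define \<eta> where "\<eta> = \<epsilon> / (2 * (cmod (b - a) + 1))"
    have \<eta>: "0 < \<eta>" using \<epsilon> by (simp add: \<eta>_def add_nonneg_pos)
    have "uniformly_continuous_on {0..1} (\<lambda>t. F (l t))"
      by (rule compact_uniformly_continuous[OF Flc compact_Icc])
    then obtain d1 where d1: "0 < d1" "\<And>t t'. t \<in> {0..1} \<Longrightarrow> t' \<in> {0..1} \<Longrightarrow> dist t' t < d1 \<Longrightarrow> dist (F (l t')) (F (l t)) < \<eta> * s"
      unfolding uniformly_continuous_on_def using \<eta> s by (metis mult_pos_pos)
    have "uniformly_continuous_on {0..1} l"
      by (rule compact_uniformly_continuous[OF lc compact_Icc])
    moreover have "0 < \<eta> * s\<^sup>2 / (K + 1)" using \<eta> s K0 by simp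
    ultimately obtain d2 where d2: "0 < d2" "\<And>t t'. t \<in> {0..1} \<Longrightarrow> t' \<in> {0..1} \<Longrightarrow> dist t' t < d2 \<Longrightarrow> dist (l t') (l t) < \<eta> * s\<^sup>2 / (K + 1)"
      unfolding uniformly_continuous_on_def by metis
    obtain N where N: "0 < N" "1 / real N < min d1 d2"
      using real_arch_inverse[of "min d1 d2"] d1 d2 by (auto simp: inverse_eq_divide)
    define v where "v = (\<lambda>z. (b - a) * (\<Sum>k<N. of_real (1 / real N) * (- F (l (real k / real N)) * (1 / (h z - l (real k / real N))))))"
    have "inM v"
      unfolding v_def
    proof (intro inM_cmult inM_sum finite_lessThan)
      fix k assume "k \<in> {..<N}"
      then have ls: "l (real k / real N) \<in> closed_segment a b" by (intro lseg) auto
      have "l (real k / real N) \<notin> closure \<Omega>"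
      proof
        assume "l (real k / real N) \<in> closure \<Omega>"
        then obtain w where "w \<in> \<Omega>" "dist w (l (real k / real N)) < s"
          using s closure_approachable[of _ \<Omega>] by blast
        then show False using far[OF ls] by (force simp: dist_norm norm_minus_commute)
      qed
      then show "inM (\<lambda>z. 1 / (h z - l (real k / real N)))" by (rule recip)
    qed
    moreover have "cmod (edge a b (h z) - v z) \<le> \<epsilon>" if z: "cmod z < 1" for z
    proof -
      have w: "h z \<in> \<Omega>" using z by simp
      define g where "g = (\<lambda>t. F (l t) / (l t - h z))"
      have v_eq: "v z = (b - a) * (\<Sum>k<N. of_real (1 / real N) * g (real k / real N))"
      proof -
        have "- F x * (1 / (h z - x)) = F x / (x - h z)" for x
          by (metis minus_diff_eq minus_divide_left minus_divide_right mult.right_neutral times_divide_eq_right)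
        then show ?thesis by (simp only: v_def g_def)
      qed
      have lz: "l t - h z \<noteq> 0" if "t \<in> {0..1}" for t using ne[OF lseg w] that by auto
      have gc: "continuous_on {0..1} g"
        unfolding g_def using lz by (intro continuous_intros Flc lc) auto
      have osc: "cmod (g t' - g t) \<le> 2 * \<eta>" if t: "0 \<le> t" "t \<le> t'" "t' \<le> 1" "t' - t \<le> 1 / real N" for t t'
      proof -
        have tt: "t \<in> {0..1}" "t' \<in> {0..1}" "dist t' t < d1" "dist t' t < d2" using t N by (auto simp: dist_real_def)
        have f1: "s \<le> cmod (l t - h z)" "s \<le> cmod (l t' - h z)" using far[OF lseg w] t by auto
        have "g t' - g t = (F (l t') - F (l t)) / (l t' - h z) + F (l t) * (l t - l t') / ((l t' - h z) * (l t - h z))"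
          using lz[OF tt(1)] lz[OF tt(2)] by (simp add: g_def divide_simps) (simp add: algebra_simps)
        then have "cmod (g t' - g t) \<le> cmod (F (l t') - F (l t)) / cmod (l t' - h z) + cmod (F (l t)) * cmod (l t - l t') / (cmod (l t' - h z) * cmod (l t - h z))"
          by (metis norm_triangle_ineq norm_divide norm_mult)
        also have "\<dots> \<le> (\<eta> * s) / s + (K + 1) * (\<eta> * s\<^sup>2 / (K + 1)) / (s * s)"
          using d1(2)[OF tt(1-3)] d2(2)[OF tt(1,2,4)] f1 s K[OF tt(1)] K0 \<eta>
          by (intro add_mono frac_le mult_mono) (auto simp: dist_norm norm_minus_commute)
        also have "\<dots> = 2 * \<eta>" using s K0 by (simp add: power2_eq_square)
        finally show ?thesis .
      qed
      have "cmod (integral {0..1} g - (\<Sum>k<N. of_real (1 / real N) * g (real k / real N))) \<le> 2 * \<eta>"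
        by (rule riemann_sum_error[OF gc N(1) osc])
      then have "cmod (b - a) * cmod (integral {0..1} g - (\<Sum>k<N. of_real (1 / real N) * g (real k / real N))) \<le> cmod (b - a) * (2 * \<eta>)"
        by (intro mult_left_mono) auto
      moreover have "edge a b (h z) - v z = (b - a) * (integral {0..1} g - (\<Sum>k<N. of_real (1 / real N) * g (real k / real N)))"
        by (simp only: edge_eq v_eq g_def right_diff_distrib)
      moreover have "cmod (b - a) * (2 * \<eta>) \<le> \<epsilon>"
        using \<epsilon> by (simp add: \<eta>_def divide_le_eq add_nonneg_pos mult_left_mono distrib_left)
      ultimately show ?thesis by (simp add: norm_mult)
    qed
    ultimately show ?thesis by blast
  qed
  \<comment> \<open>Holomorphy is inherited from the uniform approximants, which spares
    differentiation under the integral.\<close>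
  have holo: "(\<lambda>z. edge a b (h z)) holomorphic_on unit_disc"
  proof (rule holomorphic_uniform_sequence[OF open_ball])
    define v where "v = (\<lambda>n::nat. SOME v. inM v \<and> (\<forall>z. cmod z < 1 \<longrightarrow> cmod (edge a b (h z) - v z) \<le> 1 / (real n + 1)))"
    have v: "inM (v n)" "\<And>z. cmod z < 1 \<Longrightarrow> cmod (edge a b (h z) - v n z) \<le> 1 / (real n + 1)" for n
      using someI_ex[OF approx[of "1 / (real n + 1)"]] by (auto simp: v_def)
    show "v n holomorphic_on unit_disc" for n by (rule inM_holomorphic[OF v(1)])
    fix x :: complex assume x: "x \<in> unit_disc"
    then obtain d where d: "0 < d" "cball x d \<subseteq> unit_disc" using open_contains_cball by (metis open_ball)
    have "uniform_limit (cball x d) v (\<lambda>z. edge a b (h z)) sequentially"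
    proof (rule uniform_limitI)
      fix e :: real assume "0 < e"
      have "(\<lambda>n. 1 / (real n + 1)) \<longlonglongrightarrow> 0" by real_asymp
      then have "\<forall>\<^sub>F n in sequentially. 1 / (real n + 1) < e" using \<open>0 < e\<close> by (rule order_tendstoD)
      then show "\<forall>\<^sub>F n in sequentially. \<forall>z\<in>cball x d. dist (v n z) (edge a b (h z)) < e"
      proof eventually_elim
        case (elim n)
        show ?case
        proof
          fix z assume "z \<in> cball x d"
          then have "cmod z < 1" using d by auto
          then show "dist (v n z) (edge a b (h z)) < e" using v(2)[of z n] elim by (simp add: dist_norm norm_minus_commute)
        qed
      qed
    qed
    then show "\<exists>d>0. cball x d \<subseteq> unit_disc \<and> uniform_limit (cball x d) v (\<lambda>z. edge a b (h z)) sequentially"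
      using d by blast
  qed
  show "inM (\<lambda>z. edge a b (h z))"
    by (rule inM_uniform_limit[OF holo approx])
qed

section \<open>Cells of the grid near the domain, and the edges that separate them from the
  others\<close>

definition pt :: "int \<Rightarrow> int \<Rightarrow> complex" where
  "pt i j = Complex (s * of_int i) (s * of_int j)"

definition cell :: "int \<Rightarrow> int \<Rightarrow> complex set" where
  "cell i j = cbox (pt i j) (pt (i + 1) (j + 1))"

definition mid :: "int \<Rightarrow> int \<Rightarrow> complex" where
  "mid i j = Complex (s * (of_int i + 1/2)) (s * (of_int j + 1/2))"

text \<open>A cell lies within \<open>s\<close> of its midpoint. So the threshold 2 s puts near
  cells inside \<open>U\<close>, while all points of the other cells keep the distance
  \<open>s\<close> from \<open>\<Omega>\<close>.\<close>

definition near :: "int \<Rightarrow> int \<Rightarrow> bool" where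
  "near i j \<longleftrightarrow> (\<exists>w\<in>\<Omega>. cmod (mid i j - w) < 2 * s)"

definition wt :: "int \<Rightarrow> int \<Rightarrow> complex" where
  "wt i j = (if near i j then 1 else 0)"

definition hor :: "int \<Rightarrow> int \<Rightarrow> complex \<Rightarrow> complex" where
  "hor i j = edge (pt i j) (pt (i + 1) j)"

definition ver :: "int \<Rightarrow> int \<Rightarrow> complex \<Rightarrow> complex" where
  "ver i j = edge (pt i j) (pt i (j + 1))"

lemma cell_iff: "x \<in> cell i j \<longleftrightarrow>
    s * of_int i \<le> Re x \<and> Re x \<le> s * of_int i + s \<and> s * of_int j \<le> Im x \<and> Im x \<le> s * of_int j + s"
  by (auto simp: cell_def pt_def in_cbox_complex_iff algebra_simps)

lemma cell_mid: "x \<in> cell i j \<Longrightarrow> cmod (x - mid i j) \<le> s"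
proof -
  assume "x \<in> cell i j"
  moreover have "Re (mid i j) = s * of_int i + s / 2" "Im (mid i j) = s * of_int j + s / 2"
    by (simp_all add: mid_def algebra_simps)
  ultimately have "\<bar>Re x - Re (mid i j)\<bar> \<le> s / 2" "\<bar>Im x - Im (mid i j)\<bar> \<le> s / 2"
    unfolding cell_iff by linarith+
  then have "\<bar>Re (x - mid i j)\<bar> \<le> s / 2" "\<bar>Im (x - mid i j)\<bar> \<le> s / 2" by simp_all
  then show ?thesis using cmod_le[of "x - mid i j"] by linarith
qed

lemma near_cell_subset: "near i j \<Longrightarrow> cell i j \<subseteq> U"
proof
  fix x assume "near i j" "x \<in> cell i j"
  then obtain w where w: "w \<in> \<Omega>" "cmod (mid i j - w) < 2 * s" by (auto simp: near_def)
  have "cmod (x - w) \<le> cmod (x - mid i j) + cmod (mid i j - w)" using norm_triangle_ineq[of "x - mid i j" "mid i j - w"] by simp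
  then have "cmod (x - w) < 3 * s" using w(2) cell_mid[OF \<open>x \<in> cell i j\<close>] by linarith
  then have "x \<in> ball w (3 * s)" by (simp add: dist_norm norm_minus_commute)
  then show "x \<in> U" using w(1) by blast
qed

lemma far_cell: "\<not> near i j \<Longrightarrow> x \<in> cell i j \<Longrightarrow> w \<in> \<Omega> \<Longrightarrow> s \<le> cmod (x - w)"
proof -
  assume "\<not> near i j" "x \<in> cell i j" "w \<in> \<Omega>"
  then have "2 * s \<le> cmod (mid i j - w)" by (auto simp: near_def not_less)
  also have "\<dots> \<le> cmod (mid i j - x) + cmod (x - w)" using norm_triangle_ineq[of "mid i j - x" "x - w"] by simp
  finally show ?thesis using cell_mid[OF \<open>x \<in> cell i j\<close>] by (simp add: norm_minus_commute)
qed

lemma segment_cell: "a \<in> cell i j \<Longrightarrow> b \<in> cell i j \<Longrightarrow> closed_segment a b \<subseteq> cell i j"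
  unfolding cell_def by (intro closed_segment_subset convex_box)

lemma hor_cells: "closed_segment (pt i j) (pt (i + 1) j) \<subseteq> cell i j" "closed_segment (pt i j) (pt (i + 1) j) \<subseteq> cell i (j - 1)"
  using s by (intro segment_cell; simp add: cell_iff pt_def algebra_simps)+

lemma ver_cells: "closed_segment (pt i j) (pt i (j + 1)) \<subseteq> cell i j" "closed_segment (pt i j) (pt i (j + 1)) \<subseteq> cell (i - 1) j"
  using s by (intro segment_cell; simp add: cell_iff pt_def algebra_simps)+

text \<open>For a point in column i one has s |i| \<le> |Re x| + s, hence 1 + |i| \<le> (2 + 1 / s)
  (1 + |Re x|); this converts the decay of \<open>F\<close> into decay in the column index.\<close>

definition E :: real where "E = D * (2 + 1 / s)\<^sup>2"

lemma E_nonneg: "0 \<le> E"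
  using D s by (simp add: E_def)

lemma F_column:
  assumes "x \<in> U" "s * of_int i \<le> Re x" "Re x \<le> s * of_int i + s"
  shows "cmod (F x) \<le> E / (1 + \<bar>real_of_int i\<bar>)\<^sup>2"
proof -
  have "s * \<bar>real_of_int i\<bar> \<le> \<bar>Re x\<bar> + s" using assms s by (auto simp: abs_if algebra_simps)
  then have "\<bar>real_of_int i\<bar> \<le> \<bar>Re x\<bar> / s + 1" using s by (simp add: field_simps)
  moreover have "(2 + 1 / s) * (1 + \<bar>Re x\<bar>) = 2 + 2 * \<bar>Re x\<bar> + 1 / s + \<bar>Re x\<bar> / s" by (simp add: algebra_simps)
  moreover have "0 \<le> 1 / s" using s by simp
  ultimately have "1 + \<bar>real_of_int i\<bar> \<le> (2 + 1 / s) * (1 + \<bar>Re x\<bar>)" by linarith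
  then have "(1 + \<bar>real_of_int i\<bar>)\<^sup>2 \<le> ((2 + 1 / s) * (1 + \<bar>Re x\<bar>))\<^sup>2" by (intro power_mono) auto
  then have "D * (1 + \<bar>real_of_int i\<bar>)\<^sup>2 \<le> D * ((2 + 1 / s)\<^sup>2 * (1 + \<bar>Re x\<bar>)\<^sup>2)"
    using D by (intro mult_left_mono) (auto simp: power_mult_distrib)
  then have "D / (1 + \<bar>Re x\<bar>)\<^sup>2 \<le> E / (1 + \<bar>real_of_int i\<bar>)\<^sup>2"
    by (simp add: E_def field_simps add_pos_nonneg)
  then show ?thesis using F_bd[OF assms(1)] by linarith
qed

text \<open>The weights differ exactly when the edge separates a near cell from another one. As part
  of the first it lies in \<open>U\<close>, as part of the second it stays away from
  \<open>\<Omega>\<close>.\<close>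

lemma
  assumes "wt i j \<noteq> wt i (j - 1)"
  shows hor_inM: "inM (\<lambda>z. hor i j (h z))"
    and hor_bound: "\<And>w. w \<in> \<Omega> \<Longrightarrow> cmod (hor i j w) \<le> E / (1 + \<bar>real_of_int i\<bar>)\<^sup>2"
proof -
  let ?S = "closed_segment (pt i j) (pt (i + 1) j)"
  consider "near i j" "\<not> near i (j - 1)" | "\<not> near i j" "near i (j - 1)"
    using assms by (auto simp: wt_def split: if_splits)
  then have *: "?S \<subseteq> U \<and> (\<forall>x\<in>?S. \<forall>w\<in>\<Omega>. s \<le> cmod (x - w))"
    by cases (use hor_cells[of i j] near_cell_subset far_cell in \<open>meson subset_eq\<close>)+
  then have sub: "?S \<subseteq> U" and far: "\<And>x w. x \<in> ?S \<Longrightarrow> w \<in> \<Omega> \<Longrightarrow> s \<le> cmod (x - w)" by blast+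
  show "inM (\<lambda>z. hor i j (h z))" unfolding hor_def by (rule edge_inM[OF sub far])
  fix w assume w: "w \<in> \<Omega>"
  have "cmod (hor i j w) \<le> E / (1 + \<bar>real_of_int i\<bar>)\<^sup>2 / s * cmod (pt (i + 1) j - pt i j)"
    unfolding hor_def
  proof (rule edge_bound[OF sub far _ w])
    fix x assume x: "x \<in> ?S"
    then have "x \<in> U" "x \<in> cell i j" using sub hor_cells by blast+
    then show "cmod (F x) \<le> E / (1 + \<bar>real_of_int i\<bar>)\<^sup>2" by (intro F_column) (auto simp: cell_iff)
  qed
  moreover have "pt (i + 1) j - pt i j = of_real s" by (simp add: pt_def complex_eq_iff algebra_simps)
  ultimately show "cmod (hor i j w) \<le> E / (1 + \<bar>real_of_int i\<bar>)\<^sup>2" using s by simp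
qed

lemma pt_ver: "pt i (j + 1) - pt i j = \<i> * of_real s"
  by (simp add: pt_def complex_eq_iff algebra_simps)

lemma
  assumes "wt i j \<noteq> wt (i - 1) j"
  shows ver_inM: "inM (\<lambda>z. ver i j (h z))"
    and ver_bound: "\<And>w. w \<in> \<Omega> \<Longrightarrow> cmod (ver i j w) \<le> E / (1 + \<bar>real_of_int i\<bar>)\<^sup>2"
proof -
  let ?S = "closed_segment (pt i j) (pt i (j + 1))"
  consider "near i j" "\<not> near (i - 1) j" | "\<not> near i j" "near (i - 1) j"
    using assms by (auto simp: wt_def split: if_splits)
  then have *: "?S \<subseteq> U \<and> (\<forall>x\<in>?S. \<forall>w\<in>\<Omega>. s \<le> cmod (x - w))"
    by cases (use ver_cells[of i j] near_cell_subset far_cell in \<open>meson subset_eq\<close>)+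
  then have sub: "?S \<subseteq> U" and far: "\<And>x w. x \<in> ?S \<Longrightarrow> w \<in> \<Omega> \<Longrightarrow> s \<le> cmod (x - w)" by blast+
  show "inM (\<lambda>z. ver i j (h z))" unfolding ver_def by (rule edge_inM[OF sub far])
  fix w assume w: "w \<in> \<Omega>"
  have "cmod (ver i j w) \<le> E / (1 + \<bar>real_of_int i\<bar>)\<^sup>2 / s * cmod (pt i (j + 1) - pt i j)"
    unfolding ver_def
  proof (rule edge_bound[OF sub far _ w])
    fix x assume x: "x \<in> ?S"
    then have "x \<in> U" "x \<in> cell i j" using sub ver_cells by blast+
    then show "cmod (F x) \<le> E / (1 + \<bar>real_of_int i\<bar>)\<^sup>2" by (intro F_column) (auto simp: cell_iff)
  qed
  then show "cmod (ver i j w) \<le> E / (1 + \<bar>real_of_int i\<bar>)\<^sup>2" using s by (simp add: pt_ver norm_mult)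
qed

text \<open>More rows than the strip occupies: the summand 4 leaves the rows m and - m - 1 without
  near cells, so that the weights vanish there.\<close>

definition m :: int where "m = \<lceil>B / s\<rceil> + 4"

lemma near_row: "near i j \<Longrightarrow> - m < j \<and> j < m - 1"
proof -
  assume "near i j"
  then obtain z where z: "cmod z < 1" "cmod (mid i j - h z) < 2 * s" by (auto simp: near_def)
  have "\<bar>s * (of_int j + 1/2)\<bar> \<le> \<bar>Im (h z)\<bar> + \<bar>Im (mid i j - h z)\<bar>"
    by (simp add: mid_def)
  also have "\<dots> < B + 2 * s" using Im_h[OF z(1)] abs_Im_le_cmod[of "mid i j - h z"] z(2) by linarith
  finally have "s * \<bar>of_int j + 1/2\<bar> < B + 2 * s" using s by (simp add: abs_mult)
  then have "\<bar>of_int j + 1/2\<bar> < B / s + 2" using s by (simp add: field_simps)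
  moreover have "B / s \<le> of_int \<lceil>B / s\<rceil>" by simp
  ultimately have "\<bar>real_of_int j + 1/2\<bar> < of_int (m - 2)" by (simp add: m_def) linarith
  then have "real_of_int j < of_int (m - 2)" "- of_int (m - 2) - 1 < real_of_int j" by linarith+
  then show ?thesis by linarith
qed

lemma m_pos: "0 < m"
proof -
  have "0 \<le> B / s" using B_nonneg s by simp
  then have "0 \<le> \<lceil>B / s\<rceil>" by linarith
  then show ?thesis unfolding m_def by linarith
qed

lemma near_self: "w \<in> \<Omega> \<Longrightarrow> w \<in> cell i j \<Longrightarrow> near i j"
  using cell_mid[of w i j] s unfolding near_def by (intro bexI[of _ w]) (auto simp: norm_minus_commute)

text \<open>
  On the boundary of the union of the near cells with \<open>\<bar>Re\<bar> \<le> s n\<close>, \<open>PS n\<close> is the integral over the edges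
  away from \<open>\<Omega>\<close>, and \<open>QS n\<close> is the integral over the two vertical cuts that cross \<open>\<Omega>\<close>; the latter is
  small for large \<open>n\<close> by the decay of \<open>F\<close>.
\<close>

definition PS :: "int \<Rightarrow> complex \<Rightarrow> complex" where
  "PS n w = (\<Sum>i\<in>{-n..<n}. \<Sum>j\<in>{-m..m}. (wt i j - wt i (j - 1)) * hor i j w)
     + (\<Sum>j\<in>{-m..<m}. \<Sum>i\<in>{-n+1..<n}. (wt (i - 1) j - wt i j) * ver i j w)"

definition QS :: "int \<Rightarrow> complex \<Rightarrow> complex" where
  "QS n w = (\<Sum>j\<in>{-m..<m}. wt (n - 1) j * ver n j w - wt (- n) j * ver (- n) j w)"

text \<open>A point off the grid lines is interior to exactly one cell, which is near, and outside
  all others. So the rectangle formula summed over the near cells gives 2 pi \<i> F w; cells that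
  are not near have weight 0. Summation by parts cancels the inner edges, leaving those counted by
  \<open>PS\<close> and the two cuts counted by \<open>QS\<close>.\<close>

lemma grid_Cauchy:
  assumes w: "w \<in> \<Omega>" and off: "Re w / s \<notin> \<int>" "Im w / s \<notin> \<int>" and n: "0 < n" "\<bar>Re w\<bar> < s * of_int n"
  shows "2 * pi * \<i> * F w = PS n w + QS n w"
proof -
  define i0 j0 where "i0 = \<lfloor>Re w / s\<rfloor>" and "j0 = \<lfloor>Im w / s\<rfloor>"
  have strict: "of_int \<lfloor>x\<rfloor> < x \<and> x < of_int \<lfloor>x\<rfloor> + 1" if "x \<notin> \<int>" for x :: real
    using that floor_correct[of x] by (metis Ints_of_int less_eq_real_def of_int_1 of_int_add)
  have i0: "s * of_int i0 < Re w" "Re w < s * of_int i0 + s"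
    using strict[OF off(1)] s by (auto simp: i0_def field_simps)
  have j0: "s * of_int j0 < Im w" "Im w < s * of_int j0 + s"
    using strict[OF off(2)] s by (auto simp: j0_def field_simps)
  have wcell: "w \<in> cell i0 j0" using i0 j0 by (simp add: cell_iff)
  have near0: "near i0 j0" by (rule near_self[OF w wcell])
  have uniq: "i = i0" if "s * of_int i \<le> Re w" "Re w \<le> s * of_int i + s" for i
  proof -
    have "s * of_int i < s * (of_int i0 + 1)" "s * of_int i0 < s * (of_int i + 1)" using that i0 by (auto simp: algebra_simps)
    then have "real_of_int i < of_int i0 + 1" "real_of_int i0 < of_int i + 1" using s by auto
    then show ?thesis by linarith
  qed
  have uniq': "j = j0" if "s * of_int j \<le> Im w" "Im w \<le> s * of_int j + s" for j
  proof -
    have "s * of_int j < s * (of_int j0 + 1)" "s * of_int j0 < s * (of_int j + 1)" using that j0 by (auto simp: algebra_simps)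
    then have "real_of_int j < of_int j0 + 1" "real_of_int j0 < of_int j + 1" using s by auto
    then show ?thesis by linarith
  qed
  have cellval: "wt i j * (hor i j w + ver (i + 1) j w - hor i (j + 1) w - ver i j w)
     = (if i = i0 then if j = j0 then 2 * pi * \<i> * F w else 0 else 0)" for i j
  proof (cases "near i j")
    case True
    have bx: "w \<in> box (pt i j) (pt (i + 1) (j + 1)) \<longleftrightarrow> i = i0 \<and> j = j0"
    proof
      assume "w \<in> box (pt i j) (pt (i + 1) (j + 1))"
      then have "w \<in> cell i j" using box_subset_cbox by (auto simp: cell_def)
      then show "i = i0 \<and> j = j0" using uniq uniq' by (auto simp: cell_iff)
    next
      assume "i = i0 \<and> j = j0"
      then show "w \<in> box (pt i j) (pt (i + 1) (j + 1))" using i0 j0 by (simp add: in_box_complex_iff pt_def algebra_simps)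
    qed
    have "w \<in> box (pt i j) (pt (i + 1) (j + 1)) \<or> w \<notin> cbox (pt i j) (pt (i + 1) (j + 1))"
      using bx uniq uniq' by (auto simp: cell_iff simp flip: cell_def)
    then have "hor i j w + ver (i + 1) j w - hor i (j + 1) w - ver i j w
      = (if w \<in> box (pt i j) (pt (i + 1) (j + 1)) then 2 * pi * \<i> * F w else 0)"
      unfolding hor_def ver_def edge_def pt_def using s holomorphic_on_subset[OF F_hol near_cell_subset[OF True]]
      by (intro rectangle_Cauchy) (auto simp: cell_def pt_def)
    then show ?thesis using True by (simp add: wt_def bx)
  next
    case False
    then show ?thesis using near0 by (auto simp: wt_def)
  qed
  have i0n: "i0 \<in> {-n..<n}"
  proof -
    have "s * of_int i0 < s * of_int n" using i0 n(2) by linarith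
    moreover have "s * of_int (- n) < s * (of_int i0 + 1)"
      using i0 n(2) by (simp only: of_int_minus distrib_left mult_minus_right mult_1_right)
    ultimately have "real_of_int i0 < of_int n" "real_of_int (- n) < of_int i0 + 1" using s mult_less_cancel_left_pos by blast+
    then have "i0 < n" "- n < i0 + 1" by linarith+
    then show ?thesis by simp
  qed
  have j0m: "j0 \<in> {-m..<m}" using near_row[OF near0] by simp
  have "2 * pi * \<i> * F w = (\<Sum>i\<in>{-n..<n}. \<Sum>j\<in>{-m..<m}. if i = i0 then if j = j0 then 2 * pi * \<i> * F w else 0 else 0)"
  proof -
    have "(\<Sum>j\<in>{-m..<m}. if i = i0 then if j = j0 then 2 * pi * \<i> * F w else 0 else 0) = (if i = i0 then 2 * pi * \<i> * F w else 0)" for i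
      using j0m by (simp add: sum.delta)
    then show ?thesis using i0n by (simp add: sum.delta)
  qed
  also have "\<dots> = (\<Sum>i\<in>{-n..<n}. \<Sum>j\<in>{-m..<m}. wt i j * (hor i j w + ver (i + 1) j w - hor i (j + 1) w - ver i j w))"
    by (simp only: cellval)
  also have "\<dots> = (\<Sum>i\<in>{-n..<n}. \<Sum>j\<in>{-m..<m}. wt i j * (hor i j w - hor i (j + 1) w))
      + (\<Sum>i\<in>{-n..<n}. \<Sum>j\<in>{-m..<m}. wt i j * (ver (i + 1) j w - ver i j w))"
    unfolding sum.distrib[symmetric] by (intro sum.cong refl) (simp add: algebra_simps)
  also have "(\<Sum>i\<in>{-n..<n}. \<Sum>j\<in>{-m..<m}. wt i j * (hor i j w - hor i (j + 1) w))
      = (\<Sum>i\<in>{-n..<n}. \<Sum>j\<in>{-m..m}. (wt i j - wt i (j - 1)) * hor i j w)"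
  proof (rule sum.cong[OF refl])
    fix i
    show "(\<Sum>j\<in>{-m..<m}. wt i j * (hor i j w - hor i (j + 1) w)) = (\<Sum>j\<in>{-m..m}. (wt i j - wt i (j - 1)) * hor i j w)"
    proof (rule sum_by_parts_zero_ends[where a = "wt i" and g = "\<lambda>j. hor i j w"])
      show "wt i (- m - 1) = 0" using near_row[of i "- m - 1"] by (auto simp: wt_def)
      show "wt i m = 0" using near_row[of i m] by (auto simp: wt_def)
    qed (use m_pos in simp)
  qed
  also have "(\<Sum>i\<in>{-n..<n}. \<Sum>j\<in>{-m..<m}. wt i j * (ver (i + 1) j w - ver i j w))
      = (\<Sum>j\<in>{-m..<m}. \<Sum>i\<in>{-n..<n}. wt i j * (ver (i + 1) j w - ver i j w))"
    by (rule sum.swap)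
  also have "\<dots> = (\<Sum>j\<in>{-m..<m}. (\<Sum>i\<in>{-n+1..<n}. (wt (i - 1) j - wt i j) * ver i j w)
       + (wt (n - 1) j * ver n j w - wt (- n) j * ver (- n) j w))"
    using n by (intro sum.cong refl sum_by_parts_ends) auto
  finally show ?thesis by (simp add: PS_def QS_def sum.distrib)
qed

lemma PS_inM: "inM (\<lambda>z. PS n (h z))"
proof -
  have 1: "inM (\<lambda>z. (wt i j - wt i (j - 1)) * hor i j (h z))" for i j
    using inM_cmult[OF hor_inM, of i j] inM_const[of 0] by (cases "wt i j = wt i (j - 1)") auto
  have 2: "inM (\<lambda>z. (wt (i - 1) j - wt i j) * ver i j (h z))" for i j
    using inM_cmult[OF ver_inM, of i j] inM_const[of 0] by (cases "wt i j = wt (i - 1) j") auto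
  show ?thesis unfolding PS_def by (intro inM_add inM_sum 1 2) auto
qed

text \<open>There are 2 m + 1 horizontal lines and 2 m rows of vertical edges, and each contributes
  at most the sum of E / (1 + |i|)^2 over the columns, hence at most 4 E for every
  \<open>n\<close>.\<close>

definition G :: real where "G = (4 * of_int m + 1) * (4 * E)"

lemma PS_bound:
  assumes w: "w \<in> \<Omega>"
  shows "cmod (PS (int n) w) \<le> G"
proof -
  define b where "b = (\<lambda>i::int. E / (1 + \<bar>real_of_int i\<bar>)\<^sup>2)"
  have b0: "0 \<le> b i" for i using E_nonneg by (simp add: b_def)
  have wt01: "cmod (wt i j - wt i' j') \<le> 1" for i j i' j' by (simp add: wt_def)
  have 1: "cmod ((wt i j - wt i (j - 1)) * hor i j w) \<le> b i" for i j
    using mult_mono[OF wt01 hor_bound[OF _ w, of i j]] b0[of i] b_def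
    by (cases "wt i j = wt i (j - 1)") (auto simp: norm_mult)
  have 2: "cmod ((wt (i - 1) j - wt i j) * ver i j w) \<le> b i" for i j
    using mult_mono[OF wt01 ver_bound[OF _ w, of i j]] b0[of i] b_def
    by (cases "wt i j = wt (i - 1) j") (auto simp: norm_mult)
  have S: "(\<Sum>i\<in>A. b i) \<le> 4 * E" if "A \<subseteq> {- int n..int n}" for A
  proof -
    have "(\<Sum>i\<in>A. b i) \<le> (\<Sum>i\<in>{- int n..int n}. b i)" using that b0 by (intro sum_mono2) auto
    also have "\<dots> = E * (\<Sum>i\<in>{- int n..int n}. 1 / (1 + \<bar>real_of_int i\<bar>)\<^sup>2)"
      by (simp add: b_def sum_distrib_left)
    also have "\<dots> \<le> E * 4"
    proof (intro mult_left_mono E_nonneg)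
      have "0 \<le> 2 / (real n + 1)" by simp
      then show "(\<Sum>i\<in>{- int n..int n}. 1 / (1 + \<bar>real_of_int i\<bar>)\<^sup>2) \<le> 4" using inverse_square_sum_le[of n] by linarith
    qed
    finally show ?thesis by simp
  qed
  have m0: "0 \<le> real_of_int m" using m_pos by simp
  have "cmod (\<Sum>i\<in>{- int n..<int n}. \<Sum>j\<in>{-m..m}. (wt i j - wt i (j - 1)) * hor i j w)
     \<le> (\<Sum>i\<in>{- int n..<int n}. \<Sum>j\<in>{-m..m}. b i)"
    by (intro order_trans[OF norm_sum] sum_mono 1)
  also have "\<dots> = (2 * of_int m + 1) * (\<Sum>i\<in>{- int n..<int n}. b i)"
    using m_pos by (simp add: sum_distrib_left)
  also have "\<dots> \<le> (2 * of_int m + 1) * (4 * E)" using m0 by (intro mult_left_mono S) auto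
  finally have A: "cmod (\<Sum>i\<in>{- int n..<int n}. \<Sum>j\<in>{-m..m}. (wt i j - wt i (j - 1)) * hor i j w) \<le> (2 * of_int m + 1) * (4 * E)" .
  have "cmod (\<Sum>j\<in>{-m..<m}. \<Sum>i\<in>{-int n+1..<int n}. (wt (i - 1) j - wt i j) * ver i j w)
     \<le> (\<Sum>j\<in>{-m..<m}. \<Sum>i\<in>{-int n+1..<int n}. b i)"
    by (intro order_trans[OF norm_sum] sum_mono 2)
  also have "\<dots> \<le> (\<Sum>j\<in>{-m..<m}. 4 * E)" by (intro sum_mono S) auto
  also have "\<dots> = 2 * of_int m * (4 * E)" using m_pos by simp
  finally show ?thesis
    unfolding PS_def G_def using A
    by (intro order_trans[OF norm_triangle_ineq]) (simp add: algebra_simps)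
qed

text \<open>The cuts have real parts s n and - s n, hence distance at least s n / 2 from
  \<open>w\<close>. Two cuts with 2 m edges each contribute at most 2 D / n per edge.\<close>

lemma QS_bound:
  assumes w: "w \<in> \<Omega>" and n: "0 < n" "\<bar>Re w\<bar> \<le> s * of_int n / 2"
  shows "cmod (QS n w) \<le> 8 * of_int m * D / of_int n"
proof -
  have n0: "0 < real_of_int n" using n by simp
  have vb: "cmod (ver i j w) \<le> 2 * D / of_int n" if seg: "closed_segment (pt i j) (pt i (j + 1)) \<subseteq> U" and i: "\<bar>i\<bar> = n" for i j
  proof -
    have Re: "Re x = s * of_int i" if "x \<in> closed_segment (pt i j) (pt i (j + 1))" for x
    proof -
      have "x \<in> cell i j" "x \<in> cell (i - 1) j" using that ver_cells[of i j] by blast+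
      then show ?thesis by (simp add: cell_iff algebra_simps)
    qed
    have far: "s * of_int n / 2 \<le> cmod (x - w)" if "x \<in> closed_segment (pt i j) (pt i (j + 1))" for x
    proof -
      have "s * of_int n = \<bar>Re x\<bar>" using i s by (simp add: Re[OF that] abs_mult flip: of_int_abs)
      then have "s * of_int n / 2 \<le> \<bar>Re x\<bar> - \<bar>Re w\<bar>" using n(2) by linarith
      also have "\<dots> \<le> \<bar>Re (x - w)\<bar>" using abs_triangle_ineq2[of "Re x" "Re w"] by simp
      finally have "s * of_int n / 2 \<le> \<bar>Re (x - w)\<bar>" .
      then show ?thesis using abs_Re_le_cmod order_trans by blast
    qed
    have pos: "0 < s * of_int n / 2" using s n0 by simp
    have FD: "cmod (F x) \<le> D" if "x \<in> closed_segment (pt i j) (pt i (j + 1))" for x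
    proof -
      have "D / (1 + \<bar>Re x\<bar>)\<^sup>2 \<le> D / 1" using D by (intro divide_left_mono) (auto simp: one_le_power add_pos_nonneg)
      then show ?thesis using F_bd[of x] that seg by fastforce
    qed
    have "cmod (ver i j w) \<le> D / (s * of_int n / 2) * cmod (pt i (j + 1) - pt i j)"
      unfolding ver_def edge_def
    proof (rule contour_integral_bound_linepath)
      have "x \<noteq> w" if "x \<in> closed_segment (pt i j) (pt i (j + 1))" for x using far[OF that] pos by auto
      then show "(\<lambda>\<xi>. F \<xi> / (\<xi> - w)) contour_integrable_on linepath (pt i j) (pt i (j + 1))"
        using seg by (intro contour_integrable_continuous_linepath continuous_intros
             continuous_on_subset[OF holomorphic_on_imp_continuous_on[OF F_hol]]) auto
      show "0 \<le> D / (s * of_int n / 2)" using D pos by (intro divide_nonneg_pos)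
      show "cmod (F x / (x - w)) \<le> D / (s * of_int n / 2)" if "x \<in> closed_segment (pt i j) (pt i (j + 1))" for x
        unfolding norm_divide using far[OF that] FD[OF that] pos D by (intro frac_le) auto
    qed
    also have "\<dots> = 2 * D / of_int n" using s n0 by (simp add: pt_ver norm_mult)
    finally show ?thesis .
  qed
  have nn: "\<bar>n\<bar> = n" "\<bar>- n\<bar> = n" using n by auto
  have bd0: "0 \<le> 2 * D / of_int n" using D n0 by simp
  have t1: "cmod (wt (n - 1) j * ver n j w) \<le> 2 * D / of_int n" for j
  proof (cases "near (n - 1) j")
    case True
    then have "closed_segment (pt n j) (pt n (j + 1)) \<subseteq> U" using ver_cells(2)[of n j] near_cell_subset by blast
    then show ?thesis using True vb[OF _ nn(1)] by (simp add: wt_def)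
  qed (use bd0 in \<open>simp add: wt_def\<close>)
  have t2: "cmod (wt (- n) j * ver (- n) j w) \<le> 2 * D / of_int n" for j
  proof (cases "near (- n) j")
    case True
    then have "closed_segment (pt (- n) j) (pt (- n) (j + 1)) \<subseteq> U" using ver_cells(1)[of "- n" j] near_cell_subset by blast
    then show ?thesis using True vb[OF _ nn(2)] by (simp add: wt_def)
  qed (use bd0 in \<open>simp add: wt_def\<close>)
  have "cmod (QS n w) \<le> (\<Sum>j\<in>{-m..<m}. 2 * D / of_int n + 2 * D / of_int n)"
    unfolding QS_def
    by (intro order_trans[OF norm_sum] sum_mono order_trans[OF norm_triangle_ineq4] add_mono t1 t2)
  also have "\<dots> = 8 * of_int m * D / of_int n" using m_pos by simp
  finally show ?thesis .
qed

text \<open>The error \<open>e\<close> of the approximation by \<open>PS\<close> equals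
  \<open>QS\<close>, of order 1 / N, when |Re w| is less than s N / 2. For the remaining
  \<open>w\<close> it is merely bounded by \<open>W\<close>, but there |w| is at least s N / 2, so
  it is again small relative to 1 + |w|.\<close>

lemma inM_grid: "inM (\<lambda>z. F (h z))"
proof (rule inM_dominated_limit)
  have \<Omega>U: "\<Omega> \<subseteq> U" using s by force
  have op: "open \<Omega>" by (rule open_mapping_thm3[OF hol_h open_ball inj_h])
  show Fh: "(\<lambda>z. F (h z)) holomorphic_on unit_disc"
    using holomorphic_on_compose_gen[OF hol_h holomorphic_on_subset[OF F_hol \<Omega>U]] by (simp add: o_def)
  obtain k where k: "k holomorphic_on \<Omega>" "\<And>z. z \<in> unit_disc \<Longrightarrow> k (h z) = z"
    using holomorphic_has_inverse[OF hol_h open_ball inj_h] by metis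
  fix \<epsilon> :: real assume \<epsilon>: "0 < \<epsilon>"
  define W where "W = 2 * pi * D + G"
  have W0: "0 \<le> W"
  proof -
    have "0 \<le> G" using E_nonneg m_pos by (simp add: G_def)
    then show ?thesis using D by (simp add: W_def)
  qed
  obtain N :: nat where N: "0 < N" "8 * of_int m * D / real N \<le> 2 * pi * \<epsilon>" "2 * W / s / real N \<le> 2 * pi * \<epsilon>"
  proof -
    have "(\<lambda>n::nat. 8 * of_int m * D / real n) \<longlonglongrightarrow> 0" "(\<lambda>n::nat. 2 * W / s / real n) \<longlonglongrightarrow> 0"
      by (intro lim_const_over_n)+
    then have "\<forall>\<^sub>F n in sequentially. 8 * of_int m * D / real n < 2 * pi * \<epsilon>" "\<forall>\<^sub>F n in sequentially. 2 * W / s / real n < 2 * pi * \<epsilon>"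
      using \<epsilon> by (auto intro!: order_tendstoD(2))
    then have "\<forall>\<^sub>F n in sequentially. 0 < n \<and> 8 * of_int m * D / real n < 2 * pi * \<epsilon> \<and> 2 * W / s / real n < 2 * pi * \<epsilon>"
      using eventually_gt_at_top[of "0::nat"] by eventually_elim auto
    then obtain n :: nat where "0 < n \<and> 8 * of_int m * D / real n < 2 * pi * \<epsilon> \<and> 2 * W / s / real n < 2 * pi * \<epsilon>"
      unfolding eventually_sequentially by blast
    then show ?thesis by (intro that[of n]) auto
  qed
  define e where "e = (\<lambda>w. 2 * pi * \<i> * F w - PS (int N) w)"
  have ec: "continuous_on \<Omega> e"
  proof -
    have "continuous_on \<Omega> (\<lambda>w. PS (int N) (h (k w)))"
      by (rule continuous_on_compose2[OF holomorphic_on_imp_continuous_on[OF inM_holomorphic[OF PS_inM]]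
            holomorphic_on_imp_continuous_on[OF k(1)]]) (use k(2) in auto)
    moreover have "PS (int N) (h (k w)) = PS (int N) w" if "w \<in> \<Omega>" for w using that k(2) by auto
    ultimately have "continuous_on \<Omega> (PS (int N))" by (simp cong: continuous_on_cong)
    then show ?thesis unfolding e_def
      by (intro continuous_intros continuous_on_subset[OF holomorphic_on_imp_continuous_on[OF F_hol] \<Omega>U])
  qed
  have eb: "cmod (e w) \<le> 2 * pi * \<epsilon> * (1 + cmod w)" if w: "w \<in> \<Omega>" for w
  proof (cases "\<bar>Re w\<bar> < s * real N / 2")
    case True
    \<comment> \<open>Points on grid lines are reached by continuity: small moves in the direction 1
      + \<i> leave the horizontal and the vertical lines at once.\<close>
    define g where "g = (\<lambda>t::real. w + of_real t * (1 + \<i>))"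
    have gl: "(g \<longlongrightarrow> w) (at_right 0)"
    proof -
      have "(g \<longlongrightarrow> w + of_real 0 * (1 + \<i>)) (at_right 0)" unfolding g_def by (intro tendsto_intros)
      then show ?thesis by simp
    qed
    have ev1: "\<forall>\<^sub>F t in at_right 0. g t \<in> \<Omega>"
      using topological_tendstoD[OF gl op w] .
    have ev2: "\<forall>\<^sub>F t in at_right 0. \<bar>Re (g t)\<bar> < s * real N / 2"
      using order_tendstoD(2)[OF tendsto_rabs[OF tendsto_Re[OF gl]] True] .
    have offgrid: "\<forall>\<^sub>F t in at_right 0. (x + t) / s \<notin> \<int>" for x :: real
    proof -
      define \<delta> where "\<delta> = s * (of_int \<lfloor>x / s\<rfloor> + 1) - x"
      have "x / s < of_int \<lfloor>x / s\<rfloor> + 1" by linarith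
      then have \<delta>: "0 < \<delta>" using s by (simp add: \<delta>_def field_simps)
      have "(x + t) / s \<notin> \<int>" if t: "0 < t" "t < \<delta>" for t
      proof
        assume "(x + t) / s \<in> \<int>"
        then obtain q where q: "(x + t) / s = of_int q" by (auto elim: Ints_cases)
        have "x / s < of_int q" using q t s by (simp add: field_simps)
        moreover have "s * of_int q < s * (of_int \<lfloor>x / s\<rfloor> + 1)" using q t s by (simp add: \<delta>_def field_simps)
        then have "of_int q < of_int \<lfloor>x / s\<rfloor> + (1::real)" using s by simp
        moreover from \<open>x / s < of_int q\<close> have "\<lfloor>x / s\<rfloor> < q" by (simp add: floor_less_iff)
        ultimately show False by linarith
      qed
      then show ?thesis unfolding eventually_at_right_field using \<delta> by (intro exI[of _ \<delta>]) auto
    qed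
    have "\<forall>\<^sub>F t in at_right 0. cmod (e (g t)) \<le> 2 * pi * \<epsilon>"
      using ev1 ev2 offgrid[of "Re w"] offgrid[of "Im w"]
    proof eventually_elim
      case (elim t)
      have pos: "0 < s * real N" using s N by simp
      have "e (g t) = QS (int N) (g t)"
        using grid_Cauchy[OF elim(1), of "int N"] elim N(1) pos by (simp add: e_def g_def)
      also have "cmod \<dots> \<le> 8 * of_int m * D / of_int (int N)"
        using elim N by (intro QS_bound) auto
      finally show ?case using N by simp
    qed
    moreover have "((\<lambda>t. cmod (e (g t))) \<longlongrightarrow> cmod (e w)) (at_right 0)"
    proof (rule tendsto_norm)
      have "isCont e w" using ec w unfolding continuous_on_eq_continuous_at[OF op] by blast
      then show "((\<lambda>t. e (g t)) \<longlongrightarrow> e w) (at_right 0)" using gl by (rule isCont_tendsto_compose)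
    qed
    ultimately have "cmod (e w) \<le> 2 * pi * \<epsilon>" by (intro tendsto_upperbound) auto
    also have "\<dots> \<le> 2 * pi * \<epsilon> * (1 + cmod w)" using \<epsilon> by (simp add: distrib_left)
    finally show ?thesis .
  next
    case False
    then have big: "s * real N / 2 \<le> cmod w" using abs_Re_le_cmod[of w] by linarith
    have "D / (1 + \<bar>Re w\<bar>)\<^sup>2 \<le> D / 1" using D by (intro divide_left_mono) (auto simp: one_le_power add_pos_nonneg)
    then have "cmod (F w) \<le> D" using F_bd[of w] w \<Omega>U by fastforce
    then have "cmod (2 * pi * \<i> * F w) \<le> 2 * pi * D" by (simp add: norm_mult)
    then have "cmod (e w) \<le> W" unfolding e_def W_def
      using PS_bound[OF w, of N] norm_triangle_ineq4[of "2 * pi * \<i> * F w" "PS (int N) w"] by linarith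
    also have "W = 2 * W / s / real N * (s * real N / 2)" using s N by simp
    also have "\<dots> \<le> 2 * pi * \<epsilon> * (1 + cmod w)"
      using N(3) big \<epsilon> s by (intro mult_mono) auto
    finally show ?thesis .
  qed
  show "\<exists>v. inM v \<and> (\<forall>z. cmod z < 1 \<longrightarrow> cmod (F (h z) - v z) \<le> \<epsilon> * (1 + cmod (h z)))"
  proof (intro exI[of _ "\<lambda>z. 1 / (2 * pi * \<i>) * PS (int N) (h z)"] conjI allI impI)
    show "inM (\<lambda>z. 1 / (2 * pi * \<i>) * PS (int N) (h z))" by (intro inM_cmult PS_inM)
    fix z :: complex assume z: "cmod z < 1"
    have "F (h z) - 1 / (2 * pi * \<i>) * PS (int N) (h z) = e (h z) / (2 * pi * \<i>)"
      by (simp add: e_def divide_simps)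
    then have "cmod (F (h z) - 1 / (2 * pi * \<i>) * PS (int N) (h z)) = cmod (e (h z)) / (2 * pi)"
      by (simp add: norm_divide norm_mult)
    also have "\<dots> \<le> \<epsilon> * (1 + cmod (h z))" using eb[of "h z"] z by (simp add: divide_le_eq mult_ac)
    finally show "cmod (F (h z) - 1 / (2 * pi * \<i>) * PS (int N) (h z)) \<le> \<epsilon> * (1 + cmod (h z))" .
  qed
qed

end

section \<open>Density of the exponentials\<close>

text \<open>The complement is invariant under translations to the left, so each of its components
  contains a ray and is unbounded.\<close>

lemma shift_invariant_simply_connected:
  fixes U :: "complex set"
  assumes U: "open U" "connected U" and shift: "\<And>w t. w \<in> U \<Longrightarrow> 0 \<le> t \<Longrightarrow> w + of_real t \<in> U"
  shows "simply_connected U"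
  unfolding simply_connected_eq_unbounded_complement_components[OF U(1)]
proof (intro conjI ballI notI U)
  fix C assume C: "C \<in> components (- U)" and bd: "bounded C"
  obtain x where x: "x \<in> C" using in_components_nonempty[OF C] by blast
  have xU: "x \<in> - U" using x in_components_subset[OF C] by blast
  define ray where "ray = (\<lambda>t::real. x - of_real t) ` {0..}"
  have "ray \<subseteq> - U"
  proof
    fix y assume "y \<in> ray"
    then obtain t :: real where t: "0 \<le> t" "y = x - of_real t" by (auto simp: ray_def)
    show "y \<in> - U" using shift[of y t] t xU by auto
  qed
  moreover have "connected ray" unfolding ray_def by (intro connected_continuous_image continuous_intros) auto
  moreover have "x \<in> C \<inter> ray" using x by (force simp: ray_def)
  ultimately have "ray \<subseteq> C" using components_maximal[OF C] by blast
  then obtain b where b: "\<And>y. y \<in> ray \<Longrightarrow> cmod y \<le> b" using bd unfolding bounded_iff by blast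
  define t where "t = \<bar>b\<bar> + cmod x + 1"
  have "x - of_real t \<in> ray" unfolding ray_def by (rule imageI) (simp add: t_def)
  then have "cmod (x - of_real t) \<le> b" by (rule b)
  moreover have "t - cmod x \<le> cmod (x - of_real t)"
  proof -
    have "0 \<le> t" by (simp add: t_def)
    then show ?thesis using norm_triangle_ineq2[of "of_real t" x] by (simp add: norm_minus_commute)
  qed
  ultimately show False by (simp add: t_def)
qed

lemma Riemann_map_normalized:
  assumes U: "open U" "simply_connected U" "U \<noteq> UNIV" and w0: "w0 \<in> U"
  obtains \<psi> \<kappa> where "\<psi> holomorphic_on U" "\<kappa> holomorphic_on unit_disc" "\<psi> w0 = 0"
    "\<And>w. w \<in> U \<Longrightarrow> cmod (\<psi> w) < 1 \<and> \<kappa> (\<psi> w) = w" "\<And>z. cmod z < 1 \<Longrightarrow> \<kappa> z \<in> U \<and> \<psi> (\<kappa> z) = z"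
proof -
  obtain f g where f: "f holomorphic_on U" and g: "g holomorphic_on unit_disc"
    and fg: "\<And>z. z \<in> U \<Longrightarrow> f z \<in> unit_disc \<and> g (f z) = z" and gf: "\<And>z. z \<in> unit_disc \<Longrightarrow> g z \<in> U \<and> f (g z) = z"
    using simply_connected_eq_biholomorphic_to_disc[OF U(1)] U w0 by blast
  define a where "a = f w0"
  have a: "cmod a < 1" using fg[OF w0] by (simp add: a_def)
  define M where "M = Moebius_function 0"
  have Mh: "M b holomorphic_on unit_disc" if "cmod b < 1" for b
    unfolding M_def by (rule Moebius_function_holomorphic[OF that])
  have Ml: "cmod (M b z) < 1" if "cmod b < 1" "cmod z < 1" for b z
    unfolding M_def by (rule Moebius_function_norm_lt_1[OF that])
  have M1: "M a (M (- a) z) = z" if "cmod z < 1" for z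
    unfolding M_def using a that by (intro Moebius_function_compose) auto
  have M2: "M (- a) (M a z) = z" if "cmod z < 1" for z
    unfolding M_def using a that by (intro Moebius_function_compose) auto
  have a': "cmod (- a) < 1" using a by simp
  show ?thesis
  proof (rule that[of "M a \<circ> f" "g \<circ> M (- a)"])
    show "M a \<circ> f holomorphic_on U" by (rule holomorphic_on_compose_gen[OF f Mh[OF a]]) (use fg in auto)
    show "g \<circ> M (- a) holomorphic_on unit_disc" by (rule holomorphic_on_compose_gen[OF Mh[OF a'] g]) (use Ml[OF a'] in auto)
    show "(M a \<circ> f) w0 = 0" by (simp add: M_def a_def[symmetric] Moebius_function_simple)
    show "cmod ((M a \<circ> f) w) < 1 \<and> (g \<circ> M (- a)) ((M a \<circ> f) w) = w" if "w \<in> U" for w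
      using fg[OF that] Ml[OF a] M2 by auto
    show "(g \<circ> M (- a)) z \<in> U \<and> (M a \<circ> f) ((g \<circ> M (- a)) z) = z" if "cmod z < 1" for z
      using gf[of "M (- a) z"] Ml[OF a' that] M1[OF that] by auto
  qed
qed

context strip_map
begin

lemma open_\<Omega>: "open \<Omega>"
  by (rule open_mapping_thm3[OF hol_h open_ball inj_h])

lemma connected_\<Omega>: "connected \<Omega>"
  by (intro connected_continuous_image holomorphic_on_imp_continuous_on hol_h) auto

section \<open>Neighbourhoods of the Koenigs domain and their Riemann maps\<close>

definition thick :: "real \<Rightarrow> complex set" where
  "thick \<epsilon> = (\<Union>w\<in>\<Omega>. ball w \<epsilon>)"

lemma thick_Im: "x \<in> thick \<epsilon> \<Longrightarrow> \<bar>Im x\<bar> < B + \<epsilon>"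
proof -
  assume "x \<in> thick \<epsilon>"
  then obtain z where z: "cmod z < 1" "cmod (h z - x) < \<epsilon>" by (auto simp: thick_def dist_norm)
  show ?thesis using Im_h[OF z(1)] abs_Im_le_cmod[of "h z - x"] z(2) by simp
qed

lemma thick_superset: "0 < \<epsilon> \<Longrightarrow> \<Omega> \<subseteq> thick \<epsilon>"
  by (force simp: thick_def)

lemma thick_simply_connected:
  assumes "0 < \<epsilon>"
  shows "open (thick \<epsilon>)" "simply_connected (thick \<epsilon>)" "thick \<epsilon> \<noteq> UNIV"
proof -
  show op: "open (thick \<epsilon>)" by (auto simp: thick_def)
  have "thick \<epsilon> = \<Union>((\<lambda>w. \<Omega> \<union> ball w \<epsilon>) ` \<Omega>)" using thick_superset[OF assms] by (auto simp: thick_def)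
  moreover have "connected (\<Union>((\<lambda>w. \<Omega> \<union> ball w \<epsilon>) ` \<Omega>))"
  proof (rule connected_Union)
    show "connected S" if S: "S \<in> (\<lambda>w. \<Omega> \<union> ball w \<epsilon>) ` \<Omega>" for S
    proof -
      obtain w where w: "w \<in> \<Omega>" "S = \<Omega> \<union> ball w \<epsilon>" using S by blast
      have "w \<in> \<Omega> \<inter> ball w \<epsilon>" using w assms by simp
      then show ?thesis unfolding w(2) by (intro connected_Un connected_\<Omega> connected_ball) blast
    qed
    have "h 0 \<in> \<Inter>((\<lambda>w. \<Omega> \<union> ball w \<epsilon>) ` \<Omega>)" by auto
    then show "\<Inter>((\<lambda>w. \<Omega> \<union> ball w \<epsilon>) ` \<Omega>) \<noteq> {}" by blast
  qed
  ultimately have conn: "connected (thick \<epsilon>)" by simp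
  show "simply_connected (thick \<epsilon>)"
  proof (rule shift_invariant_simply_connected[OF op conn])
    fix x t assume "x \<in> thick \<epsilon>" "0 \<le> (t::real)"
    then obtain z where z: "cmod z < 1" "dist (h z) x < \<epsilon>" by (auto simp: thick_def)
    have "h z + of_real t \<in> \<Omega>" using shift[OF z(1) \<open>0 \<le> t\<close>] .
    moreover have "x + of_real t \<in> ball (h z + of_real t) \<epsilon>" using z(2) by (simp add: dist_norm)
    ultimately show "x + of_real t \<in> thick \<epsilon>" unfolding thick_def by blast
  qed
  have "\<i> * of_real (B + \<epsilon>) \<notin> thick \<epsilon>" using thick_Im[of "\<i> * of_real (B + \<epsilon>)" \<epsilon>] by auto
  then show "thick \<epsilon> \<noteq> UNIV" by blast
qed

text \<open>\<open>F\<close> need not decay, so it is multiplied by the square of \<open>y\<close>,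
  which has its pole at \<i> R above the strip, decays like 1 / |Re w|, and tends to 1 as R grows.
  The product is covered by the grid argument, and the error is at most (6 / R) |w|.\<close>

lemma inM_neighborhood:
  assumes recip: "\<And>\<xi>. \<xi> \<notin> closure \<Omega> \<Longrightarrow> inM (\<lambda>z. 1 / (h z - \<xi>))" and \<epsilon>: "0 < \<epsilon>"
    and F: "F holomorphic_on thick \<epsilon>" "\<And>w. w \<in> thick \<epsilon> \<Longrightarrow> cmod (F w) \<le> 1"
  shows "inM (\<lambda>z. F (h z))"
proof (rule inM_dominated_limit)
  have "F \<circ> h holomorphic_on unit_disc"
    using thick_superset[OF \<epsilon>] by (rule holomorphic_on_compose_gen[OF hol_h F(1)])
  then show "(\<lambda>z. F (h z)) holomorphic_on unit_disc" by (simp add: o_def)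
  fix \<eta> :: real assume \<eta>: "0 < \<eta>"
  define b where "b = B + \<epsilon>"
  have b: "0 < b" using B_nonneg \<epsilon> by (simp add: b_def)
  \<comment> \<open>The part 2 b + 2 keeps |\<i> R - w| above both R / 2 and the square root of 1 +
    (Re w)^2. The 6 is 2 times 3, from |1 - y| \<le> 2 |w| / R and |1 + y| \<le> 3.\<close>
  define R where "R = 2 * b + 2 + 6 / \<eta>"
  have R: "2 * b + 2 \<le> R" "6 / \<eta> \<le> R" using \<eta> b by (auto simp: R_def)
  define y where "y = (\<lambda>w. \<i> * of_real R / (\<i> * of_real R - w))"
  have den: "1 + (Re w)\<^sup>2 \<le> (cmod (\<i> * of_real R - w))\<^sup>2" "R / 2 \<le> cmod (\<i> * of_real R - w)" if "w \<in> thick \<epsilon>" for w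
  proof -
    have "\<bar>Im w\<bar> < b" using thick_Im[OF that] by (simp add: b_def)
    then have *: "R - b \<le> R - Im w" by linarith
    have "1 \<le> R - Im w" using * R b by linarith
    then have "1\<^sup>2 \<le> (R - Im w)\<^sup>2" by (intro power_mono) auto
    then show "1 + (Re w)\<^sup>2 \<le> (cmod (\<i> * of_real R - w))\<^sup>2" by (simp add: cmod_power2)
    have "R / 2 \<le> R - Im w" using * R b by linarith
    then show "R / 2 \<le> cmod (\<i> * of_real R - w)" using complex_Re_le_cmod[of "- \<i> * (\<i> * of_real R - w)"] by (simp add: norm_mult)
  qed
  have R0: "0 < R" using R b by linarith
  have ne: "\<i> * of_real R - w \<noteq> 0" if "w \<in> thick \<epsilon>" for w using den(2)[OF that] R0 by auto
  interpret G: grid p B h "\<epsilon> / 3" "2 * R\<^sup>2" "\<lambda>w. F w * (y w)\<^sup>2"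
  proof unfold_locales
    have U: "(\<Union>w\<in>\<Omega>. ball w (3 * (\<epsilon> / 3))) = thick \<epsilon>" by (simp add: thick_def)
    show "(\<lambda>w. F w * (y w)\<^sup>2) holomorphic_on (\<Union>w\<in>\<Omega>. ball w (3 * (\<epsilon> / 3)))"
      unfolding U y_def using ne by (intro holomorphic_intros F) auto
    fix w assume "w \<in> (\<Union>w\<in>\<Omega>. ball w (3 * (\<epsilon> / 3)))"
    then have w: "w \<in> thick \<epsilon>" unfolding U .
    have "(cmod (y w))\<^sup>2 = R\<^sup>2 / (cmod (\<i> * of_real R - w))\<^sup>2"
      by (simp add: y_def norm_divide norm_mult power_divide)
    also have "\<dots> \<le> R\<^sup>2 / (1 + (Re w)\<^sup>2)" using den(1)[OF w] ne[OF w] by (intro divide_left_mono) (auto simp: add_pos_nonneg)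
    also have "\<dots> \<le> 2 * R\<^sup>2 / (1 + \<bar>Re w\<bar>)\<^sup>2"
    proof -
      have "(1 + \<bar>Re w\<bar>)\<^sup>2 \<le> 2 * (1 + (Re w)\<^sup>2)"
        using zero_le_power2[of "1 - \<bar>Re w\<bar>"] by (simp add: power2_eq_square algebra_simps)
      then have "2 * R\<^sup>2 / (2 * (1 + (Re w)\<^sup>2)) \<le> 2 * R\<^sup>2 / (1 + \<bar>Re w\<bar>)\<^sup>2"
        by (intro divide_left_mono mult_pos_pos) (auto simp: add_pos_nonneg)
      moreover have "2 * R\<^sup>2 / (2 * (1 + (Re w)\<^sup>2)) = R\<^sup>2 / (1 + (Re w)\<^sup>2)" by (rule mult_divide_mult_cancel_left) simp
      ultimately show ?thesis by simp
    qed
    finally have "1 * (cmod (y w))\<^sup>2 \<le> 2 * R\<^sup>2 / (1 + \<bar>Re w\<bar>)\<^sup>2" by simp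
    moreover have "cmod (F w) * (cmod (y w))\<^sup>2 \<le> 1 * (cmod (y w))\<^sup>2" using F(2)[OF w] by (intro mult_right_mono) auto
    ultimately show "cmod (F w * (y w)\<^sup>2) \<le> 2 * R\<^sup>2 / (1 + \<bar>Re w\<bar>)\<^sup>2" by (simp add: norm_mult norm_power)
  qed (use \<epsilon> recip in auto)
  show "\<exists>v. inM v \<and> (\<forall>z. cmod z < 1 \<longrightarrow> cmod (F (h z) - v z) \<le> \<eta> * (1 + cmod (h z)))"
  proof (intro exI[of _ "\<lambda>z. F (h z) * (y (h z))\<^sup>2"] conjI allI impI)
    show "inM (\<lambda>z. F (h z) * (y (h z))\<^sup>2)" by (rule G.inM_grid)
    fix z :: complex assume z: "cmod z < 1"
    define w where "w = h z"
    have w: "w \<in> thick \<epsilon>" using thick_superset[OF \<epsilon>] z by (auto simp: w_def)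
    have y2: "cmod (y w) \<le> 2"
    proof -
      have "cmod (y w) = R / cmod (\<i> * of_real R - w)" using R0 by (simp add: y_def norm_divide norm_mult)
      also have "\<dots> \<le> R / (R / 2)" using den(2)[OF w] R0 by (intro divide_left_mono) (auto intro!: mult_pos_pos)
      finally show ?thesis using R0 by simp
    qed
    have y1: "cmod (1 - y w) \<le> 2 * cmod w / R"
    proof -
      have "1 - y w = - w / (\<i> * of_real R - w)" using ne[OF w] by (simp add: y_def divide_simps)
      then have "cmod (1 - y w) = cmod w / cmod (\<i> * of_real R - w)" by (simp add: norm_divide)
      also have "\<dots> \<le> cmod w / (R / 2)" using den(2)[OF w] R0 by (intro divide_left_mono) (auto intro!: mult_pos_pos)
      finally show ?thesis by (simp add: mult.commute)
    qed
    have "F w - F w * (y w)\<^sup>2 = F w * ((1 - y w) * (1 + y w))" by (simp add: power2_eq_square algebra_simps)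
    then have "cmod (F w - F w * (y w)\<^sup>2) = cmod (F w) * (cmod (1 - y w) * cmod (1 + y w))" by (simp add: norm_mult)
    also have "\<dots> \<le> 1 * (2 * cmod w / R * 3)"
      using F(2)[OF w] y1 y2 norm_triangle_ineq[of 1 "y w"] R0 by (intro mult_mono) auto
    also have "\<dots> = 6 / R * cmod w" by simp
    also have "\<dots> \<le> \<eta> * (1 + cmod w)"
    proof -
      have "6 / R \<le> \<eta>" using R(2) \<eta> R0 by (simp add: field_simps)
      then have "6 / R * cmod w \<le> \<eta> * cmod w" by (rule mult_right_mono) auto
      then show ?thesis using \<eta> by (simp add: distrib_left)
    qed
    finally show "cmod (F (h z) - F (h z) * (y (h z))\<^sup>2) \<le> \<eta> * (1 + cmod (h z))" by (simp add: w_def)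
  qed
qed

text \<open>
  The Riemann maps of the thickened domains, restricted to \<open>\<Omega>\<close> and transported to the disc, have a
  derivative at 0 of modulus at most 1. A limit of their inverses maps the disc into the interior of
  the closure of \<open>\<Omega>\<close>, so by the Schwarz lemma the moduli tend to 1.
\<close>

lemma inM_almost_identity:
  assumes recip: "\<And>\<xi>. \<xi> \<notin> closure \<Omega> \<Longrightarrow> inM (\<lambda>z. 1 / (h z - \<xi>))"
    and int: "interior (closure \<Omega>) = \<Omega>" and \<delta>: "0 < \<delta>"
  obtains g where "inM g" "g 0 = 0" "\<And>z. cmod z < 1 \<Longrightarrow> cmod (g z) < 1" "1 - \<delta> < cmod (deriv g 0)"
proof -
  define \<epsilon> where "\<epsilon> = (\<lambda>n::nat. 1 / (real n + 1))"
  have \<epsilon>: "0 < \<epsilon> n" "\<epsilon> n \<le> 1" for n by (auto simp: \<epsilon>_def)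
  have h0: "h 0 \<in> \<Omega>" by simp
  define Q where "Q = (\<lambda>n \<psi> \<kappa>. \<psi> holomorphic_on thick (\<epsilon> n) \<and> \<kappa> holomorphic_on unit_disc \<and> \<psi> (h 0) = 0 \<and>
    (\<forall>w\<in>thick (\<epsilon> n). cmod (\<psi> w) < 1 \<and> \<kappa> (\<psi> w) = w) \<and> (\<forall>z. cmod z < 1 \<longrightarrow> \<kappa> z \<in> thick (\<epsilon> n) \<and> \<psi> (\<kappa> z) = z))"
  have "\<exists>\<psi> \<kappa>. Q n \<psi> \<kappa>" for n
  proof -
    have h0t: "h 0 \<in> thick (\<epsilon> n)" by (rule subsetD[OF thick_superset[OF \<epsilon>(1)] h0])
    show ?thesis
    proof (rule Riemann_map_normalized[OF thick_simply_connected[OF \<epsilon>(1)[of n]] h0t])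
      fix \<psi> \<kappa>
      assume "\<psi> holomorphic_on thick (\<epsilon> n)" "\<kappa> holomorphic_on unit_disc" "\<psi> (h 0) = 0"
        "\<And>w. w \<in> thick (\<epsilon> n) \<Longrightarrow> cmod (\<psi> w) < 1 \<and> \<kappa> (\<psi> w) = w"
        "\<And>z. cmod z < 1 \<Longrightarrow> \<kappa> z \<in> thick (\<epsilon> n) \<and> \<psi> (\<kappa> z) = z"
      then have "Q n \<psi> \<kappa>" unfolding Q_def by (intro conjI ballI allI impI) auto
      then show ?thesis by blast
    qed
  qed
  then obtain \<psi> \<kappa> where Q: "\<And>n. Q n (\<psi> n) (\<kappa> n)" by metis
  have \<psi>: "\<And>n. \<psi> n holomorphic_on thick (\<epsilon> n)" and \<kappa>: "\<And>n. \<kappa> n holomorphic_on unit_disc"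
    and \<psi>0: "\<And>n. \<psi> n (h 0) = 0" and \<psi>\<kappa>: "\<And>n w. w \<in> thick (\<epsilon> n) \<Longrightarrow> cmod (\<psi> n w) < 1 \<and> \<kappa> n (\<psi> n w) = w"
    and \<kappa>\<psi>: "\<And>n z. cmod z < 1 \<Longrightarrow> \<kappa> n z \<in> thick (\<epsilon> n) \<and> \<psi> n (\<kappa> n z) = z"
    using Q unfolding Q_def by simp_all
  have sup: "\<Omega> \<subseteq> thick (\<epsilon> n)" for n by (rule thick_superset[OF \<epsilon>(1)])
  define g where "g = (\<lambda>n z. \<psi> n (h z))"
  have gM: "inM (g n)" for n
    unfolding g_def using \<psi>\<kappa>[of _ n] by (intro inM_neighborhood[OF recip \<epsilon>(1)[of n] \<psi>]) (auto intro: less_imp_le)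
  have gh: "g n holomorphic_on unit_disc" for n by (rule inM_holomorphic[OF gM])
  have g0: "g n 0 = 0" for n by (simp add: g_def \<psi>0)
  have g1: "cmod (g n z) < 1" if "cmod z < 1" for n z using \<psi>\<kappa>[OF subsetD[OF sup[of n], of "h z"]] that by (simp add: g_def)
  have \<kappa>g: "\<kappa> n (g n z) = h z" if "cmod z < 1" for n z using \<psi>\<kappa>[OF subsetD[OF sup[of n], of "h z"]] that by (simp add: g_def)
  have \<kappa>0: "\<kappa> n 0 = h 0" for n using \<kappa>g[of 0 n] by (simp add: g0)
  have diff: "f field_differentiable at x" if "f holomorphic_on unit_disc" "cmod x < 1" for f x
    using that holomorphic_on_imp_differentiable_at by auto
  \<comment> \<open>\<open>\<kappa> n\<close> inverts the Riemann map and g n is that map composed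
    with \<open>h\<close>; so a derivative of \<open>g n\<close> at 0 close to modulus 1 means one
    of \<open>\<kappa> n\<close> close to that of \<open>h\<close>.\<close>
  have chain: "deriv (\<kappa> n) 0 * deriv (g n) 0 = deriv h 0" for n
  proof -
    have "deriv (\<kappa> n \<circ> g n) 0 = deriv (\<kappa> n) (g n 0) * deriv (g n) 0"
      by (rule deriv_chain) (use diff[OF gh] diff[OF \<kappa>] g0 in auto)
    moreover have "deriv (\<kappa> n \<circ> g n) 0 = deriv h 0"
    proof (rule deriv_cong_ev)
      have "\<forall>\<^sub>F z in nhds 0. z \<in> unit_disc" by (rule eventually_nhds_in_open) auto
      then show "\<forall>\<^sub>F z in nhds 0. (\<kappa> n \<circ> g n) z = h z" by eventually_elim (simp add: \<kappa>g)
    qed simp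
    ultimately show ?thesis by (simp add: g0)
  qed
  have dh: "deriv h 0 \<noteq> 0" by (rule holomorphic_injective_imp_regular[OF hol_h open_ball inj_h]) simp
  have dg: "cmod (deriv (g n) 0) \<le> 1" for n by (rule Schwarz_Lemma(2)[OF gh g0 g1, of 0]) auto
  have dk: "cmod (deriv h 0) \<le> cmod (deriv (\<kappa> n) 0)" for n
  proof -
    have "cmod (deriv h 0) = cmod (deriv (\<kappa> n) 0) * cmod (deriv (g n) 0)" by (simp add: norm_mult flip: chain[of n])
    also have "\<dots> \<le> cmod (deriv (\<kappa> n) 0) * 1" using dg by (intro mult_left_mono) auto
    finally show ?thesis by simp
  qed
  define b where "b = (\<lambda>z. cmod (h 0) + 2 * (B + 2 - Im (h 0)) * cmod z / (1 - cmod z))"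
  have bc: "continuous_on unit_disc b" unfolding b_def by (intro continuous_intros) auto
  have kb: "cmod (\<kappa> n z) \<le> b z" if z: "cmod z < 1" for n z
  proof -
    \<comment> \<open>The real part of - \<i> \<kappa> n is the imaginary part of
      \<open>\<kappa> n\<close>, bounded because the thickened domains stay in one strip; this makes
      the inverse maps a normal family.\<close>
    have "cmod (- \<i> * \<kappa> n z - - \<i> * \<kappa> n 0) \<le> 2 * (B + 2 - Re (- \<i> * \<kappa> n 0)) * cmod z / (1 - cmod z)"
    proof (rule Borel_Caratheodory[where f = "\<lambda>z. - \<i> * \<kappa> n z", OF _ _ z])
      show "(\<lambda>z. - \<i> * \<kappa> n z) holomorphic_on unit_disc" by (intro holomorphic_on_mult holomorphic_on_const \<kappa>)
      show "Re (- \<i> * \<kappa> n z) < B + 2" if "cmod z < 1" for z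
        using thick_Im[of "\<kappa> n z" "\<epsilon> n"] \<kappa>\<psi>[OF that, of n] \<epsilon>(2)[of n] by simp
    qed
    moreover have "- \<i> * \<kappa> n z - - \<i> * \<kappa> n 0 = - \<i> * (\<kappa> n z - h 0)" by (simp add: \<kappa>0 algebra_simps)
    ultimately have "cmod (\<kappa> n z - h 0) \<le> 2 * (B + 2 - Im (h 0)) * cmod z / (1 - cmod z)"
      by (simp add: norm_mult \<kappa>0)
    then show ?thesis using norm_triangle_ineq2[of "\<kappa> n z" "h 0"] by (simp add: b_def)
  qed
  obtain K r where K: "K holomorphic_on unit_disc" and r: "strict_mono (r :: nat \<Rightarrow> nat)"
    and Klim: "\<And>z. cmod z < 1 \<Longrightarrow> (\<lambda>n. \<kappa> (r n) z) \<longlonglongrightarrow> K z"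
    and Kunif: "\<And>C. compact C \<Longrightarrow> C \<subseteq> unit_disc \<Longrightarrow> uniform_limit C (\<kappa> \<circ> r) K sequentially"
    using Montel_disc[of \<kappa>, OF \<kappa> bc kb] by metis
  have "uniform_limit (ball 0 (1/2)) (\<kappa> \<circ> r) K sequentially"
    by (rule uniform_limit_on_subset[OF Kunif[of "cball 0 (1/2)"]]) auto
  then have "(\<lambda>n. (deriv ^^ 1) ((\<kappa> \<circ> r) n) 0) \<longlonglongrightarrow> (deriv ^^ 1) K 0"
    by (rule higher_deriv_complex_uniform_limit)
       (auto intro!: always_eventually holomorphic_on_subset[OF \<kappa>])
  then have dK: "(\<lambda>n. deriv (\<kappa> (r n)) 0) \<longlonglongrightarrow> deriv K 0" by simp
  have K0: "K 0 = h 0" using Klim[of 0] by (simp add: \<kappa>0 LIMSEQ_const_iff)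
  have dKge: "cmod (deriv h 0) \<le> cmod (deriv K 0)"
    by (rule LIMSEQ_le_const[OF tendsto_norm[OF dK]]) (use dk in blast)
  \<comment> \<open>The derivative of the limit is at least as large as that of \<open>h\<close> at
    0, which is nonzero by univalence; so the image of \<open>K\<close> is open.\<close>
  have nc: "\<not> K constant_on unit_disc"
  proof
    assume "K constant_on unit_disc"
    then obtain c where "\<And>z. z \<in> unit_disc \<Longrightarrow> K z = c" unfolding constant_on_def by blast
    then have "deriv K 0 = deriv (\<lambda>_. c) 0"
      by (intro deriv_cong_ev) (auto intro!: eventually_mono[OF eventually_nhds_in_open[of unit_disc 0]])
    then show False using dKge dh by simp
  qed
  have "open (K ` unit_disc)" by (rule open_mapping_thm[OF K open_ball connected_ball open_ball order_refl nc])
  moreover have "K ` unit_disc \<subseteq> closure \<Omega>"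
  proof
    fix y assume "y \<in> K ` unit_disc"
    then obtain z where z: "cmod z < 1" "y = K z" by auto
    show "y \<in> closure \<Omega>"
      unfolding closure_approachable
    proof (intro allI impI)
      fix e :: real assume e: "0 < e"
      have "(\<lambda>n. \<epsilon> (r n)) \<longlonglongrightarrow> 0"
      proof -
        have "\<epsilon> \<longlonglongrightarrow> 0" unfolding \<epsilon>_def by real_asymp
        then show ?thesis using LIMSEQ_subseq_LIMSEQ[OF _ r] unfolding o_def by blast
      qed
      then have "\<forall>\<^sub>F n in sequentially. \<epsilon> (r n) < e / 2" using e by (intro order_tendstoD) auto
      moreover have "\<forall>\<^sub>F n in sequentially. dist (\<kappa> (r n) z) (K z) < e / 2" using e by (intro tendstoD Klim z) auto
      ultimately have "\<forall>\<^sub>F n in sequentially. \<epsilon> (r n) < e / 2 \<and> dist (\<kappa> (r n) z) (K z) < e / 2" by (rule eventually_conj)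
      then obtain n where n: "\<epsilon> (r n) < e / 2" "dist (\<kappa> (r n) z) (K z) < e / 2" unfolding eventually_sequentially by blast
      obtain w where w: "w \<in> \<Omega>" "dist w (\<kappa> (r n) z) < \<epsilon> (r n)" using \<kappa>\<psi>[OF z(1), of "r n"] unfolding thick_def by auto
      have "dist w y \<le> dist w (\<kappa> (r n) z) + dist (\<kappa> (r n) z) (K z)" unfolding z(2) by (rule dist_triangle)
      also have "\<dots> < e" using n w(2) by linarith
      finally show "\<exists>y'\<in>\<Omega>. dist y' y < e" using w(1) by blast
    qed
  qed
  \<comment> \<open>An open subset of the closure lies in its interior. Here the equation
    \<open>interior (closure \<Omega>) = \<Omega>\<close> enters.\<close>
  ultimately have K\<Omega>: "K ` unit_disc \<subseteq> \<Omega>" using int interior_maximal by metis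
  obtain k where k: "k holomorphic_on \<Omega>" "\<And>z. z \<in> unit_disc \<Longrightarrow> k (h z) = z"
    using holomorphic_has_inverse[OF hol_h open_ball inj_h] by metis
  define \<theta> where "\<theta> = k \<circ> K"
  have \<theta>h: "\<theta> holomorphic_on unit_disc" unfolding \<theta>_def by (rule holomorphic_on_compose_gen[OF K k(1) K\<Omega>])
  have \<theta>K: "cmod (\<theta> z) < 1 \<and> h (\<theta> z) = K z" if "cmod z < 1" for z
  proof -
    have "K z \<in> \<Omega>" using K\<Omega> that by auto
    then obtain x where x: "x \<in> unit_disc" "K z = h x" by blast
    then show ?thesis using k(2)[OF x(1)] by (simp add: \<theta>_def)
  qed
  have \<theta>0: "\<theta> 0 = 0" using k(2)[of 0] by (simp add: \<theta>_def K0)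
  have "cmod (deriv \<theta> 0) \<le> 1" using \<theta>K by (intro Schwarz_Lemma(2)[OF \<theta>h \<theta>0, of 0]) auto
  moreover have "deriv h 0 * deriv \<theta> 0 = deriv K 0"
  proof -
    have "deriv (h \<circ> \<theta>) 0 = deriv h (\<theta> 0) * deriv \<theta> 0"
      by (rule deriv_chain) (use diff[OF \<theta>h] diff[OF hol_h] \<theta>0 in auto)
    moreover have "deriv (h \<circ> \<theta>) 0 = deriv K 0"
    proof (rule deriv_cong_ev)
      have "\<forall>\<^sub>F z in nhds 0. z \<in> unit_disc" by (rule eventually_nhds_in_open) auto
      then show "\<forall>\<^sub>F z in nhds 0. (h \<circ> \<theta>) z = K z" by eventually_elim (use \<theta>K in auto)
    qed simp
    ultimately show ?thesis by (simp add: \<theta>0)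
  qed
  \<comment> \<open>Schwarz for the self-map \<open>\<theta>\<close>, given by h \<circ> \<theta> =
    K, yields the inequality opposite to \<open>dKge\<close>. Equality makes the quotients of
    derivatives, which are the moduli of the derivatives of g (r n), converge to 1.\<close>
  ultimately have "cmod (deriv K 0) \<le> cmod (deriv h 0)"
    by (metis norm_mult mult_left_le norm_ge_zero)
  then have eq: "cmod (deriv K 0) = cmod (deriv h 0)" using dKge by simp
  have "(\<lambda>n. cmod (deriv h 0) / cmod (deriv (\<kappa> (r n)) 0)) \<longlonglongrightarrow> cmod (deriv h 0) / cmod (deriv K 0)"
    using dh eq by (intro tendsto_intros dK) auto
  then have lim: "(\<lambda>n. cmod (deriv h 0) / cmod (deriv (\<kappa> (r n)) 0)) \<longlonglongrightarrow> 1" using eq dh by simp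
  have "\<forall>\<^sub>F n in sequentially. 1 - \<delta> < cmod (deriv h 0) / cmod (deriv (\<kappa> (r n)) 0)"
    using \<delta> by (intro order_tendstoD(1)[OF lim]) auto
  then obtain n where n: "1 - \<delta> < cmod (deriv h 0) / cmod (deriv (\<kappa> (r n)) 0)" unfolding eventually_sequentially by blast
  have "cmod (deriv h 0) / cmod (deriv (\<kappa> (r n)) 0) = cmod (deriv (g (r n)) 0)"
  proof -
    have "deriv (\<kappa> (r n)) 0 \<noteq> 0" using dk[of "r n"] dh by auto
    then show ?thesis by (simp add: norm_mult flip: chain[of "r n"])
  qed
  with n show ?thesis by (intro that[of "g (r n)"] gM g0 g1) auto
qed

text \<open>Rotated by \<open>c\<close>, the almost extremal function is z q z with |q| \<le> 1 and
  Re (q 0) > 1 - \<delta>. Since |1 - q|^2 \<le> 2 (1 - Re q), the mean value property makes the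
  quadratic mean of 1 - q small, and the pointwise bound \<open>pw\<close> transfers this to the
  exponent p.\<close>

lemma inM_identity:
  assumes recip: "\<And>\<xi>. \<xi> \<notin> closure \<Omega> \<Longrightarrow> inM (\<lambda>z. 1 / (h z - \<xi>))" and int: "interior (closure \<Omega>) = \<Omega>"
  shows "inM (\<lambda>z. z)"
proof (rule inM_limit)
  show "disc_ext (\<lambda>z. z) \<in> hardy_space p"
    using p by (intro hardy_space_bounded(1)[where B = 1]) (auto intro: holomorphic_intros)
  fix \<epsilon> :: real assume \<epsilon>: "0 < \<epsilon>"
  define \<eta> where "\<eta> = \<epsilon> / (4 * pi)"
  have \<eta>: "0 < \<eta>" using \<epsilon> by (simp add: \<eta>_def)
  \<comment> \<open>\<open>C\<close> makes x^p \<le> C x^2 for x between \<eta>^(1/p) and 2. In the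
    final estimate 2 pi \<eta> and 4 pi C \<delta> are \<epsilon> / 2 each.\<close>
  define C where "C = 2 powr p / (\<eta> powr (1 / p))\<^sup>2"
  have C: "0 < C" using \<eta> by (simp add: C_def)
  define \<delta> where "\<delta> = \<epsilon> / (8 * pi * C)"
  have \<delta>: "0 < \<delta>" using \<epsilon> C by (simp add: \<delta>_def)
  have pw: "x powr p \<le> \<eta> + C * x\<^sup>2" if x: "0 \<le> x" "x \<le> 2" for x
  proof (cases "x \<le> \<eta> powr (1 / p)")
    case True
    then have "x powr p \<le> (\<eta> powr (1 / p)) powr p" using x p by (intro powr_mono2) auto
    also have "\<dots> = \<eta>" using p \<eta> by (simp add: powr_powr)
    finally show ?thesis using C by (simp add: add_increasing2)
  next
    case False
    have "x powr p \<le> 2 powr p * 1" using x p by (simp add: powr_mono2)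
    also have "\<dots> \<le> 2 powr p * (x / \<eta> powr (1 / p))\<^sup>2"
    proof (rule mult_left_mono)
      have "1 \<le> x / \<eta> powr (1 / p)" using False \<eta> by simp
      then show "1 \<le> (x / \<eta> powr (1 / p))\<^sup>2" by (rule one_le_power)
    qed simp
    also have "\<dots> = C * x\<^sup>2" by (simp add: C_def power_divide)
    finally show ?thesis using \<eta> by linarith
  qed
  obtain g where gM: "inM g" and g0: "g 0 = 0" and g1: "\<And>z. cmod z < 1 \<Longrightarrow> cmod (g z) < 1" and gd: "1 - \<delta> < cmod (deriv g 0)"
    using inM_almost_identity[OF recip int \<delta>] by metis
  have gh: "g holomorphic_on unit_disc" by (rule inM_holomorphic[OF gM])
  define c where "c = (if deriv g 0 = 0 then 1 else cnj (deriv g 0) / cmod (deriv g 0))"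
  have c1: "cmod c = 1" by (simp add: c_def norm_divide)
  have cd: "c * deriv g 0 = of_real (cmod (deriv g 0))"
  proof (cases "deriv g 0 = 0")
    case False
    have "cnj (deriv g 0) * deriv g 0 = of_real ((cmod (deriv g 0))\<^sup>2)" by (metis complex_norm_square mult.commute)
    then show ?thesis using False by (simp add: c_def power2_eq_square)
  qed auto
  define q where "q = (\<lambda>z. c * (if z = 0 then deriv g 0 else (g z - g 0) / (z - 0)))"
  have qh: "q holomorphic_on unit_disc" unfolding q_def
    by (intro holomorphic_on_mult holomorphic_on_const pole_lemma_open[OF gh open_ball])
  have qg: "c * g z = z * q z" for z by (simp add: q_def g0)
  have q1: "cmod (q z) \<le> 1" if z: "cmod z < 1" for z
  proof (cases "z = 0")
    case True
    then show ?thesis using Schwarz_Lemma(2)[OF gh g0 g1, of 0] c1 by (simp add: q_def norm_mult)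
  next
    case False
    then show ?thesis using Schwarz_Lemma(1)[OF gh g0 g1 z] c1 by (simp add: q_def norm_mult norm_divide g0)
  qed
  have q0: "1 - \<delta> < Re (q 0)" using gd by (simp add: q_def cd)
  show "\<exists>v. inM v \<and> hardy_bounded p \<epsilon> (\<lambda>z. z - v z)"
  proof (intro exI[of _ "\<lambda>z. c * g z"] conjI)
    show "inM (\<lambda>z. c * g z)" by (rule inM_cmult[OF gM])
    have "hardy_mean p (\<lambda>z. z - c * g z) R \<le> \<epsilon>" if R: "0 < R" "R < 1" for R
    proof -
      have R0: "0 \<le> R" using R by simp
      have dh: "(\<lambda>z. z - c * g z) holomorphic_on unit_disc" by (intro holomorphic_intros gh)
      have int: "((\<lambda>\<theta>. \<eta> + 2 * C * (1 - Re (q (of_real R * cis \<theta>)))) has_integral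
          (\<eta> * (2 * pi) + 2 * C * (1 * (2 * pi) - 2 * pi * Re (q 0)))) {0..2*pi}"
      proof -
        have "((\<lambda>\<theta>. Re (q (of_real R * cis \<theta>))) has_integral (2 * pi * Re (q 0))) {0..2*pi}"
          using has_integral_Re[OF mean_value_circle[OF qh R0 R(2)]] by (simp del: times_divide_eq_right)
        moreover have "((\<lambda>\<theta>::real. x) has_integral (x * (2 * pi))) {0..2*pi}" for x :: real
          using has_integral_const_real[of x 0 "2 * pi"] by (simp add: mult.commute)
        ultimately show ?thesis by (intro has_integral_add has_integral_mult_right has_integral_diff)
      qed
      have "hardy_mean p (\<lambda>z. z - c * g z) R \<le> \<eta> * (2 * pi) + 2 * C * (1 * (2 * pi) - 2 * pi * Re (q 0))"
        unfolding hardy_mean_def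
      proof (rule has_integral_le[OF integrable_integral int])
        show "(\<lambda>\<theta>. cmod (of_real R * cis \<theta> - c * g (of_real R * cis \<theta>)) powr p) integrable_on {0..2*pi}"
          by (rule hardy_mean_integrable[OF dh R0 R(2) p])
        fix \<theta> :: real
        define z where "z = of_real R * cis \<theta>"
        have z: "cmod z < 1" using R by (simp add: z_def norm_mult)
        define x where "x = cmod (1 - q z)"
        have x2: "x \<le> 2" using norm_triangle_ineq4[of 1 "q z"] q1[OF z] by (simp add: x_def)
        have "cmod (z - c * g z) = cmod z * x" by (simp add: qg x_def norm_mult[symmetric] algebra_simps)
        also have "\<dots> \<le> x" using z by (simp add: x_def mult_left_le_one_le)
        finally have "cmod (z - c * g z) powr p \<le> x powr p" using p by (intro powr_mono2) auto
        also have "\<dots> \<le> \<eta> + C * x\<^sup>2" using x2 by (intro pw) (auto simp: x_def)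
        also have "x\<^sup>2 \<le> 2 * (1 - Re (q z))"
        proof -
          have "x\<^sup>2 = 1 - 2 * Re (q z) + (cmod (q z))\<^sup>2"
            unfolding x_def cmod_power2 by (simp add: power2_eq_square algebra_simps)
          moreover have "(cmod (q z))\<^sup>2 \<le> 1" using q1[OF z] by (simp add: power_le_one)
          ultimately show ?thesis by simp
        qed
        finally have "cmod (z - c * g z) powr p \<le> \<eta> + C * (2 * (1 - Re (q z)))" using C by simp
        then show "cmod (of_real R * cis \<theta> - c * g (of_real R * cis \<theta>)) powr p \<le> \<eta> + 2 * C * (1 - Re (q (of_real R * cis \<theta>)))"
          by (simp add: z_def mult_ac)
      qed
      also have "\<dots> = \<epsilon> / 2 + 4 * pi * C * (1 - Re (q 0))" by (simp add: \<eta>_def algebra_simps)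
      also have "\<dots> \<le> \<epsilon> / 2 + 4 * pi * C * \<delta>" using q0 C by (intro add_left_mono mult_left_mono) auto
      also have "\<dots> = \<epsilon>" using C by (simp add: \<delta>_def)
      finally show ?thesis .
    qed
    then show "hardy_bounded p \<epsilon> (\<lambda>z. z - c * g z)"
      using gh by (auto simp: hardy_bounded_def intro!: holomorphic_intros)
  qed
qed

text \<open>With the identity the span contains all polynomials, hence every dilation f (r z) with r
  < 1, whose power series converges uniformly on the disc; and dilations converge to
  \<open>f\<close> in H^p.\<close>

lemma span_exp_eq:
  assumes comp: "finite (components (- closure \<Omega>))" "card (components (- closure \<Omega>)) \<le> 2"
    and int: "interior (closure \<Omega>) = \<Omega>"
  shows "span_exp = hardy_space p"
proof
  show "span_exp \<subseteq> hardy_space p" using closed_subspaceD(1)[OF span_exp_subspace] by blast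
  have idM: "inM (\<lambda>z. z)" by (rule inM_identity[OF inM_reciprocal[OF comp] int])
  have powM: "inM (\<lambda>z. z ^ k)" for k by (rule inM_power[OF idM, of 1]) auto
  have dilM: "inM (\<lambda>z. f (of_real r * z))" if f: "f holomorphic_on unit_disc" and r: "0 < r" "r < 1" for f r
  proof (rule inM_uniform_limit)
    show "(\<lambda>z. f (of_real r * z)) holomorphic_on unit_disc" using f r by (intro holomorphic_scale) auto
    define a where "a = (\<lambda>k. (deriv ^^ k) f 0 / fact k * of_real r ^ k)"
    have sums: "(\<lambda>k. a k * z ^ k) sums f (of_real r * z)" if "cmod z < 1 / r" for z
    proof -
      have "of_real r * z \<in> ball 0 1" using that r by (simp add: norm_mult field_simps)
      from holomorphic_power_series[OF f this] show ?thesis by (simp add: a_def power_mult_distrib mult_ac)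
    qed
    \<comment> \<open>Any radius between 1 and 1 / r would do: convergence at \<rho> > 1 gives
      absolute convergence of the coefficients.\<close>
    define \<rho> where "\<rho> = (1 + 1 / r) / 2"
    have r1: "1 < 1 / r" using r by simp
    have \<rho>: "1 < \<rho>" "\<rho> < 1 / r" using r1 by (auto simp: \<rho>_def)
    have "summable (\<lambda>k. a k * of_real \<rho> ^ k)" using sums[of "of_real \<rho>"] \<rho> by (simp add: sums_iff)
    then have sm: "summable (\<lambda>k. norm (a k))" using powser_insidea[of a "of_real \<rho>" 1] \<rho> by simp
    have "uniform_limit unit_disc (\<lambda>n z. \<Sum>k<n. a k * z ^ k) (\<lambda>z. \<Sum>k. a k * z ^ k) sequentially"
      by (rule Weierstrass_m_test[OF _ sm]) (auto simp: norm_mult norm_power mult_left_le power_le_one)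
    moreover fix \<epsilon> :: real assume \<epsilon>: "0 < \<epsilon>"
    ultimately have "\<forall>\<^sub>F n in sequentially. \<forall>z\<in>unit_disc. dist (\<Sum>k<n. a k * z ^ k) (\<Sum>k. a k * z ^ k) < \<epsilon>"
      by (rule uniform_limitD)
    then obtain n where n: "\<And>z. z \<in> unit_disc \<Longrightarrow> dist (\<Sum>k<n. a k * z ^ k) (\<Sum>k. a k * z ^ k) < \<epsilon>"
      unfolding eventually_sequentially by blast
    show "\<exists>v. inM v \<and> (\<forall>z. cmod z < 1 \<longrightarrow> cmod (f (of_real r * z) - v z) \<le> \<epsilon>)"
    proof (intro exI[of _ "\<lambda>z. \<Sum>k<n. a k * z ^ k"] conjI allI impI)
      show "inM (\<lambda>z. \<Sum>k<n. a k * z ^ k)" by (intro inM_sum inM_cmult powM) auto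
      fix z :: complex assume z: "cmod z < 1"
      have "(\<Sum>k. a k * z ^ k) = f (of_real r * z)" using sums[of z] z r1 by (simp add: sums_iff)
      then show "cmod (f (of_real r * z) - (\<Sum>k<n. a k * z ^ k)) \<le> \<epsilon>" using n[of z] z by (simp add: dist_norm norm_minus_commute)
    qed
  qed
  show "hardy_space p \<subseteq> span_exp"
  proof
    fix f assume f: "f \<in> hardy_space p"
    have fe: "disc_ext f = f" using hardy_space_zero[OF f] by (auto simp: disc_ext_def)
    have "inM f"
    proof (rule inM_limit)
      show "disc_ext f \<in> hardy_space p" using f by (simp add: fe)
      fix \<epsilon> :: real assume \<epsilon>: "0 < \<epsilon>"
      have "hardy_bounded p (hardy_sup p f) f"
        using f by (simp add: hardy_bounded_def hardy_space_holomorphic hardy_mean_le_sup)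
      then obtain r where "0 < r" "r < 1" "hardy_bounded p \<epsilon> (\<lambda>z. f z - f (of_real r * z))"
        using dilation_converges[OF _ p \<epsilon>] by metis
      then show "\<exists>v. inM v \<and> hardy_bounded p \<epsilon> (\<lambda>z. f z - v z)"
        using dilM[OF hardy_space_holomorphic[OF f]] by blast
    qed
    then show "f \<in> span_exp" by (simp add: inM_def fe)
  qed
qed

end

section \<open>The bicommutant\<close>

lemma koenigs_conjugation:
  assumes koe: "koenigs_function \<phi> h" and t: "0 \<le> t" and z: "cmod z < 1"
  shows "h z + of_real t \<in> h ` unit_disc" "\<phi> t z \<in> unit_disc" "h (\<phi> t z) = h z + of_real t"
proof -
  have inj: "inj_on h unit_disc" and zD: "z \<in> unit_disc" using koe z by (simp_all add: koenigs_function_def)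
  have *: "h z + of_real t \<in> h ` unit_disc \<and> \<phi> t z = the_inv_into unit_disc h (h z + of_real t)"
    using koe t zD unfolding koenigs_function_def by blast
  then show m: "h z + of_real t \<in> h ` unit_disc" by blast
  show "\<phi> t z \<in> unit_disc" using * the_inv_into_into[OF inj m order_refl] by simp
  show "h (\<phi> t z) = h z + of_real t" using * f_the_inv_into_f[OF inj m] by simp
qed

text \<open>
  Transported to the Koenigs domain, the equation reads \<open>F (w + t) = exp (\<kappa> t) F w\<close>; differentiating in
  \<open>t\<close> gives \<open>F' = \<kappa> F\<close>.
\<close>

lemma semigroup_eigenfunction:
  assumes koe: "koenigs_function \<phi> h" and q: "q holomorphic_on unit_disc"
    and eq: "\<And>t z. 0 \<le> t \<Longrightarrow> cmod z < 1 \<Longrightarrow> q (\<phi> t z) = exp (\<kappa> * of_real t) * q z + c * of_real t"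
    and c: "c = 0 \<or> \<kappa> = 0"
  shows "\<exists>C. \<forall>z. cmod z < 1 \<longrightarrow> q z = C * exp (\<kappa> * h z) + c * h z"
proof -
  have hol: "h holomorphic_on unit_disc" and inj: "inj_on h unit_disc"
    using koe by (simp_all add: koenigs_function_def)
  note conj = koenigs_conjugation[OF koe]
  let ?\<Omega> = "h ` unit_disc"
  have op: "open ?\<Omega>" by (rule open_mapping_thm3[OF hol open_ball inj])
  have conn: "connected ?\<Omega>" by (intro connected_continuous_image holomorphic_on_imp_continuous_on hol) auto
  obtain k where k: "k holomorphic_on ?\<Omega>" "\<And>z. z \<in> unit_disc \<Longrightarrow> k (h z) = z"
    using holomorphic_has_inverse[OF hol open_ball inj] by metis
  define F where "F = q \<circ> k"
  have Fh: "F holomorphic_on ?\<Omega>"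
    unfolding F_def by (rule holomorphic_on_compose_gen[OF k(1) q]) (use k(2) in auto)
  have Feq: "F (w + of_real t) = exp (\<kappa> * of_real t) * F w + c * of_real t" if w: "w \<in> ?\<Omega>" and t: "0 \<le> t" for w t
  proof -
    obtain z where z: "cmod z < 1" "w = h z" using w by auto
    have "F (w + of_real t) = q (\<phi> t z)" using conj[OF t z(1)] k(2)[of "\<phi> t z"] by (simp add: F_def z(2))
    moreover have "F w = q z" using k(2)[of z] z by (simp add: F_def)
    ultimately show ?thesis using eq[OF t z(1)] by simp
  qed
  have F': "deriv F w = \<kappa> * F w + c" if w: "w \<in> ?\<Omega>" for w
  proof -
    have "(F has_field_derivative deriv F w) (at w)" by (rule holomorphic_derivI[OF Fh op w])
    \<comment> \<open>The functional equation is available for t \<ge> 0 only, so derivatives at 0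
      are taken from the right, where they are still unique.\<close>
    moreover have "((\<lambda>t. w + of_real t) has_vector_derivative 1) (at 0 within {0..})"
      by (auto intro!: derivative_eq_intros)
    ultimately have "((F \<circ> (\<lambda>t. w + of_real t)) has_vector_derivative 1 * deriv F w) (at 0 within {0..})"
      by (intro field_vector_diff_chain_within) (auto intro: DERIV_subset)
    moreover have "((\<lambda>t. exp (\<kappa> * of_real t) * F w + c * of_real t) has_vector_derivative (\<kappa> * F w + c)) (at (0::real) within {0..})"
      by (auto intro!: derivative_eq_intros has_vector_derivative_real_field)
    moreover have "((F \<circ> (\<lambda>t. w + of_real t)) has_vector_derivative 1 * deriv F w) (at 0 within {0..}) \<longleftrightarrow>
       ((\<lambda>t. exp (\<kappa> * of_real t) * F w + c * of_real t) has_vector_derivative 1 * deriv F w) (at (0::real) within {0..})"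
      by (rule has_vector_derivative_cong_ev) (auto simp: Feq[OF w] eventually_at_filter)
    ultimately have "((\<lambda>t. exp (\<kappa> * of_real t) * F w + c * of_real t) has_vector_derivative 1 * deriv F w) (at (0::real) within {0..})"
      "((\<lambda>t. exp (\<kappa> * of_real t) * F w + c * of_real t) has_vector_derivative (\<kappa> * F w + c)) (at (0::real) within {0..})" by blast+
    then have "1 * deriv F w = \<kappa> * F w + c"
      by (rule vector_derivative_unique_within[rotated]) (simp add: at_within_Ici_at_right)
    then show ?thesis by simp
  qed
  \<comment> \<open>The derivative is c \<kappa> w exp (- \<kappa> w), which vanishes because c = 0
    or \<kappa> = 0.\<close>
  have "(\<lambda>w. (F w - c * w) * exp (- \<kappa> * w)) constant_on ?\<Omega>"
  proof (rule has_field_derivative_0_imp_constant_on[OF _ conn op])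
    fix w assume w: "w \<in> ?\<Omega>"
    have "(F has_field_derivative (\<kappa> * F w + c)) (at w)"
      using holomorphic_derivI[OF Fh op w] F'[OF w] by simp
    then show "((\<lambda>w. (F w - c * w) * exp (- \<kappa> * w)) has_field_derivative 0) (at w)"
      using c by (auto intro!: derivative_eq_intros simp: algebra_simps)
  qed
  then obtain C where C: "\<And>w. w \<in> ?\<Omega> \<Longrightarrow> (F w - c * w) * exp (- \<kappa> * w) = C" unfolding constant_on_def by blast
  have "q z = C * exp (\<kappa> * h z) + c * h z" if z: "cmod z < 1" for z
  proof -
    have "C * exp (\<kappa> * h z) = (F (h z) - c * h z) * (exp (- \<kappa> * h z) * exp (\<kappa> * h z))"
      using C[of "h z"] z by simp
    also have "exp (- \<kappa> * h z) * exp (\<kappa> * h z) = 1" by (simp add: exp_minus)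
    finally have "C * exp (\<kappa> * h z) = F (h z) - c * h z" by simp
    moreover have "F (h z) = q z" using k(2)[of z] z by (simp add: F_def)
    ultimately show ?thesis by simp
  qed
  then show ?thesis by blast
qed

text \<open>The inhomogeneous case \<kappa> = 0, c = 1 of \<open>semigroup_eigenfunction\<close>
  shows that the bounded-strip linearizer and \<open>h\<close> differ by a constant.\<close>

lemma koenigs_strip:
  assumes hyp: "hyperbolic_semiflow \<phi>" and koe: "koenigs_function \<phi> h" and p: "1 \<le> p"
  obtains B where "strip_map p B h"
proof -
  obtain L B where L: "L holomorphic_on unit_disc" "\<And>z. cmod z < 1 \<Longrightarrow> \<bar>Im (L z)\<bar> \<le> B"
    and Leq: "\<And>t z. 0 \<le> t \<Longrightarrow> cmod z < 1 \<Longrightarrow> L (\<phi> t z) = L z + of_real t"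
    using hyperbolic_linearizer[OF hyp] by metis
  have "\<exists>C. \<forall>z. cmod z < 1 \<longrightarrow> L z = C * exp (0 * h z) + 1 * h z"
    by (rule semigroup_eigenfunction[OF koe L(1)]) (use Leq in auto)
  then obtain C where C: "\<And>z. cmod z < 1 \<Longrightarrow> L z = C + h z" by auto
  have Im: "\<bar>Im (h z)\<bar> \<le> B + \<bar>Im C\<bar>" if "cmod z < 1" for z
  proof -
    have "Im (h z) = Im (L z) - Im C" using C[OF that] by simp
    then show ?thesis using L(2)[OF that] by linarith
  qed
  have "strip_map p (B + \<bar>Im C\<bar>) h"
    by unfold_locales (use koe p Im koenigs_conjugation(1)[OF koe] in \<open>auto simp: koenigs_function_def\<close>)
  then show ?thesis by (rule that)
qed

section \<open>The bicommutant as an algebra of operators\<close>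

lemma bounded_operators_add:
  assumes p: "1 \<le> p" and A: "A \<in> bounded_operators (hardy_space p) (hardy_norm p)"
    and A': "A' \<in> bounded_operators (hardy_space p) (hardy_norm p)"
  shows "(\<lambda>f z. A f z + A' f z) \<in> bounded_operators (hardy_space p) (hardy_norm p)"
proof -
  obtain K where K: "0 \<le> K" "\<And>f. f \<in> hardy_space p \<Longrightarrow> hardy_sup p (A f) \<le> K * hardy_sup p f"
    using bounded_operator_sup[OF p A] by metis
  obtain K' where K': "0 \<le> K'" "\<And>f. f \<in> hardy_space p \<Longrightarrow> hardy_sup p (A' f) \<le> K' * hardy_sup p f"
    using bounded_operator_sup[OF p A'] by metis
  show ?thesis
  proof (rule bounded_operatorI[OF p, where K = "2 powr p * (K + K')"])
    show "(\<lambda>f z. A f z + A' f z) \<in> hardy_space p \<rightarrow> hardy_space p"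
      using bounded_operator_mem[OF A] bounded_operator_mem[OF A'] hardy_space_add(1)[OF _ _ p] by blast
    show "linear_map_on (hardy_space p) (\<lambda>f z. A f z + A' f z)"
      unfolding linear_map_on_def
      by (auto simp: bounded_operator_add[OF A] bounded_operator_add[OF A'] bounded_operator_cmult[OF A] bounded_operator_cmult[OF A'] algebra_simps)
    show "0 \<le> 2 powr p * (K + K')" using K K' by simp
    fix f assume f: "f \<in> hardy_space p"
    have "hardy_sup p (\<lambda>z. A f z + A' f z) \<le> 2 powr p * (hardy_sup p (A f) + hardy_sup p (A' f))"
      by (rule hardy_space_add(2)[OF bounded_operator_mem[OF A f] bounded_operator_mem[OF A' f] p])
    also have "\<dots> \<le> 2 powr p * (K * hardy_sup p f + K' * hardy_sup p f)"
      using K(2)[OF f] K'(2)[OF f] by (intro mult_left_mono add_mono) auto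
    finally show "hardy_sup p (\<lambda>z. A f z + A' f z) \<le> 2 powr p * (K + K') * hardy_sup p f" by (simp add: algebra_simps)
  qed (simp add: bounded_operator_outside[OF A] bounded_operator_outside[OF A'])
qed

lemma bounded_operators_cmult:
  assumes p: "1 \<le> p" and A: "A \<in> bounded_operators (hardy_space p) (hardy_norm p)"
  shows "(\<lambda>f z. c * A f z) \<in> bounded_operators (hardy_space p) (hardy_norm p)"
proof -
  obtain K where K: "0 \<le> K" "\<And>f. f \<in> hardy_space p \<Longrightarrow> hardy_sup p (A f) \<le> K * hardy_sup p f"
    using bounded_operator_sup[OF p A] by metis
  show ?thesis
  proof (rule bounded_operatorI[OF p, where K = "cmod c powr p * K"])
    show "(\<lambda>f z. c * A f z) \<in> hardy_space p \<rightarrow> hardy_space p"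
      using bounded_operator_mem[OF A] hardy_space_cmult(1)[OF _ p] by blast
    show "linear_map_on (hardy_space p) (\<lambda>f z. c * A f z)"
      unfolding linear_map_on_def
      by (auto simp: bounded_operator_add[OF A] bounded_operator_cmult[OF A] algebra_simps)
    show "0 \<le> cmod c powr p * K" using K by simp
    fix f assume f: "f \<in> hardy_space p"
    have "hardy_sup p (\<lambda>z. c * A f z) \<le> cmod c powr p * hardy_sup p (A f)"
      by (rule hardy_space_cmult(2)[OF bounded_operator_mem[OF A f] p])
    also have "\<dots> \<le> cmod c powr p * (K * hardy_sup p f)"
      using K(2)[OF f] by (intro mult_left_mono) auto
    finally show "hardy_sup p (\<lambda>z. c * A f z) \<le> cmod c powr p * K * hardy_sup p f" by simp
  qed (simp add: bounded_operator_outside[OF A])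
qed

lemma bounded_operators_comp:
  assumes p: "1 \<le> p" and A: "A \<in> bounded_operators (hardy_space p) (hardy_norm p)"
    and A': "A' \<in> bounded_operators (hardy_space p) (hardy_norm p)"
  shows "A \<circ> A' \<in> bounded_operators (hardy_space p) (hardy_norm p)"
proof -
  obtain K where K: "0 \<le> K" "\<And>f. f \<in> hardy_space p \<Longrightarrow> hardy_sup p (A f) \<le> K * hardy_sup p f"
    using bounded_operator_sup[OF p A] by metis
  obtain K' where K': "0 \<le> K'" "\<And>f. f \<in> hardy_space p \<Longrightarrow> hardy_sup p (A' f) \<le> K' * hardy_sup p f"
    using bounded_operator_sup[OF p A'] by metis
  show ?thesis
  proof (rule bounded_operatorI[OF p, where K = "K * K'"])
    show "A \<circ> A' \<in> hardy_space p \<rightarrow> hardy_space p"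
      using bounded_operator_mem[OF A] bounded_operator_mem[OF A'] by auto
    show "linear_map_on (hardy_space p) (A \<circ> A')"
      unfolding linear_map_on_def
      using bounded_operator_mem[OF A']
      by (auto simp: bounded_operator_add[OF A] bounded_operator_add[OF A'] bounded_operator_cmult[OF A] bounded_operator_cmult[OF A'])
    show "0 \<le> K * K'" using K K' by simp
    fix f assume f: "f \<in> hardy_space p"
    have "hardy_sup p (A (A' f)) \<le> K * hardy_sup p (A' f)" by (rule K(2)[OF bounded_operator_mem[OF A' f]])
    also have "\<dots> \<le> K * (K' * hardy_sup p f)" using K'(2)[OF f] K(1) by (rule mult_left_mono)
    finally show "hardy_sup p ((A \<circ> A') f) \<le> K * K' * hardy_sup p f" by simp
  qed (simp add: bounded_operator_outside[OF A'] bounded_operator_zero[OF p A])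
qed

text \<open>\<open>T\<close> belongs to its own commutant, so the intersection that defines the
  bicommutant consists of bounded operators.\<close>

lemma bicommutant_iff:
  assumes "T \<in> bounded_operators X N"
  shows "A \<in> bicommutant X N T \<longleftrightarrow> A \<in> bounded_operators X N \<and> (\<forall>S\<in>commutant X N T. A \<circ> S = S \<circ> A)"
proof -
  have "T \<in> commutant X N T" using assms by (simp add: commutant_def)
  then show ?thesis by (auto simp: bicommutant_def commutant_def)
qed

lemma bicommutant_algebra:
  assumes p: "1 \<le> p" and T: "T \<in> bounded_operators (hardy_space p) (hardy_norm p)"
    and A: "A \<in> bicommutant (hardy_space p) (hardy_norm p) T"
    and A': "A' \<in> bicommutant (hardy_space p) (hardy_norm p) T"
  shows "(\<lambda>f z. A f z + A' f z) \<in> bicommutant (hardy_space p) (hardy_norm p) T"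
    and "(\<lambda>f z. c * A f z) \<in> bicommutant (hardy_space p) (hardy_norm p) T"
    and "A \<circ> A' \<in> bicommutant (hardy_space p) (hardy_norm p) T"
proof -
  note iff = bicommutant_iff[OF T]
  have Ab: "A \<in> bounded_operators (hardy_space p) (hardy_norm p)" and A'b: "A' \<in> bounded_operators (hardy_space p) (hardy_norm p)"
    using A A' by (simp_all add: iff)
  have AS: "A (S f) = S (A f)" if "S \<in> commutant (hardy_space p) (hardy_norm p) T" for S f
    using A that unfolding iff by (metis comp_apply)
  have A'S: "A' (S f) = S (A' f)" if "S \<in> commutant (hardy_space p) (hardy_norm p) T" for S f
    using A' that unfolding iff by (metis comp_apply)
  have Sb: "S \<in> bounded_operators (hardy_space p) (hardy_norm p)" if "S \<in> commutant (hardy_space p) (hardy_norm p) T" for S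
    using that by (simp add: commutant_def)
  show "(\<lambda>f z. A f z + A' f z) \<in> bicommutant (hardy_space p) (hardy_norm p) T"
    unfolding iff
  proof (intro conjI ballI bounded_operators_add p Ab A'b)
    fix S assume S: "S \<in> commutant (hardy_space p) (hardy_norm p) T"
    show "(\<lambda>f z. A f z + A' f z) \<circ> S = S \<circ> (\<lambda>f z. A f z + A' f z)"
      using bounded_operator_mem[OF Ab] bounded_operator_mem[OF A'b]
      by (intro operators_commuteI[OF p bounded_operators_add[OF p Ab A'b] Sb[OF S]])
         (simp add: AS[OF S] A'S[OF S] bounded_operator_add[OF Sb[OF S]])
  qed
  show "(\<lambda>f z. c * A f z) \<in> bicommutant (hardy_space p) (hardy_norm p) T"
    unfolding iff
  proof (intro conjI ballI bounded_operators_cmult p Ab)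
    fix S assume S: "S \<in> commutant (hardy_space p) (hardy_norm p) T"
    show "(\<lambda>f z. c * A f z) \<circ> S = S \<circ> (\<lambda>f z. c * A f z)"
      using bounded_operator_mem[OF Ab]
      by (intro operators_commuteI[OF p bounded_operators_cmult[OF p Ab] Sb[OF S]])
         (simp add: AS[OF S] bounded_operator_cmult[OF Sb[OF S]])
  qed
  show "A \<circ> A' \<in> bicommutant (hardy_space p) (hardy_norm p) T"
    unfolding iff using AS A'S by (auto intro!: bounded_operators_comp p Ab A'b)
qed

text \<open>
  \<open>symbol A\<close> is the function of the eigenvalues of \<open>A\<close> on the imaginary exponentials of the Koenigs
  function, on the real axis as index set.
\<close>

context strip_map
begin

definition E :: "real \<Rightarrow> complex \<Rightarrow> complex" where
  "E s = disc_ext (\<lambda>z. exp (\<i> * of_real s * h z))"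

definition symbol :: "((complex \<Rightarrow> complex) \<Rightarrow> complex \<Rightarrow> complex) \<Rightarrow> complex \<Rightarrow> complex" where
  "symbol A w = (if w \<in> \<real> then A (E (Re w)) 0 * exp (- \<i> * of_real (Re w) * h 0) else 0)"

lemma E_mem: "E s \<in> hardy_space p"
  using inM_mem[OF inM_exp] by (simp add: E_def)

lemma symbol_of_real: "symbol A (of_real s) = A (E s) 0 * exp (- \<i> * of_real s * h 0)"
  by (simp add: symbol_def)

text \<open>The mean value inequality in the parameter produces a factor |h|, which
  \<open>dominated_hardy_bounded\<close> absorbs. The exponential bounds |exp (\<i> r h)| for all r
  between \<open>s\<close> and \<open>t\<close>.\<close>

lemma E_diff_bound: "hardy_sup p (\<lambda>z. E s z - E t z) \<le> (exp ((\<bar>s\<bar> + \<bar>t\<bar>) * B) * \<bar>s - t\<bar>) powr p * H"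
proof -
  define K where "K = exp ((\<bar>s\<bar> + \<bar>t\<bar>) * B)"
  have "cmod (exp (\<i> * of_real s * h z) - exp (\<i> * of_real t * h z)) \<le> K * \<bar>s - t\<bar> * (1 + cmod (h z))" if z: "cmod z < 1" for z
  proof -
    define w where "w = h z"
    have "cmod (exp (\<i> * of_real s * w) - exp (\<i> * of_real t * w)) \<le> (K * cmod w) * cmod (of_real s - of_real t :: complex)"
    proof (rule field_differentiable_bound[where f = "\<lambda>x. exp (\<i> * x * w)" and f' = "\<lambda>x. \<i> * w * exp (\<i> * x * w)" and S = "closed_segment (of_real s) (of_real t)"])
      fix x :: complex assume "x \<in> closed_segment (of_real s) (of_real t)"
      then obtain r where r: "x = of_real r" "r \<in> closed_segment s t"
        by (metis closed_segment_of_real imageE)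
      have "\<bar>r\<bar> \<le> \<bar>s\<bar> + \<bar>t\<bar>" using r(2) by (auto simp: closed_segment_eq_real_ivl split: if_splits)
      then have "exp (\<bar>r\<bar> * B) \<le> K" using B_nonneg by (simp add: K_def mult_right_mono)
      then have "cmod (exp (\<i> * x * w)) \<le> K" by (rule order_trans[rotated]) (use exp_bounded[OF z, of r] in \<open>simp add: r(1) w_def\<close>)
      then show "cmod (\<i> * w * exp (\<i> * x * w)) \<le> K * cmod w"
        by (simp add: norm_mult mult.commute[of K] mult_left_mono del: norm_exp_eq_Re)
    qed (auto intro!: derivative_eq_intros)
    also have "\<dots> = K * \<bar>s - t\<bar> * cmod w" by (simp flip: of_real_diff)
    also have "\<dots> \<le> K * \<bar>s - t\<bar> * (1 + cmod w)" by (intro mult_left_mono) (auto simp: K_def)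
    finally show ?thesis by (simp add: w_def)
  qed
  then have "hardy_bounded p ((K * \<bar>s - t\<bar>) powr p * H) (\<lambda>z. exp (\<i> * of_real s * h z) - exp (\<i> * of_real t * h z))"
    by (intro dominated_hardy_bounded holomorphic_intros hol_h) (auto simp: K_def)
  moreover have "(\<lambda>z. E s z - E t z) = disc_ext (\<lambda>z. exp (\<i> * of_real s * h z) - exp (\<i> * of_real t * h z))"
    by (auto simp: E_def disc_ext_def)
  ultimately show ?thesis
    by (auto intro!: hardy_sup_le simp: hardy_bounded_def hardy_mean_disc_ext K_def)
qed

text \<open>Boundedness of \<open>A\<close> and of evaluation at 0 carries the norm continuity of
  the exponentials in their parameter over to the symbol; the p-th root is taken only at the
  end.\<close>

lemma continuous_on_symbol:
  assumes A: "A \<in> bounded_operators (hardy_space p) (hardy_norm p)"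
  shows "continuous_on \<real> (symbol A)"
proof -
  obtain K where K: "0 \<le> K" "\<And>f. f \<in> hardy_space p \<Longrightarrow> hardy_sup p (A f) \<le> K * hardy_sup p f"
    using bounded_operator_sup[OF p A] by metis
  have bound: "cmod (A (E s) 0 - A (E t) 0) powr p \<le> K * ((exp ((\<bar>s\<bar> + \<bar>t\<bar>) * B) * \<bar>s - t\<bar>) powr p * H)" for s t
  proof -
    have m: "(\<lambda>z. - 1 * E t z) \<in> hardy_space p" by (rule hardy_space_cmult(1)[OF E_mem p])
    have d: "(\<lambda>z. E s z + - 1 * E t z) \<in> hardy_space p" by (rule hardy_space_add(1)[OF E_mem m p])
    have "A (\<lambda>z. E s z + - 1 * E t z) = (\<lambda>z. A (E s) z + - 1 * A (E t) z)"
      by (simp only: bounded_operator_add[OF A E_mem m] bounded_operator_cmult[OF A E_mem])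
    then have "cmod (A (E s) 0 - A (E t) 0) powr p = cmod (A (\<lambda>z. E s z + - 1 * E t z) 0) powr p" by simp
    also have "\<dots> \<le> hardy_sup p (A (\<lambda>z. E s z + - 1 * E t z))"
      using hardy_eval[OF bounded_operator_mem[OF A d], of 0] p by simp
    also have "\<dots> \<le> K * hardy_sup p (\<lambda>z. E s z + - 1 * E t z)" by (rule K(2)[OF d])
    also have "\<dots> \<le> K * ((exp ((\<bar>s\<bar> + \<bar>t\<bar>) * B) * \<bar>s - t\<bar>) powr p * H)"
      using E_diff_bound[of s t] K(1) by (intro mult_left_mono) auto
    finally show ?thesis .
  qed
  have "isCont (\<lambda>s. A (E s) 0) t" for t
  proof -
    have "((\<lambda>s. K * ((exp ((\<bar>s\<bar> + \<bar>t\<bar>) * B) * \<bar>s - t\<bar>) powr p * H)) \<longlongrightarrow> K * ((exp ((\<bar>t\<bar> + \<bar>t\<bar>) * B) * \<bar>t - t\<bar>) powr p * H)) (at t)"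
      using p by (intro tendsto_intros tendsto_powr') auto
    then have "((\<lambda>s. K * ((exp ((\<bar>s\<bar> + \<bar>t\<bar>) * B) * \<bar>s - t\<bar>) powr p * H)) \<longlongrightarrow> 0) (at t)" by simp
    then have "((\<lambda>s. cmod (A (E s) 0 - A (E t) 0) powr p) \<longlongrightarrow> 0) (at t)"
      by (rule Lim_null_comparison[rotated]) (simp add: bound)
    then have "((\<lambda>s. (cmod (A (E s) 0 - A (E t) 0) powr p) powr (1 / p)) \<longlongrightarrow> 0 powr (1 / p)) (at t)"
      using p by (intro tendsto_powr' tendsto_const) auto
    then have "((\<lambda>s. cmod (A (E s) 0 - A (E t) 0)) \<longlongrightarrow> 0) (at t)"
      using p by (simp add: powr_powr)
    then show ?thesis by (simp add: isCont_def tendsto_norm_zero_iff LIM_zero_iff)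
  qed
  then have c: "continuous_on UNIV (\<lambda>s. A (E s) 0)" by (simp add: continuous_on_eq_continuous_at)
  have "continuous_on \<real> (\<lambda>w. A (E (Re w)) 0 * exp (- \<i> * of_real (Re w) * h 0))"
    by (intro continuous_intros continuous_on_compose2[OF c]) auto
  then show ?thesis by (rule continuous_on_eq) (simp add: symbol_def)
qed

text \<open>The kernel of the difference is a closed subspace, being the preimage of the zero
  subspace, and it contains the exponentials.\<close>

lemma operator_eq_on_span:
  assumes full: "span_exp = hardy_space p"
    and A: "A \<in> bounded_operators (hardy_space p) (hardy_norm p)" and A': "A' \<in> bounded_operators (hardy_space p) (hardy_norm p)"
    and eq: "\<And>s. A (E s) = A' (E s)"
  shows "A = A'"
proof
  fix f
  define D where "D = (\<lambda>f z. A f z + - 1 * A' f z)"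
  have D: "D \<in> bounded_operators (hardy_space p) (hardy_norm p)"
    unfolding D_def by (intro bounded_operators_add bounded_operators_cmult p A A')
  have Z: "closed_subspace p {\<lambda>_. 0}"
    unfolding closed_subspace_def
  proof (intro conjI ballI allI impI)
    show "{\<lambda>_. 0} \<subseteq> hardy_space p" using hardy_zero_mem[OF p] by simp
    fix f assume f: "f \<in> hardy_space p" and *: "\<forall>\<epsilon>>0. \<exists>g\<in>{\<lambda>_. 0}. hardy_sup p (\<lambda>z. f z - g z) \<le> \<epsilon>"
    then have "hardy_sup p f \<le> \<epsilon>" if "0 < \<epsilon>" for \<epsilon> using that by simp
    then have "hardy_sup p f \<le> 0" by (rule field_le_epsilon[where y = 0, simplified])
    then have S0: "hardy_sup p f = 0" using hardy_sup_nonneg[OF f] by simp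
    have "f z = 0" for z
    proof (cases "cmod z < 1")
      case True
      have "cmod (f z) powr p \<le> 0" using hardy_eval[OF f True p] S0 by simp
      then show ?thesis using powr_gt_zero[of "cmod (f z)" p] by (simp add: not_less)
    qed (rule hardy_space_zero[OF f])
    then show "f \<in> {\<lambda>_. 0}" by auto
  qed auto
  have "closed_subspace p {f \<in> hardy_space p. D f \<in> {\<lambda>_. 0}}"
    by (rule closed_subspace_vimage[OF p Z D])
  moreover have "range (\<lambda>s::real. disc_ext (\<lambda>z. exp (\<i> * of_real s * h z))) \<subseteq> {f \<in> hardy_space p. D f \<in> {\<lambda>_. 0}}"
    using E_mem eq by (auto simp: D_def simp flip: E_def)
  ultimately have "span_exp \<subseteq> {f \<in> hardy_space p. D f \<in> {\<lambda>_. 0}}"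
    unfolding span_exp_def by (rule closed_span_subset)
  then have "f \<in> hardy_space p \<Longrightarrow> D f = (\<lambda>_. 0)" unfolding full by blast
  then show "A f = A' f"
    by (cases "f \<in> hardy_space p")
       (auto simp: D_def fun_eq_iff bounded_operator_outside[OF A] bounded_operator_outside[OF A'])
qed

end

text \<open>Density of the exponentials enters as the assumption \<open>full\<close>, which
  separates the algebra below from the geometry of the domain.\<close>

locale koenigs_strip_map = strip_map +
  fixes \<phi>s :: "real \<Rightarrow> complex \<Rightarrow> complex" and \<phi> :: "complex \<Rightarrow> complex"
  assumes koe: "koenigs_function \<phi>s h" and sf: "holomorphic_semiflow \<phi>s"
    and \<phi>_hol: "\<phi> holomorphic_on unit_disc" and \<phi>_maps: "\<phi> \<in> unit_disc \<rightarrow> unit_disc"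
    and \<phi>_eq: "\<And>z. cmod z < 1 \<Longrightarrow> \<phi> z = \<phi>s 1 z"
    and full: "span_exp = hardy_space p"
begin

abbreviation "X \<equiv> hardy_space p"
abbreviation "N \<equiv> hardy_norm p"
abbreviation "T \<equiv> composition_operator p \<phi>"

lemma T_bounded: "T \<in> bounded_operators X N"
  by (rule composition_operator_bounded[OF p \<phi>_hol \<phi>_maps])

lemma bicommutant_bounded: "A \<in> bicommutant X N T \<Longrightarrow> A \<in> bounded_operators X N"
  by (simp add: bicommutant_iff[OF T_bounded])

text \<open>\<open>A\<close> commutes with the composition operators of the whole semiflow, since
  these commute with \<open>T\<close>. So A (E s) satisfies the same functional equation as
  \<open>E s\<close>, whose holomorphic solutions are the multiples of \<open>E s\<close>.\<close>

lemma eigenvector: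
  assumes A: "A \<in> bicommutant X N T"
  shows "A (E s) = (\<lambda>z. symbol A (of_real s) * E s z)"
proof -
  have Ab: "A \<in> bounded_operators X N" by (rule bicommutant_bounded[OF A])
  define q where "q = A (E s)"
  have qX: "q \<in> X" unfolding q_def by (rule bounded_operator_mem[OF Ab E_mem])
  have hol: "\<phi>s t holomorphic_on unit_disc" and maps: "\<phi>s t \<in> unit_disc \<rightarrow> unit_disc" if "0 \<le> t" for t
    using sf that by (auto simp: holomorphic_semiflow_def)
  have "q (\<phi>s t z) = exp ((\<i> * of_real s) * of_real t) * q z + 0 * of_real t" if t: "0 \<le> t" and z: "cmod z < 1" for t z
  proof -
    have lt: "cmod (\<phi>s u x) < 1" if "0 \<le> u" "cmod x < 1" for u x using maps[OF that(1)] that(2) by auto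
    have "\<phi> (\<phi>s t x) = \<phi>s t (\<phi> x)" if x: "cmod x < 1" for x
    proof -
      have xD: "x \<in> unit_disc" using x by simp
      have "\<phi>s (1 + t) x = \<phi>s 1 (\<phi>s t x)" "\<phi>s (t + 1) x = \<phi>s t (\<phi>s 1 x)"
        using sf xD t unfolding holomorphic_semiflow_def by (metis zero_le_one)+
      then show ?thesis using \<phi>_eq[OF x] \<phi>_eq[OF lt[OF t x]] by (simp add: add.commute)
    qed
    then have "composition_operator p (\<phi>s t) \<in> commutant X N T"
      by (intro composition_operators_commute[OF p hol[OF t] maps[OF t] \<phi>_hol \<phi>_maps])
    then have "A \<circ> composition_operator p (\<phi>s t) = composition_operator p (\<phi>s t) \<circ> A"
      using A unfolding bicommutant_iff[OF T_bounded] by blast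
    then have comm: "A (composition_operator p (\<phi>s t) (E s)) = composition_operator p (\<phi>s t) q"
      unfolding q_def by (metis comp_apply)
    have "composition_operator p (\<phi>s t) (E s) = (\<lambda>z. exp ((\<i> * of_real s) * of_real t) * E s z)"
    proof
      fix x
      show "composition_operator p (\<phi>s t) (E s) x = exp ((\<i> * of_real s) * of_real t) * E s x"
        unfolding composition_operator_apply[OF E_mem]
        using koenigs_conjugation(3)[OF koe t, of x] lt[OF t, of x]
        by (cases "cmod x < 1") (simp_all add: E_def distrib_left exp_add mult.commute)
    qed
    from fun_cong[OF comm[unfolded this], of z]
    have "exp ((\<i> * of_real s) * of_real t) * q z = composition_operator p (\<phi>s t) q z"
      by (simp only: bounded_operator_cmult[OF Ab E_mem] q_def)
    also have "\<dots> = q (\<phi>s t z)" using z by (simp add: composition_operator_apply[OF qX])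
    finally show ?thesis by simp
  qed
  then have "\<exists>C. \<forall>z. cmod z < 1 \<longrightarrow> q z = C * exp (\<i> * of_real s * h z) + 0 * h z"
    by (intro semigroup_eigenfunction[OF koe hardy_space_holomorphic[OF qX]]) auto
  then obtain C where C: "\<And>z. cmod z < 1 \<Longrightarrow> q z = C * exp (\<i> * of_real s * h z)" by auto
  have "symbol A (of_real s) = C * (exp (\<i> * of_real s * h 0) * exp (- \<i> * of_real s * h 0))"
    using C[of 0] by (simp add: symbol_of_real q_def)
  also have "\<dots> = C" by (simp add: exp_minus)
  finally have sC: "symbol A (of_real s) = C" .
  show ?thesis
  proof
    fix z
    show "A (E s) z = symbol A (of_real s) * E s z"
      using C[of z] hardy_space_zero[OF qX, of z] by (cases "cmod z < 1") (auto simp: sC E_def q_def)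
  qed
qed

lemma E0: "E s 0 = exp (\<i> * of_real s * h 0)"
  by (simp add: E_def)

lemma symbol_unique:
  assumes "\<And>s. symbol A (of_real s) = c s" "\<And>w. w \<notin> \<real> \<Longrightarrow> F w = 0" "\<And>s. F (of_real s) = c s"
  shows "symbol A = F"
proof
  fix w
  show "symbol A w = F w"
    using assms by (cases "w \<in> \<real>") (auto elim!: Reals_cases simp: symbol_def)
qed

lemma symbol_value:
  assumes "A (E s) = (\<lambda>z. c * E s z)"
  shows "symbol A (of_real s) = c"
proof -
  have "symbol A (of_real s) = c * (exp (\<i> * of_real s * h 0) * exp (- \<i> * of_real s * h 0))"
    by (simp add: symbol_of_real assms E0)
  then show ?thesis by (simp add: exp_minus)
qed

lemma symbol_outside: "w \<notin> \<real> \<Longrightarrow> symbol A w = 0"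
  by (simp add: symbol_def)

lemma symbol_add:
  assumes A: "A \<in> bicommutant X N T" and A': "A' \<in> bicommutant X N T"
  shows "symbol (\<lambda>f z. A f z + A' f z) = (\<lambda>w. symbol A w + symbol A' w)"
  by (rule symbol_unique[where c = "\<lambda>s. symbol A (of_real s) + symbol A' (of_real s)"])
     (auto intro!: symbol_value simp: eigenvector[OF A] eigenvector[OF A'] symbol_outside algebra_simps)

lemma symbol_cmult:
  assumes A: "A \<in> bicommutant X N T"
  shows "symbol (\<lambda>f z. c * A f z) = (\<lambda>w. c * symbol A w)"
  by (rule symbol_unique[where c = "\<lambda>s. c * symbol A (of_real s)"])
     (auto intro!: symbol_value simp: eigenvector[OF A] symbol_outside algebra_simps)

lemma symbol_comp:
  assumes A: "A \<in> bicommutant X N T" and A': "A' \<in> bicommutant X N T"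
  shows "symbol (A \<circ> A') = (\<lambda>w. symbol A w * symbol A' w)"
proof (rule symbol_unique[where c = "\<lambda>s. symbol A (of_real s) * symbol A' (of_real s)"])
  fix s
  have "(A \<circ> A') (E s) = A (\<lambda>z. symbol A' (of_real s) * E s z)" by (simp add: eigenvector[OF A'])
  also have "\<dots> = (\<lambda>z. symbol A' (of_real s) * A (E s) z)"
    by (rule bounded_operator_cmult[OF bicommutant_bounded[OF A] E_mem])
  also have "\<dots> = (\<lambda>z. symbol A (of_real s) * symbol A' (of_real s) * E s z)"
    by (simp add: eigenvector[OF A] mult_ac)
  finally show "symbol (A \<circ> A') (of_real s) = symbol A (of_real s) * symbol A' (of_real s)" by (rule symbol_value)
qed (auto simp: symbol_outside)

lemma symbol_inj:
  assumes A: "A \<in> bicommutant X N T" and A': "A' \<in> bicommutant X N T" and eq: "symbol A = symbol A'"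
  shows "A = A'"
  by (rule operator_eq_on_span[OF full bicommutant_bounded[OF A] bicommutant_bounded[OF A']])
     (simp add: eigenvector[OF A] eigenvector[OF A'] eq)

lemma id_in_bicommutant: "id_operator X \<in> bicommutant X N T"
  unfolding bicommutant_iff[OF T_bounded]
proof (intro conjI ballI id_operator_bounded p)
  fix S assume "S \<in> commutant X N T"
  then have S: "S \<in> bounded_operators X N" by (simp add: commutant_def)
  show "id_operator X \<circ> S = S \<circ> id_operator X"
    by (rule operators_commuteI[OF p id_operator_bounded[OF p] S]) (simp add: id_operator_def bounded_operator_mem[OF S])
qed

lemma zero_in_bicommutant: "zero_operator \<in> bicommutant X N T"
  using bicommutant_algebra(2)[OF p T_bounded id_in_bicommutant id_in_bicommutant, of 0]
  by (simp add: zero_operator_def)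

lemma functional_bicommutant: "functional_bicommutant_property X N T"
proof -
  let ?S = "bicommutant X N T"
  define F where "F = symbol ` ?S"
  \<comment> \<open>The isomorphism runs from functions to operators, so it is the inverse of
    \<open>symbol\<close>, which is injective by density.\<close>
  define \<Phi> where "\<Phi> = the_inv_into ?S symbol"
  have inj: "inj_on symbol ?S" using symbol_inj by (auto intro!: inj_onI)
  have \<Phi>s: "\<Phi> (symbol A) = A" if "A \<in> ?S" for A unfolding \<Phi>_def by (rule the_inv_into_f_f[OF inj that])
  note alg = bicommutant_algebra[OF p T_bounded]
  have "subalgebra_of_continuous_functions \<real> F"
    unfolding subalgebra_of_continuous_functions_def
  proof (intro conjI ballI allI)
    show "F \<subseteq> continuous_functions \<real>"
      using continuous_on_symbol[OF bicommutant_bounded] by (auto simp: F_def continuous_functions_def symbol_outside)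
    show "F \<noteq> {}" using id_in_bicommutant by (auto simp: F_def)
  next
    fix f g assume "f \<in> F" "g \<in> F"
    then obtain A A' where *: "A \<in> ?S" "A' \<in> ?S" "f = symbol A" "g = symbol A'" by (auto simp: F_def)
    show "(\<lambda>z. f z + g z) \<in> F" unfolding *(3,4) symbol_add[OF *(1,2), symmetric] F_def by (intro imageI alg(1) *(1,2))
    show "(\<lambda>z. f z * g z) \<in> F" unfolding *(3,4) symbol_comp[OF *(1,2), symmetric] F_def by (intro imageI alg(3) *(1,2))
  next
    fix c f assume "f \<in> F"
    then obtain A where *: "A \<in> ?S" "f = symbol A" by (auto simp: F_def)
    show "(\<lambda>z. c * f z) \<in> F" unfolding *(2) symbol_cmult[OF *(1), symmetric] F_def by (intro imageI alg(2)[OF *(1,1)])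
  qed
  moreover have "algebra_isomorphism F ?S \<Phi>"
    unfolding algebra_isomorphism_def
  proof (intro conjI ballI allI)
    show "bij_betw \<Phi> F ?S" unfolding \<Phi>_def F_def using inj by (intro bij_betw_the_inv_into inj_on_imp_bij_betw)
  next
    fix f g assume "f \<in> F" "g \<in> F"
    then obtain A A' where *: "A \<in> ?S" "A' \<in> ?S" "f = symbol A" "g = symbol A'" by (auto simp: F_def)
    show "\<Phi> (\<lambda>z. f z + g z) = (\<lambda>x w. \<Phi> f x w + \<Phi> g x w)"
      unfolding *(3,4) symbol_add[OF *(1,2), symmetric] \<Phi>s[OF *(1)] \<Phi>s[OF *(2)] by (rule \<Phi>s[OF alg(1)[OF *(1,2)]])
    show "\<Phi> (\<lambda>z. f z * g z) = \<Phi> f \<circ> \<Phi> g"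
      unfolding *(3,4) symbol_comp[OF *(1,2), symmetric] \<Phi>s[OF *(1)] \<Phi>s[OF *(2)] by (rule \<Phi>s[OF alg(3)[OF *(1,2)]])
  next
    fix c f assume "f \<in> F"
    then obtain A where *: "A \<in> ?S" "f = symbol A" by (auto simp: F_def)
    show "\<Phi> (\<lambda>z. c * f z) = (\<lambda>x w. c * \<Phi> f x w)"
      unfolding *(2) symbol_cmult[OF *(1), symmetric] \<Phi>s[OF *(1)] by (rule \<Phi>s[OF alg(2)[OF *(1,1)]])
  qed
  moreover have "connected (\<real> :: complex set)"
  proof -
    have "connected (range complex_of_real)" by (intro connected_continuous_image continuous_intros) auto
    then show ?thesis by (simp add: Reals_def)
  qed
  ultimately show ?thesis unfolding functional_bicommutant_property_def by blast
qed

lemma no_nontrivial_idempotent: "\<not> (\<exists>J. nontrivial_idempotent X N J \<and> J \<in> bicommutant X N T)"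
proof
  assume "\<exists>J. nontrivial_idempotent X N J \<and> J \<in> bicommutant X N T"
  then obtain J where J: "J \<in> bicommutant X N T" and JJ: "J \<circ> J = J" and ne: "J \<noteq> zero_operator" "J \<noteq> id_operator X"
    unfolding nontrivial_idempotent_def by blast
  define m where "m = (\<lambda>s::real. symbol J (of_real s))"
  have sq: "m s * m s = m s" for s
    using symbol_comp[OF J J] unfolding JJ m_def by metis
  have m01: "m s \<in> {0, 1}" for s using sq[of s] by auto
  have "continuous_on UNIV m"
    unfolding m_def using continuous_on_symbol[OF bicommutant_bounded[OF J]]
    by (rule continuous_on_compose2) (auto intro!: continuous_intros)
  then have "connected (range m)" by (intro connected_continuous_image) auto
  moreover have "finite (range m)" using m01 by (intro finite_subset[of "range m" "{0, 1}"]) auto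
  ultimately have "\<exists>c. range m = {c}" using connected_finite_iff_sing by blast
  then obtain c where "range m = {c}" by blast
  then have c: "m s = c" for s by blast
  have c01: "c = 0 \<or> c = 1" using m01[of 0] c[of 0] by auto
  have JE: "J (E s) = (\<lambda>z. c * E s z)" for s using eigenvector[OF J, of s] c[of s] by (simp add: m_def)
  show False
  proof (cases "c = 0")
    case True
    have "J = zero_operator"
      using True by (intro operator_eq_on_span[OF full bicommutant_bounded[OF J] bicommutant_bounded[OF zero_in_bicommutant]])
        (simp add: JE zero_operator_def)
    then show False using ne by simp
  next
    case False
    have "J = id_operator X"
      using False c01 E_mem by (intro operator_eq_on_span[OF full bicommutant_bounded[OF J] bicommutant_bounded[OF id_in_bicommutant]])
        (simp add: JE id_operator_def)
    then show False using ne by simp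
  qed
qed

end

text \<open>Finiteness of the set of components is stated beside the bound on \<open>card\<close>,
  because \<open>card\<close> is 0 on infinite sets. The absence of non-trivial idempotents follows
  from connectedness of the real line, on which symbols live.\<close>

theorem theorem1:
  fixes \<phi> :: "complex \<Rightarrow> complex"
    and \<phi>s :: "real \<Rightarrow> complex \<Rightarrow> complex"
    and p :: real
  assumes "\<phi> holomorphic_on unit_disc"
    and "\<phi> \<in> unit_disc \<rightarrow> unit_disc"
    and "hyperbolic_semiflow \<phi>s"
    and "\<forall>z\<in>unit_disc. \<phi> z = \<phi>s 1 z"
    and "1 \<le> p"
  defines "X \<equiv> hardy_space p"
    and "N \<equiv> hardy_norm p"
    and "T \<equiv> composition_operator p \<phi>"
  shows "T \<in> bounded_operators X N \<and>
    (\<forall>\<Omega>. koenigs_domain \<phi>s \<Omega> \<and> interior (closure \<Omega>) = \<Omega> \<and>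
        finite (components (- closure \<Omega>)) \<and> card (components (- closure \<Omega>)) \<le> 2 \<longrightarrow>
      functional_bicommutant_property X N T \<and>
      \<not> (\<exists>J. nontrivial_idempotent X N J \<and> J \<in> bicommutant X N T)) \<and>
    \<not> (\<forall>A\<in>commutant X N T. \<forall>B\<in>commutant X N T. A \<circ> B = B \<circ> A) \<and>
    \<not> functional_commutant_property X N T \<and>
    \<not> minimal_commutant X N T"
proof -
  have T: "T \<in> bounded_operators X N"
    unfolding T_def X_def N_def by (rule composition_operator_bounded[OF assms(5,1,2)])
  have part1: "functional_bicommutant_property X N T \<and> \<not> (\<exists>J. nontrivial_idempotent X N J \<and> J \<in> bicommutant X N T)"
    if \<Omega>: "koenigs_domain \<phi>s \<Omega>" "interior (closure \<Omega>) = \<Omega>" "finite (components (- closure \<Omega>))"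
      "card (components (- closure \<Omega>)) \<le> 2" for \<Omega>
  proof -
    obtain h where h: "koenigs_function \<phi>s h" "\<Omega> = h ` unit_disc" using \<Omega>(1) by (auto simp: koenigs_domain_def)
    obtain B where "strip_map p B h" using koenigs_strip[OF assms(3) h(1) assms(5)] by blast
    then interpret S: strip_map p B h .
    have "S.span_exp = hardy_space p" by (rule S.span_exp_eq[OF \<Omega>(3,4,2)[unfolded h(2)]])
    then interpret koenigs_strip_map p B h \<phi>s \<phi>
      using h(1) assms by unfold_locales (auto simp: hyperbolic_semiflow_def)
    show ?thesis unfolding X_def N_def T_def using functional_bicommutant no_nontrivial_idempotent by blast
  qed
  have "\<exists>A\<in>commutant X N T. \<exists>B\<in>commutant X N T. A \<circ> B \<noteq> B \<circ> A"
    unfolding X_def N_def T_def using assms(4) by (intro noncommuting_commutant[OF assms(5,1,2,3)]) auto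
  then obtain A B where AB: "A \<in> commutant X N T" "B \<in> commutant X N T" "A \<circ> B \<noteq> B \<circ> A" by blast
  have "\<not> functional_commutant_property X N T"
    using functional_commutant_imp_commutative[OF _ AB(1,2)] AB(3) by blast
  moreover have "\<not> minimal_commutant X N T"
  proof
    assume "minimal_commutant X N T"
    then have "A \<in> weak_operator_topology X N closure_of alg X T" using AB(1) by (simp add: minimal_commutant_def)
    then show False using wot_closure_commutes[OF assms(5)] T AB unfolding X_def N_def by blast
  qed
  ultimately show ?thesis using T part1 AB by blast
qed

end
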